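(* Let $\Omega\subset\mathbb{R}^N$ be an open bounded convex set and let $1<p<\infty$. Then \[ \mu_{p,p}(\Omega)<\lambda_{p,p}(B)\left(\frac{\mathrm{diam}(B)}{\mathrm{diam}(\Omega)}\right)^{p}, \] where $B$ is any $N$-dimensional ball. Equality in this inequality is never achieved, but the inequality is sharp. More precisely, there exists a sequence $\{\Omega_k\}_{k\in\mathbb{N}}$ of convex sets in $\mathbb{R}^N$ such that: - $\mathrm{diam}(\Omega_k)=d>0$ for every $k\in\mathbb{N}$; - $\Omega_k$ converges to a segment of length $d$ in the Hausdorff topology; - $\displaystyle\lim_{k\to\infty}\mu_{p,p}(\Omega_k)=\lambda_{p,p}(B_{d/2})$, where $B_{d/2}$ is an $N$-dimensional ball having radius $d/2$.
   Context: For an open bounded Lipschitz set $\Omega\subset\mathbb{R}^N$ and $1<p<\infty$, define \[ \mu_{p,p}(\Omega)=\inf_{v\in W^{1,p}(\Omega)\setminus\{0\}}\left\{\frac{\int_\Omega|\nabla v|^p\,dx}{\int_\Omega|v|^p\,dx}\ :\ \int_\Omega|v|^{p-2}v\,dx=0\right\} \] (first nontrivial Neumann eigenvalue of the $p$-Laplacian) and \[ \lambda_{p,p}(\Omega)=\inf_{v\in W^{1,p}_0(\Omega)\setminus\{0\}}\frac{\int_\Omega|\nabla v|^p\,dx}{\int_\Omega|v|^p\,dx} \] (first Dirichlet eigenvalue of the $p$-Laplacian). Here $W^{1,p}_0(\Omega)$ is the completion of $C_0^\infty(\Omega)$ in the norm of $W^{1,p}(\Omega)$, and $\mathrm{diam}$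 denotes the diameter.
   Formalization: The strict inequality is stated for N ≥ 2 and nonempty Ω: for N = 1 it fails, since Ω and B are intervals and equality always holds, while for empty Ω the infimum is undefined; the sharpness part is stated for every N ≥ 1. *)

theory Defs
  imports "HOL-Analysis.Analysis"
begin

primrec Ck :: "nat \<Rightarrow> ('a::euclidean_space \<Rightarrow> real) \<Rightarrow> bool" where
  "Ck 0 f \<longleftrightarrow> continuous_on UNIV f"
| "Ck (Suc n) f \<longleftrightarrow>
     (\<forall>x. f differentiable (at x)) \<and>
     (\<forall>i\<in>Basis. Ck n (\<lambda>x. frechet_derivative f (at x) i))"

text \<open>The elements of \<open>C_0^\<infinity>(\<Omega>)\<close>, extended by zero to the whole space.\<close>

definition test_functions :: "'a::euclidean_space set \<Rightarrow> ('a \<Rightarrow> real) set" where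
  "test_functions \<Omega> =
     {\<phi>. (\<forall>n. Ck n \<phi>) \<and> compact (closure {x. \<phi> x \<noteq> 0}) \<and> closure {x. \<phi> x \<noteq> 0} \<subseteq> \<Omega>}"

definition grad :: "('a::euclidean_space \<Rightarrow> real) \<Rightarrow> 'a \<Rightarrow> 'a" where
  "grad \<phi> x = (\<Sum>i\<in>Basis. frechet_derivative \<phi> (at x) i *\<^sub>R i)"

definition Lp :: "real \<Rightarrow> 'a::euclidean_space set \<Rightarrow> ('a \<Rightarrow> 'b::euclidean_space) set" where
  "Lp p \<Omega> = {f. f \<in> borel_measurable (lebesgue_on \<Omega>) \<and>
                integrable (lebesgue_on \<Omega>) (\<lambda>x. norm (f x) powr p)}"

definition locally_integrable :: "'a::euclidean_space set \<Rightarrow> ('a \<Rightarrow> 'b::euclidean_space) \<Rightarrow> bool" where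
  "locally_integrable \<Omega> f \<longleftrightarrow> (\<forall>K. compact K \<and> K \<subseteq> \<Omega> \<longrightarrow> integrable (lebesgue_on K) f)"

definition has_weak_gradient ::
    "'a::euclidean_space set \<Rightarrow> ('a \<Rightarrow> real) \<Rightarrow> ('a \<Rightarrow> 'a) \<Rightarrow> bool" where
  "has_weak_gradient \<Omega> v g \<longleftrightarrow>
     locally_integrable \<Omega> v \<and> locally_integrable \<Omega> g \<and>
     (\<forall>\<phi>\<in>test_functions \<Omega>. \<forall>i\<in>Basis.
        (LINT x|lebesgue_on \<Omega>. v x * frechet_derivative \<phi> (at x) i)
          = - (LINT x|lebesgue_on \<Omega>. (g x \<bullet> i) * \<phi> x))"

text \<open>
  Sobolev functions are functions on the whole space of which only the values on \<open>\<Omega>\<close> matter;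
  they are not quotiented by equality almost everywhere.  The predicates carry the weak gradient
  \<open>g\<close>, which is determined by \<open>v\<close> up to a null subset of \<open>\<Omega>\<close>, as an explicit argument:
  \<open>W1p p \<Omega> v g\<close> means that \<open>v \<in> W^{1,p}(\<Omega>)\<close> and \<open>\<nabla>v = g\<close>.
\<close>

definition W1p :: "real \<Rightarrow> 'a::euclidean_space set \<Rightarrow> ('a \<Rightarrow> real) \<Rightarrow> ('a \<Rightarrow> 'a) \<Rightarrow> bool" where
  "W1p p \<Omega> v g \<longleftrightarrow> v \<in> Lp p \<Omega> \<and> g \<in> Lp p \<Omega> \<and> has_weak_gradient \<Omega> v g"

text \<open>
  The completion of \<open>C_0^\<infinity>(\<Omega>)\<close> in the norm of \<open>W^{1,p}(\<Omega>)\<close>, realised as its closure in the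
  complete space \<open>W^{1,p}(\<Omega>)\<close>.
\<close>

definition W1p_0 :: "real \<Rightarrow> 'a::euclidean_space set \<Rightarrow> ('a \<Rightarrow> real) \<Rightarrow> ('a \<Rightarrow> 'a) \<Rightarrow> bool" where
  "W1p_0 p \<Omega> v g \<longleftrightarrow> W1p p \<Omega> v g \<and>
     (\<exists>\<phi>. (\<forall>n. \<phi> n \<in> test_functions \<Omega>) \<and>
        (\<lambda>n. LINT x|lebesgue_on \<Omega>. \<bar>\<phi> n x - v x\<bar> powr p) \<longlonglongrightarrow> 0 \<and>
        (\<lambda>n::nat. LINT x|lebesgue_on \<Omega>. norm (grad (\<phi> n) x - g x) powr p) \<longlonglongrightarrow> 0)"

text \<open>
  The condition that \<open>v\<close> is not almost everywhere zero on \<open>\<Omega>\<close> says that \<open>v\<close> is a nonzero element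
  of the Sobolev space.  For nonempty open bounded \<open>\<Omega>\<close> and \<open>1 < p\<close> the sets below are nonempty
  sets of nonnegative reals, so that the infimum of reals is the intended one.
\<close>

definition mu :: "real \<Rightarrow> 'a::euclidean_space set \<Rightarrow> real" where
  "mu p \<Omega> = Inf {(LINT x|lebesgue_on \<Omega>. norm (g x) powr p) / (LINT x|lebesgue_on \<Omega>. \<bar>v x\<bar> powr p) | v g.
     W1p p \<Omega> v g \<and> \<not> (AE x in lebesgue_on \<Omega>. v x = 0) \<and>
     (LINT x|lebesgue_on \<Omega>. \<bar>v x\<bar> powr (p - 2) * v x) = 0}"

definition lambda :: "real \<Rightarrow> 'a::euclidean_space set \<Rightarrow> real" where
  "lambda p \<Omega> = Inf {(LINT x|lebesgue_on \<Omega>. norm (g x) powr p) / (LINT x|lebesgue_on \<Omega>. \<bar>v x\<bar> powr p) | v g.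
     W1p_0 p \<Omega> v g \<and> \<not> (AE x in lebesgue_on \<Omega>. v x = 0)}"

text \<open>
  Meaningful for nonempty bounded sets.  On sets that are not closed it is only a pseudometric: it
  is the Hausdorff distance of the closures.
\<close>

definition hausdorff_dist :: "'a::metric_space set \<Rightarrow> 'a set \<Rightarrow> real" where
  "hausdorff_dist S T = max (SUP x\<in>S. infdist x T) (SUP y\<in>T. infdist y S)"

end

theory Submission
  imports Defs
begin

text \<open>
  Writing the first radial eigenfunction of a ball as \<open>U(\<bar>x\<bar>)\<close>, the function \<open>w = (- U' / U) powr (p - 1)\<close> solves a
  Riccati equation, and the radial field \<open>w(\<bar>x\<bar>) x / \<bar>x\<bar>\<close> has divergence \<open>\<lambda> + (p - 1) w powr (p / (p - 1))\<close>.
  A radial field centred at a point of a convex set crosses the boundary outwards, so that \<open>U\<close>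
  truncated to the set has Rayleigh quotient at most \<open>\<lambda>\<close>.  Two copies of \<open>U\<close> with radius \<open>diam \<Omega> / 2\<close>, centred at the
  end points of a diameter and combined with opposite signs, bound \<open>\<mu>\<close> from above; shrinking the distance to the
  end points orthogonally to the diameter makes the inequality strict.

  Conversely, the radial field is tangent to the sides of a cone centred at the apex, so Picone's inequality gives the
  reverse estimate there.  A double cone whose opening tends to zero consists of two such cones, which up to a
  vanishing error decouple across the thin waist, and its eigenvalue tends to that of the ball.
\<close>

section \<open>Powers, integrals and affine changes of variables\<close>

text \<open>The radial field is useful because its product with \<open>U^p\<close> has divergence
  \<open>\<lambda> U^p - w^(p/(p-1)) U^p\<close>, where the subtracted term is exactly
  \<open>|U'|^p\<close>. An outward flux therefore bounds energy by mass, while a vanishing flux of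
  \<open>|v|^p\<close> times the field bounds mass by energy. No minimiser, compactness or
  regularity theory enters: \<open>w\<close> and \<open>U\<close> serve both bounds. Passing from
  \<open>U\<close> to \<open>w\<close> turns a degenerate second order equation into a monotone
  first order integral equation, solved by a least fixed point up to its blow-up radius, where
  \<open>U\<close> vanishes. The infima range over weakly differentiable functions, but these
  computations need classical derivatives, so both are reduced to smooth functions by mollification.
  Since \<open>w\<close> blows up at the radius of its ball, the lower bound on a double cone
  borrows \<open>w\<close> from a slightly larger ball. One solution with eigenvalue 1 suffices; the
  ratio of diameters comes from rescaling it. The dimension condition in the strict inequality is
  genuine: on an interval both sides agree.\<close>

lemma young_powr:
  fixes p x m :: real
  assumes "1 < p" "0 \<le> x" "0 \<le> m"
  shows "p * x * m powr (p - 1) \<le> x powr p + (p - 1) * m powr p"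
proof -
  have "x * m powr (p - 1) \<le> x powr p / p + (m powr (p - 1)) powr (p / (p - 1)) / (p / (p - 1))"
    by (rule Youngs_inequality) (use assms in \<open>auto simp: field_simps\<close>)
  also have "(m powr (p - 1)) powr (p / (p - 1)) = m powr p"
    using assms by (simp add: powr_powr)
  finally have "p * (x * m powr (p - 1)) \<le> p * (x powr p / p + m powr p / (p / (p - 1)))"
    using assms by (intro mult_left_mono) auto
  also have "\<dots> = x powr p + (p - 1) * m powr p"
    using assms by (simp add: field_simps)
  finally show ?thesis by (simp add: mult.assoc)
qed

text \<open>\<open>0 powr s\<close> is 0 for every \<open>s\<close>, also for negative
  \<open>s\<close>, so \<open>\<bar>a\<bar> powr (p - 2) * a\<close> is the signed power of exponent
  \<open>p - 1\<close> even when \<open>p < 2\<close> and \<open>a = 0\<close>.\<close>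

lemma abs_powr_mult_self:
  fixes a p :: real
  shows "\<bar>a\<bar> powr (p - 2) * a * a = \<bar>a\<bar> powr p" "\<bar>\<bar>a\<bar> powr (p - 2) * a\<bar> = \<bar>a\<bar> powr (p - 1)"
proof -
  have "\<bar>a\<bar> powr (p - 2) * a * a = \<bar>a\<bar> powr (p - 2) * \<bar>a\<bar> powr 2"
    by (cases "a = 0") (auto simp: power2_eq_square)
  also have "\<dots> = \<bar>a\<bar> powr p" by (subst powr_add [symmetric]) simp
  finally show "\<bar>a\<bar> powr (p - 2) * a * a = \<bar>a\<bar> powr p" .
  have "\<bar>\<bar>a\<bar> powr (p - 2) * a\<bar> = \<bar>a\<bar> powr (p - 2) * \<bar>a\<bar> powr 1"
    by (simp add: abs_mult)
  also have "\<dots> = \<bar>a\<bar> powr (p - 1)" by (subst powr_add [symmetric]) simp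
  finally show "\<bar>\<bar>a\<bar> powr (p - 2) * a\<bar> = \<bar>a\<bar> powr (p - 1)" .
qed

text \<open>Convexity of the p-th power along its tangent at \<open>a\<close>, read off from
  \<open>young_powr\<close> with \<open>m = \<bar>a\<bar>\<close>. Integrated, it shows that the
  Neumann constraint makes the shift by 0 optimal.\<close>

lemma abs_powr_tangent:
  fixes a b p :: real
  assumes "1 < p"
  shows "\<bar>a\<bar> powr p + p * (\<bar>a\<bar> powr (p - 2) * a) * b \<le> \<bar>a + b\<bar> powr p"
proof -
  let ?s = "\<bar>a\<bar> powr (p - 2) * a"
  have "p * \<bar>a + b\<bar> * \<bar>a\<bar> powr (p - 1) \<le> \<bar>a + b\<bar> powr p + (p - 1) * \<bar>a\<bar> powr p"
    using assms by (intro young_powr) auto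
  moreover have "(a + b) * ?s \<le> \<bar>a + b\<bar> * \<bar>a\<bar> powr (p - 1)"
    by (metis abs_ge_self abs_mult abs_powr_mult_self(2))
  then have "p * ((a + b) * ?s) \<le> p * (\<bar>a + b\<bar> * \<bar>a\<bar> powr (p - 1))"
    using assms by (intro mult_left_mono) auto
  moreover have "a * ?s = \<bar>a\<bar> powr p" by (metis abs_powr_mult_self(1) mult.commute)
  moreover have "p * ((a + b) * ?s) = p * (a * ?s) + p * ?s * b" by (simp add: algebra_simps)
  ultimately show ?thesis by (simp add: left_diff_distrib mult.assoc)
qed

text \<open>A replacement for Minkowski's inequality: the factor of the main term is as close to 1
  as desired, so p-th powers of norms pass to the limit although \<open>C\<close> grows as
  \<open>\<eta>\<close> tends to 0.\<close>

lemma powr_add_le: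
  fixes p \<eta> :: real
  assumes "1 < p" "0 < \<eta>"
  obtains C where "0 \<le> C" "\<And>a b::real. 0 \<le> a \<Longrightarrow> 0 \<le> b \<Longrightarrow> (a + b) powr p \<le> (1 + \<eta>) * a powr p + C * b powr p"
proof
  \<comment> \<open>\<open>k\<close> solves \<open>(1 + k) powr p = 1 + \<eta>\<close>. If
    \<open>b\<close> is at most \<open>k * a\<close>, the sum is absorbed into \<open>a\<close>;
    otherwise it is absorbed into \<open>b\<close>.\<close>
  define k where "k = (1 + \<eta>) powr (1 / p) - 1"
  have "1 powr (1/p) < (1 + \<eta>) powr (1 / p)" using assms by (intro powr_less_mono2) auto
  then have k: "0 < k" by (simp add: k_def)
  have kp: "(1 + k) powr p = 1 + \<eta>" using assms by (simp add: k_def powr_powr)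
  show "0 \<le> (1 + 1 / k) powr p" by simp
  fix a b :: real assume ab: "0 \<le> a" "0 \<le> b"
  show "(a + b) powr p \<le> (1 + \<eta>) * a powr p + (1 + 1 / k) powr p * b powr p"
  proof (cases "b \<le> k * a")
    case True
    then have "(a + b) powr p \<le> ((1 + k) * a) powr p"
      using ab assms by (intro powr_mono2) (auto simp: algebra_simps)
    also have "\<dots> = (1 + \<eta>) * a powr p" using ab k by (simp add: powr_mult kp)
    finally show ?thesis by (smt (verit) mult_nonneg_nonneg powr_ge_zero)
  next
    case False
    then have "(a + b) powr p \<le> ((1 + 1 / k) * b) powr p"
      using ab assms k by (intro powr_mono2) (auto simp: field_simps)
    also have "\<dots> = (1 + 1 / k) powr p * b powr p" using ab k by (simp add: powr_mult)
    finally show ?thesis using assms by (smt (verit) mult_nonneg_nonneg powr_ge_zero)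
  qed
qed

lemma powr_add_le2:
  fixes p a b :: real
  assumes "1 < p" "0 \<le> a" "0 \<le> b"
  shows "(a + b) powr p \<le> 2 powr p * (a powr p + b powr p)"
proof -
  have "(a + b) powr p \<le> (2 * max a b) powr p" using assms by (intro powr_mono2) auto
  also have "\<dots> = 2 powr p * max a b powr p" using assms by (simp add: powr_mult)
  also have "max a b powr p \<le> a powr p + b powr p" by (auto simp: max_def)
  finally show ?thesis by simp
qed

lemma has_real_derivative_abs_powr:
  fixes p t :: real
  assumes "1 < p"
  shows "((\<lambda>t. \<bar>t\<bar> powr p) has_real_derivative p * (\<bar>t\<bar> powr (p - 2) * t)) (at t)"
proof -
  consider "t > 0" | "t < 0" | "t = 0" by linarith
  then show ?thesis
  proof cases
    case 1
    have "((\<lambda>t. t powr p) has_real_derivative p * t powr (p - 1)) (at t)"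
      using 1 by (auto intro!: derivative_eq_intros)
    moreover have "t powr (p - 1) = \<bar>t\<bar> powr (p - 2) * t" using 1 abs_powr_mult_self(2)[of t p] by simp
    ultimately show ?thesis
      using 1 by (auto elim!: DERIV_cong_ev[THEN iffD1, rotated -1]
          intro!: eventually_mono[OF eventually_nhds_in_open[of "{0<..}"]])
  next
    case 2
    have "((\<lambda>t. (- t) powr p) has_real_derivative - (p * (- t) powr (p - 1))) (at t)"
      using 2 by (auto intro!: derivative_eq_intros)
    moreover have "- ((- t) powr (p - 1)) = \<bar>t\<bar> powr (p - 2) * t"
      using 2 abs_powr_mult_self(2)[of t p] by (simp add: abs_mult)
    then have "- (p * (- t) powr (p - 1)) = p * (\<bar>t\<bar> powr (p - 2) * t)" by (simp flip: mult_minus_right)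
    ultimately show ?thesis
      using 2 by (auto elim!: DERIV_cong_ev[THEN iffD1, rotated -1]
          intro!: eventually_mono[OF eventually_nhds_in_open[of "{..<0}"]])
  next
    case 3
    have "((\<lambda>h::real. \<bar>h\<bar> powr (p - 1)) \<longlongrightarrow> \<bar>0\<bar> powr (p - 1)) (at 0)"
      using assms by (intro tendsto_powr' tendsto_rabs tendsto_ident_at) auto
    then have "((\<lambda>h::real. \<bar>h\<bar> powr (p - 1)) \<longlongrightarrow> 0) (at 0)" by simp
    then have "((\<lambda>h::real. \<bar>h\<bar> powr p / h) \<longlongrightarrow> 0) (at 0)"
    proof (rule Lim_null_comparison[rotated])
      have "norm (\<bar>h\<bar> powr p / h) \<le> \<bar>h\<bar> powr (p - 1)" if "h \<noteq> 0" for h :: real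
        using that by (simp add: powr_diff)
      then show "\<forall>\<^sub>F h::real in at 0. norm (\<bar>h\<bar> powr p / h) \<le> \<bar>h\<bar> powr (p - 1)"
        by (simp add: eventually_at_filter)
    qed
    then show ?thesis using 3 assms by (simp add: has_field_derivative_iff)
  qed
qed

lemma integrable_powr_norm_add:
  fixes f g :: "'c \<Rightarrow> 'b::euclidean_space"
  assumes "1 < p" "f \<in> borel_measurable M" "g \<in> borel_measurable M"
    and "integrable M (\<lambda>x. norm (f x) powr p)" "integrable M (\<lambda>x. norm (g x) powr p)"
  shows "integrable M (\<lambda>x. norm (f x + g x) powr p)"
proof (rule Bochner_Integration.integrable_bound)
  show "integrable M (\<lambda>x. 2 powr p * (norm (f x) powr p + norm (g x) powr p))"
    using assms by simp
  show "(\<lambda>x. norm (f x + g x) powr p) \<in> borel_measurable M" using assms by measurable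
  have "norm (f x + g x) powr p \<le> 2 powr p * (norm (f x) powr p + norm (g x) powr p)" for x
    by (rule order_trans[OF powr_mono2 powr_add_le2]) (use assms norm_triangle_ineq in auto)
  then show "AE x in M. norm (norm (f x + g x) powr p)
      \<le> norm (2 powr p * (norm (f x) powr p + norm (g x) powr p))" by simp
qed

lemma integrable_powr_norm_diff:
  fixes f g :: "'c \<Rightarrow> 'b::euclidean_space"
  assumes "1 < p" "f \<in> borel_measurable M" "g \<in> borel_measurable M"
    and "integrable M (\<lambda>x. norm (f x) powr p)" "integrable M (\<lambda>x. norm (g x) powr p)"
  shows "integrable M (\<lambda>x. norm (f x - g x) powr p)"
  using integrable_powr_norm_add[of p f M "\<lambda>x. - g x"] assms by simp

lemma integral_powr_norm_le:
  fixes f g :: "'c \<Rightarrow> 'b::euclidean_space"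
  assumes "1 < p" "f \<in> borel_measurable M" "g \<in> borel_measurable M"
    and "integrable M (\<lambda>x. norm (f x) powr p)" "integrable M (\<lambda>x. norm (g x) powr p)"
    and C: "\<And>a b::real. 0 \<le> a \<Longrightarrow> 0 \<le> b \<Longrightarrow> (a + b) powr p \<le> (1 + \<eta>) * a powr p + C * b powr p"
  shows "(LINT x|M. norm (f x) powr p)
     \<le> (1 + \<eta>) * (LINT x|M. norm (g x) powr p) + C * (LINT x|M. norm (f x - g x) powr p)"
proof -
  have i: "integrable M (\<lambda>x. norm (f x - g x) powr p)"
    using assms by (intro integrable_powr_norm_diff)
  have "(LINT x|M. norm (f x) powr p)
      \<le> (LINT x|M. (1 + \<eta>) * norm (g x) powr p + C * norm (f x - g x) powr p)"
  proof (rule integral_mono)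
    fix x
    have "norm (f x) powr p \<le> (norm (g x) + norm (f x - g x)) powr p"
      using assms(1) norm_triangle_sub by (intro powr_mono2) auto
    also have "\<dots> \<le> (1 + \<eta>) * norm (g x) powr p + C * norm (f x - g x) powr p"
      by (intro C) auto
    finally show "norm (f x) powr p \<le> (1 + \<eta>) * norm (g x) powr p + C * norm (f x - g x) powr p" .
  qed (use assms i in auto)
  also have "\<dots> = (1 + \<eta>) * (LINT x|M. norm (g x) powr p) + C * (LINT x|M. norm (f x - g x) powr p)"
    using assms i by simp
  finally show ?thesis .
qed

text \<open>The near-triangle inequality is applied in both directions, with \<open>F n\<close> and
  \<open>f\<close> exchanged, so convergence of the energies follows from convergence of the
  differences alone, without pointwise limits or a dominating function.\<close>

lemma tendsto_integral_powr_norm: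
  fixes F :: "nat \<Rightarrow> 'c \<Rightarrow> 'b::euclidean_space"
  assumes p: "1 < p" and F: "\<And>n. F n \<in> borel_measurable M" "\<And>n. integrable M (\<lambda>x. norm (F n x) powr p)"
    and f: "f \<in> borel_measurable M" "integrable M (\<lambda>x. norm (f x) powr p)"
    and lim: "(\<lambda>n. LINT x|M. norm (F n x - f x) powr p) \<longlonglongrightarrow> 0"
  shows "(\<lambda>n. LINT x|M. norm (F n x) powr p) \<longlonglongrightarrow> (LINT x|M. norm (f x) powr p)"
proof (rule LIMSEQ_I)
  fix e :: real assume e: "0 < e"
  define I where "I = (LINT x|M. norm (f x) powr p)"
  define J where "J n = (LINT x|M. norm (F n x) powr p)" for n
  define D where "D n = (LINT x|M. norm (F n x - f x) powr p)" for n
  have I0: "0 \<le> I" and J0: "\<And>n. 0 \<le> J n" and D0: "\<And>n. 0 \<le> D n"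
    by (auto simp: I_def J_def D_def)
  \<comment> \<open>Chosen so that \<open>\<eta> * I\<close> is at most \<open>e / 4\<close>; being
    at most 1, it also controls the quadratic term that appears when \<open>J n\<close> is in turn
    estimated by \<open>I\<close>.\<close>
  define \<eta> where "\<eta> = min 1 (e / (4 * I + 4))"
  have \<eta>: "0 < \<eta>" "\<eta> \<le> 1" using e I0 by (auto simp: \<eta>_def)
  have "\<eta> * (4 * I + 4) \<le> e / (4 * I + 4) * (4 * I + 4)" using I0 by (intro mult_right_mono) (auto simp: \<eta>_def)
  moreover have "e / (4 * I + 4) * (4 * I + 4) = e" using I0 by simp
  ultimately have \<eta>I: "\<eta> * I * 4 + 4 * \<eta> \<le> e" by (simp add: algebra_simps)
  obtain C where C: "0 \<le> C" "\<And>a b::real. 0 \<le> a \<Longrightarrow> 0 \<le> b \<Longrightarrow> (a + b) powr p \<le> (1 + \<eta>) * a powr p + C * b powr p"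
    using powr_add_le[OF p \<eta>(1)] by blast
  have 1: "J n \<le> (1 + \<eta>) * I + C * D n" for n
    unfolding J_def I_def D_def by (rule integral_powr_norm_le[OF p]) (use F f C in auto)
  have 2: "I \<le> (1 + \<eta>) * J n + C * D n" for n
    unfolding J_def I_def D_def norm_minus_commute[of "F n _" "f _"]
    by (rule integral_powr_norm_le[OF p]) (use F f C in auto)
  have "(\<lambda>n. C * D n) \<longlonglongrightarrow> C * 0" using lim unfolding D_def by (intro tendsto_intros)
  then have "\<forall>\<^sub>F n in sequentially. C * D n < e / 8"
    using e by (intro order_tendstoD(2)) auto
  then obtain n0 where n0: "\<And>n. n \<ge> n0 \<Longrightarrow> C * D n < e / 8" by (auto simp: eventually_sequentially)
  show "\<exists>n0. \<forall>n\<ge>n0. norm ((LINT x|M. norm (F n x) powr p) - (LINT x|M. norm (f x) powr p)) < e"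
  proof (intro exI allI impI)
    fix n assume "n \<ge> n0"
    then have CD: "C * D n < e / 8" using n0 by auto
    have a: "J n - I < e" using 1[of n] CD \<eta>I \<eta> e I0 by (simp add: algebra_simps)
    have "\<eta> * J n \<le> \<eta> * ((1 + \<eta>) * I + C * D n)" using 1[of n] \<eta> by (intro mult_left_mono) auto
    also have "\<dots> = \<eta> * I + \<eta> * (\<eta> * I) + \<eta> * (C * D n)" by (simp add: algebra_simps)
    also have "\<dots> \<le> \<eta> * I + 1 * (\<eta> * I) + 1 * (C * D n)"
      using \<eta> I0 C D0 by (intro add_mono mult_right_mono order_refl) auto
    finally have b: "I - J n < e" using 2[of n] CD \<eta>I \<eta> e I0 by (simp add: algebra_simps)
    from a b show "norm ((LINT x|M. norm (F n x) powr p) - (LINT x|M. norm (f x) powr p)) < e"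
      by (simp add: I_def J_def)
  qed
qed

text \<open>Jensen's inequality for the probability density \<open>\<eta>\<close>: the p-th power
  lies above its tangent at the mean \<open>m\<close> of the norms, and that tangent bound is
  \<open>young_powr\<close>.\<close>

lemma powr_norm_integral_le:
  fixes F :: "'c \<Rightarrow> 'b::euclidean_space"
  assumes p: "1 < p" and \<eta>: "\<And>z. 0 \<le> \<eta> z" "integrable M \<eta>" "(LINT z|M. \<eta> z) = 1"
    and i: "integrable M (\<lambda>z. \<eta> z * norm (F z))" "integrable M (\<lambda>z. \<eta> z * norm (F z) powr p)"
  shows "norm (LINT z|M. \<eta> z *\<^sub>R F z) powr p \<le> (LINT z|M. \<eta> z * norm (F z) powr p)"
proof -
  define m where "m = (LINT z|M. \<eta> z * norm (F z))"
  have m0: "0 \<le> m" unfolding m_def using \<eta>(1) by (intro integral_nonneg_AE) auto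
  have "norm (LINT z|M. \<eta> z *\<^sub>R F z) \<le> m"
    using integral_norm_bound[of M "\<lambda>z. \<eta> z *\<^sub>R F z"] \<eta>(1) by (simp add: m_def)
  then have "norm (LINT z|M. \<eta> z *\<^sub>R F z) powr p \<le> m powr p" using p by (intro powr_mono2) auto
  \<comment> \<open>Because \<open>\<eta>\<close> has mass 1, integrating the tangent at
    \<open>m\<close> returns the value of the power at the mean.\<close>
  also have "m powr p = (LINT z|M. p * m powr (p - 1) * (\<eta> z * norm (F z)) - (p - 1) * m powr p * \<eta> z)"
  proof -
    have "m powr (p - 1) * m = m powr p" using m0 by (cases "m = 0") (auto simp: powr_diff)
    moreover have "(LINT z|M. p * m powr (p - 1) * (\<eta> z * norm (F z)) - (p - 1) * m powr p * \<eta> z)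
        = p * m powr (p - 1) * m - (p - 1) * m powr p"
      using \<eta> i by (simp add: m_def)
    ultimately show ?thesis by (simp add: left_diff_distrib mult.assoc)
  qed
  also have "\<dots> \<le> (LINT z|M. \<eta> z * norm (F z) powr p)"
  proof (rule integral_mono)
    fix z
    have "\<eta> z * (p * norm (F z) * m powr (p - 1)) \<le> \<eta> z * (norm (F z) powr p + (p - 1) * m powr p)"
      using young_powr[OF p, of "norm (F z)" m] m0 \<eta>(1) by (intro mult_left_mono) auto
    then show "p * m powr (p - 1) * (\<eta> z * norm (F z)) - (p - 1) * m powr p * \<eta> z \<le> \<eta> z * norm (F z) powr p"
      by (simp add: algebra_simps)
  qed (use \<eta> i in auto)
  finally show ?thesis .
qed

lemma nn_integral_lborel_affine:
  fixes f :: "'a::euclidean_space \<Rightarrow> ennreal"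
  assumes [measurable]: "f \<in> borel_measurable borel" and c: "c \<noteq> 0"
  shows "(\<integral>\<^sup>+x. f (t + c *\<^sub>R x) \<partial>lborel) = ennreal (1 / \<bar>c\<bar> ^ DIM('a)) * (\<integral>\<^sup>+x. f x \<partial>lborel)"
proof -
  have "(\<integral>\<^sup>+x. f x \<partial>lborel) = (\<integral>\<^sup>+x. ennreal (\<bar>c\<bar> ^ DIM('a)) * f (t + c *\<^sub>R x) \<partial>lborel)"
    by (subst lborel_affine[OF c, of t]) (simp add: nn_integral_density nn_integral_distr)
  also have "\<dots> = ennreal (\<bar>c\<bar> ^ DIM('a)) * (\<integral>\<^sup>+x. f (t + c *\<^sub>R x) \<partial>lborel)"
    by (rule nn_integral_cmult) measurable
  finally show ?thesis
    using c by (simp add: mult.assoc[symmetric] ennreal_mult'[symmetric])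
qed

lemma
  fixes f :: "'a::euclidean_space \<Rightarrow> 'b::euclidean_space"
  assumes [measurable]: "f \<in> borel_measurable borel" and c: "c \<noteq> 0"
  shows integral_lborel_affine:
      "(LINT x|lborel. f (t + c *\<^sub>R x)) = (1 / \<bar>c\<bar> ^ DIM('a)) *\<^sub>R (LINT x|lborel. f x)"
    and integrable_lborel_affine: "integrable lborel (\<lambda>x. f (t + c *\<^sub>R x)) \<longleftrightarrow> integrable lborel f"
proof -
  have "(LINT x|lborel. f x) = (LINT x|lborel. \<bar>c\<bar> ^ DIM('a) *\<^sub>R f (t + c *\<^sub>R x))"
    by (subst lborel_affine[OF c, of t]) (simp add: integral_density integral_distr)
  then show "(LINT x|lborel. f (t + c *\<^sub>R x)) = (1 / \<bar>c\<bar> ^ DIM('a)) *\<^sub>R (LINT x|lborel. f x)"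
    using c by simp
  have "integrable lborel f \<longleftrightarrow> integrable lborel (\<lambda>x. \<bar>c\<bar> ^ DIM('a) *\<^sub>R f (t + c *\<^sub>R x))"
    by (subst (1) lborel_affine[OF c, of t]) (simp add: integrable_density integrable_distr_eq)
  also have "\<dots> \<longleftrightarrow> integrable lborel (\<lambda>x. f (t + c *\<^sub>R x))"
  proof
    assume "integrable lborel (\<lambda>x. \<bar>c\<bar> ^ DIM('a) *\<^sub>R f (t + c *\<^sub>R x))"
    then have "integrable lborel (\<lambda>x. (1 / \<bar>c\<bar> ^ DIM('a)) *\<^sub>R \<bar>c\<bar> ^ DIM('a) *\<^sub>R f (t + c *\<^sub>R x))"
      by (rule integrable_scaleR_right)
    then show "integrable lborel (\<lambda>x. f (t + c *\<^sub>R x))" using c by simp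
  qed (intro integrable_scaleR_right)
  finally show "integrable lborel (\<lambda>x. f (t + c *\<^sub>R x)) \<longleftrightarrow> integrable lborel f" by simp
qed

text \<open>The definitions integrate over \<open>lebesgue_on\<close>, whereas Fubini and changes of
  variables are carried out over \<open>lborel\<close> with an indicator. For Borel integrands these
  identities translate between the two.\<close>

lemma
  fixes f :: "'a::euclidean_space \<Rightarrow> 'b::euclidean_space"
  assumes "S \<in> sets borel" and [measurable]: "f \<in> borel_measurable borel"
  shows integral_lebesgue_on_borel: "(LINT x|lebesgue_on S. f x) = (LINT x|lborel. indicator S x *\<^sub>R f x)"
    and integrable_lebesgue_on_borel: "integrable (lebesgue_on S) f \<longleftrightarrow> integrable lborel (\<lambda>x. indicator S x *\<^sub>R f x)"
proof -
  have [measurable]: "S \<in> sets borel" by fact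
  have S: "S \<inter> space lebesgue \<in> sets lebesgue" using assms(1) by simp
  have "(\<lambda>x. indicator S x *\<^sub>R f x) \<in> lborel \<rightarrow>\<^sub>M borel" by measurable
  then show "(LINT x|lebesgue_on S. f x) = (LINT x|lborel. indicator S x *\<^sub>R f x)"
    "integrable (lebesgue_on S) f \<longleftrightarrow> integrable lborel (\<lambda>x. indicator S x *\<^sub>R f x)"
    using S by (simp_all add: integral_restrict_space integrable_restrict_space integral_completion integrable_completion)
qed

section \<open>Gradients and smooth functions\<close>

text \<open>The gradient is an explicit argument, matching the predicates for weak gradients.
  Continuity of \<open>g\<close> is assumed separately where it matters, because the trial functions
  are only shown to have bounded gradients.\<close>

definition has_gradient :: "('a::euclidean_space \<Rightarrow> real) \<Rightarrow> ('a \<Rightarrow> 'a) \<Rightarrow> bool" where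
  "has_gradient f g \<longleftrightarrow> (\<forall>x. (f has_derivative (\<lambda>h. g x \<bullet> h)) (at x))"

lemma has_gradientD: "has_gradient f g \<Longrightarrow> (f has_derivative (\<lambda>h. g x \<bullet> h)) (at x)"
  by (simp add: has_gradient_def)

lemma has_gradient_continuous: "has_gradient f g \<Longrightarrow> continuous_on UNIV f"
  by (meson continuous_at_imp_continuous_on has_derivative_continuous has_gradientD)

lemma has_gradient_line:
  assumes "has_gradient f g"
  shows "((\<lambda>t. f (x + t *\<^sub>R h)) has_real_derivative (g (x + t *\<^sub>R h) \<bullet> h)) (at t)"
proof -
  have "((\<lambda>t. x + t *\<^sub>R h) has_derivative (\<lambda>t. t *\<^sub>R h)) (at t)" by (auto intro!: derivative_eq_intros)
  from has_derivative_compose[OF this has_gradientD[OF assms]]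
  show ?thesis by (simp add: has_field_derivative_def mult.commute[of _ "g _ \<bullet> _"] cong: if_cong)
qed

lemma has_gradient_mvt:
  assumes "has_gradient f g"
  obtains t where "0 < t" "t < 1" "f (x + h) - f x = g (x + t *\<^sub>R h) \<bullet> h"
proof -
  have "\<exists>z>0. z < 1 \<and> f (x + 1 *\<^sub>R h) - f (x + 0 *\<^sub>R h) = (1 - 0) * (g (x + z *\<^sub>R h) \<bullet> h)"
    by (rule MVT2) (auto intro: has_gradient_line[OF assms])
  then show ?thesis using that by auto
qed

lemma has_gradient_mult:
  assumes "has_gradient f g" "has_gradient f' g'"
  shows "has_gradient (\<lambda>x. f x * f' x) (\<lambda>x. f x *\<^sub>R g' x + f' x *\<^sub>R g x)"
  unfolding has_gradient_def
proof
  fix x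
  show "((\<lambda>x. f x * f' x) has_derivative (\<lambda>h. (f x *\<^sub>R g' x + f' x *\<^sub>R g x) \<bullet> h)) (at x)"
    by (rule has_derivative_eq_rhs[OF has_derivative_mult[OF has_gradientD[OF assms(1)] has_gradientD[OF assms(2)]]])
      (auto simp: inner_add_left mult.commute)
qed

lemma has_gradient_cmult: "has_gradient f g \<Longrightarrow> has_gradient (\<lambda>x. c * f x) (\<lambda>x. c *\<^sub>R g x)"
  unfolding has_gradient_def by (auto intro!: derivative_eq_intros)

lemma has_gradient_add_const: "has_gradient f g \<Longrightarrow> has_gradient (\<lambda>x. f x + c) g"
  unfolding has_gradient_def by (auto intro!: derivative_eq_intros)

lemma has_gradient_diff:
  "has_gradient f g \<Longrightarrow> has_gradient f' g' \<Longrightarrow> has_gradient (\<lambda>x. f x - f' x) (\<lambda>x. g x - g' x)"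
  unfolding has_gradient_def by (auto intro!: derivative_eq_intros simp: inner_diff_left)

lemma has_gradient_affine:
  assumes "has_gradient f g"
  shows "has_gradient (\<lambda>x. f (t + c *\<^sub>R x)) (\<lambda>x. c *\<^sub>R g (t + c *\<^sub>R x))"
  unfolding has_gradient_def
proof
  fix x
  have "((\<lambda>x. t + c *\<^sub>R x) has_derivative (\<lambda>h. c *\<^sub>R h)) (at x)" by (auto intro!: derivative_eq_intros)
  from has_derivative_compose[OF this has_gradientD[OF assms]]
  show "((\<lambda>x. f (t + c *\<^sub>R x)) has_derivative (\<lambda>h. (c *\<^sub>R g (t + c *\<^sub>R x)) \<bullet> h)) (at x)" by simp
qed

lemma has_gradient_unique:
  assumes "has_gradient f g" "has_gradient f g'" shows "g = g'"
proof
  fix x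
  have "(\<lambda>h. g x \<bullet> h) = (\<lambda>h. g' x \<bullet> h)"
    using assms has_derivative_unique unfolding has_gradient_def by blast
  then show "g x = g' x" by (metis inner_commute vector_eq_rdot)
qed

lemma has_gradient_frechet:
  "has_gradient f g \<Longrightarrow> frechet_derivative f (at x) h = g x \<bullet> h"
  by (metis frechet_derivative_at has_gradientD)

lemma has_gradient_grad:
  assumes "\<And>x. f differentiable (at x)"
  shows "has_gradient f (grad f)"
  unfolding has_gradient_def
proof
  fix x
  have d: "(f has_derivative frechet_derivative f (at x)) (at x)"
    using assms frechet_derivative_works by blast
  then interpret bounded_linear "frechet_derivative f (at x)" by (rule has_derivative_bounded_linear)
  have "frechet_derivative f (at x) h = grad f x \<bullet> h" for h
  proof -
    have "frechet_derivative f (at x) h = frechet_derivative f (at x) (\<Sum>i\<in>Basis. (h \<bullet> i) *\<^sub>R i)"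
      by (simp add: euclidean_representation)
    also have "\<dots> = (\<Sum>i\<in>Basis. (h \<bullet> i) * frechet_derivative f (at x) i)"
      by (simp add: sum scaleR)
    also have "\<dots> = grad f x \<bullet> h"
      by (simp add: grad_def inner_sum_left inner_commute[of h] mult.commute)
    finally show ?thesis .
  qed
  then show "(f has_derivative (\<lambda>h. grad f x \<bullet> h)) (at x)"
    using d by (metis (no_types, lifting) ext)
qed

lemma has_gradient_eq_grad: "has_gradient f g \<Longrightarrow> grad f = g"
  by (meson differentiable_def has_gradientD has_gradient_grad has_gradient_unique)

text \<open>Each component of the gradient is a pointwise limit of continuous difference quotients,
  so it is Borel even when it is not continuous.\<close>

lemma has_gradient_measurable:
  assumes "has_gradient f g"
  shows "g \<in> borel_measurable borel"
proof -
  have [measurable]: "f \<in> borel_measurable borel"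
    using has_gradient_continuous[OF assms] by (rule borel_measurable_continuous_onI)
  have "(\<lambda>x. g x \<bullet> i) \<in> borel_measurable borel" for i
  proof (rule borel_measurable_LIMSEQ_real)
    fix x
    have "((\<lambda>t. (f (x + t *\<^sub>R i) - f x) / t) \<longlongrightarrow> g x \<bullet> i) (at 0)"
      using has_gradient_line[OF assms, of x i 0] by (simp add: has_field_derivative_iff)
    moreover have "filterlim (\<lambda>n. inverse (real (Suc n))) (at 0) sequentially"
      using LIMSEQ_inverse_real_of_nat by (auto simp: filterlim_at)
    ultimately show "(\<lambda>n. (f (x + inverse (real (Suc n)) *\<^sub>R i) - f x) / inverse (real (Suc n))) \<longlonglongrightarrow> g x \<bullet> i"
      by (rule filterlim_compose)
  qed measurable
  then show ?thesis
    by (subst borel_measurable_euclidean_space) auto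
qed

lemma has_gradient_zero_outside:
  assumes "has_gradient f g" "\<And>x. B < norm x \<Longrightarrow> f x = 0" "B < norm x"
  shows "g x = 0"
proof -
  have "((\<lambda>_. 0) has_derivative (\<lambda>h. g x \<bullet> h)) (at x)"
  proof (rule has_derivative_transform_within_open[OF has_gradientD[OF assms(1)]])
    show "open {y. B < norm y}" by (intro open_Collect_less continuous_intros)
  qed (use assms in auto)
  then have "(\<lambda>h. g x \<bullet> h) = (\<lambda>_. 0)"
    by (rule has_derivative_unique) simp
  then show ?thesis by (metis inner_eq_zero_iff)
qed

text \<open>The germ of all integrations by parts. Translation invariance makes the integral of
  every difference quotient vanish, and the mean value theorem bounds the quotients by
  \<open>C\<close> on a slightly larger ball, so dominated convergence applies with a merely bounded
  gradient.\<close>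

lemma integral_gradient_zero:
  fixes f :: "'a::euclidean_space \<Rightarrow> real"
  assumes g: "has_gradient f g" and C: "\<And>x. norm (g x) \<le> C" and B: "\<And>x. B < norm x \<Longrightarrow> f x = 0"
    and i: "i \<in> Basis"
  shows "(LINT x|lborel. g x \<bullet> i) = 0"
proof -
  define t where "t n = inverse (real (Suc n))" for n
  have t: "0 < t n" "t n \<le> 1" for n by (auto simp: t_def field_simps)
  have fc: "continuous_on UNIV f" by (rule has_gradient_continuous[OF g])
  have [measurable]: "f \<in> borel_measurable borel"
    using fc by (rule borel_measurable_continuous_onI)
  have [measurable]: "g \<in> borel_measurable borel" by (rule has_gradient_measurable[OF g])
  have C0: "0 \<le> C" using C[of 0] norm_ge_zero order_trans by blast
  have fi: "integrable lborel f"
  proof -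
    have "integrable lborel (\<lambda>x. indicator (cball 0 B) x *\<^sub>R f x)"
      by (rule borel_integrable_compact) (auto intro: continuous_on_subset[OF fc])
    also have "(\<lambda>x. indicator (cball 0 B) x *\<^sub>R f x) = f" using B by (auto simp: indicator_def fun_eq_iff)
    finally show ?thesis .
  qed
  have "(\<lambda>n. LINT x|lborel. (f (t n *\<^sub>R i + 1 *\<^sub>R x) - f x) / t n) \<longlonglongrightarrow> (LINT x|lborel. g x \<bullet> i)"
  proof (rule integral_dominated_convergence)
    show "integrable lborel (\<lambda>x::'a. C * indicator (cball 0 (B + 1)) x)"
      using emeasure_lborel_cball_finite[of "0::'a" "B + 1"]
      by (intro integrable_mult_right integrable_real_indicator) (auto simp: less_top[symmetric])
    show "AE x in lborel. (\<lambda>n. (f (t n *\<^sub>R i + 1 *\<^sub>R x) - f x) / t n) \<longlonglongrightarrow> g x \<bullet> i"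
    proof (rule AE_I2)
      fix x
      have "((\<lambda>t. (f (x + t *\<^sub>R i) - f x) / t) \<longlongrightarrow> g x \<bullet> i) (at 0)"
        using has_gradient_line[OF g, of x i 0] by (simp add: has_field_derivative_iff)
      moreover have "filterlim t (at 0) sequentially"
        using LIMSEQ_inverse_real_of_nat unfolding t_def by (auto simp: filterlim_at)
      ultimately have "(\<lambda>n. (f (x + t n *\<^sub>R i) - f x) / t n) \<longlonglongrightarrow> g x \<bullet> i"
        by (rule filterlim_compose)
      then show "(\<lambda>n. (f (t n *\<^sub>R i + 1 *\<^sub>R x) - f x) / t n) \<longlonglongrightarrow> g x \<bullet> i" by (simp add: add.commute)
    qed
    fix n
    show "AE x in lborel. norm ((f (t n *\<^sub>R i + 1 *\<^sub>R x) - f x) / t n) \<le> C * indicator (cball 0 (B + 1)) x"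
    proof (rule AE_I2)
      fix x
      obtain s where s: "f (x + t n *\<^sub>R i) - f x = g (x + s *\<^sub>R t n *\<^sub>R i) \<bullet> (t n *\<^sub>R i)"
        using has_gradient_mvt[OF g] by blast
      have "\<bar>g (x + s *\<^sub>R t n *\<^sub>R i) \<bullet> i\<bar> \<le> C"
        using Cauchy_Schwarz_ineq2[of "g (x + s *\<^sub>R t n *\<^sub>R i)" i] C[of "x + s *\<^sub>R t n *\<^sub>R i"] i by simp
      then have 1: "norm ((f (t n *\<^sub>R i + 1 *\<^sub>R x) - f x) / t n) \<le> C"
        using s t[of n] by (simp add: add.commute)
      have 2: "f (t n *\<^sub>R i + 1 *\<^sub>R x) = 0 \<and> f x = 0" if "x \<notin> cball 0 (B + 1)"
      proof -
        have "norm x \<le> norm (t n *\<^sub>R i + x) + norm (t n *\<^sub>R i)"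
          by (metis add_diff_cancel_left' norm_triangle_ineq4 add.commute)
        then have "B < norm (t n *\<^sub>R i + x)" using that t[of n] i by simp
        then show ?thesis using that B by auto
      qed
      show "norm ((f (t n *\<^sub>R i + 1 *\<^sub>R x) - f x) / t n) \<le> C * indicator (cball 0 (B + 1)) x"
        using 1 2 C0 by (cases "x \<in> cball 0 (B + 1)") auto
    qed
  qed measurable
  moreover have "(LINT x|lborel. (f (t n *\<^sub>R i + 1 *\<^sub>R x) - f x) / t n) = 0" for n
  proof -
    have "integrable lborel (\<lambda>x. f (t n *\<^sub>R i + 1 *\<^sub>R x))"
      using fi by (subst integrable_lborel_affine) auto
    moreover have "(LINT x|lborel. f (t n *\<^sub>R i + 1 *\<^sub>R x)) = (LINT x|lborel. f x)"
      by (subst integral_lborel_affine) auto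
    ultimately have "(LINT x|lborel. f (t n *\<^sub>R i + 1 *\<^sub>R x) - f x) = 0" using fi by simp
    then show ?thesis by (simp only: integral_divide_zero div_0)
  qed
  ultimately have "(\<lambda>n. 0) \<longlonglongrightarrow> (LINT x|lborel. g x \<bullet> i)" by (simp only:)
  then show ?thesis by (simp add: LIMSEQ_const_iff)
qed

section \<open>Closure properties of the classes \<open>Ck\<close> and a smooth bump\<close>

lemma Ck_SucI:
  assumes "has_gradient f g" "\<And>i. i \<in> Basis \<Longrightarrow> Ck n (\<lambda>x. g x \<bullet> i)"
  shows "Ck (Suc n) f"
proof -
  have "f differentiable (at x)" for x using has_gradientD[OF assms(1)] by (rule differentiableI)
  then show ?thesis using assms(2) by (simp add: has_gradient_frechet[OF assms(1)])
qed

lemma Ck_SucD: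
  assumes "Ck (Suc n) f"
  shows "has_gradient f (grad f)" "\<And>i. i \<in> Basis \<Longrightarrow> Ck n (\<lambda>x. grad f x \<bullet> i)"
proof -
  show 1: "has_gradient f (grad f)" using assms by (intro has_gradient_grad) auto
  show "Ck n (\<lambda>x. grad f x \<bullet> i)" if "i \<in> Basis" for i
    using assms that by (simp add: has_gradient_frechet[OF 1])
qed

lemma Ck_Suc_imp: "Ck (Suc n) f \<Longrightarrow> Ck n f"
proof (induction n arbitrary: f)
  case 0
  then show ?case using has_gradient_continuous[OF Ck_SucD(1)[OF 0]] by simp
next
  case (Suc n)
  show ?case by (rule Ck_SucI[OF Ck_SucD(1)[OF Suc.prems]]) (rule Suc.IH[OF Ck_SucD(2)[OF Suc.prems]])
qed

lemma Ck_continuous: "Ck n f \<Longrightarrow> continuous_on UNIV f"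
proof (induction n)
  case (Suc n)
  then show ?case using Ck_Suc_imp by blast
qed simp

lemma Ck_const: "Ck n (\<lambda>x. c)"
proof (induction n arbitrary: c)
  case (Suc n)
  show ?case by (rule Ck_SucI[where g = "\<lambda>_. 0"]) (auto simp: has_gradient_def Suc)
qed auto

lemma Ck_add: "Ck n f \<Longrightarrow> Ck n g \<Longrightarrow> Ck n (\<lambda>x. f x + g x)"
proof (induction n arbitrary: f g)
  case (Suc n)
  have "has_gradient (\<lambda>x. f x + g x) (\<lambda>x. grad f x + grad g x)"
    using Suc.prems[THEN Ck_SucD(1)] unfolding has_gradient_def
    by (auto intro!: derivative_eq_intros simp: inner_add_left)
  moreover have "Ck n (\<lambda>x. grad f x \<bullet> i + grad g x \<bullet> i)" if "i \<in> Basis" for i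
    using that by (intro Suc.IH Ck_SucD(2)[OF Suc.prems(1)] Ck_SucD(2)[OF Suc.prems(2)])
  ultimately show ?case
    by (intro Ck_SucI[where g = "\<lambda>x. grad f x + grad g x"]) (auto simp: inner_add_left)
qed (auto intro: continuous_intros)

lemma Ck_mult: "Ck n f \<Longrightarrow> Ck n g \<Longrightarrow> Ck n (\<lambda>x. f x * g x)"
proof (induction n arbitrary: f g)
  case (Suc n)
  have "Ck n (\<lambda>x. f x * (grad g x \<bullet> i) + g x * (grad f x \<bullet> i))" if "i \<in> Basis" for i
    using that by (intro Ck_add Suc.IH Ck_Suc_imp[OF Suc.prems(1)] Ck_Suc_imp[OF Suc.prems(2)]
        Ck_SucD(2)[OF Suc.prems(1)] Ck_SucD(2)[OF Suc.prems(2)])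
  then show ?case
    by (intro Ck_SucI[OF has_gradient_mult[OF Ck_SucD(1)[OF Suc.prems(1)] Ck_SucD(1)[OF Suc.prems(2)]]])
      (simp add: inner_add_left)
qed (auto intro: continuous_intros)

lemma Ck_inner: "Ck n (\<lambda>x. x \<bullet> b)"
proof (cases n)
  case (Suc m)
  have "has_gradient (\<lambda>x. x \<bullet> b) (\<lambda>_. b)"
    by (auto simp: has_gradient_def inner_commute intro!: derivative_eq_intros)
  then show ?thesis unfolding Suc by (rule Ck_SucI) (rule Ck_const)
qed (auto intro: continuous_intros)

lemma Ck_affine: "Ck n f \<Longrightarrow> Ck n (\<lambda>x. f (t + c *\<^sub>R x))"
proof (induction n arbitrary: f)
  case 0
  then show ?case by (auto intro!: continuous_intros continuous_on_compose2[of UNIV f])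
next
  case (Suc n)
  have "Ck n (\<lambda>x. c * (grad f (t + c *\<^sub>R x) \<bullet> i))" if "i \<in> Basis" for i
    using Suc.IH[OF Ck_SucD(2)[OF Suc.prems that]] by (intro Ck_mult Ck_const)
  then show ?case
    by (intro Ck_SucI[OF has_gradient_affine[OF Ck_SucD(1)[OF Suc.prems]]]) simp
qed

text \<open>With polynomial prefactors the class of flat exponentials is closed under differentiation.\<close>

definition flat_exp :: "real poly \<Rightarrow> real \<Rightarrow> real" where
  "flat_exp P t = (if 0 < t then poly P (1 / t) * exp (- (1 / t)) else 0)"

lemma poly_mult_exp_tendsto_0: "((\<lambda>u::real. poly Q u * exp (- u)) \<longlongrightarrow> 0) at_top"
proof -
  have "((\<lambda>u::real. \<Sum>i\<le>degree Q. coeff Q i * (u ^ i / exp u)) \<longlongrightarrow> (\<Sum>i\<le>degree Q. coeff Q i * 0)) at_top"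
    by (intro tendsto_intros tendsto_power_div_exp_0)
  moreover have "(\<Sum>i\<le>degree Q. coeff Q i * (u ^ i / exp u)) = poly Q u * exp (- u)" for u
    by (simp add: poly_altdef sum_distrib_right exp_minus divide_inverse mult.assoc)
  ultimately show ?thesis by simp
qed

text \<open>With \<open>u = 1 / t\<close> one has \<open>d/dt = - u^2 d/du\<close>, and
  differentiating \<open>P(u) exp (- u)\<close> produces the new prefactor
  \<open>u^2 (P - P')\<close>. At 0 the decay of the exponential beats the extra factor
  \<open>u\<close> of the difference quotient.\<close>

lemma flat_exp_derivative:
  "(flat_exp P has_real_derivative flat_exp (monom 1 2 * (P - pderiv P)) t) (at t)"
proof -
  consider "t > 0" | "t < 0" | "t = 0" by linarith
  then show ?thesis
  proof cases
    case 1
    have "((\<lambda>t. poly P (1 / t) * exp (- (1 / t))) has_real_derivative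
        flat_exp (monom 1 2 * (P - pderiv P)) t) (at t)"
      using 1 by (auto intro!: derivative_eq_intros simp: flat_exp_def poly_monom field_simps power2_eq_square)
    then show ?thesis
      by (rule DERIV_cong_ev[THEN iffD1, rotated -1])
        (use 1 in \<open>auto simp: flat_exp_def intro!: eventually_mono[OF eventually_nhds_in_open[of "{0<..}"]]\<close>)
  next
    case 2
    have "((\<lambda>t. 0) has_real_derivative flat_exp (monom 1 2 * (P - pderiv P)) t) (at t)"
      using 2 by (auto simp: flat_exp_def)
    then show ?thesis
      by (rule DERIV_cong_ev[THEN iffD1, rotated -1])
        (use 2 in \<open>auto simp: flat_exp_def intro!: eventually_mono[OF eventually_nhds_in_open[of "{..<0}"]]\<close>)
  next
    case 3
    have "((\<lambda>h. flat_exp P h / h) \<longlongrightarrow> 0) (at_left 0)"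
      by (rule tendsto_eventually) (auto simp: flat_exp_def eventually_at_filter)
    moreover have "((\<lambda>h. flat_exp P h / h) \<longlongrightarrow> 0) (at_right 0)"
    proof -
      have "((\<lambda>h. poly (pCons 0 P) (inverse h) * exp (- inverse h)) \<longlongrightarrow> 0) (at_right (0::real))"
        by (rule filterlim_compose[OF poly_mult_exp_tendsto_0 filterlim_inverse_at_top_right])
      moreover have "\<forall>\<^sub>F h in at_right 0. poly (pCons 0 P) (inverse h) * exp (- inverse h) = flat_exp P h / h"
        by (auto simp: flat_exp_def eventually_at_filter divide_inverse)
      ultimately show ?thesis by (rule Lim_transform_eventually)
    qed
    ultimately have "((\<lambda>h. flat_exp P h / h) \<longlongrightarrow> 0) (at 0)" by (simp add: filterlim_split_at)
    then show ?thesis using 3 by (simp add: has_field_derivative_iff flat_exp_def)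
  qed
qed

lemma Ck_flat_exp: "Ck n (\<lambda>x::'a::euclidean_space. flat_exp P (1 - x \<bullet> x))"
proof (induction n arbitrary: P)
  case 0
  have "continuous_on UNIV (flat_exp P)"
    by (meson DERIV_isCont continuous_at_imp_continuous_on flat_exp_derivative)
  then show ?case by (auto intro!: continuous_intros continuous_on_compose2[of UNIV "flat_exp P"])
next
  case (Suc n)
  let ?Q = "monom 1 2 * (P - pderiv P)"
  have "has_gradient (\<lambda>x::'a. flat_exp P (1 - x \<bullet> x)) (\<lambda>x. (-2 * flat_exp ?Q (1 - x \<bullet> x)) *\<^sub>R x)"
    unfolding has_gradient_def
  proof
    fix x :: 'a
    have "((\<lambda>x::'a. 1 - x \<bullet> x) has_derivative (\<lambda>h. - 2 * (x \<bullet> h))) (at x)"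
      by (auto intro!: derivative_eq_intros simp: inner_commute)
    from has_derivative_compose[OF this flat_exp_derivative[of P "1 - x \<bullet> x", unfolded has_field_derivative_def]]
    show "((\<lambda>x. flat_exp P (1 - x \<bullet> x)) has_derivative (\<lambda>h. ((-2 * flat_exp ?Q (1 - x \<bullet> x)) *\<^sub>R x) \<bullet> h)) (at x)"
      by (simp add: mult_ac)
  qed
  moreover have "Ck n (\<lambda>x::'a. (-2 * flat_exp ?Q (1 - x \<bullet> x)) * (x \<bullet> i))" for i
    by (intro Ck_mult Ck_const Suc.IH Ck_inner)
  ultimately show ?case by (intro Ck_SucI) auto
qed

lemma AE_notin_open:
  fixes S :: "'a::euclidean_space set"
  assumes S: "open S" and ae: "AE x in lborel. x \<notin> S"
  shows "S = {}"
proof -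
  have "{x \<in> space lborel. \<not> x \<notin> S} = S" by simp
  then have "emeasure lborel S = 0"
    using AE_iff_measurable[of S lborel "\<lambda>x. x \<notin> S"] ae S by simp
  then have "S \<in> null_sets lborel" using S by auto
  then have "S \<in> null_sets lebesgue" by (rule null_sets_completionI)
  then show ?thesis using open_not_negligible[OF S] negligible_iff_null_sets by blast
qed

lemma mollifier_exists:
  obtains \<eta> :: "'a::euclidean_space \<Rightarrow> real"
  where "\<And>n. Ck n \<eta>" "\<And>x. 0 \<le> \<eta> x" "\<And>x. 1 \<le> norm x \<Longrightarrow> \<eta> x = 0"
    "integrable lborel \<eta>" "(LINT x|lborel. \<eta> x) = 1"
proof -
  \<comment> \<open>The classical bump \<open>exp (- 1 / (1 - |x|^2))\<close> on the unit ball,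
    normalised at the end.\<close>
  define b :: "'a \<Rightarrow> real" where "b x = flat_exp 1 (1 - x \<bullet> x)" for x
  have Ckb: "Ck n b" for n unfolding b_def by (rule Ck_flat_exp)
  have b0: "0 \<le> b x" for x by (simp add: b_def flat_exp_def)
  have b1: "1 \<le> norm x \<Longrightarrow> b x = 0" for x
  proof -
    assume "1 \<le> norm x"
    then have "1 \<le> x \<bullet> x" using power_mono[of 1 "norm x" 2] by (simp add: dot_square_norm)
    then show "b x = 0" by (simp add: b_def flat_exp_def)
  qed
  have bc: "continuous_on UNIV b" using Ckb[of 0] by simp
  have bi: "integrable lborel b"
  proof -
    have "integrable lborel (\<lambda>x. indicator (cball 0 1) x *\<^sub>R b x)"
      by (rule borel_integrable_compact) (auto intro: continuous_on_subset[OF bc])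
    also have "(\<lambda>x. indicator (cball 0 1) x *\<^sub>R b x) = b" using b1 by (auto simp: indicator_def fun_eq_iff)
    finally show ?thesis .
  qed
  have "(LINT x|lborel. b x) \<noteq> 0"
  proof
    assume "(LINT x|lborel. b x) = 0"
    then have "AE x in lborel. b x = 0" using integral_nonneg_eq_0_iff_AE[OF bi] b0 by simp
    moreover have "AE x in lborel. x \<in> ball (0::'a) 1 \<longrightarrow> b x \<noteq> 0"
      by (rule AE_I2) (auto simp: b_def flat_exp_def dot_square_norm power_less_one_iff abs_square_less_1)
    ultimately have "AE x in lborel. x \<notin> ball (0::'a) 1" by eventually_elim auto
    then have "ball (0::'a) 1 = {}" by (rule AE_notin_open[OF open_ball])
    then show False by simp
  qed
  moreover have "0 \<le> (LINT x|lborel. b x)" using b0 by simp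
  ultimately have pos: "0 < (LINT x|lborel. b x)" by simp
  show ?thesis
  proof (rule that[of "\<lambda>x. (1 / (LINT x|lborel. b x)) * b x"])
    show "Ck n (\<lambda>x. (1 / (LINT x|lborel. b x)) * b x)" for n by (intro Ck_mult Ck_const Ckb)
  qed (use b0 b1 bi pos in auto)
qed

lemma uniformly_continuous_compact_support:
  fixes f :: "'a::euclidean_space \<Rightarrow> 'b::euclidean_space"
  assumes c: "continuous_on UNIV f" and B: "\<And>x. B < norm x \<Longrightarrow> f x = 0"
  shows "uniformly_continuous_on UNIV f"
  unfolding uniformly_continuous_on_def
proof (intro allI impI)
  fix e :: real assume "0 < e"
  have "uniformly_continuous_on (cball 0 (B + 1)) f"
    by (rule compact_uniformly_continuous) (auto intro: continuous_on_subset[OF c])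
  then obtain d where d: "0 < d" "\<And>x y. x \<in> cball 0 (B + 1) \<Longrightarrow> y \<in> cball 0 (B + 1) \<Longrightarrow> dist y x < d \<Longrightarrow> dist (f y) (f x) < e"
    using \<open>0 < e\<close> unfolding uniformly_continuous_on_def by metis
  show "\<exists>d>0. \<forall>x\<in>UNIV. \<forall>x'\<in>UNIV. dist x' x < d \<longrightarrow> dist (f x') (f x) < e"
  proof (intro exI[of _ "min d 1"] conjI ballI impI)
    fix x y :: 'a assume xy: "dist y x < min d 1"
    show "dist (f y) (f x) < e"
    proof (cases "x \<in> cball 0 (B + 1) \<and> y \<in> cball 0 (B + 1)")
      case False
      have "\<bar>norm x - norm y\<bar> < 1" using xy norm_triangle_ineq3[of x y] by (simp add: dist_norm norm_minus_commute)
      then have "B < norm x" "B < norm y" using False by auto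
      then show ?thesis using B \<open>0 < e\<close> by simp
    qed (use d xy in auto)
  qed (use d in auto)
qed

section \<open>Weak gradients and test functions\<close>

lemma integrable_bounded_support:
  fixes f :: "'a::euclidean_space \<Rightarrow> 'b::euclidean_space"
  assumes [measurable]: "f \<in> borel_measurable borel" and "\<And>x. norm x \<le> B \<Longrightarrow> norm (f x) \<le> C"
    and "\<And>x. B < norm x \<Longrightarrow> f x = 0"
  shows "integrable lborel f"
proof (rule Bochner_Integration.integrable_bound)
  show "integrable lborel (\<lambda>x::'a. C * indicator (cball 0 B) x)"
    using emeasure_lborel_cball_finite[of "0::'a" B]
    by (intro integrable_mult_right integrable_real_indicator) (auto simp: less_top[symmetric])
  show "AE x in lborel. norm (f x) \<le> norm (C * indicator (cball 0 B) x :: real)"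
  proof (rule AE_I2)
    fix x
    show "norm (f x) \<le> norm (C * indicator (cball 0 B) x :: real)"
      using assms(2)[of x] assms(3)[of x] by (cases "norm x \<le> B") (auto simp: indicator_def)
  qed
qed measurable

lemma bounded_on_cball:
  fixes f :: "'a::euclidean_space \<Rightarrow> 'b::euclidean_space"
  assumes "continuous_on UNIV f"
  obtains C where "0 \<le> C" "\<And>x. norm x \<le> B \<Longrightarrow> norm (f x) \<le> C"
proof -
  have "compact (f ` cball 0 B)"
    by (intro compact_continuous_image continuous_on_subset[OF assms]) auto
  then have "bounded (f ` cball 0 B)" by (rule compact_imp_bounded)
  then obtain C where C: "\<And>y. y \<in> f ` cball 0 B \<Longrightarrow> norm y \<le> C" unfolding bounded_iff by blast
  show ?thesis
  proof (rule that[of "max 0 C"])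
    fix x :: 'a assume "norm x \<le> B"
    then have "norm (f x) \<le> C" by (intro C imageI) simp
    then show "norm (f x) \<le> max 0 C" by simp
  qed simp
qed

lemma test_functionD:
  assumes "\<phi> \<in> test_functions \<Omega>"
  shows "has_gradient \<phi> (grad \<phi>)" "continuous_on UNIV (grad \<phi>)" "x \<notin> \<Omega> \<Longrightarrow> \<phi> x = 0"
    "x \<notin> \<Omega> \<Longrightarrow> grad \<phi> x = 0"
proof -
  have C: "Ck n \<phi>" for n using assms unfolding test_functions_def by blast
  show g: "has_gradient \<phi> (grad \<phi>)" by (rule Ck_SucD(1)[OF C])
  have "continuous_on UNIV (\<lambda>x. grad \<phi> x \<bullet> i)" if "i \<in> Basis" for i
    by (rule Ck_continuous[OF Ck_SucD(2)[OF C that]])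
  then show "continuous_on UNIV (grad \<phi>)" by (subst continuous_on_componentwise) auto
  assume x: "x \<notin> \<Omega>"
  have x': "x \<notin> closure {x. \<phi> x \<noteq> 0}" using assms x unfolding test_functions_def by blast
  then show "\<phi> x = 0" using closure_subset[of "{x. \<phi> x \<noteq> 0}"] by blast
  have "((\<lambda>_. 0) has_derivative (\<lambda>h. grad \<phi> x \<bullet> h)) (at x)"
    by (rule has_derivative_transform_within_open[OF has_gradientD[OF g], of "- closure {x. \<phi> x \<noteq> 0}"])
      (use x' closure_subset[of "{x. \<phi> x \<noteq> 0}"] in auto)
  then have "(\<lambda>h. grad \<phi> x \<bullet> h) = (\<lambda>_. 0)" by (rule has_derivative_unique) simp
  then show "grad \<phi> x = 0" by (metis inner_eq_zero_iff)
qed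

lemma test_function_bounds:
  assumes "\<phi> \<in> test_functions \<Omega>"
  obtains B C where "\<And>x. B < norm x \<Longrightarrow> \<phi> x = 0" "\<And>x. B < norm x \<Longrightarrow> grad \<phi> x = 0"
    "\<And>x. \<bar>\<phi> x\<bar> \<le> C" "\<And>x. norm (grad \<phi> x) \<le> C" "0 \<le> C"
proof -
  have "bounded (closure {x. \<phi> x \<noteq> 0})" using assms compact_imp_bounded unfolding test_functions_def by blast
  then obtain B where B: "\<And>x. x \<in> closure {x. \<phi> x \<noteq> 0} \<Longrightarrow> norm x \<le> B" unfolding bounded_iff by blast
  have B1: "\<phi> x = 0" if "B < norm x" for x
    using that B[of x] closure_subset[of "{x. \<phi> x \<noteq> 0}"] by fastforce
  note g = test_functionD(1,2)[OF assms]
  have B2: "grad \<phi> x = 0" if "B < norm x" for x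
    by (rule has_gradient_zero_outside[OF g(1) B1 that])
  obtain C1 where C1: "0 \<le> C1" "\<And>x. norm x \<le> B \<Longrightarrow> norm (\<phi> x) \<le> C1"
    using bounded_on_cball[OF has_gradient_continuous[OF g(1)]] by blast
  obtain C2 where C2: "0 \<le> C2" "\<And>x. norm x \<le> B \<Longrightarrow> norm (grad \<phi> x) \<le> C2"
    using bounded_on_cball[OF g(2)] by blast
  show ?thesis
  proof (rule that[of B "max C1 C2", OF B1 B2])
    fix x
    show "\<bar>\<phi> x\<bar> \<le> max C1 C2" using C1(1) C1(2)[of x] B1[of x] by (cases "norm x \<le> B") auto
    show "norm (grad \<phi> x) \<le> max C1 C2" using C2(1) C2(2)[of x] B2[of x] by (cases "norm x \<le> B") auto
  qed (use C1 in auto)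
qed

lemma test_functionI:
  assumes "\<And>n. Ck n \<phi>" "compact K" "K \<subseteq> \<Omega>" "\<And>x. x \<notin> K \<Longrightarrow> \<phi> x = 0"
  shows "\<phi> \<in> test_functions \<Omega>"
proof -
  have "closure {x. \<phi> x \<noteq> 0} \<subseteq> K"
    using assms by (intro closure_minimal) (auto intro: compact_imp_closed)
  moreover from this have "compact (closure {x. \<phi> x \<noteq> 0})"
    using assms(2) by (meson bounded_subset closed_closure compact_eq_bounded_closed)
  ultimately show ?thesis using assms(1,3) unfolding test_functions_def by blast
qed

text \<open>\<open>integral_gradient_zero\<close> is applied to the product of \<open>f\<close> with
  a test function. Its compact support tames \<open>f\<close>, which may be unbounded on the whole
  space.\<close>

lemma has_weak_gradientI:
  fixes f :: "'a::euclidean_space \<Rightarrow> real"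
  assumes \<Omega>: "open \<Omega>" and g: "has_gradient f g" and C: "\<And>x. norm (g x) \<le> C"
  shows "has_weak_gradient \<Omega> f g"
  unfolding has_weak_gradient_def
proof (intro conjI ballI)
  have fc: "continuous_on UNIV f" by (rule has_gradient_continuous[OF g])
  have [measurable]: "f \<in> borel_measurable borel"
    using fc by (rule borel_measurable_continuous_onI)
  have [measurable]: "g \<in> borel_measurable borel" by (rule has_gradient_measurable[OF g])
  have [measurable]: "\<Omega> \<in> sets borel" using \<Omega> by simp
  show "locally_integrable \<Omega> f" unfolding locally_integrable_def
  proof (intro allI impI)
    fix K assume "compact K \<and> K \<subseteq> \<Omega>"
    then show "integrable (lebesgue_on K) f"
      using borel_integrable_compact[of K f]
      by (subst integrable_lebesgue_on_borel) (auto intro: continuous_on_subset[OF fc] borel_compact)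
  qed
  show "locally_integrable \<Omega> g" unfolding locally_integrable_def
  proof (intro allI impI)
    fix K assume K: "compact K \<and> K \<subseteq> \<Omega>"
    then have [measurable]: "K \<in> sets borel" by (simp add: compact_imp_closed)
    from K have "bounded K" by (simp add: compact_imp_bounded)
    then obtain B where B: "\<And>x. x \<in> K \<Longrightarrow> norm x \<le> B" unfolding bounded_iff by blast
    have C0: "0 \<le> C" using C[of 0] norm_ge_zero order_trans by blast
    have "integrable lborel (\<lambda>x. indicator K x *\<^sub>R g x)"
      by (rule integrable_bounded_support[where B = B and C = C]) (use B C C0 in \<open>force simp: indicator_def\<close>)+
    then show "integrable (lebesgue_on K) g" by (subst integrable_lebesgue_on_borel) auto
  qed
  fix \<phi> and i :: 'a assume \<phi>: "\<phi> \<in> test_functions \<Omega>" and i: "i \<in> Basis"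
  note t = test_functionD[OF \<phi>]
  have \<phi>c: "continuous_on UNIV \<phi>" by (rule has_gradient_continuous[OF t(1)])
  have [measurable]: "\<phi> \<in> borel_measurable borel" "grad \<phi> \<in> borel_measurable borel"
    using \<phi>c t(2) by (auto intro: borel_measurable_continuous_onI)
  obtain B D where BD: "\<And>x. B < norm x \<Longrightarrow> \<phi> x = 0" "\<And>x. B < norm x \<Longrightarrow> grad \<phi> x = 0"
    "\<And>x. \<bar>\<phi> x\<bar> \<le> D" "\<And>x. norm (grad \<phi> x) \<le> D" "0 \<le> D" using test_function_bounds[OF \<phi>] by blast
  obtain F where F: "0 \<le> F" "\<And>x. norm x \<le> B \<Longrightarrow> norm (f x) \<le> F"
    using bounded_on_cball[OF fc] by blast
  have b1: "norm (f x *\<^sub>R grad \<phi> x) \<le> F * D" if "norm x \<le> B" for x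
    using F(2)[OF that] BD(4)[of x] F(1) by (simp add: mult_mono)
  have b2: "norm (\<phi> x *\<^sub>R g x) \<le> D * C" for x
    using BD(3)[of x] C[of x] BD(5) by (simp add: mult_mono)
  have "(LINT x|lborel. (f x *\<^sub>R grad \<phi> x + \<phi> x *\<^sub>R g x) \<bullet> i) = 0"
  proof (rule integral_gradient_zero[OF has_gradient_mult[OF g t(1)] _ _ i, where B = B and C = "F * D + D * C"])
    fix x
    show "norm (f x *\<^sub>R grad \<phi> x + \<phi> x *\<^sub>R g x) \<le> F * D + D * C"
    proof (cases "norm x \<le> B")
      case True
      then show ?thesis using b1 b2 by (meson norm_triangle_mono)
    next
      case False
      then show ?thesis using BD(1,2)[of x] F(1) BD(5) C[of x] norm_ge_zero[of "g x"]
        by (smt (verit, best) add_0 mult_nonneg_nonneg norm_zero scaleR_zero_left scaleR_zero_right)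
    qed
  qed (use BD in auto)
  moreover have "integrable lborel (\<lambda>x. f x *\<^sub>R grad \<phi> x)"
    by (rule integrable_bounded_support[OF _ b1]) (use BD in auto)
  then have "integrable lborel (\<lambda>x. (f x *\<^sub>R grad \<phi> x) \<bullet> i)" by (rule integrable_inner_left)
  moreover have "integrable lborel (\<lambda>x. \<phi> x *\<^sub>R g x)"
    by (rule integrable_bounded_support[OF _ b2]) (use BD in auto)
  then have "integrable lborel (\<lambda>x. (\<phi> x *\<^sub>R g x) \<bullet> i)" by (rule integrable_inner_left)
  ultimately have *: "(LINT x|lborel. (f x *\<^sub>R grad \<phi> x) \<bullet> i) + (LINT x|lborel. (\<phi> x *\<^sub>R g x) \<bullet> i) = 0"
    unfolding inner_add_left by (simp only: Bochner_Integration.integral_add)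
  have "(LINT x|lebesgue_on \<Omega>. f x * frechet_derivative \<phi> (at x) i)
      = (LINT x|lborel. indicator \<Omega> x *\<^sub>R ((f x *\<^sub>R grad \<phi> x) \<bullet> i))"
    by (subst integral_lebesgue_on_borel[symmetric]) (auto simp: has_gradient_frechet[OF t(1)])
  also have "(\<lambda>x. indicator \<Omega> x *\<^sub>R ((f x *\<^sub>R grad \<phi> x) \<bullet> i)) = (\<lambda>x. (f x *\<^sub>R grad \<phi> x) \<bullet> i)"
    using t(4) by (auto simp: indicator_def fun_eq_iff)
  also have "(LINT x|lborel. (f x *\<^sub>R grad \<phi> x) \<bullet> i) = - (LINT x|lborel. (\<phi> x *\<^sub>R g x) \<bullet> i)"
    using * by simp
  also have "(\<lambda>x. (\<phi> x *\<^sub>R g x) \<bullet> i) = (\<lambda>x. indicator \<Omega> x *\<^sub>R ((g x \<bullet> i) * \<phi> x))"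
    using t(3) by (auto simp: indicator_def fun_eq_iff)
  also have "(LINT x|lborel. indicator \<Omega> x *\<^sub>R ((g x \<bullet> i) * \<phi> x)) = (LINT x|lebesgue_on \<Omega>. (g x \<bullet> i) * \<phi> x)"
    by (subst integral_lebesgue_on_borel[symmetric]) auto
  finally show "(LINT x|lebesgue_on \<Omega>. f x * frechet_derivative \<phi> (at x) i) = - (LINT x|lebesgue_on \<Omega>. (g x \<bullet> i) * \<phi> x)" .
qed

lemma Lp_bounded:
  fixes f :: "'a::euclidean_space \<Rightarrow> 'b::euclidean_space"
  assumes \<Omega>: "open \<Omega>" "bounded \<Omega>" and [measurable]: "f \<in> borel_measurable borel"
    and C: "\<And>x. x \<in> \<Omega> \<Longrightarrow> norm (f x) \<le> C" and p: "0 < p"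
  shows "f \<in> Lp p \<Omega>"
proof -
  have [measurable]: "\<Omega> \<in> sets borel" using \<Omega> by simp
  obtain B where B: "\<And>x. x \<in> \<Omega> \<Longrightarrow> norm x \<le> B" using \<Omega>(2) bounded_iff by metis
  have "integrable lborel (\<lambda>x. indicator \<Omega> x *\<^sub>R (norm (f x) powr p))"
  proof (rule integrable_bounded_support[where B = B and C = "C powr p"])
    fix x
    show "norm (indicator \<Omega> x *\<^sub>R (norm (f x) powr p)) \<le> C powr p"
      using C[of x] p by (auto simp: indicator_def intro!: powr_mono2)
    show "B < norm x \<Longrightarrow> indicator \<Omega> x *\<^sub>R (norm (f x) powr p) = 0"
      using B by (force simp: indicator_def)
  qed measurable
  then have "integrable (lebesgue_on \<Omega>) (\<lambda>x. norm (f x) powr p)"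
    by (subst integrable_lebesgue_on_borel) auto
  moreover have "f \<in> borel_measurable (lebesgue_on \<Omega>)"
    by (intro measurable_restrict_space1 measurable_completion) simp
  ultimately show ?thesis by (simp add: Lp_def)
qed

lemma W1pI:
  fixes f :: "'a::euclidean_space \<Rightarrow> real"
  assumes \<Omega>: "open \<Omega>" "bounded \<Omega>" and g: "has_gradient f g" and C: "\<And>x. norm (g x) \<le> C" and p: "0 < p"
  shows "W1p p \<Omega> f g"
proof -
  have fc: "continuous_on UNIV f" by (rule has_gradient_continuous[OF g])
  obtain B where B: "\<And>x. x \<in> \<Omega> \<Longrightarrow> norm x \<le> B" using \<Omega>(2) bounded_iff by metis
  obtain F where F: "0 \<le> F" "\<And>x. norm x \<le> B \<Longrightarrow> norm (f x) \<le> F"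
    using bounded_on_cball[OF fc] by blast
  have "f \<in> Lp p \<Omega>" using F(2)[OF B] fc
    by (intro Lp_bounded[OF \<Omega> _ _ p]) (auto intro: borel_measurable_continuous_onI)
  moreover have "g \<in> Lp p \<Omega>" using C p has_gradient_measurable[OF g] by (intro Lp_bounded[OF \<Omega>])
  ultimately show ?thesis using has_weak_gradientI[OF \<Omega>(1) g C] by (simp add: W1p_def)
qed

text \<open>The convolution of \<open>v\<close> with the kernel \<open>H\<close>. The kernel may be
  vector valued, so that a gradient of the convolution is again an instance, with all derivatives
  falling on \<open>H\<close>.\<close>

definition conv :: "('a::euclidean_space \<Rightarrow> 'b::euclidean_space) \<Rightarrow> ('a \<Rightarrow> real) \<Rightarrow> 'a \<Rightarrow> 'b" where
  "conv H v x = (LINT y|lborel. v y *\<^sub>R H (x - y))"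

lemma integrable_conv:
  fixes H :: "'a::euclidean_space \<Rightarrow> 'b::euclidean_space"
  assumes v: "integrable lborel v" and H: "continuous_on UNIV H" "\<And>x. B < norm x \<Longrightarrow> H x = 0"
  shows "integrable lborel (\<lambda>y. v y *\<^sub>R H (x - y))"
proof -
  have [measurable]: "v \<in> borel_measurable borel" using borel_measurable_integrable[OF v] by simp
  have [measurable]: "H \<in> borel_measurable borel" using H(1) by (rule borel_measurable_continuous_onI)
  obtain C where C: "0 \<le> C" "\<And>x. norm x \<le> B \<Longrightarrow> norm (H x) \<le> C" using bounded_on_cball[OF H(1)] by blast
  have C': "norm (H z) \<le> C" for z using C H(2)[of z] by (cases "norm z \<le> B") auto
  show ?thesis
  proof (rule Bochner_Integration.integrable_bound)
    show "integrable lborel (\<lambda>y. C * v y)" using v by simp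
    show "AE y in lborel. norm (v y *\<^sub>R H (x - y)) \<le> norm (C * v y)"
      using C' C(1) by (intro AE_I2) (simp add: abs_mult mult.commute[of C] mult_left_mono)
  qed measurable
qed

lemma continuous_conv:
  fixes H :: "'a::euclidean_space \<Rightarrow> 'b::euclidean_space"
  assumes v: "integrable lborel v" and H: "continuous_on UNIV H" "\<And>x. B < norm x \<Longrightarrow> H x = 0"
  shows "continuous_on UNIV (conv H v)"
  unfolding continuous_on_iff
proof (intro ballI allI impI)
  fix x :: 'a and e :: real assume "0 < e"
  define V where "V = (LINT y|lborel. \<bar>v y\<bar>)"
  have V: "0 \<le> V" by (simp add: V_def)
  have "uniformly_continuous_on UNIV H" by (rule uniformly_continuous_compact_support[OF H])
  moreover have "0 < e / (V + 1)" using V \<open>0 < e\<close> by simp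
  ultimately obtain d where d: "0 < d" "\<And>x y. dist y x < d \<Longrightarrow> dist (H y) (H x) < e / (V + 1)"
    unfolding uniformly_continuous_on_def by (metis UNIV_I)
  show "\<exists>d>0. \<forall>x'\<in>UNIV. dist x' x < d \<longrightarrow> dist (conv H v x') (conv H v x) < e"
  proof (intro exI[of _ d] conjI ballI impI d(1))
    fix x' assume x': "dist x' x < d"
    have "conv H v x' - conv H v x = (LINT y|lborel. v y *\<^sub>R (H (x' - y) - H (x - y)))"
      unfolding conv_def scaleR_diff_right using integrable_conv[OF assms] by simp
    also have "norm \<dots> \<le> (LINT y|lborel. \<bar>v y\<bar> * (e / (V + 1)))"
    proof (rule Bochner_Integration.integral_norm_bound_integral)
      show "integrable lborel (\<lambda>y. v y *\<^sub>R (H (x' - y) - H (x - y)))"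
        unfolding scaleR_diff_right using integrable_conv[OF assms] by simp
      show "integrable lborel (\<lambda>y. \<bar>v y\<bar> * (e / (V + 1)))" using v by simp
      fix y
      have "dist (x' - y) (x - y) < d" using x' by (simp add: dist_norm)
      then have "norm (H (x' - y) - H (x - y)) \<le> e / (V + 1)"
        using d(2)[of "x' - y" "x - y"] unfolding dist_norm by linarith
      then show "norm (v y *\<^sub>R (H (x' - y) - H (x - y))) \<le> \<bar>v y\<bar> * (e / (V + 1))"
        unfolding norm_scaleR by (rule mult_left_mono) simp
    qed
    also have "\<dots> = V * (e / (V + 1))" by (simp only: integral_mult_left_zero V_def)
    also have "\<dots> < e" using V \<open>0 < e\<close> by (simp add: field_simps)
    finally show "dist (conv H v x') (conv H v x) < e" by (simp add: dist_norm)
  qed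
qed

text \<open>By the mean value theorem, the first order remainder of \<open>H\<close> is at most
  \<open>|h|\<close> times the oscillation of \<open>gH\<close> over distance \<open>|h|\<close>.
  Compact support makes that oscillation uniformly small, so the remainder of the convolution is
  controlled by the L^1 norm of \<open>v\<close>.\<close>

lemma has_gradient_conv:
  fixes H :: "'a::euclidean_space \<Rightarrow> real"
  assumes v: "integrable lborel v" and H: "has_gradient H gH" "continuous_on UNIV gH" "\<And>x. B < norm x \<Longrightarrow> H x = 0"
  shows "has_gradient (conv H v) (conv gH v)"
  unfolding has_gradient_def has_derivative_at_alt
proof (intro allI conjI impI)
  fix x :: 'a and e :: real assume "0 < e"
  have Hc: "continuous_on UNIV H" by (rule has_gradient_continuous[OF H(1)])
  have g0: "gH x = 0" if "B < norm x" for x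
    by (rule has_gradient_zero_outside[OF H(1) H(3) that])
  have i1: "integrable lborel (\<lambda>y. v y * H (x - y))" for x
    using integrable_conv[OF v Hc H(3)] by simp
  have i2: "integrable lborel (\<lambda>y. v y *\<^sub>R gH (x - y))" for x
    by (rule integrable_conv[OF v H(2) g0])
  define V where "V = (LINT y|lborel. \<bar>v y\<bar>)"
  have V: "0 \<le> V" by (simp add: V_def)
  have "uniformly_continuous_on UNIV gH" by (rule uniformly_continuous_compact_support[OF H(2) g0])
  moreover have e: "0 < e / (V + 1)" using V \<open>0 < e\<close> by simp
  ultimately obtain d where d: "0 < d" "\<And>x y. dist y x < d \<Longrightarrow> dist (gH y) (gH x) < e / (V + 1)"
    unfolding uniformly_continuous_on_def by (metis UNIV_I)
  show "\<exists>d>0. \<forall>y. norm (y - x) < d \<longrightarrow>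
      norm (conv H v y - conv H v x - conv gH v x \<bullet> (y - x)) \<le> e * norm (y - x)"
  proof (intro exI[of _ d] conjI allI impI d(1))
    fix y :: 'a define h where "h = y - x"
    assume "norm (y - x) < d"
    then have h: "norm h < d" by (simp add: h_def)
    have b: "\<bar>H (z + h) - H z - gH z \<bullet> h\<bar> \<le> e / (V + 1) * norm h" for z
    proof -
      obtain t where t: "0 < t" "t < 1" "H (z + h) - H z = gH (z + t *\<^sub>R h) \<bullet> h"
        using has_gradient_mvt[OF H(1)] by metis
      have "t * norm h \<le> norm h" using t by (simp add: mult_left_le_one_le)
      then have "dist (z + t *\<^sub>R h) z < d" using t h by (simp add: dist_norm)
      then have "norm (gH (z + t *\<^sub>R h) - gH z) \<le> e / (V + 1)"
        using less_imp_le[OF d(2)[of "z + t *\<^sub>R h" z]] unfolding dist_norm by blast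
      moreover have "\<bar>(gH (z + t *\<^sub>R h) - gH z) \<bullet> h\<bar> \<le> norm (gH (z + t *\<^sub>R h) - gH z) * norm h"
        by (rule Cauchy_Schwarz_ineq2)
      ultimately have "\<bar>(gH (z + t *\<^sub>R h) - gH z) \<bullet> h\<bar> \<le> e / (V + 1) * norm h"
        by (meson mult_right_mono norm_ge_zero order_trans)
      then show ?thesis by (simp add: t(3) inner_diff_left)
    qed
    have "conv gH v x \<bullet> h = (LINT z|lborel. v z * (gH (x - z) \<bullet> h))"
      unfolding conv_def by (subst integral_inner_left[symmetric]) (use i2 in auto)
    moreover have "integrable lborel (\<lambda>z. (v z *\<^sub>R gH (x - z)) \<bullet> h)"
      by (rule integrable_inner_left) (rule i2)
    then have i3: "integrable lborel (\<lambda>z. v z * (gH (x - z) \<bullet> h))" by simp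
    ultimately have "conv H v y - conv H v x - conv gH v x \<bullet> h
        = (LINT z|lborel. v z * (H (x - z + h) - H (x - z) - gH (x - z) \<bullet> h))"
    proof -
      assume a: "conv gH v x \<bullet> h = (LINT z|lborel. v z * (gH (x - z) \<bullet> h))"
      have "(LINT z|lborel. v z * (H (x - z + h) - H (x - z) - gH (x - z) \<bullet> h))
          = (LINT z|lborel. v z * H (y - z) - v z * H (x - z) - v z * (gH (x - z) \<bullet> h))"
        by (simp add: h_def right_diff_distrib add_diff_eq diff_add_eq)
      also have "\<dots> = conv H v y - conv H v x - conv gH v x \<bullet> h"
        using i1 i3 unfolding a by (simp add: conv_def)
      finally show ?thesis by simp
    qed
    also have "norm \<dots> \<le> (LINT z|lborel. \<bar>v z\<bar> * (e / (V + 1) * norm h))"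
    proof (rule Bochner_Integration.integral_norm_bound_integral)
      show "integrable lborel (\<lambda>z. v z * (H (x - z + h) - H (x - z) - gH (x - z) \<bullet> h))"
      proof -
        have "integrable lborel (\<lambda>z. v z * H (y - z) - v z * H (x - z) - v z * (gH (x - z) \<bullet> h))"
          using i1 i3 by simp
        then show ?thesis by (simp add: h_def right_diff_distrib add_diff_eq diff_add_eq)
      qed
      show "integrable lborel (\<lambda>z. \<bar>v z\<bar> * (e / (V + 1) * norm h))" using v by simp
      show "norm (v z * (H (x - z + h) - H (x - z) - gH (x - z) \<bullet> h)) \<le> \<bar>v z\<bar> * (e / (V + 1) * norm h)" for z
        unfolding real_norm_def abs_mult by (rule mult_left_mono[OF b]) simp
    qed
    also have "\<dots> = V * (e / (V + 1) * norm h)" by (simp only: integral_mult_left_zero V_def)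
    also have "\<dots> = (V * (e / (V + 1))) * norm h" by simp
    also have "\<dots> \<le> e * norm h"
      using V \<open>0 < e\<close> by (intro mult_right_mono) (auto simp: field_simps)
    finally show "norm (conv H v y - conv H v x - conv gH v x \<bullet> (y - x)) \<le> e * norm (y - x)"
      by (simp add: h_def)
  qed
qed (rule bounded_linear_inner_right)

lemma Ck_conv:
  fixes H :: "'a::euclidean_space \<Rightarrow> real"
  assumes v: "integrable lborel v"
  shows "(\<And>n. Ck n H) \<Longrightarrow> (\<And>x. B < norm x \<Longrightarrow> H x = 0) \<Longrightarrow> Ck n (conv H v)"
proof (induction n arbitrary: H)
  case 0
  have "continuous_on UNIV H" by (rule Ck_continuous[OF 0(1)])
  then show ?case using continuous_conv[OF v _ 0(2)] by simp
next
  case (Suc n)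
  have g: "has_gradient H (grad H)" by (rule Ck_SucD(1)[OF Suc.prems(1)])
  have gC: "Ck m (\<lambda>x. grad H x \<bullet> i)" if "i \<in> Basis" for i m using Ck_SucD(2)[OF Suc.prems(1) that] .
  have gc: "continuous_on UNIV (grad H)"
    by (subst continuous_on_componentwise) (intro ballI Ck_continuous[OF gC])
  have g0: "grad H x = 0" if "B < norm x" for x
    by (rule has_gradient_zero_outside[OF g Suc.prems(2) that])
  have "conv (\<lambda>x. grad H x \<bullet> i) v x = conv (grad H) v x \<bullet> i" for x i
    unfolding conv_def by (subst integral_inner_left[symmetric]) (use integrable_conv[OF v gc g0] in auto)
  then have eq: "(\<lambda>x. conv (grad H) v x \<bullet> i) = conv (\<lambda>x. grad H x \<bullet> i) v" for i by auto
  show ?case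
  proof (rule Ck_SucI[OF has_gradient_conv[OF v g gc]])
    show "Ck n (\<lambda>x. conv (grad H) v x \<bullet> i)" if "i \<in> Basis" for i
      unfolding eq using that g0 by (intro Suc.IH gC) auto
  qed (rule Suc.prems(2))
qed

section \<open>Smooth approximation\<close>

lemma norm_sum3_powr_le:
  fixes a b c :: "'b::real_normed_vector"
  assumes "1 < p"
  shows "norm (a + b + c) powr p \<le> 4 powr p * (norm a powr p + norm b powr p + norm c powr p)"
proof -
  have a: "norm (x + y) powr p \<le> 2 powr p * (norm x powr p + norm y powr p)" for x y :: 'b
    by (rule order_trans[OF powr_mono2 powr_add_le2]) (use assms norm_triangle_ineq in auto)
  have "1 \<le> (2::real) powr p" using assms by (intro ge_one_powr_ge_zero) auto
  then have "norm c powr p \<le> 2 powr p * norm c powr p"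
    by (metis mult.left_neutral mult_right_mono powr_ge_zero)
  with a[of a b] have "norm (a + b) powr p + norm c powr p \<le> 2 powr p * (norm a powr p + norm b powr p + norm c powr p)"
    by (simp add: algebra_simps)
  then have "2 powr p * (norm (a + b) powr p + norm c powr p) \<le> 2 powr p * (2 powr p * (norm a powr p + norm b powr p + norm c powr p))"
    by (rule mult_left_mono) simp
  with a[of "a + b" c] have "norm (a + b + c) powr p \<le> 2 powr p * (2 powr p * (norm a powr p + norm b powr p + norm c powr p))"
    by (rule order_trans)
  then have "norm (a + b + c) powr p \<le> (2 powr p * 2 powr p) * (norm a powr p + norm b powr p + norm c powr p)"
    by (simp only: mult.assoc)
  also have "2 powr p * 2 powr p = (4::real) powr p" by (simp flip: powr_mult)
  finally show ?thesis .
qed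

text \<open>First \<open>F\<close> is cut in value to \<open>Fk k\<close>, then this bounded
  function is approximated almost everywhere by continuous ones, clipped to norm \<open>k\<close>
  and cut off between \<open>B\<close> and \<open>B + 1\<close>. The clipping and the cut-off supply
  the majorant for dominated convergence.\<close>

lemma Lp_continuous_dense:
  fixes F :: "'a::euclidean_space \<Rightarrow> 'b::euclidean_space"
  assumes p: "1 < p" and [measurable]: "F \<in> borel_measurable borel"
    and i: "integrable lborel (\<lambda>x. norm (F x) powr p)" and B: "\<And>x. B < norm x \<Longrightarrow> F x = 0" and e: "0 < e"
  obtains w where "continuous_on UNIV w" "\<And>x. B + 1 < norm x \<Longrightarrow> w x = 0"
    "(LINT x|lborel. norm (F x - w x) powr p) < e"
proof -
  define Fk where "Fk k x = (if norm (F x) \<le> real k then F x else 0)" for k x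
  have [measurable]: "Fk k \<in> borel_measurable borel" for k unfolding Fk_def by measurable
  have "(\<lambda>k. LINT x|lborel. norm (F x - Fk k x) powr p) \<longlonglongrightarrow> (LINT x::'a|lborel. 0)"
  proof (rule integral_dominated_convergence[OF _ _ i])
    show "AE x in lborel. (\<lambda>k. norm (F x - Fk k x) powr p) \<longlonglongrightarrow> 0"
    proof (rule AE_I2)
      fix x
      have "\<forall>\<^sub>F k in sequentially. norm (F x - Fk k x) powr p = 0"
        using eventually_ge_at_top[of "nat \<lceil>norm (F x)\<rceil>"] by eventually_elim (auto simp: Fk_def)
      then show "(\<lambda>k. norm (F x - Fk k x) powr p) \<longlonglongrightarrow> 0" by (rule tendsto_eventually)
    qed
    show "AE x in lborel. norm (norm (F x - Fk k x) powr p) \<le> norm (F x) powr p" for k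
      by (rule AE_I2) (auto simp: Fk_def)
  qed auto
  then have "\<forall>\<^sub>F k in sequentially. (LINT x|lborel. norm (F x - Fk k x) powr p) < e / (2 * 2 powr p)"
    using e by (intro order_tendstoD(2)) auto
  then obtain k0 where "\<And>k. k \<ge> k0 \<Longrightarrow> (LINT x|lborel. norm (F x - Fk k x) powr p) < e / (2 * 2 powr p)"
    unfolding eventually_sequentially by blast
  then obtain k where k: "1 \<le> k" "(LINT x|lborel. norm (F x - Fk k x) powr p) < e / (2 * 2 powr p)"
    by (metis max.cobounded1 max.cobounded2)
  have k0: "0 < real k" using k by simp
  have "Fk k \<in> borel_measurable (lebesgue_on UNIV)"
    by (intro measurable_restrict_space1 measurable_completion) simp
  \<comment> \<open>\<open>measurable_on\<close> unfolds to the existence of continuous functions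
    that converge to the truncation off a negligible set.\<close>
  then have "Fk k measurable_on UNIV" by (subst measurable_on_iff_borel_measurable) auto
  then obtain Z g where Z: "negligible Z" and g: "\<And>n. continuous_on UNIV (g n)"
    "\<And>x. x \<notin> Z \<Longrightarrow> (\<lambda>n. g n x) \<longlonglongrightarrow> Fk k x"
    unfolding measurable_on_def by auto
  \<comment> \<open>The radial retraction onto the ball of radius \<open>k\<close>: it fixes the
    values of \<open>Fk k\<close>, so clipping does not spoil the limit.\<close>
  define cl :: "'b \<Rightarrow> 'b" where "cl y = (1 / max 1 (norm y / k)) *\<^sub>R y" for y
  have clc: "continuous_on UNIV cl" unfolding cl_def using k0 by (intro continuous_intros) auto
  have cln: "norm (cl y) \<le> k" for y
    using k0 by (auto simp: cl_def max_def field_simps)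
  have cl_id: "cl y = y" if "norm y \<le> k" for y using that k0 by (simp add: cl_def max_def field_simps)
  define \<kappa> where "\<kappa> x = max 0 (min 1 (B + 1 - norm x))" for x :: 'a
  have \<kappa>: "0 \<le> \<kappa> x" "\<kappa> x \<le> 1" for x by (auto simp: \<kappa>_def)
  define w where "w n x = \<kappa> x *\<^sub>R cl (g n x)" for n x
  have wc: "continuous_on UNIV (w n)" for n
    unfolding w_def \<kappa>_def by (intro continuous_intros continuous_on_compose2[OF clc g(1)]) auto
  have [measurable]: "w n \<in> borel_measurable borel" for n using wc by (rule borel_measurable_continuous_onI)
  have w0: "w n x = 0" if "B + 1 < norm x" for n x using that by (simp add: w_def \<kappa>_def)
  have wn: "norm (w n x) \<le> k" for n x
    using \<kappa>[of x] cln[of "g n x"] mult_mono[of "\<kappa> x" 1 "norm (cl (g n x))" k] by (simp add: w_def)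
  have fkn: "norm (Fk k x) \<le> k" for x by (simp add: Fk_def)
  have Fkw: "integrable lborel (\<lambda>x. norm (Fk k x - w n x) powr p)" for n
  proof (rule integrable_bounded_support[where B = "B + 1" and C = "(2 * k) powr p"])
    fix x
    have "norm (Fk k x - w n x) \<le> 2 * k" using norm_triangle_ineq4[of "Fk k x" "w n x"] fkn[of x] wn[of n x] by simp
    then show "norm (norm (Fk k x - w n x) powr p) \<le> (2 * k) powr p" using p by (simp add: powr_mono2)
    show "norm (Fk k x - w n x) powr p = 0" if "B + 1 < norm x" using that w0 B[of x] by (simp add: Fk_def)
  qed measurable
  have "(\<lambda>n. LINT x|lborel. norm (Fk k x - w n x) powr p) \<longlonglongrightarrow> (LINT x::'a|lborel. 0)"
  proof (rule integral_dominated_convergence)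
    show "integrable lborel (\<lambda>x::'a. (2 * k) powr p * indicator (cball 0 (B + 1)) x)"
      using emeasure_lborel_cball_finite[of "0::'a" "B + 1"]
      by (intro integrable_mult_right integrable_real_indicator) (auto simp: less_top[symmetric])
    have "AE x in lebesgue. x \<notin> Z" using Z negligible_iff_null_sets AE_not_in by blast
    then have "AE x in lborel. x \<notin> Z" by (simp add: AE_completion_iff)
    then show "AE x in lborel. (\<lambda>n. norm (Fk k x - w n x) powr p) \<longlonglongrightarrow> 0"
    proof eventually_elim
      case (elim x)
      have "isCont cl (Fk k x)" using clc by (simp add: continuous_on_eq_continuous_at)
      then have "(\<lambda>n. cl (g n x)) \<longlonglongrightarrow> cl (Fk k x)" using g(2)[OF elim] by (rule isCont_tendsto_compose)
      then have "(\<lambda>n. w n x) \<longlonglongrightarrow> \<kappa> x *\<^sub>R cl (Fk k x)" unfolding w_def by (intro tendsto_intros)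
      also have "\<kappa> x *\<^sub>R cl (Fk k x) = Fk k x"
      proof (cases "norm x \<le> B")
        case True
        then show ?thesis using fkn by (simp add: cl_id \<kappa>_def)
      qed (use B[of x] in \<open>simp add: Fk_def cl_def\<close>)
      finally have "(\<lambda>n. norm (Fk k x - w n x)) \<longlonglongrightarrow> norm (Fk k x - Fk k x)" by (intro tendsto_intros)
      then have "(\<lambda>n. norm (Fk k x - w n x) powr p) \<longlonglongrightarrow> 0 powr p"
        using p by (intro tendsto_powr') auto
      then show ?case by simp
    qed
    fix n
    show "AE x in lborel. norm (norm (Fk k x - w n x) powr p) \<le> (2 * k) powr p * indicator (cball 0 (B + 1)) x"
    proof (rule AE_I2)
      fix x
      have "norm (Fk k x - w n x) \<le> 2 * k" using norm_triangle_ineq4[of "Fk k x" "w n x"] fkn[of x] wn[of n x] by simp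
      then have "norm (Fk k x - w n x) powr p \<le> (2 * k) powr p" using p by (intro powr_mono2) auto
      then show "norm (norm (Fk k x - w n x) powr p) \<le> (2 * k) powr p * indicator (cball 0 (B + 1)) x"
        using w0[of x n] B[of x] by (auto simp: indicator_def Fk_def)
    qed
  qed auto
  then have "\<forall>\<^sub>F n in sequentially. (LINT x|lborel. norm (Fk k x - w n x) powr p) < e / (2 * 2 powr p)"
    using e by (intro order_tendstoD(2)) auto
  then obtain n where n: "(LINT x|lborel. norm (Fk k x - w n x) powr p) < e / (2 * 2 powr p)"
    unfolding eventually_sequentially by blast
  have FFk: "integrable lborel (\<lambda>x. norm (F x - Fk k x) powr p)"
    by (rule Bochner_Integration.integrable_bound[OF i]) (auto simp: Fk_def)
  have "(LINT x|lborel. norm (F x - w n x) powr p)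
      \<le> (LINT x|lborel. 2 powr p * (norm (F x - Fk k x) powr p + norm (Fk k x - w n x) powr p))"
  proof (rule integral_mono_AE')
    show "integrable lborel (\<lambda>x. 2 powr p * (norm (F x - Fk k x) powr p + norm (Fk k x - w n x) powr p))"
      using FFk Fkw by simp
    have "norm (F x - w n x) powr p \<le> 2 powr p * (norm (F x - Fk k x) powr p + norm (Fk k x - w n x) powr p)" for x
      using p norm_triangle_ineq[of "F x - Fk k x" "Fk k x - w n x"]
      by (intro order_trans[OF powr_mono2 powr_add_le2]) auto
    then show "AE x in lborel. norm (F x - w n x) powr p \<le> 2 powr p * (norm (F x - Fk k x) powr p + norm (Fk k x - w n x) powr p)"
      by (rule AE_I2)
  qed auto
  also have "\<dots> = 2 powr p * ((LINT x|lborel. norm (F x - Fk k x) powr p) + (LINT x|lborel. norm (Fk k x - w n x) powr p))"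
    using FFk Fkw by simp
  also have "\<dots> < 2 powr p * (e / (2 * 2 powr p) + e / (2 * 2 powr p))"
    using k(2) n by (intro mult_strict_left_mono add_strict_mono) auto
  also have "\<dots> = e" by (simp add: field_simps)
  finally show ?thesis using that wc w0 by blast
qed

locale mollifier =
  fixes \<eta> :: "'a::euclidean_space \<Rightarrow> real"
  assumes Ck_eta: "Ck n \<eta>" and eta_nonneg: "0 \<le> \<eta> x" and eta_support: "1 \<le> norm x \<Longrightarrow> \<eta> x = 0"
    and eta_integrable: "integrable lborel \<eta>" and eta_integral: "(LINT x|lborel. \<eta> x) = 1"
begin

text \<open>The dilation by \<open>\<tau> < 1\<close> moves a convex neighbourhood of \<open>0\<close> into its interior, so that on it no value of \<open>F\<close>
  outside the set enters the average.\<close>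

definition avg :: "real \<Rightarrow> real \<Rightarrow> ('a \<Rightarrow> 'b::euclidean_space) \<Rightarrow> 'a \<Rightarrow> 'b" where
  "avg \<tau> \<delta> F x = (LINT z|lborel. \<eta> z *\<^sub>R F (\<tau> *\<^sub>R x - \<delta> *\<^sub>R z))"

lemma eta_continuous: "continuous_on UNIV \<eta>"
  by (rule Ck_continuous[OF Ck_eta])

lemma eta_measurable [measurable]: "\<eta> \<in> borel_measurable borel"
  using eta_continuous by (rule borel_measurable_continuous_onI)

lemma eta_bounded: obtains C where "0 \<le> C" "\<And>z. \<eta> z \<le> C"
proof -
  obtain C where C: "0 \<le> C" "\<And>x. norm x \<le> 1 \<Longrightarrow> norm (\<eta> x) \<le> C"
    using bounded_on_cball[OF eta_continuous] by blast
  show ?thesis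
  proof (rule that[OF C(1)])
    show "\<eta> z \<le> C" for z using C(1) C(2)[of z] eta_support[of z] by (cases "norm z \<le> 1") auto
  qed
qed

lemma integrable_eta_mult:
  fixes f :: "'a \<Rightarrow> 'b::euclidean_space"
  assumes f: "integrable lborel f" and \<delta>: "\<delta> \<noteq> 0"
  shows "integrable lborel (\<lambda>z. \<eta> z *\<^sub>R f (t - \<delta> *\<^sub>R z))"
proof -
  have [measurable]: "f \<in> borel_measurable borel" using borel_measurable_integrable[OF f] by simp
  obtain C where C: "0 \<le> C" "\<And>z. \<eta> z \<le> C" using eta_bounded by blast
  have "integrable lborel (\<lambda>z. f (t + (- \<delta>) *\<^sub>R z))" using f \<delta> by (subst integrable_lborel_affine) auto
  then have "integrable lborel (\<lambda>z. C *\<^sub>R f (t - \<delta> *\<^sub>R z))" by simp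
  then show ?thesis
    by (rule Bochner_Integration.integrable_bound) (auto intro!: AE_I2 mult_right_mono simp: C eta_nonneg)
qed

lemma integrable_powr_imp_integrable:
  fixes F :: "'a \<Rightarrow> 'b::euclidean_space"
  assumes p: "1 < p" and [measurable]: "F \<in> borel_measurable borel"
    and i: "integrable lborel (\<lambda>x. norm (F x) powr p)" and B: "\<And>x. B < norm x \<Longrightarrow> F x = 0"
  shows "integrable lborel F"
proof (rule Bochner_Integration.integrable_bound)
  show "integrable lborel (\<lambda>x. norm (F x) powr p + indicator (cball 0 B) x)"
    using emeasure_lborel_cball_finite[of "0::'a" "B"] i
    by (intro Bochner_Integration.integrable_add integrable_real_indicator) (auto simp: less_top[symmetric])
  have "norm (F x) \<le> norm (F x) powr p + indicator (cball 0 B) x" for x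
  proof (cases "norm x \<le> B")
    case True
    have "norm (F x) \<le> norm (F x) powr p" if "1 \<le> norm (F x)"
      using powr_mono[OF less_imp_le[OF p] that] that by simp
    then show ?thesis using True powr_ge_zero[of "norm (F x)" p]
      by (cases "1 \<le> norm (F x)") (auto intro: order_trans[of _ 1])
  qed (use B[of x] in auto)
  then show "AE x in lborel. norm (F x) \<le> norm (norm (F x) powr p + indicator (cball 0 B) x)"
    using powr_ge_zero by (intro AE_I2) (metis abs_ge_self order_trans real_norm_def)
qed measurable

lemma avg_measurable [measurable]:
  fixes F :: "'a \<Rightarrow> 'b::euclidean_space"
  assumes [measurable]: "F \<in> borel_measurable borel"
  shows "avg \<tau> \<delta> F \<in> borel_measurable borel"
  unfolding avg_def by measurable

lemma norm_avg_powr_le: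
  fixes F :: "'a \<Rightarrow> 'b::euclidean_space"
  assumes p: "1 < p" and [measurable]: "F \<in> borel_measurable borel"
    and i: "integrable lborel (\<lambda>x. norm (F x) powr p)" and B: "\<And>x. B < norm x \<Longrightarrow> F x = 0" and \<delta>: "\<delta> \<noteq> 0"
  shows "norm (avg \<tau> \<delta> F x) powr p \<le> (LINT z|lborel. \<eta> z * norm (F (\<tau> *\<^sub>R x - \<delta> *\<^sub>R z)) powr p)"
  unfolding avg_def
proof (rule powr_norm_integral_le[OF p eta_nonneg eta_integrable eta_integral])
  show "integrable lborel (\<lambda>z. \<eta> z * norm (F (\<tau> *\<^sub>R x - \<delta> *\<^sub>R z)) powr p)"
    using integrable_eta_mult[OF i \<delta>] by simp
  show "integrable lborel (\<lambda>z. \<eta> z * norm (F (\<tau> *\<^sub>R x - \<delta> *\<^sub>R z)))"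
  proof -
    have "integrable lborel (\<lambda>z. norm (\<eta> z *\<^sub>R F (\<tau> *\<^sub>R x - \<delta> *\<^sub>R z)))"
      by (intro integrable_norm integrable_eta_mult[OF integrable_powr_imp_integrable[OF p _ i B] \<delta>]) auto
    then show ?thesis by (simp add: eta_nonneg)
  qed
qed

text \<open>Jensen's inequality under the integral, then Fubini: for fixed \<open>z\<close> the
  substitution in \<open>x\<close> has Jacobian \<open>\<tau>\<close> to the power minus the
  dimension, at most \<open>2 ^ DIM('a)\<close> since \<open>\<tau>\<close> is at least 1/2. The
  bound is thus uniform in both parameters.\<close>

lemma
  fixes F :: "'a \<Rightarrow> 'b::euclidean_space"
  assumes p: "1 < p" and [measurable]: "F \<in> borel_measurable borel"
    and i: "integrable lborel (\<lambda>x. norm (F x) powr p)" and B: "\<And>x. B < norm x \<Longrightarrow> F x = 0" and \<delta>: "\<delta> \<noteq> 0"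
    and \<tau>: "1 / 2 \<le> \<tau>"
  shows integrable_avg_powr: "integrable lborel (\<lambda>x. norm (avg \<tau> \<delta> F x) powr p)"
    and integral_avg_powr_le: "(LINT x|lborel. norm (avg \<tau> \<delta> F x) powr p) \<le> 2 ^ DIM('a) * (LINT x|lborel. norm (F x) powr p)"
proof -
  define I where "I = (LINT x|lborel. norm (F x) powr p)"
  have I0: "0 \<le> I" by (simp add: I_def)
  have I: "(\<integral>\<^sup>+x. norm (F x) powr p \<partial>lborel) = ennreal I"
    unfolding I_def using i by (intro nn_integral_eq_integral) auto
  have "(\<integral>\<^sup>+x. norm (avg \<tau> \<delta> F x) powr p \<partial>lborel)
      \<le> (\<integral>\<^sup>+x. (\<integral>\<^sup>+z. ennreal (\<eta> z) * norm (F (\<tau> *\<^sub>R x - \<delta> *\<^sub>R z)) powr p \<partial>lborel) \<partial>lborel)"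
  proof (rule nn_integral_mono)
    fix x
    have "ennreal (norm (avg \<tau> \<delta> F x) powr p) \<le> ennreal (LINT z|lborel. \<eta> z * norm (F (\<tau> *\<^sub>R x - \<delta> *\<^sub>R z)) powr p)"
      by (intro ennreal_leI norm_avg_powr_le[OF p _ i B \<delta>]) auto
    also have "\<dots> = (\<integral>\<^sup>+z. \<eta> z * norm (F (\<tau> *\<^sub>R x - \<delta> *\<^sub>R z)) powr p \<partial>lborel)"
      using integrable_eta_mult[OF i \<delta>, of "\<tau> *\<^sub>R x"]
      by (intro nn_integral_eq_integral[symmetric]) (auto simp: eta_nonneg)
    finally show "ennreal (norm (avg \<tau> \<delta> F x) powr p)
        \<le> (\<integral>\<^sup>+z. ennreal (\<eta> z) * norm (F (\<tau> *\<^sub>R x - \<delta> *\<^sub>R z)) powr p \<partial>lborel)"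
      by (simp add: ennreal_mult' eta_nonneg)
  qed
  also have "\<dots> = (\<integral>\<^sup>+z. (\<integral>\<^sup>+x. ennreal (\<eta> z) * norm (F (\<tau> *\<^sub>R x - \<delta> *\<^sub>R z)) powr p \<partial>lborel) \<partial>lborel)"
    by (rule lborel_pair.Fubini') measurable
  also have "\<dots> \<le> (\<integral>\<^sup>+z. ennreal (\<eta> z) * ennreal (2 ^ DIM('a) * I) \<partial>lborel)"
  proof (rule nn_integral_mono)
    fix z
    have "(\<integral>\<^sup>+x. ennreal (\<eta> z) * norm (F (\<tau> *\<^sub>R x - \<delta> *\<^sub>R z)) powr p \<partial>lborel)
        = ennreal (\<eta> z) * (\<integral>\<^sup>+x. norm (F (- (\<delta> *\<^sub>R z) + \<tau> *\<^sub>R x)) powr p \<partial>lborel)"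
      by (subst nn_integral_cmult) (auto simp: algebra_simps)
    also have "\<dots> = ennreal (\<eta> z) * (ennreal (1 / \<bar>\<tau>\<bar> ^ DIM('a)) * ennreal I)"
      using \<tau> by (subst nn_integral_lborel_affine) (auto simp: I)
    also have "ennreal (1 / \<bar>\<tau>\<bar> ^ DIM('a)) * ennreal I = ennreal ((1 / \<tau>) ^ DIM('a) * I)"
      using \<tau> I0 by (subst ennreal_mult'[symmetric]) (auto simp: power_one_over)
    also have "ennreal (\<eta> z) * \<dots> \<le> ennreal (\<eta> z) * ennreal (2 ^ DIM('a) * I)"
      using \<tau> I0 by (intro mult_left_mono ennreal_leI mult_right_mono power_mono) (auto simp: field_simps)
    finally show "(\<integral>\<^sup>+x. ennreal (\<eta> z) * norm (F (\<tau> *\<^sub>R x - \<delta> *\<^sub>R z)) powr p \<partial>lborel)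
        \<le> ennreal (\<eta> z) * ennreal (2 ^ DIM('a) * I)" .
  qed
  also have "\<dots> = (\<integral>\<^sup>+z. \<eta> z \<partial>lborel) * ennreal (2 ^ DIM('a) * I)"
    by (rule nn_integral_multc) measurable
  also have "(\<integral>\<^sup>+z. \<eta> z \<partial>lborel) = 1"
    using nn_integral_eq_integral[OF eta_integrable] eta_nonneg eta_integral by simp
  finally have le: "(\<integral>\<^sup>+x. norm (avg \<tau> \<delta> F x) powr p \<partial>lborel) \<le> ennreal (2 ^ DIM('a) * I)" by simp
  then have "(\<integral>\<^sup>+x. norm (avg \<tau> \<delta> F x) powr p \<partial>lborel) < \<infinity>" using ennreal_less_top le_less_trans by fastforce
  then show int: "integrable lborel (\<lambda>x. norm (avg \<tau> \<delta> F x) powr p)"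
    by (intro integrableI_nonneg) auto
  then have "ennreal (LINT x|lborel. norm (avg \<tau> \<delta> F x) powr p) \<le> ennreal (2 ^ DIM('a) * I)"
    using le nn_integral_eq_integral[OF int] by simp
  then show "(LINT x|lborel. norm (avg \<tau> \<delta> F x) powr p) \<le> 2 ^ DIM('a) * (LINT x|lborel. norm (F x) powr p)"
    using I0 by (simp add: I_def ennreal_le_iff)
qed

lemma avg_diff:
  fixes F G :: "'a \<Rightarrow> 'b::euclidean_space"
  assumes "integrable lborel F" "integrable lborel G" "\<delta> \<noteq> 0"
  shows "avg \<tau> \<delta> (\<lambda>x. F x - G x) x = avg \<tau> \<delta> F x - avg \<tau> \<delta> G x"
  unfolding avg_def scaleR_diff_right using assms integrable_eta_mult by (intro Bochner_Integration.integral_diff)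

lemma avg_uniform:
  fixes w :: "'a \<Rightarrow> 'b::euclidean_space"
  assumes w: "continuous_on UNIV w" "\<And>x. B < norm x \<Longrightarrow> w x = 0" and B: "0 \<le> B"
    and \<tau>: "\<And>n. 1 / 2 \<le> \<tau> n" "\<And>n. \<tau> n \<le> 1" "\<tau> \<longlonglongrightarrow> 1"
    and \<delta>: "\<And>n. 0 < \<delta> n" "\<And>n. \<delta> n \<le> 1" "\<delta> \<longlonglongrightarrow> 0" and e: "0 < e"
  shows "\<forall>\<^sub>F n in sequentially. \<forall>x. norm (avg (\<tau> n) (\<delta> n) w x - w x) \<le> e * indicator (cball 0 (2 * B + 2)) x"
proof -
  have "uniformly_continuous_on UNIV w" by (rule uniformly_continuous_compact_support[OF w])
  then obtain d where d: "0 < d" "\<And>x y. dist y x < d \<Longrightarrow> dist (w y) (w x) < e"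
    using e unfolding uniformly_continuous_on_def by (metis UNIV_I)
  \<comment> \<open>For \<open>z\<close> in the unit ball and \<open>x\<close> of norm at most
    \<open>2 * B + 2\<close>, this quantity bounds the distance from the sampled point to
    \<open>x\<close>. For larger \<open>x\<close> both points lie outside the support, because
    \<open>\<tau>\<close> is at least 1/2 and \<open>\<delta>\<close> at most 1.\<close>
  have "(\<lambda>n. (1 - \<tau> n) * (2 * B + 2) + \<delta> n) \<longlonglongrightarrow> (1 - 1) * (2 * B + 2) + 0"
    by (intro tendsto_intros \<tau> \<delta>)
  then have "\<forall>\<^sub>F n in sequentially. (1 - \<tau> n) * (2 * B + 2) + \<delta> n < d"
    using d by (intro order_tendstoD(2)) auto
  then show ?thesis
  proof eventually_elim
    case (elim n)
    have wi: "integrable lborel w"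
    proof -
      have "integrable lborel (\<lambda>x. indicator (cball 0 B) x *\<^sub>R w x)"
        by (rule borel_integrable_compact) (auto intro: continuous_on_subset[OF w(1)])
      also have "(\<lambda>x. indicator (cball 0 B) x *\<^sub>R w x) = w" using w(2) by (auto simp: indicator_def fun_eq_iff)
      finally show ?thesis .
    qed
    show ?case
    proof
      fix x
      have i1: "integrable lborel (\<lambda>z. \<eta> z *\<^sub>R w (\<tau> n *\<^sub>R x - \<delta> n *\<^sub>R z))"
        using \<delta>(1)[of n] by (intro integrable_eta_mult wi) simp
      have i2: "integrable lborel (\<lambda>z. \<eta> z *\<^sub>R w x)" using eta_integrable by simp
      have "w x = (LINT z|lborel. \<eta> z *\<^sub>R w x)" using eta_integrable eta_integral by simp
      then have eq: "avg (\<tau> n) (\<delta> n) w x - w x = (LINT z|lborel. \<eta> z *\<^sub>R (w (\<tau> n *\<^sub>R x - \<delta> n *\<^sub>R z) - w x))"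
        unfolding avg_def scaleR_diff_right using i1 i2 by simp
      have b: "norm (\<eta> z *\<^sub>R (w (\<tau> n *\<^sub>R x - \<delta> n *\<^sub>R z) - w x)) \<le> \<eta> z * (e * indicator (cball 0 (2 * B + 2)) x)" for z
      proof (cases "norm z < 1")
        case True
        have dz: "norm (\<delta> n *\<^sub>R z) \<le> \<delta> n" using True \<delta>(1)[of n] by (simp add: mult_left_le)
        have "norm (w (\<tau> n *\<^sub>R x - \<delta> n *\<^sub>R z) - w x) \<le> e * indicator (cball 0 (2 * B + 2)) x"
        proof (cases "norm x \<le> 2 * B + 2")
          case x: True
          have "\<tau> n *\<^sub>R x - \<delta> n *\<^sub>R z - x = - ((1 - \<tau> n) *\<^sub>R x) - \<delta> n *\<^sub>R z" by (simp add: algebra_simps)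
          also have "norm \<dots> \<le> norm ((1 - \<tau> n) *\<^sub>R x) + norm (\<delta> n *\<^sub>R z)" by (metis norm_minus_cancel norm_triangle_ineq4)
          also have "\<dots> \<le> (1 - \<tau> n) * (2 * B + 2) + \<delta> n"
            using dz x \<tau>(2)[of n] by (intro add_mono) (auto intro: mult_left_mono)
          finally have "dist (\<tau> n *\<^sub>R x - \<delta> n *\<^sub>R z) x < d" using elim by (simp add: dist_norm)
          then show ?thesis using d(2) x by (auto simp: dist_norm less_imp_le)
        next
          case x: False
          have "(1/2) * norm x \<le> \<tau> n * norm x" using \<tau>(1)[of n] by (intro mult_right_mono) auto
          moreover have "norm (\<tau> n *\<^sub>R x) - norm (\<delta> n *\<^sub>R z) \<le> norm (\<tau> n *\<^sub>R x - \<delta> n *\<^sub>R z)" by (rule norm_triangle_ineq2)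
          ultimately have "B < norm (\<tau> n *\<^sub>R x - \<delta> n *\<^sub>R z)" using x dz \<delta>(2)[of n] \<tau>(1)[of n] by simp
          moreover have "B < norm x" using x B by simp
          ultimately show ?thesis using w(2) e by simp
        qed
        then show ?thesis using eta_nonneg[of z] by (simp add: mult_left_mono)
      qed (use eta_support[of z] in simp)
      have "norm (avg (\<tau> n) (\<delta> n) w x - w x) \<le> (LINT z|lborel. \<eta> z * (e * indicator (cball 0 (2 * B + 2)) x))"
        unfolding eq
      proof (rule Bochner_Integration.integral_norm_bound_integral)
        show "integrable lborel (\<lambda>z. \<eta> z *\<^sub>R (w (\<tau> n *\<^sub>R x - \<delta> n *\<^sub>R z) - w x))"
          unfolding scaleR_diff_right using i1 i2 by simp
      qed (use b eta_integrable in auto)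
      then show "norm (avg (\<tau> n) (\<delta> n) w x - w x) \<le> e * indicator (cball 0 (2 * B + 2)) x"
        by (simp only: integral_mult_left_zero eta_integral mult_1)
    qed
  qed
qed

text \<open>A density argument: with \<open>w\<close> continuous and close to \<open>F\<close>, the
  averages of \<open>F - w\<close> stay small by the uniform bound on averaging, and those of
  \<open>w\<close> converge uniformly.\<close>

lemma avg_tendsto:
  fixes F :: "'a \<Rightarrow> 'b::euclidean_space"
  assumes p: "1 < p" and [measurable]: "F \<in> borel_measurable borel"
    and i: "integrable lborel (\<lambda>x. norm (F x) powr p)" and B: "\<And>x. B < norm x \<Longrightarrow> F x = 0" "0 \<le> B"
    and \<tau>: "\<And>n. 1 / 2 \<le> \<tau> n" "\<And>n. \<tau> n \<le> 1" "\<tau> \<longlonglongrightarrow> 1"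
    and \<delta>: "\<And>n. 0 < \<delta> n" "\<And>n. \<delta> n \<le> 1" "\<delta> \<longlonglongrightarrow> 0"
  shows "(\<lambda>n. LINT x|lborel. norm (avg (\<tau> n) (\<delta> n) F x - F x) powr p) \<longlonglongrightarrow> 0"
proof (rule tendstoI)
  fix e :: real assume e: "0 < e"
  \<comment> \<open>\<open>4 powr p\<close> comes from splitting into three summands,
    \<open>2 ^ DIM('a)\<close> from averaging \<open>F - w\<close>, and the 1 from
    \<open>w - F\<close> itself.\<close>
  define K where "K = 4 powr p * (2 ^ DIM('a) + 1 :: real)"
  have K: "0 < K" by (simp add: K_def add_pos_pos)
  obtain w where w: "continuous_on UNIV w" "\<And>x. B + 1 < norm x \<Longrightarrow> w x = 0"
    "(LINT x|lborel. norm (F x - w x) powr p) < e / (2 * K)"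
  proof (rule Lp_continuous_dense[OF p _ i B(1)])
    show "0 < e / (2 * K)" using e K by simp
  qed auto
  have [measurable]: "w \<in> borel_measurable borel" using w(1) by (rule borel_measurable_continuous_onI)
  define V where "V = measure lborel (cball (0::'a) (2 * (B + 1) + 2))"
  have V: "0 \<le> V" by (simp add: V_def)
  \<comment> \<open>The uniform error allowed for \<open>w\<close>, calibrated against the volume
    \<open>V\<close> of the ball that carries it, so that its contribution stays below
    \<open>e / 4\<close>.\<close>
  define e' where "e' = (e / (4 powr p * 4 * (V + 1))) powr (1 / p)"
  have e': "0 < e'" using e V by (simp add: e'_def)
  have e'p: "e' powr p = e / (4 powr p * 4 * (V + 1))" using e V p by (simp add: e'_def powr_powr)
  have ci: "integrable lborel (\<lambda>x::'a. e' powr p * indicator (cball 0 (2 * (B + 1) + 2)) x)"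
    using emeasure_lborel_cball_finite[of "0::'a" "2 * (B + 1) + 2"]
    by (intro integrable_mult_right integrable_real_indicator) (auto simp: less_top[symmetric])
  have wi: "integrable lborel (\<lambda>x. norm (w x) powr p)"
  proof -
    obtain C where C: "0 \<le> C" "\<And>x. norm x \<le> B + 1 \<Longrightarrow> norm (w x) \<le> C" using bounded_on_cball[OF w(1)] by blast
    show ?thesis
      by (rule integrable_bounded_support[where B = "B + 1" and C = "C powr p"]) (use C w(2) p in \<open>auto intro: powr_mono2\<close>)
  qed
  have D: "integrable lborel (\<lambda>x. norm (F x - w x) powr p)"
    by (rule integrable_powr_norm_diff[OF p _ _ i wi]) auto
  have D0: "F x - w x = 0" if "B + 1 < norm x" for x using that B w(2) by simp
  have "\<forall>\<^sub>F n in sequentially. \<forall>x. norm (avg (\<tau> n) (\<delta> n) w x - w x) \<le> e' * indicator (cball 0 (2 * (B + 1) + 2)) x"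
    by (rule avg_uniform[OF w(1,2) _ \<tau> \<delta> e']) (use B in auto)
  then show "\<forall>\<^sub>F n in sequentially. dist (LINT x|lborel. norm (avg (\<tau> n) (\<delta> n) F x - F x) powr p) 0 < e"
  proof eventually_elim
    case (elim n)
    have \<delta>n: "\<delta> n \<noteq> 0" using \<delta>(1)[of n] by simp
    let ?A = "\<lambda>x. avg (\<tau> n) (\<delta> n) (\<lambda>x. F x - w x) x"
    have Ai: "integrable lborel (\<lambda>x. norm (?A x) powr p)"
      by (rule integrable_avg_powr[OF p _ D D0 \<delta>n \<tau>(1)]) auto
    have Ale: "(LINT x|lborel. norm (?A x) powr p) \<le> 2 ^ DIM('a) * (LINT x|lborel. norm (F x - w x) powr p)"
      by (rule integral_avg_powr_le[OF p _ D D0 \<delta>n \<tau>(1)]) auto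
    have eq: "avg (\<tau> n) (\<delta> n) F x - F x = ?A x + (avg (\<tau> n) (\<delta> n) w x - w x) + (w x - F x)" for x
      by (subst avg_diff[OF integrable_powr_imp_integrable[OF p _ i B(1)] integrable_powr_imp_integrable[OF p _ wi w(2)] \<delta>n]) auto
    let ?R = "\<lambda>x. 4 powr p * (norm (?A x) powr p + e' powr p * indicator (cball 0 (2 * (B + 1) + 2)) x + norm (F x - w x) powr p)"
    have "(LINT x|lborel. norm (avg (\<tau> n) (\<delta> n) F x - F x) powr p) \<le> (LINT x|lborel. ?R x)"
    proof (rule integral_mono_AE')
      show "integrable lborel ?R" using Ai ci D by simp
      have "norm (avg (\<tau> n) (\<delta> n) F x - F x) powr p \<le> ?R x" for x
      proof -
        have "norm (avg (\<tau> n) (\<delta> n) w x - w x) powr p \<le> (e' * indicator (cball 0 (2 * (B + 1) + 2)) x) powr p"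
          using elim p by (intro powr_mono2) auto
        also have "\<dots> = e' powr p * indicator (cball 0 (2 * (B + 1) + 2)) x" by (auto simp: indicator_def)
        finally show ?thesis unfolding eq
          by (intro order_trans[OF norm_sum3_powr_le[OF p]] mult_left_mono add_mono) (auto simp: norm_minus_commute)
      qed
      then show "AE x in lborel. norm (avg (\<tau> n) (\<delta> n) F x - F x) powr p \<le> ?R x" by (rule AE_I2)
    qed auto
    also have "\<dots> = 4 powr p * ((LINT x|lborel. norm (?A x) powr p) + e' powr p * V + (LINT x|lborel. norm (F x - w x) powr p))"
      using Ai ci D by (simp add: V_def)
    also have "\<dots> \<le> 4 powr p * ((2 ^ DIM('a) + 1) * (LINT x|lborel. norm (F x - w x) powr p) + e' powr p * V)"
      using Ale by (intro mult_left_mono) (auto simp: algebra_simps)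
    also have "\<dots> = K * (LINT x|lborel. norm (F x - w x) powr p) + e / 4 * (V / (V + 1))"
    proof -
      have "V + 1 \<noteq> 0" using V by simp
      then have "4 powr p * (e' powr p * V) = e / 4 * (V / (V + 1))" unfolding e'p by (simp add: divide_simps)
      then show ?thesis unfolding K_def by (subst distrib_left) (simp only: mult.assoc)
    qed
    also have "\<dots> < K * (e / (2 * K)) + e / 4 * 1"
      using w(3) K e V by (intro add_less_le_mono mult_strict_left_mono mult_left_mono) auto
    also have "\<dots> < e" using K e by simp
    finally show ?case by simp
  qed
qed

text \<open>The substitution \<open>y = \<tau> x - \<delta> z\<close> exhibits the average as a
  convolution with a rescaled kernel, evaluated at \<open>\<tau> x\<close>. The redundant
  \<open>0 +\<close> keeps the shape required by \<open>Ck_affine\<close> and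
  \<open>has_gradient_affine\<close>.\<close>

lemma avg_eq_conv:
  fixes v :: "'a \<Rightarrow> real"
  assumes [measurable]: "v \<in> borel_measurable borel" and \<delta>: "0 < \<delta>"
  shows "avg \<tau> \<delta> v x = conv (\<lambda>u. (1 / \<delta> ^ DIM('a)) * \<eta> (0 + (1 / \<delta>) *\<^sub>R u)) v (0 + \<tau> *\<^sub>R x)"
proof -
  let ?G = "\<lambda>y. v y * \<eta> ((1 / \<delta>) *\<^sub>R (\<tau> *\<^sub>R x - y))"
  have "avg \<tau> \<delta> v x = (LINT z|lborel. ?G (\<tau> *\<^sub>R x + (- \<delta>) *\<^sub>R z))"
    unfolding avg_def using \<delta> by (intro Bochner_Integration.integral_cong) (auto simp: mult.commute)
  also have "\<dots> = (1 / \<bar>- \<delta>\<bar> ^ DIM('a)) *\<^sub>R (LINT y|lborel. ?G y)"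
    using \<delta> by (intro integral_lborel_affine) auto
  also have "\<dots> = conv (\<lambda>u. (1 / \<delta> ^ DIM('a)) * \<eta> (0 + (1 / \<delta>) *\<^sub>R u)) v (0 + \<tau> *\<^sub>R x)"
    unfolding conv_def using \<delta> by (simp flip: integral_mult_right_zero add: mult_ac)
  finally show ?thesis .
qed

end

section \<open>Borel representatives and mollification of Sobolev functions\<close>

lemma integrable_lebesgue_onI:
  fixes f :: "'a::euclidean_space \<Rightarrow> 'b::euclidean_space"
  assumes "S \<in> sets borel" "integrable lborel f"
  shows "integrable (lebesgue_on S) f"
proof -
  have "integrable lborel (\<lambda>x. indicator S x *\<^sub>R f x)"
    using assms by (intro integrable_mult_indicator) auto
  then show ?thesis
    using assms borel_measurable_integrable[OF assms(2)] by (subst integrable_lebesgue_on_borel) auto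
qed

lemma borel_representative:
  fixes f :: "'a::euclidean_space \<Rightarrow> 'b::euclidean_space"
  assumes \<Omega>: "\<Omega> \<in> sets borel" and f: "f \<in> borel_measurable (lebesgue_on \<Omega>)"
  obtains f' where "f' \<in> borel_measurable borel" "\<And>x. x \<notin> \<Omega> \<Longrightarrow> f' x = 0" "AE x in lebesgue_on \<Omega>. f x = f' x"
proof -
  have [measurable]: "\<Omega> \<in> sets borel" by fact
  have \<Omega>': "\<Omega> \<inter> space lebesgue \<in> sets lebesgue" using \<Omega> by simp
  have "\<exists>h. h \<in> borel_measurable borel \<and> (AE x in lborel. indicator \<Omega> x * (f x \<bullet> i) = h x)" for i
  proof -
    have "(\<lambda>x. indicator \<Omega> x *\<^sub>R f x) \<in> borel_measurable lebesgue"
      using f \<Omega>' by (subst (asm) borel_measurable_restrict_space_iff) auto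
    then have "(\<lambda>x. (indicator \<Omega> x *\<^sub>R f x) \<bullet> i) \<in> borel_measurable lebesgue"
      by (rule borel_measurable_inner) simp
    then show ?thesis using completion_ex_borel_measurable_real[of "\<lambda>x. indicator \<Omega> x * (f x \<bullet> i)" lborel] by auto
  qed
  then obtain h where h: "\<And>i. h i \<in> borel_measurable borel" "\<And>i. AE x in lborel. indicator \<Omega> x * (f x \<bullet> i) = h i x"
    by metis
  have [measurable]: "h i \<in> borel_measurable borel" for i by (rule h)
  show ?thesis
  proof (rule that[of "\<lambda>x. indicator \<Omega> x *\<^sub>R (\<Sum>i\<in>Basis. h i x *\<^sub>R i)"])
    have "AE x in lborel. \<forall>i\<in>Basis. indicator \<Omega> x * (f x \<bullet> i) = h i x"
      by (rule AE_finite_allI) (auto intro: h)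
    then have "AE x in lborel. x \<in> \<Omega> \<longrightarrow> f x = indicator \<Omega> x *\<^sub>R (\<Sum>i\<in>Basis. h i x *\<^sub>R i)"
    proof eventually_elim
      case (elim x)
      show ?case
      proof
        assume "x \<in> \<Omega>"
        then have "h i x = f x \<bullet> i" if "i \<in> Basis" for i using elim that by auto
        then show "f x = indicator \<Omega> x *\<^sub>R (\<Sum>i\<in>Basis. h i x *\<^sub>R i)"
          using \<open>x \<in> \<Omega>\<close> by (simp add: euclidean_representation)
      qed
    qed
    then show "AE x in lebesgue_on \<Omega>. f x = indicator \<Omega> x *\<^sub>R (\<Sum>i\<in>Basis. h i x *\<^sub>R i)"
      using \<Omega>' by (simp add: AE_restrict_space_iff AE_completion_iff)
  qed auto
qed

lemma measurable_lebesgue_on: "f \<in> borel_measurable borel \<Longrightarrow> f \<in> borel_measurable (lebesgue_on \<Omega>)"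
  by (intro measurable_restrict_space1 measurable_completion) simp

text \<open>Making \<open>f'\<close> vanish off the set turns integrals over \<Omega> into integrals
  over the whole space, where averages can be formed without regard to the boundary.\<close>

definition borel_version :: "real \<Rightarrow> 'a::euclidean_space set \<Rightarrow> ('a \<Rightarrow> 'b::euclidean_space) \<Rightarrow> ('a \<Rightarrow> 'b) \<Rightarrow> bool" where
  "borel_version p \<Omega> f f' \<longleftrightarrow> f' \<in> borel_measurable borel \<and> (\<forall>x. x \<notin> \<Omega> \<longrightarrow> f' x = 0) \<and>
     (AE x in lebesgue_on \<Omega>. f x = f' x) \<and> integrable lborel (\<lambda>x. norm (f' x) powr p) \<and>
     (LINT x|lborel. norm (f' x) powr p) = (LINT x|lebesgue_on \<Omega>. norm (f x) powr p)"

lemma borel_versionD: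
  assumes "borel_version p \<Omega> f f'"
  shows "f' \<in> borel_measurable borel" "\<And>x. x \<notin> \<Omega> \<Longrightarrow> f' x = 0" "AE x in lebesgue_on \<Omega>. f x = f' x"
    "integrable lborel (\<lambda>x. norm (f' x) powr p)"
    "(LINT x|lborel. norm (f' x) powr p) = (LINT x|lebesgue_on \<Omega>. norm (f x) powr p)"
  using assms by (auto simp: borel_version_def)

lemma borel_version_exists:
  fixes f :: "'a::euclidean_space \<Rightarrow> 'b::euclidean_space"
  assumes \<Omega>: "open \<Omega>" and f: "f \<in> Lp p \<Omega>"
  shows "\<exists>f'. borel_version p \<Omega> f f'"
proof -
  have [measurable]: "\<Omega> \<in> sets borel" using \<Omega> by simp
  have fm [measurable]: "f \<in> borel_measurable (lebesgue_on \<Omega>)" and fi: "integrable (lebesgue_on \<Omega>) (\<lambda>x. norm (f x) powr p)"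
    using f by (auto simp: Lp_def)
  obtain f' where f': "f' \<in> borel_measurable borel" "\<And>x. x \<notin> \<Omega> \<Longrightarrow> f' x = 0" "AE x in lebesgue_on \<Omega>. f x = f' x"
    using borel_representative[OF _ fm] by auto
  have [measurable]: "f' \<in> borel_measurable borel" by (rule f')
  have [measurable]: "f' \<in> borel_measurable (lebesgue_on \<Omega>)" by (rule measurable_lebesgue_on[OF f'(1)])
  have ae: "AE x in lebesgue_on \<Omega>. norm (f x) powr p = norm (f' x) powr p"
    using f'(3) by eventually_elim simp
  have ind: "(\<lambda>x. indicator \<Omega> x *\<^sub>R (norm (f' x) powr p)) = (\<lambda>x. norm (f' x) powr p)"
    using f'(2) by (auto simp: fun_eq_iff indicator_def)
  have "integrable (lebesgue_on \<Omega>) (\<lambda>x. norm (f' x) powr p)"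
    using fi by (rule integrable_cong_AE_imp) (use ae in auto)
  then have i: "integrable lborel (\<lambda>x. norm (f' x) powr p)"
    by (subst (asm) integrable_lebesgue_on_borel) (auto simp: ind[simplified])
  have "(LINT x|lebesgue_on \<Omega>. norm (f x) powr p) = (LINT x|lebesgue_on \<Omega>. norm (f' x) powr p)"
    using ae by (intro integral_cong_AE) auto
  also have "\<dots> = (LINT x|lborel. norm (f' x) powr p)"
    by (subst integral_lebesgue_on_borel) (auto simp: ind[simplified])
  finally have eq: "(LINT x|lborel. norm (f' x) powr p) = (LINT x|lebesgue_on \<Omega>. norm (f x) powr p)" by simp
  show ?thesis unfolding borel_version_def using f' i eq by blast
qed

context mollifier
begin

text \<open>The mollifying kernel seen from \<open>t\<close>, as a function of the integration
  variable; the factor \<open>-1\<close> is the reflection. This is the test function inserted into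
  the definition of the weak gradient.\<close>

lemma mollified_test_function:
  assumes \<delta>: "0 < \<delta>" and K: "cball t \<delta> \<subseteq> \<Omega>"
  shows "(\<lambda>y. (1 / \<delta> ^ DIM('a)) * \<eta> (0 + (1 / \<delta>) *\<^sub>R (t + (-1) *\<^sub>R y))) \<in> test_functions \<Omega>"
proof (rule test_functionI[OF _ compact_cball K])
  show "Ck n (\<lambda>y. (1 / \<delta> ^ DIM('a)) * \<eta> (0 + (1 / \<delta>) *\<^sub>R (t + (-1) *\<^sub>R y)))" for n
    by (intro Ck_mult Ck_const Ck_affine[of n "\<lambda>u. \<eta> (0 + (1 / \<delta>) *\<^sub>R u)"] Ck_affine[of n \<eta>] Ck_eta)
  fix y assume "y \<notin> cball t \<delta>"
  then have "\<delta> < norm (t - y)" by (simp add: dist_norm)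
  then have "1 \<le> norm ((1 / \<delta>) *\<^sub>R (t - y))" unfolding norm_scaleR using \<delta> by (simp add: field_simps)
  then have "1 \<le> norm (0 + (1 / \<delta>) *\<^sub>R (t + (-1) *\<^sub>R y))" by simp
  then show "(1 / \<delta> ^ DIM('a)) * \<eta> (0 + (1 / \<delta>) *\<^sub>R (t + (-1) *\<^sub>R y)) = 0" by (simp add: eta_support)
qed

text \<open>Differentiation falls on the kernel; where the ball of radius \<open>\<delta>\<close>
  about \<open>\<tau> x\<close> lies in \<Omega>, the reflected kernel is admissible in the weak
  formulation and the derivative moves onto \<open>v\<close>. The two minus signs, from the
  reflection and from integration by parts, cancel.\<close>

lemma avg_gradient:
  fixes v :: "'a \<Rightarrow> real" and g :: "'a \<Rightarrow> 'a"
  assumes \<delta>: "0 < \<delta>" and v: "integrable lborel v" and g: "integrable lborel g"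
    and w: "\<And>\<phi> i. \<phi> \<in> test_functions \<Omega> \<Longrightarrow> i \<in> Basis \<Longrightarrow>
        (LINT x|lborel. v x * (grad \<phi> x \<bullet> i)) = - (LINT x|lborel. (g x \<bullet> i) * \<phi> x)"
  obtains G where "has_gradient (avg \<tau> \<delta> v) G" "continuous_on UNIV G"
    "\<And>x. cball (\<tau> *\<^sub>R x) \<delta> \<subseteq> \<Omega> \<Longrightarrow> G x = \<tau> *\<^sub>R avg \<tau> \<delta> g x"
proof -
  have [measurable]: "v \<in> borel_measurable borel" "g \<in> borel_measurable borel"
    using borel_measurable_integrable[OF v] borel_measurable_integrable[OF g] by auto
  define H where "H u = (1 / \<delta> ^ DIM('a)) * \<eta> (0 + (1 / \<delta>) *\<^sub>R u)" for u
  have CkH: "Ck n H" for n unfolding H_def by (intro Ck_mult Ck_const Ck_affine Ck_eta)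
  have H: "has_gradient H (grad H)" by (rule Ck_SucD(1)[OF CkH])
  have Hc: "continuous_on UNIV H" by (rule has_gradient_continuous[OF H])
  have "continuous_on UNIV (\<lambda>x. grad H x \<bullet> i)" if "i \<in> Basis" for i
    by (rule Ck_continuous[OF Ck_SucD(2)[OF CkH that]])
  then have gHc: "continuous_on UNIV (grad H)" by (subst continuous_on_componentwise) blast
  have H0: "H x = 0" if "\<delta> < norm x" for x
    using that \<delta> eta_support[of "0 + (1 / \<delta>) *\<^sub>R x"] by (simp add: H_def field_simps)
  have gH0: "grad H x = 0" if "\<delta> < norm x" for x by (rule has_gradient_zero_outside[OF H H0 that])
  have avg_v: "avg \<tau> \<delta> v = (\<lambda>x. conv H v (0 + \<tau> *\<^sub>R x))"
    using avg_eq_conv[of v \<delta> \<tau>] \<delta> unfolding H_def by auto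
  have hg: "has_gradient (avg \<tau> \<delta> v) (\<lambda>x. \<tau> *\<^sub>R conv (grad H) v (0 + \<tau> *\<^sub>R x))"
    unfolding avg_v by (intro has_gradient_affine has_gradient_conv[OF v H gHc H0])
  have cc: "continuous_on UNIV (conv (grad H) v)" by (rule continuous_conv[OF v gHc gH0])
  show ?thesis
  proof (rule that[OF hg])
    show "continuous_on UNIV (\<lambda>x. \<tau> *\<^sub>R conv (grad H) v (0 + \<tau> *\<^sub>R x))"
      by (intro continuous_intros continuous_on_compose2[OF cc]) auto
    fix x assume x: "cball (\<tau> *\<^sub>R x) \<delta> \<subseteq> \<Omega>"
    define t where "t = \<tau> *\<^sub>R x"
    define \<phi> where "\<phi> y = H (t + (-1) *\<^sub>R y)" for y
    have \<phi>: "\<phi> \<in> test_functions \<Omega>"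
      using mollified_test_function[OF \<delta> x[folded t_def]] unfolding \<phi>_def H_def .
    have g\<phi>: "grad \<phi> = (\<lambda>y. (-1) *\<^sub>R grad H (t + (-1) *\<^sub>R y))"
      unfolding \<phi>_def by (rule has_gradient_eq_grad[OF has_gradient_affine[OF H]])
    have gi: "integrable lborel (\<lambda>z. \<eta> z *\<^sub>R g (t - \<delta> *\<^sub>R z))" using \<delta> by (intro integrable_eta_mult g) simp
    have "conv (grad H) v t \<bullet> i = avg \<tau> \<delta> g x \<bullet> i" if i: "i \<in> Basis" for i
    proof -
      have "conv (grad H) v t \<bullet> i = (LINT y|lborel. v y * (grad H (t - y) \<bullet> i))"
        unfolding conv_def by (subst integral_inner_left[symmetric]) (use integrable_conv[OF v gHc gH0] in auto)
      also have "\<dots> = - (LINT y|lborel. v y * (grad \<phi> y \<bullet> i))" by (simp add: g\<phi>)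
      also have "\<dots> = (LINT y|lborel. (g y \<bullet> i) * \<phi> y)" using w[OF \<phi> i] by simp
      also have "\<dots> = conv H (\<lambda>y. g y \<bullet> i) t" by (simp add: conv_def \<phi>_def)
      also have "\<dots> = avg \<tau> \<delta> (\<lambda>y. g y \<bullet> i) x"
        using avg_eq_conv[of "\<lambda>y. g y \<bullet> i" \<delta> \<tau> x] \<delta> unfolding H_def[abs_def] t_def by simp
      also have "\<dots> = avg \<tau> \<delta> g x \<bullet> i"
        unfolding avg_def by (subst integral_inner_left[symmetric]) (use gi in \<open>auto simp: t_def\<close>)
      finally show ?thesis .
    qed
    then show "\<tau> *\<^sub>R conv (grad H) v (0 + \<tau> *\<^sub>R x) = \<tau> *\<^sub>R avg \<tau> \<delta> g x"
      by (auto simp: t_def intro: euclidean_eqI)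
  qed
qed

end

lemma mollifier_obtain:
  obtains \<eta> :: "'a::euclidean_space \<Rightarrow> real" where "mollifier \<eta>"
proof -
  obtain \<eta> :: "'a \<Rightarrow> real" where "\<And>n. Ck n \<eta>" "\<And>x. 0 \<le> \<eta> x" "\<And>x. 1 \<le> norm x \<Longrightarrow> \<eta> x = 0"
    "integrable lborel \<eta>" "(LINT x|lborel. \<eta> x) = 1" using mollifier_exists by blast
  then show ?thesis by (intro that[of \<eta>] mollifier.intro)
qed

text \<open>Convexity gives approximation up to the boundary by functions that are smooth on the
  whole space. For the gradients only convergence of the energies is recorded, which is what a lower
  bound on quotients consumes.\<close>

lemma W1p_smooth_approximation:
  fixes v :: "'a::euclidean_space \<Rightarrow> real"
  assumes \<Omega>: "open \<Omega>" "bounded \<Omega>" "convex \<Omega>" "0 \<in> \<Omega>" and p: "1 < p" and vg: "W1p p \<Omega> v g"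
  obtains V G where "\<And>n::nat. has_gradient (V n) (G n)" "\<And>n. continuous_on UNIV (G n)"
    "(\<lambda>n. LINT x|lebesgue_on \<Omega>. \<bar>V n x - v x\<bar> powr p) \<longlonglongrightarrow> 0"
    "(\<lambda>n. LINT x|lebesgue_on \<Omega>. norm (G n x) powr p) \<longlonglongrightarrow> (LINT x|lebesgue_on \<Omega>. norm (g x) powr p)"
proof -
  have [measurable]: "\<Omega> \<in> sets borel" using \<Omega> by simp
  have vL: "v \<in> Lp p \<Omega>" and gL: "g \<in> Lp p \<Omega>" and wg: "has_weak_gradient \<Omega> v g" using vg by (auto simp: W1p_def)
  have [measurable]: "v \<in> borel_measurable (lebesgue_on \<Omega>)" "g \<in> borel_measurable (lebesgue_on \<Omega>)"
    using vL gL by (auto simp: Lp_def)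
  obtain v' where "borel_version p \<Omega> v v'" using borel_version_exists[OF \<Omega>(1) vL] by (elim exE) (rule that)
  note v' = borel_versionD[OF this]
  obtain g' where "borel_version p \<Omega> g g'" using borel_version_exists[OF \<Omega>(1) gL] by (elim exE) (rule that)
  note g' = borel_versionD[OF this]
  obtain B0 where B0: "\<And>x. x \<in> \<Omega> \<Longrightarrow> norm x \<le> B0" using \<Omega>(2) unfolding bounded_iff by blast
  define B where "B = max 0 B0"
  have B: "0 \<le> B" by (simp add: B_def)
  have v'B: "v' x = 0" and g'B: "g' x = 0" if "B < norm x" for x
    using that B0[of x] v'(2)[of x] g'(2)[of x] by (force simp: B_def)+
  note [measurable] = v'(1) g'(1) measurable_lebesgue_on[OF v'(1), of \<Omega>] measurable_lebesgue_on[OF g'(1), of \<Omega>]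
  obtain \<eta> :: "'a \<Rightarrow> real" where "mollifier \<eta>" by (rule mollifier_obtain)
  then interpret mollifier \<eta> .
  have v'i: "integrable lborel v'" by (rule integrable_powr_imp_integrable[OF p v'(1,4) v'B])
  have g'i: "integrable lborel g'" by (rule integrable_powr_imp_integrable[OF p g'(1,4) g'B])
  have w: "(LINT x|lborel. v' x * (grad \<phi> x \<bullet> i)) = - (LINT x|lborel. (g' x \<bullet> i) * \<phi> x)"
    if \<phi>: "\<phi> \<in> test_functions \<Omega>" and i: "i \<in> Basis" for \<phi> i
  proof -
    note t = test_functionD[OF \<phi>]
    have [measurable]: "\<phi> \<in> borel_measurable borel" "grad \<phi> \<in> borel_measurable borel"
      using has_gradient_continuous[OF t(1)] t(2) by (auto intro: borel_measurable_continuous_onI)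
    have [measurable]: "\<phi> \<in> borel_measurable (lebesgue_on \<Omega>)" "grad \<phi> \<in> borel_measurable (lebesgue_on \<Omega>)"
      by (rule measurable_lebesgue_on; measurable)+
    have "(LINT x|lebesgue_on \<Omega>. v x * frechet_derivative \<phi> (at x) i) = (LINT x|lebesgue_on \<Omega>. v' x * (grad \<phi> x \<bullet> i))"
      unfolding has_gradient_frechet[OF t(1)]
    proof (rule integral_cong_AE)
      show "AE x in lebesgue_on \<Omega>. v x * (grad \<phi> x \<bullet> i) = v' x * (grad \<phi> x \<bullet> i)"
        using v'(3) by eventually_elim simp
    qed measurable
    also have "\<dots> = (LINT x|lborel. indicator \<Omega> x *\<^sub>R (v' x * (grad \<phi> x \<bullet> i)))"
      by (subst integral_lebesgue_on_borel) auto
    also have "\<dots> = (LINT x|lborel. v' x * (grad \<phi> x \<bullet> i))"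
      by (intro Bochner_Integration.integral_cong refl) (auto simp: indicator_def v'(2))
    finally have 1: "(LINT x|lebesgue_on \<Omega>. v x * frechet_derivative \<phi> (at x) i) = (LINT x|lborel. v' x * (grad \<phi> x \<bullet> i))" .
    have "(LINT x|lebesgue_on \<Omega>. (g x \<bullet> i) * \<phi> x) = (LINT x|lebesgue_on \<Omega>. (g' x \<bullet> i) * \<phi> x)"
    proof (rule integral_cong_AE)
      show "AE x in lebesgue_on \<Omega>. (g x \<bullet> i) * \<phi> x = (g' x \<bullet> i) * \<phi> x"
        using g'(3) by eventually_elim simp
    qed measurable
    also have "\<dots> = (LINT x|lborel. indicator \<Omega> x *\<^sub>R ((g' x \<bullet> i) * \<phi> x))"
      by (subst integral_lebesgue_on_borel) auto
    also have "\<dots> = (LINT x|lborel. (g' x \<bullet> i) * \<phi> x)"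
      by (intro Bochner_Integration.integral_cong refl) (auto simp: indicator_def g'(2))
    finally have 2: "(LINT x|lebesgue_on \<Omega>. (g x \<bullet> i) * \<phi> x) = (LINT x|lborel. (g' x \<bullet> i) * \<phi> x)" .
    show ?thesis using wg \<phi> i unfolding has_weak_gradient_def 1[symmetric] 2[symmetric] by blast
  qed
  obtain r0 where r0: "0 < r0" "cball 0 r0 \<subseteq> \<Omega>" using \<Omega>(1,4) open_contains_cball by blast
  define r where "r = min r0 1"
  have r: "0 < r" "r \<le> 1" "cball 0 r \<subseteq> \<Omega>" using r0 by (auto simp: r_def)
  \<comment> \<open>Matched weights: a point of
    \<open>cball (\<tau> n *\<^sub>R x) (\<delta> n)\<close> is the convex combination of
    \<open>x\<close> and a point of \<open>cball 0 r\<close> with weights \<open>1 - 1/(n+2)\<close>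
    and \<open>1/(n+2)\<close>. Starting at \<open>n + 2\<close> ensures that
    \<open>\<tau> n\<close> is at least 1/2.\<close>
  define \<tau> where "\<tau> n = 1 - 1 / real (n + 2)" for n
  define \<delta> where "\<delta> n = r / real (n + 2)" for n
  have n0: "(\<lambda>n. 1 / real (n + 2)) \<longlonglongrightarrow> 0"
    by (rule LIMSEQ_ignore_initial_segment[OF lim_1_over_n])
  have \<tau>: "\<And>n. 1 / 2 \<le> \<tau> n" "\<And>n. \<tau> n \<le> 1" "\<tau> \<longlonglongrightarrow> 1"
    using tendsto_diff[OF tendsto_const[of 1] n0] unfolding \<tau>_def by (auto simp: field_simps)
  have \<delta>: "\<And>n. 0 < \<delta> n" "\<And>n. \<delta> n \<le> 1" "\<delta> \<longlonglongrightarrow> 0"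
    using tendsto_mult[OF tendsto_const[of r] n0] r unfolding \<delta>_def by (auto simp: field_simps)
  have inc: "cball (\<tau> n *\<^sub>R x) (\<delta> n) \<subseteq> \<Omega>" if "x \<in> \<Omega>" for n x
  proof
    fix y assume y: "y \<in> cball (\<tau> n *\<^sub>R x) (\<delta> n)"
    define z where "z = real (n + 2) *\<^sub>R (y - \<tau> n *\<^sub>R x)"
    have "norm z = real (n + 2) * dist (\<tau> n *\<^sub>R x) y" by (simp add: z_def dist_norm norm_minus_commute)
    also have "\<dots> \<le> real (n + 2) * \<delta> n" using y by (intro mult_left_mono) auto
    finally have "z \<in> \<Omega>" using r by (auto simp: \<delta>_def)
    then have "\<tau> n *\<^sub>R x + (1 / real (n + 2)) *\<^sub>R z \<in> \<Omega>"
      using that \<tau>(1)[of n] by (intro convexD[OF \<Omega>(3)]) (auto simp: \<tau>_def)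
    then show "y \<in> \<Omega>" by (simp add: z_def)
  qed
  have "\<exists>G. has_gradient (avg (\<tau> n) (\<delta> n) v') G \<and> continuous_on UNIV G \<and>
      (\<forall>x. cball (\<tau> n *\<^sub>R x) (\<delta> n) \<subseteq> \<Omega> \<longrightarrow> G x = \<tau> n *\<^sub>R avg (\<tau> n) (\<delta> n) g' x)" for n
    by (rule avg_gradient[OF \<delta>(1)[of n] v'i g'i w, where \<tau> = "\<tau> n"]) blast+
  then obtain G where G: "\<And>n. has_gradient (avg (\<tau> n) (\<delta> n) v') (G n)" "\<And>n. continuous_on UNIV (G n)"
     "\<And>n x. cball (\<tau> n *\<^sub>R x) (\<delta> n) \<subseteq> \<Omega> \<Longrightarrow> G n x = \<tau> n *\<^sub>R avg (\<tau> n) (\<delta> n) g' x" by metis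
  have sub: "(\<lambda>n. LINT x|lebesgue_on \<Omega>. norm (avg (\<tau> n) (\<delta> n) F x - F x) powr p) \<longlonglongrightarrow> 0"
    if F: "F \<in> borel_measurable borel" "integrable lborel (\<lambda>x. norm (F x) powr p)" "\<And>x. b < norm x \<Longrightarrow> F x = 0" "0 \<le> b"
    for F :: "'a \<Rightarrow> 'b::euclidean_space" and b
  proof -
    have up: "(\<lambda>n. LINT x|lborel. norm (avg (\<tau> n) (\<delta> n) F x - F x) powr p) \<longlonglongrightarrow> 0"
      by (rule avg_tendsto[OF p F(1,2) _ F(4) \<tau> \<delta>]) (rule F(3))
    have le: "(LINT x|lebesgue_on \<Omega>. norm (avg (\<tau> n) (\<delta> n) F x - F x) powr p)
        \<le> (LINT x|lborel. norm (avg (\<tau> n) (\<delta> n) F x - F x) powr p)" for n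
    proof -
    have [measurable]: "F \<in> borel_measurable borel" by (rule F)
    have "\<delta> n \<noteq> 0" using \<delta>(1)[of n] by simp
    then have i: "integrable lborel (\<lambda>x. norm (avg (\<tau> n) (\<delta> n) F x - F x) powr p)"
      by (intro integrable_powr_norm_diff[OF p] integrable_avg_powr[OF p F(1,2,3)] F(2) \<tau>) auto
    have "(LINT x|lebesgue_on \<Omega>. norm (avg (\<tau> n) (\<delta> n) F x - F x) powr p)
        = (LINT x|lborel. indicator \<Omega> x *\<^sub>R norm (avg (\<tau> n) (\<delta> n) F x - F x) powr p)"
      by (rule integral_lebesgue_on_borel) auto
    also have "\<dots> \<le> (LINT x|lborel. norm (avg (\<tau> n) (\<delta> n) F x - F x) powr p)"
      by (rule integral_mono_AE'[OF i]) (auto simp: indicator_def)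
    finally show ?thesis .
    qed
    show ?thesis
      by (rule tendsto_sandwich[OF _ _ tendsto_const up]) (use le in \<open>auto intro!: always_eventually\<close>)
  qed
  show ?thesis
  proof (rule that[OF G(1,2)])
    have "(LINT x|lebesgue_on \<Omega>. \<bar>avg (\<tau> n) (\<delta> n) v' x - v x\<bar> powr p)
        = (LINT x|lebesgue_on \<Omega>. norm (avg (\<tau> n) (\<delta> n) v' x - v' x) powr p)" for n
    proof (rule integral_cong_AE)
      have [measurable]: "avg (\<tau> n) (\<delta> n) v' \<in> borel_measurable (lebesgue_on \<Omega>)"
        by (rule measurable_lebesgue_on) measurable
      show "(\<lambda>x. \<bar>avg (\<tau> n) (\<delta> n) v' x - v x\<bar> powr p) \<in> borel_measurable (lebesgue_on \<Omega>)" by measurable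
      show "(\<lambda>x. norm (avg (\<tau> n) (\<delta> n) v' x - v' x) powr p) \<in> borel_measurable (lebesgue_on \<Omega>)" by measurable
      show "AE x in lebesgue_on \<Omega>. \<bar>avg (\<tau> n) (\<delta> n) v' x - v x\<bar> powr p = norm (avg (\<tau> n) (\<delta> n) v' x - v' x) powr p"
        using v'(3) by eventually_elim simp
    qed
    then show "(\<lambda>n. LINT x|lebesgue_on \<Omega>. \<bar>avg (\<tau> n) (\<delta> n) v' x - v x\<bar> powr p) \<longlonglongrightarrow> 0"
      using sub[OF v'(1,4) v'B B] by simp
    have 1: "(\<lambda>n. LINT x|lebesgue_on \<Omega>. norm (avg (\<tau> n) (\<delta> n) g' x) powr p) \<longlonglongrightarrow> (LINT x|lebesgue_on \<Omega>. norm (g' x) powr p)"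
    proof (rule tendsto_integral_powr_norm[OF p _ _ _ _ sub[OF g'(1,4) g'B B]])
      fix n
      have "\<delta> n \<noteq> 0" using \<delta>(1)[of n] by simp
      then have "integrable lborel (\<lambda>x. norm (avg (\<tau> n) (\<delta> n) g' x) powr p)"
        by (intro integrable_avg_powr[OF p g'(1,4) g'B] \<tau>) auto
      then show "integrable (lebesgue_on \<Omega>) (\<lambda>x. norm (avg (\<tau> n) (\<delta> n) g' x) powr p)"
        by (intro integrable_lebesgue_onI) auto
      show "avg (\<tau> n) (\<delta> n) g' \<in> borel_measurable (lebesgue_on \<Omega>)"
        by (rule measurable_lebesgue_on) measurable
    next
      show "integrable (lebesgue_on \<Omega>) (\<lambda>x. norm (g' x) powr p)"
        using g'(4) by (intro integrable_lebesgue_onI) auto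
    qed measurable
    have 2: "(LINT x|lebesgue_on \<Omega>. norm (g' x) powr p) = (LINT x|lebesgue_on \<Omega>. norm (g x) powr p)"
    proof (rule integral_cong_AE)
      show "AE x in lebesgue_on \<Omega>. norm (g' x) powr p = norm (g x) powr p"
        using g'(3) by eventually_elim simp
    qed measurable
    have "(LINT x|lebesgue_on \<Omega>. norm (G n x) powr p) = \<tau> n powr p * (LINT x|lebesgue_on \<Omega>. norm (avg (\<tau> n) (\<delta> n) g' x) powr p)" for n
    proof -
      have "(LINT x|lebesgue_on \<Omega>. norm (G n x) powr p) = (LINT x|lebesgue_on \<Omega>. \<tau> n powr p * norm (avg (\<tau> n) (\<delta> n) g' x) powr p)"
        using \<tau>(1)[of n] by (intro Bochner_Integration.integral_cong refl) (simp add: G(3)[OF inc] powr_mult)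
      then show ?thesis by simp
    qed
    moreover have "(\<lambda>n. \<tau> n powr p * (LINT x|lebesgue_on \<Omega>. norm (avg (\<tau> n) (\<delta> n) g' x) powr p))
        \<longlonglongrightarrow> 1 powr p * (LINT x|lebesgue_on \<Omega>. norm (g x) powr p)"
      using 1 unfolding 2 by (intro tendsto_intros tendsto_powr \<tau>) auto
    ultimately show "(\<lambda>n. LINT x|lebesgue_on \<Omega>. norm (G n x) powr p) \<longlonglongrightarrow> (LINT x|lebesgue_on \<Omega>. norm (g x) powr p)"
      by simp
  qed
qed

section \<open>Reduction of both eigenvalues to smooth functions\<close>

text \<open>The constraint says that \<open>c = 0\<close> is a critical point, hence by convexity a minimum, of \<open>c \<mapsto> \<parallel>v - c\<parallel>\<^sub>p\<close>.\<close>

lemma powr_integral_le_shift: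
  fixes v :: "'a::euclidean_space \<Rightarrow> real"
  assumes \<Omega>: "open \<Omega>" "bounded \<Omega>" and p: "1 < p" and v: "v \<in> Lp p \<Omega>"
    and c: "(LINT x|lebesgue_on \<Omega>. \<bar>v x\<bar> powr (p - 2) * v x) = 0"
  shows "(LINT x|lebesgue_on \<Omega>. \<bar>v x\<bar> powr p) \<le> (LINT x|lebesgue_on \<Omega>. \<bar>v x - c\<bar> powr p)"
proof -
  have [measurable]: "\<Omega> \<in> sets borel" using \<Omega> by simp
  have [measurable]: "v \<in> borel_measurable (lebesgue_on \<Omega>)" and vi: "integrable (lebesgue_on \<Omega>) (\<lambda>x. \<bar>v x\<bar> powr p)"
    using v by (auto simp: Lp_def)
  have cL: "integrable (lebesgue_on \<Omega>) (\<lambda>x. K)" for K :: real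
  proof -
    obtain B where B: "\<And>x. x \<in> \<Omega> \<Longrightarrow> norm x \<le> B" using \<Omega>(2) unfolding bounded_iff by blast
    have "integrable lborel (\<lambda>x. indicator \<Omega> x *\<^sub>R K)"
    proof (rule integrable_bounded_support[where B = B and C = "\<bar>K\<bar>"])
      fix x
      show "norm (indicator \<Omega> x *\<^sub>R K) \<le> \<bar>K\<bar>" by (simp add: indicator_def)
      show "indicator \<Omega> x *\<^sub>R K = 0" if "B < norm x" using B[of x] that by (cases "x \<in> \<Omega>") auto
    qed measurable
    then show ?thesis by (subst integrable_lebesgue_on_borel) auto
  qed
  have i: "integrable (lebesgue_on \<Omega>) (\<lambda>x. \<bar>v x\<bar> powr (p - 2) * v x)"
  proof (rule Bochner_Integration.integrable_bound)
    show "integrable (lebesgue_on \<Omega>) (\<lambda>x. 1 + \<bar>v x\<bar> powr p)" using cL vi by simp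
    have "\<bar>t\<bar> powr (p - 1) \<le> 1 + \<bar>t\<bar> powr p" for t :: real
    proof (cases "1 \<le> \<bar>t\<bar>")
      case True
      then have "\<bar>t\<bar> powr (p - 1) \<le> \<bar>t\<bar> powr p" by (intro powr_mono) auto
      then show ?thesis by simp
    next
      case False
      then have "\<bar>t\<bar> powr (p - 1) \<le> 1" using p powr_mono2[of "p - 1" "\<bar>t\<bar>" 1] by simp
      then show ?thesis using powr_ge_zero[of "\<bar>t\<bar>" p] by linarith
    qed
    then show "AE x in lebesgue_on \<Omega>. norm (\<bar>v x\<bar> powr (p - 2) * v x) \<le> norm (1 + \<bar>v x\<bar> powr p)"
      by (intro AE_I2) (metis abs_ge_self abs_powr_mult_self(2) order_trans real_norm_def)
  qed measurable
  have vc: "integrable (lebesgue_on \<Omega>) (\<lambda>x. \<bar>v x - c\<bar> powr p)"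
    using integrable_powr_norm_diff[OF p, of v "lebesgue_on \<Omega>" "\<lambda>_. c"] vi cL[of "\<bar>c\<bar> powr p"] by simp
  have "(LINT x|lebesgue_on \<Omega>. \<bar>v x\<bar> powr p + (- p * c) * (\<bar>v x\<bar> powr (p - 2) * v x)) \<le> (LINT x|lebesgue_on \<Omega>. \<bar>v x - c\<bar> powr p)"
  proof (rule integral_mono)
    show "\<bar>v x\<bar> powr p + (- p * c) * (\<bar>v x\<bar> powr (p - 2) * v x) \<le> \<bar>v x - c\<bar> powr p" for x
      using abs_powr_tangent[OF p, of "v x" "- c"] by (simp add: mult_ac)
  qed (use vi i vc in auto)
  moreover have "(LINT x|lebesgue_on \<Omega>. \<bar>v x\<bar> powr p + (- p * c) * (\<bar>v x\<bar> powr (p - 2) * v x))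
      = (LINT x|lebesgue_on \<Omega>. \<bar>v x\<bar> powr p)"
    using vi i c by simp
  ultimately show ?thesis by simp
qed

text \<open>The constants supplied by \<open>P\<close> for the approximants are not known to
  converge. This is harmless, since the constraint on \<open>v\<close> bounds its norm by that of
  \<open>v - c\<close> for every \<open>c\<close>, in particular for the constant belonging to each
  approximant.\<close>

lemma neumann_lower_bound:
  fixes v :: "'a::euclidean_space \<Rightarrow> real"
  assumes \<Omega>: "open \<Omega>" "bounded \<Omega>" "convex \<Omega>" "0 \<in> \<Omega>" and p: "1 < p" and K: "0 < K"
    and P: "\<And>v g. has_gradient v g \<Longrightarrow> continuous_on UNIV g \<Longrightarrow>
        \<exists>c. K * (LINT x|lebesgue_on \<Omega>. \<bar>v x - c\<bar> powr p) \<le> (LINT x|lebesgue_on \<Omega>. norm (g x) powr p)"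
    and vg: "W1p p \<Omega> v g" and c: "(LINT x|lebesgue_on \<Omega>. \<bar>v x\<bar> powr (p - 2) * v x) = 0"
  shows "K * (LINT x|lebesgue_on \<Omega>. \<bar>v x\<bar> powr p) \<le> (LINT x|lebesgue_on \<Omega>. norm (g x) powr p)"
proof -
  have [measurable]: "\<Omega> \<in> sets borel" using \<Omega> by simp
  have vL: "v \<in> Lp p \<Omega>" using vg by (auto simp: W1p_def)
  have vm [measurable]: "v \<in> borel_measurable (lebesgue_on \<Omega>)" and vi: "integrable (lebesgue_on \<Omega>) (\<lambda>x. \<bar>v x\<bar> powr p)"
    using vL by (auto simp: Lp_def)
  define E where "E = (LINT x|lebesgue_on \<Omega>. norm (g x) powr p)"
  define I where "I = (LINT x|lebesgue_on \<Omega>. \<bar>v x\<bar> powr p)"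
  have E0: "0 \<le> E" by (simp add: E_def)
  show ?thesis
  proof (rule W1p_smooth_approximation[OF \<Omega> p vg, folded E_def])
  fix V :: "nat \<Rightarrow> 'a \<Rightarrow> real" and G :: "nat \<Rightarrow> 'a \<Rightarrow> 'a"
  assume V: "\<And>n. has_gradient (V n) (G n)" "\<And>n. continuous_on UNIV (G n)"
    "(\<lambda>n. LINT x|lebesgue_on \<Omega>. \<bar>V n x - v x\<bar> powr p) \<longlonglongrightarrow> 0"
    "(\<lambda>n. LINT x|lebesgue_on \<Omega>. norm (G n x) powr p) \<longlonglongrightarrow> E"
  have "\<forall>n. \<exists>c. K * (LINT x|lebesgue_on \<Omega>. \<bar>V n x - c\<bar> powr p) \<le> (LINT x|lebesgue_on \<Omega>. norm (G n x) powr p)"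
    using P[OF V(1,2)] by blast
  from choice[OF this] obtain C where
    C: "\<And>n. K * (LINT x|lebesgue_on \<Omega>. \<bar>V n x - C n\<bar> powr p) \<le> (LINT x|lebesgue_on \<Omega>. norm (G n x) powr p)"
    by blast
  have Vc: "continuous_on UNIV (V n)" for n by (rule has_gradient_continuous[OF V(1)])
  have Vm [measurable]: "V n \<in> borel_measurable borel" for n using Vc by (rule borel_measurable_continuous_onI)
  obtain B where B: "\<And>x. x \<in> \<Omega> \<Longrightarrow> norm x \<le> B" using \<Omega>(2) unfolding bounded_iff by blast
  have VL: "(\<lambda>x. V n x - a) \<in> Lp p \<Omega>" for n a
  proof -
    have "continuous_on UNIV (\<lambda>x. V n x - a)" using Vc by (intro continuous_intros)
    from bounded_on_cball[OF this] obtain D where "\<And>x. norm x \<le> B \<Longrightarrow> norm (V n x - a) \<le> D" by blast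
    then show ?thesis using B p by (intro Lp_bounded[OF \<Omega>(1,2), where C = D]) auto
  qed
  have K1: "K * I \<le> (1 + e) * E" if e: "0 < e" for e
  proof -
    obtain D where D: "0 \<le> D" "\<And>a b::real. 0 \<le> a \<Longrightarrow> 0 \<le> b \<Longrightarrow> (a + b) powr p \<le> (1 + e) * a powr p + D * b powr p"
      using powr_add_le[OF p e] by blast
    have "K * I \<le> (1 + e) * (LINT x|lebesgue_on \<Omega>. norm (G n x) powr p) + K * D * (LINT x|lebesgue_on \<Omega>. \<bar>V n x - v x\<bar> powr p)" for n
    proof -
      have vc: "integrable (lebesgue_on \<Omega>) (\<lambda>x. norm (v x - C n) powr p)"
        using Lp_bounded[OF \<Omega>(1,2), of "\<lambda>_. C n" "\<bar>C n\<bar>" p] p vi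
        by (intro integrable_powr_norm_diff[OF p]) (auto simp: Lp_def)
      have Vi: "integrable (lebesgue_on \<Omega>) (\<lambda>x. norm (V n x - C n) powr p)"
        and [measurable]: "(\<lambda>x. V n x - C n) \<in> borel_measurable (lebesgue_on \<Omega>)"
        using VL[of n "C n"] by (auto simp: Lp_def)
      have "I \<le> (LINT x|lebesgue_on \<Omega>. norm (v x - C n) powr p)"
        unfolding I_def using powr_integral_le_shift[OF \<Omega>(1,2) p vL c] by simp
      also have "\<dots> \<le> (1 + e) * (LINT x|lebesgue_on \<Omega>. norm (V n x - C n) powr p)
          + D * (LINT x|lebesgue_on \<Omega>. norm ((v x - C n) - (V n x - C n)) powr p)"
        by (rule integral_powr_norm_le[OF p _ _ vc Vi D(2)]) measurable
      also have "\<dots> = (1 + e) * (LINT x|lebesgue_on \<Omega>. \<bar>V n x - C n\<bar> powr p) + D * (LINT x|lebesgue_on \<Omega>. \<bar>V n x - v x\<bar> powr p)"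
        by (simp add: abs_minus_commute)
      finally have "K * I \<le> K * ((1 + e) * (LINT x|lebesgue_on \<Omega>. \<bar>V n x - C n\<bar> powr p) + D * (LINT x|lebesgue_on \<Omega>. \<bar>V n x - v x\<bar> powr p))"
        using K by (intro mult_left_mono) auto
      also have "\<dots> = (1 + e) * (K * (LINT x|lebesgue_on \<Omega>. \<bar>V n x - C n\<bar> powr p)) + K * D * (LINT x|lebesgue_on \<Omega>. \<bar>V n x - v x\<bar> powr p)"
        by (simp add: algebra_simps)
      also have "\<dots> \<le> (1 + e) * (LINT x|lebesgue_on \<Omega>. norm (G n x) powr p) + K * D * (LINT x|lebesgue_on \<Omega>. \<bar>V n x - v x\<bar> powr p)"
        using e by (intro add_right_mono mult_left_mono C) auto
      finally show ?thesis .
    qed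
    moreover have "(\<lambda>n. (1 + e) * (LINT x|lebesgue_on \<Omega>. norm (G n x) powr p) + K * D * (LINT x|lebesgue_on \<Omega>. \<bar>V n x - v x\<bar> powr p))
        \<longlonglongrightarrow> (1 + e) * E + K * D * 0" by (intro tendsto_intros V)
    ultimately show ?thesis by (intro LIMSEQ_le_const[of _ "(1 + e) * E"]) auto
  qed
  have "K * I \<le> E"
  proof (rule field_le_epsilon)
    fix e :: real assume e: "0 < e"
    have "K * I \<le> (1 + e / (E + 1)) * E" using K1[of "e / (E + 1)"] e E0 by simp
    also have "\<dots> = E + e * (E / (E + 1))" by (simp add: algebra_simps)
    also have "\<dots> \<le> E + e * 1" using e E0 by (intro add_left_mono mult_left_mono) auto
    finally show "K * I \<le> E + e" by simp
  qed
  then show ?thesis by (simp add: I_def E_def)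
  qed
qed

lemma test_function_W1p_0:
  assumes \<Omega>: "open \<Omega>" "bounded \<Omega>" and p: "1 < p" and \<phi>: "\<phi> \<in> test_functions \<Omega>"
  shows "W1p_0 p \<Omega> \<phi> (grad \<phi>)"
proof -
  have "\<exists>C. \<forall>x. norm (grad \<phi> x) \<le> C"
  proof (rule test_function_bounds[OF \<phi>])
    fix B C assume "\<And>x. norm (grad \<phi> x) \<le> C"
    then show ?thesis by blast
  qed
  then obtain C where C: "\<And>x. norm (grad \<phi> x) \<le> C" by blast
  have "W1p p \<Omega> \<phi> (grad \<phi>)" using p by (intro W1pI[OF \<Omega> test_functionD(1)[OF \<phi>] C]) auto
  moreover have "(\<lambda>n::nat. LINT x|lebesgue_on \<Omega>. \<bar>\<phi> x - \<phi> x\<bar> powr p) \<longlonglongrightarrow> 0"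
    "(\<lambda>n::nat. LINT x|lebesgue_on \<Omega>. norm (grad \<phi> x - grad \<phi> x) powr p) \<longlonglongrightarrow> 0" by auto
  ultimately show ?thesis unfolding W1p_0_def using \<phi> by (intro conjI exI[of _ "\<lambda>_. \<phi>"] allI)
qed

text \<open>Mass and energy are both continuous for the convergence that defines
  \<open>W1p_0\<close>, so an inequality between them on test functions survives in the
  closure.\<close>

lemma dirichlet_lower_bound:
  assumes \<Omega>: "open \<Omega>" "bounded \<Omega>" and p: "1 < p"
    and P: "\<And>\<phi>. \<phi> \<in> test_functions \<Omega> \<Longrightarrow>
      K * (LINT x|lebesgue_on \<Omega>. \<bar>\<phi> x\<bar> powr p) \<le> (LINT x|lebesgue_on \<Omega>. norm (grad \<phi> x) powr p)"
    and vg: "W1p_0 p \<Omega> v g"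
  shows "K * (LINT x|lebesgue_on \<Omega>. \<bar>v x\<bar> powr p) \<le> (LINT x|lebesgue_on \<Omega>. norm (g x) powr p)"
proof -
  obtain \<phi> where \<phi>: "\<And>n::nat. \<phi> n \<in> test_functions \<Omega>"
    and l1: "(\<lambda>n. LINT x|lebesgue_on \<Omega>. \<bar>\<phi> n x - v x\<bar> powr p) \<longlonglongrightarrow> 0"
    and l2: "(\<lambda>n. LINT x|lebesgue_on \<Omega>. norm (grad (\<phi> n) x - g x) powr p) \<longlonglongrightarrow> 0"
    and vg: "W1p p \<Omega> v g" using vg unfolding W1p_0_def by blast
  have \<phi>L: "\<phi> n \<in> Lp p \<Omega>" "grad (\<phi> n) \<in> Lp p \<Omega>" for n
    using test_function_W1p_0[OF \<Omega> p \<phi>] by (auto simp: W1p_0_def W1p_def)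
  have "(\<lambda>n. LINT x|lebesgue_on \<Omega>. norm (\<phi> n x) powr p) \<longlonglongrightarrow> (LINT x|lebesgue_on \<Omega>. norm (v x) powr p)"
    by (rule tendsto_integral_powr_norm[OF p]) (use \<phi>L vg l1 in \<open>auto simp: Lp_def W1p_def\<close>)
  then have "(\<lambda>n. K * (LINT x|lebesgue_on \<Omega>. norm (\<phi> n x) powr p)) \<longlonglongrightarrow> K * (LINT x|lebesgue_on \<Omega>. norm (v x) powr p)"
    by (rule tendsto_mult_left)
  moreover have "(\<lambda>n. LINT x|lebesgue_on \<Omega>. norm (grad (\<phi> n) x) powr p) \<longlonglongrightarrow> (LINT x|lebesgue_on \<Omega>. norm (g x) powr p)"
    by (rule tendsto_integral_powr_norm[OF p]) (use \<phi>L vg l2 in \<open>auto simp: Lp_def W1p_def\<close>)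
  ultimately show ?thesis using P[OF \<phi>] by (intro LIMSEQ_le[of "\<lambda>n. K * (LINT x|lebesgue_on \<Omega>. norm (\<phi> n x) powr p)"]) auto
qed

text \<open>Enlarges the competitors from test functions to differentiable functions with bounded
  gradient and compact support, by mollifying without dilation. The first claim provides a nonzero
  test function, so that the infimum is over a nonempty set.\<close>

lemma lambda_le_smooth:
  fixes u :: "'a::euclidean_space \<Rightarrow> real"
  assumes \<Omega>: "open \<Omega>" "bounded \<Omega>" and p: "1 < p" and u: "has_gradient u gu" "\<And>x. norm (gu x) \<le> C"
    and K: "compact K" "K \<subseteq> \<Omega>" "\<And>x. x \<notin> K \<Longrightarrow> u x = 0" and pos: "0 < (LINT x|lborel. \<bar>u x\<bar> powr p)"
  shows "\<exists>\<phi>\<in>test_functions \<Omega>. \<not> (AE x in lebesgue_on \<Omega>. \<phi> x = 0)"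
    and "lambda p \<Omega> \<le> (LINT x|lborel. norm (gu x) powr p) / (LINT x|lborel. \<bar>u x\<bar> powr p)"
proof -
  have [measurable]: "\<Omega> \<in> sets borel" using \<Omega> by simp
  have uc: "continuous_on UNIV u" by (rule has_gradient_continuous[OF u(1)])
  have [measurable]: "u \<in> borel_measurable borel" using uc by (rule borel_measurable_continuous_onI)
  have [measurable]: "gu \<in> borel_measurable borel" by (rule has_gradient_measurable[OF u(1)])
  obtain \<eta> :: "'a \<Rightarrow> real" where "mollifier \<eta>" by (rule mollifier_obtain)
  then interpret mollifier \<eta> .
  obtain B0 where B0: "\<And>x. x \<in> K \<Longrightarrow> norm x \<le> B0" using compact_imp_bounded[OF K(1)] unfolding bounded_iff by blast
  define B where "B = max 0 B0"
  have B: "0 \<le> B" by (simp add: B_def)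
  have uB: "u x = 0" if "B < norm x" for x using that B0[of x] K(3)[of x] by (force simp: B_def)
  have gB: "gu x = 0" if "B < norm x" for x by (rule has_gradient_zero_outside[OF u(1) uB that])
  obtain D where D: "\<And>x. norm x \<le> B \<Longrightarrow> norm (u x) \<le> D" using bounded_on_cball[OF uc] by blast
  have ui: "integrable lborel u" by (rule integrable_bounded_support[OF _ D uB]) auto
  have gi: "integrable lborel gu" by (rule integrable_bounded_support[OF _ u(2) gB]) auto
  have up: "integrable lborel (\<lambda>x. norm (u x) powr p)"
    by (rule integrable_bounded_support[where B = B and C = "D powr p"]) (use D uB p in \<open>auto intro: powr_mono2\<close>)
  have gp: "integrable lborel (\<lambda>x. norm (gu x) powr p)"
    by (rule integrable_bounded_support[where B = B and C = "C powr p"]) (use u(2) gB p in \<open>auto intro: powr_mono2\<close>)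
  have w: "(LINT x|lborel. u x * (grad \<phi> x \<bullet> i)) = - (LINT x|lborel. (gu x \<bullet> i) * \<phi> x)"
    if \<phi>: "\<phi> \<in> test_functions UNIV" and i: "i \<in> Basis" for \<phi> i
  proof -
    note t = test_functionD[OF \<phi>]
    have [measurable]: "\<phi> \<in> borel_measurable borel" "grad \<phi> \<in> borel_measurable borel"
      using has_gradient_continuous[OF t(1)] t(2) by (auto intro: borel_measurable_continuous_onI)
    have "(LINT x|lebesgue_on UNIV. u x * frechet_derivative \<phi> (at x) i) = - (LINT x|lebesgue_on UNIV. (gu x \<bullet> i) * \<phi> x)"
      using has_weak_gradientI[OF open_UNIV u] \<phi> i unfolding has_weak_gradient_def by blast
    then show ?thesis
      unfolding has_gradient_frechet[OF t(1)] by (subst (asm) (1 2) integral_lebesgue_on_borel) auto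
  qed
  have "\<exists>e>0. (\<Union>x\<in>K. cball x e) \<subseteq> \<Omega>"
  proof -
    obtain e where e: "e > 0" "(\<Union>x\<in>K. ball x e) \<subseteq> \<Omega>"
      using compact_subset_open_imp_ball_epsilon_subset[OF K(1) \<Omega>(1) K(2)] by metis
    have "(\<Union>x\<in>K. cball x (e / 2)) \<subseteq> (\<Union>x\<in>K. ball x e)" using e by force
    then show ?thesis using e by (intro exI[of _ "e / 2"]) auto
  qed
  then obtain e where e: "0 < e" "\<And>x. x \<in> K \<Longrightarrow> cball x e \<subseteq> \<Omega>" by blast
  \<comment> \<open>At most \<open>e\<close>, so that all mollified functions are supported in the
    compact \<open>e\<close>-enlargement \<open>K'\<close> of \<open>K\<close>, still inside
    \<Omega>.\<close>
  define \<delta> where "\<delta> n = min e 1 / real (n + 2)" for n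
  have n0: "(\<lambda>n. 1 / real (n + 2)) \<longlonglongrightarrow> 0"
    by (rule LIMSEQ_ignore_initial_segment[OF lim_1_over_n])
  have \<delta>: "\<And>n. 0 < \<delta> n" "\<And>n. \<delta> n \<le> 1" "\<delta> \<longlonglongrightarrow> 0" "\<And>n. \<delta> n \<le> e"
    using tendsto_mult[OF tendsto_const[of "min e 1"] n0] e unfolding \<delta>_def by (auto simp: divide_le_eq algebra_simps)
     (smt (verit) mult_nonneg_nonneg of_nat_0_le_iff)+
  define V where "V n = avg 1 (\<delta> n) u" for n
  have "\<exists>G. has_gradient (V n) G \<and> continuous_on UNIV G \<and> (\<forall>x. cball (1 *\<^sub>R x) (\<delta> n) \<subseteq> UNIV \<longrightarrow> G x = 1 *\<^sub>R avg 1 (\<delta> n) gu x)" for n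
    unfolding V_def by (rule avg_gradient[OF \<delta>(1)[of n] ui gi w, where \<tau> = 1]) blast+
  then have V: "has_gradient (V n) (avg 1 (\<delta> n) gu)" for n
    by (metis (no_types, lifting) ext scaleR_one top_greatest)
  have VCk: "Ck m (V n)" for n m
  proof -
    have "Ck m (\<lambda>x. conv (\<lambda>z. (1 / \<delta> n ^ DIM('a)) * \<eta> (0 + (1 / \<delta> n) *\<^sub>R z)) u (0 + 1 *\<^sub>R x))"
    proof (rule Ck_affine, rule Ck_conv[OF ui, where B = "\<delta> n"])
      show "Ck k (\<lambda>z. (1 / \<delta> n ^ DIM('a)) * \<eta> (0 + (1 / \<delta> n) *\<^sub>R z))" for k by (intro Ck_mult Ck_const Ck_affine Ck_eta)
      show "(1 / \<delta> n ^ DIM('a)) * \<eta> (0 + (1 / \<delta> n) *\<^sub>R z) = 0" if "\<delta> n < norm z" for z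
        using that \<delta>(1)[of n] eta_support[of "0 + (1 / \<delta> n) *\<^sub>R z"] by (simp add: field_simps)
    qed
    moreover have "V n = (\<lambda>x. conv (\<lambda>z. (1 / \<delta> n ^ DIM('a)) * \<eta> (0 + (1 / \<delta> n) *\<^sub>R z)) u (0 + 1 *\<^sub>R x))"
      unfolding V_def using avg_eq_conv[of u "\<delta> n" 1] \<delta>(1)[of n] by (intro ext) simp
    ultimately show ?thesis by simp
  qed
  define K' where "K' = (\<Union>x\<in>K. \<Union>y\<in>cball 0 e. {x + y})"
  have K'c: "compact K'" unfolding K'_def using compact_sums'[OF K(1) compact_cball[of 0 e]] by simp
  have K'\<Omega>: "K' \<subseteq> \<Omega>" using e(2) by (force simp: K'_def dist_norm)
  have V0: "V n x = 0" if "x \<notin> K'" for n x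
  proof -
    have "\<eta> z *\<^sub>R u (1 *\<^sub>R x - \<delta> n *\<^sub>R z) = 0" for z
    proof (cases "norm z < 1")
      case True
      have "\<delta> n * norm z \<le> e * 1" using True \<delta>(1,4)[of n] e by (intro mult_mono) auto
      then have "\<delta> n *\<^sub>R z \<in> cball 0 e" using \<delta>(1)[of n] by simp
      moreover have "x = (x - \<delta> n *\<^sub>R z) + \<delta> n *\<^sub>R z" by simp
      ultimately have "x - \<delta> n *\<^sub>R z \<notin> K" using that unfolding K'_def by blast
      then show ?thesis by (simp add: K(3))
    qed (simp add: eta_support)
    then have "avg 1 (\<delta> n) u x = (LINT z::'a|lborel. 0)" unfolding avg_def by (intro Bochner_Integration.integral_cong) auto
    then show ?thesis by (simp add: V_def)
  qed
  have Vt: "V n \<in> test_functions \<Omega>" for n by (rule test_functionI[OF VCk K'c K'\<Omega> V0])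
  have one: "\<And>n::nat. 1 / 2 \<le> (1::real)" "\<And>n::nat. (1::real) \<le> 1" "(\<lambda>n::nat. 1::real) \<longlonglongrightarrow> 1" by auto
  have \<delta>n: "\<delta> n \<noteq> 0" for n using \<delta>(1)[of n] by simp
  have [measurable]: "V n \<in> borel_measurable borel" for n unfolding V_def by measurable
  have iV: "integrable lborel (\<lambda>x. norm (avg 1 (\<delta> n) u x) powr p)" for n
    by (rule integrable_avg_powr[OF p _ up uB \<delta>n]) auto
  have iG: "integrable lborel (\<lambda>x. norm (avg 1 (\<delta> n) gu x) powr p)" for n
    by (rule integrable_avg_powr[OF p _ gp gB \<delta>n]) auto
  have l1: "(\<lambda>n. LINT x|lborel. norm (V n x) powr p) \<longlonglongrightarrow> (LINT x|lborel. norm (u x) powr p)"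
    unfolding V_def
    by (rule tendsto_integral_powr_norm[OF p _ iV _ up avg_tendsto[OF p _ up uB B one \<delta>(1,2,3)]]) auto
  have l2: "(\<lambda>n. LINT x|lborel. norm (avg 1 (\<delta> n) gu x) powr p) \<longlonglongrightarrow> (LINT x|lborel. norm (gu x) powr p)"
    by (rule tendsto_integral_powr_norm[OF p _ iG _ gp avg_tendsto[OF p _ gp gB B one \<delta>(1,2,3)]]) auto
  have eqV: "(LINT x|lebesgue_on \<Omega>. \<bar>V n x\<bar> powr p) = (LINT x|lborel. norm (V n x) powr p)" for n
  proof -
    have "(LINT x|lebesgue_on \<Omega>. \<bar>V n x\<bar> powr p) = (LINT x|lborel. indicator \<Omega> x *\<^sub>R (\<bar>V n x\<bar> powr p))"
      by (rule integral_lebesgue_on_borel) auto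
    also have "\<dots> = (LINT x|lborel. norm (V n x) powr p)"
      using test_functionD(3)[OF Vt] by (intro Bochner_Integration.integral_cong) (auto simp: indicator_def)
    finally show ?thesis .
  qed
  have eqG: "(LINT x|lebesgue_on \<Omega>. norm (grad (V n) x) powr p) = (LINT x|lborel. norm (avg 1 (\<delta> n) gu x) powr p)" for n
  proof -
    have g: "grad (V n) = avg 1 (\<delta> n) gu" by (rule has_gradient_eq_grad[OF V])
    have "(LINT x|lebesgue_on \<Omega>. norm (grad (V n) x) powr p) = (LINT x|lborel. indicator \<Omega> x *\<^sub>R (norm (grad (V n) x) powr p))"
      unfolding g by (rule integral_lebesgue_on_borel) auto
    also have "\<dots> = (LINT x|lborel. norm (grad (V n) x) powr p)"
      using test_functionD(4)[OF Vt] by (intro Bochner_Integration.integral_cong) (auto simp: indicator_def)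
    finally show ?thesis unfolding g .
  qed
  have "\<forall>\<^sub>F n in sequentially. 0 < (LINT x|lborel. norm (V n x) powr p)"
    by (rule order_tendstoD(1)[OF l1]) (use pos in simp)
  moreover have nz: "\<not> (AE x in lebesgue_on \<Omega>. V n x = 0)" if "0 < (LINT x|lborel. norm (V n x) powr p)" for n
  proof
    assume "AE x in lebesgue_on \<Omega>. V n x = 0"
    then have "AE x in lebesgue_on \<Omega>. \<bar>V n x\<bar> powr p = 0" by eventually_elim simp
    then have "(LINT x|lebesgue_on \<Omega>. \<bar>V n x\<bar> powr p) = 0" by (rule integral_eq_zero_AE)
    then show False using that eqV[of n] by simp
  qed
  ultimately have ev: "\<forall>\<^sub>F n in sequentially. \<not> (AE x in lebesgue_on \<Omega>. V n x = 0)"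
    by (rule eventually_mono)
  then show "\<exists>\<phi>\<in>test_functions \<Omega>. \<not> (AE x in lebesgue_on \<Omega>. \<phi> x = 0)"
    unfolding eventually_sequentially using Vt by blast
  have low: "\<forall>\<^sub>F n in sequentially. lambda p \<Omega> \<le> (LINT x|lborel. norm (avg 1 (\<delta> n) gu x) powr p) / (LINT x|lborel. norm (V n x) powr p)"
    using ev
  proof eventually_elim
    case (elim n)
    show ?case unfolding lambda_def
    proof (rule cInf_lower)
      show "(LINT x|lborel. norm (avg 1 (\<delta> n) gu x) powr p) / (LINT x|lborel. norm (V n x) powr p)
        \<in> {(LINT x|lebesgue_on \<Omega>. norm (g x) powr p) / (LINT x|lebesgue_on \<Omega>. \<bar>v x\<bar> powr p) | v g.
            W1p_0 p \<Omega> v g \<and> \<not> (AE x in lebesgue_on \<Omega>. v x = 0)}"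
        unfolding eqV[symmetric] eqG[symmetric] using test_function_W1p_0[OF \<Omega> p Vt] elim by blast
      show "bdd_below {(LINT x|lebesgue_on \<Omega>. norm (g x) powr p) / (LINT x|lebesgue_on \<Omega>. \<bar>v x\<bar> powr p) | v g.
            W1p_0 p \<Omega> v g \<and> \<not> (AE x in lebesgue_on \<Omega>. v x = 0)}"
        by (rule bdd_belowI[of _ 0]) auto
    qed
  qed
  have "(\<lambda>n. (LINT x|lborel. norm (avg 1 (\<delta> n) gu x) powr p) / (LINT x|lborel. norm (V n x) powr p))
      \<longlonglongrightarrow> (LINT x|lborel. norm (gu x) powr p) / (LINT x|lborel. norm (u x) powr p)"
    by (intro tendsto_divide l1 l2) (use pos in simp)
  from tendsto_lowerbound[OF this low sequentially_bot]
  show "lambda p \<Omega> \<le> (LINT x|lborel. norm (gu x) powr p) / (LINT x|lborel. \<bar>u x\<bar> powr p)"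
    unfolding real_norm_def .
qed

section \<open>The Riccati equation of a radial eigenfunction\<close>

text \<open>For a radial eigenfunction \<open>U\<close> with eigenvalue \<open>l\<close> in dimension \<open>N\<close>, \<open>w = (- U' / U) powr (p - 1)\<close>.\<close>

definition riccati :: "real \<Rightarrow> nat \<Rightarrow> real \<Rightarrow> real \<Rightarrow> (real \<Rightarrow> real) \<Rightarrow> bool" where
  "riccati p N l R w \<longleftrightarrow> w \<in> borel_measurable borel \<and>
     (\<forall>r. 0 < r \<and> r < R \<longrightarrow> 0 \<le> w r \<and>
        (w has_real_derivative l + (p - 1) * w r powr (p / (p - 1)) - (real N - 1) * w r / r) (at r)) \<and>
     (\<forall>\<rho><R. \<exists>C\<ge>0. \<forall>r. 0 < r \<and> r \<le> \<rho> \<longrightarrow> w r \<le> C * r)"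

locale riccati_construction =
  fixes p :: real and N :: nat
  assumes p: "1 < p" and N: "1 \<le> N"
begin

text \<open>The nonlinearity for \<open>l = 1\<close>, extended so that it is monotone on all of
  \<open>ennreal\<close> and infinite values persist.\<close>

definition \<Phi> :: "ennreal \<Rightarrow> ennreal" where
  "\<Phi> x = (if x = top then top else ennreal (1 + (p - 1) * enn2real x powr (p / (p - 1))))"

text \<open>The equation with \<open>l = 1\<close> says that \<open>r ^ (N - 1) * w r\<close> is the integral of \<open>t ^ (N - 1) * (1 + (p - 1) * w t powr (p / (p - 1)))\<close>.
  This is a monotone fixed point equation in \<open>ennreal\<close>; beyond the blow-up radius its least solution is \<open>\<infinity>\<close>.\<close>

definition Z :: "(real \<Rightarrow> ennreal) \<Rightarrow> real \<Rightarrow> ennreal" where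
  "Z u r = (\<integral>\<^sup>+t. ennreal (t ^ (N - 1)) * \<Phi> (u t) * indicator {0<..<r} t \<partial>lborel)"

definition S :: "(real \<Rightarrow> ennreal) \<Rightarrow> real \<Rightarrow> ennreal" where
  "S u r = ennreal (1 / r ^ (N - 1)) * Z u r"

definition W :: "real \<Rightarrow> ennreal" where "W = lfp S"

lemma \<Phi>_mono: "x \<le> y \<Longrightarrow> \<Phi> x \<le> \<Phi> y"
  using p unfolding \<Phi>_def
  by (auto simp: top_unique intro!: ennreal_leI mult_left_mono powr_mono2 enn2real_mono simp: less_top)

lemma \<Phi>_ennreal: "0 \<le> x \<Longrightarrow> \<Phi> (ennreal x) = ennreal (1 + (p - 1) * x powr (p / (p - 1)))"
  by (simp add: \<Phi>_def)

lemma \<Phi>_measurable [measurable]: "\<Phi> \<in> borel_measurable borel"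
  unfolding \<Phi>_def by measurable

lemma Z_mono: "u \<le> v \<Longrightarrow> Z u r \<le> Z v r"
  unfolding Z_def by (intro nn_integral_mono mult_right_mono mult_left_mono \<Phi>_mono) (auto simp: le_fun_def)

lemma mono_S: "mono S"
  by (rule monoI) (auto simp: S_def le_fun_def intro!: mult_left_mono Z_mono)

lemma W_eq: "W r = ennreal (1 / r ^ (N - 1)) * Z W r"
  using lfp_unfold[OF mono_S] unfolding W_def S_def by metis

lemma W_least: "(\<And>r. S u r \<le> u r) \<Longrightarrow> W r \<le> u r"
  using lfp_lowerbound[of S u] unfolding W_def by (auto simp: le_fun_def)

lemma Z_mono_r: "r \<le> s \<Longrightarrow> Z u r \<le> Z u s"
  unfolding Z_def by (intro nn_integral_mono mult_left_mono) (auto simp: indicator_def)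

lemma Z_measurable [measurable]: "Z u \<in> borel_measurable borel"
proof (rule borel_measurableI_greater)
  fix y
  have "is_interval {r. y < Z u r}"
    unfolding is_interval_1 using Z_mono_r by (auto intro: less_le_trans)
  then show "{x \<in> space borel. y < Z u x} \<in> sets borel" by (simp add: real_interval_borel_measurable)
qed

lemma W_measurable [measurable]: "W \<in> borel_measurable borel"
proof -
  have "W = (\<lambda>r. ennreal (1 / r ^ (N - 1)) * Z W r)" using W_eq by auto
  also have "\<dots> \<in> borel_measurable borel" by measurable
  finally show ?thesis .
qed

lemma Z_W: assumes "0 < r" shows "Z W r = ennreal (r ^ (N - 1)) * W r"
proof -
  have "ennreal (r ^ (N - 1)) * (ennreal (1 / r ^ (N - 1)) * Z W r) = Z W r"
    using assms by (simp add: mult.assoc[symmetric] ennreal_mult'[symmetric])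
  then show ?thesis unfolding W_eq[symmetric] by simp
qed

lemma Z_bound:
  assumes "0 < r" "\<And>t. 0 < t \<Longrightarrow> t < r \<Longrightarrow> u t \<le> ennreal M" "0 \<le> M"
  shows "Z u r \<le> ennreal (r ^ (N - 1) * (1 + (p - 1) * M powr (p / (p - 1))) * r)"
proof -
  let ?c = "1 + (p - 1) * M powr (p / (p - 1))"
  have c: "0 \<le> ?c" using p by simp
  have "Z u r \<le> (\<integral>\<^sup>+t. ennreal (r ^ (N - 1) * ?c) * indicator {0<..<r} t \<partial>lborel)"
    unfolding Z_def
  proof (rule nn_integral_mono)
    fix t
    show "ennreal (t ^ (N - 1)) * \<Phi> (u t) * indicator {0<..<r} t \<le> ennreal (r ^ (N - 1) * ?c) * indicator {0<..<r} t"
    proof (cases "0 < t \<and> t < r")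
      case True
      then have "\<Phi> (u t) \<le> ennreal ?c" using \<Phi>_mono[OF assms(2)] \<Phi>_ennreal[OF assms(3)] by simp
      moreover have "ennreal (t ^ (N - 1)) \<le> ennreal (r ^ (N - 1))" using True by (intro ennreal_leI power_mono) auto
      ultimately have "ennreal (t ^ (N - 1)) * \<Phi> (u t) \<le> ennreal (r ^ (N - 1)) * ennreal ?c" by (intro mult_mono) auto
      then show ?thesis using True c assms(1) by (simp add: ennreal_mult)
    qed auto
  qed
  also have "\<dots> = ennreal (r ^ (N - 1) * ?c) * ennreal r" using assms(1) by (simp add: nn_integral_cmult)
  also have "\<dots> = ennreal (r ^ (N - 1) * ?c * r)" using c assms(1) by (simp add: ennreal_mult)
  finally show ?thesis .
qed

lemma S_bound:
  assumes "0 < r" "\<And>t. 0 < t \<Longrightarrow> t < r \<Longrightarrow> u t \<le> ennreal M" "0 \<le> M"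
  shows "S u r \<le> ennreal ((1 + (p - 1) * M powr (p / (p - 1))) * r)"
proof -
  have "S u r \<le> ennreal (1 / r ^ (N - 1)) * ennreal (r ^ (N - 1) * (1 + (p - 1) * M powr (p / (p - 1))) * r)"
    unfolding S_def by (intro mult_left_mono Z_bound assms) auto
  also have "\<dots> = ennreal ((1 + (p - 1) * M powr (p / (p - 1))) * r)"
    using assms(1) by (subst ennreal_mult'[symmetric]) auto
  finally show ?thesis .
qed

lemma Z_nonpos: "r \<le> 0 \<Longrightarrow> Z u r = 0"
  by (simp add: Z_def)

text \<open>Since \<open>\<Phi> 1 = p\<close>, the function that is 1 below \<open>1 / p\<close> and
  infinite beyond is a supersolution: its image under \<open>S\<close> is at most
  \<open>p * r\<close>, hence at most 1, on that interval.\<close>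

lemma W_le_1: assumes "r < 1 / p" shows "W r \<le> 1"
proof -
  define u where "u t = (if t < 1 / p then 1 else top :: ennreal)" for t
  have "S u r \<le> u r" for r
  proof (cases "0 < r \<and> r < 1 / p")
    case True
    have "S u r \<le> ennreal ((1 + (p - 1) * 1 powr (p / (p - 1))) * r)"
      using True by (intro S_bound) (auto simp: u_def)
    also have "\<dots> \<le> ennreal 1" using True p by (intro ennreal_leI) (auto simp: field_simps)
    finally show ?thesis using True by (simp add: u_def)
  next
    case False
    then show ?thesis by (cases "r \<le> 0") (auto simp: S_def Z_nonpos u_def)
  qed
  from W_least[OF this, of r] show ?thesis using assms by (simp add: u_def)
qed

lemma W_finite_below:
  assumes "W r < top" "0 < s" "s \<le> r" shows "W s < top"
proof -
  have "Z W r < top" using Z_W[of r] assms by (simp add: ennreal_mult_less_top)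
  then have "Z W s < top" using Z_mono_r[OF assms(3), of W] by (rule le_less_trans[rotated])
  then show ?thesis by (subst W_eq) (simp add: ennreal_mult_less_top)
qed

text \<open>The prefactor \<open>1 / r ^ (N - 1)\<close> is useless near 0, where
  \<open>W_le_1\<close> takes over; beyond \<open>1 / p\<close> it is at most
  \<open>p ^ (N - 1)\<close> and monotonicity of \<open>Z\<close> gives the rest.\<close>

lemma W_bounded_below:
  assumes r: "W r < top" "0 < r"
  obtains M where "0 \<le> M" "\<And>t. 0 < t \<Longrightarrow> t \<le> r \<Longrightarrow> W t \<le> ennreal M"
proof -
  have Zr: "Z W r < top" using Z_W[of r] r by (simp add: ennreal_mult_less_top)
  define K where "K = enn2real (Z W r)"
  have K: "Z W r = ennreal K" "0 \<le> K" using Zr by (auto simp: K_def)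
  have "W t \<le> ennreal (max 1 (p ^ (N - 1) * K))" if t: "0 < t" "t \<le> r" for t
  proof (cases "t < 1 / p")
    case True
    have "W t \<le> 1" by (rule W_le_1[OF True])
    also have "1 \<le> ennreal (max 1 (p ^ (N - 1) * K))" by (subst ennreal_1[symmetric], rule ennreal_leI) simp
    finally show ?thesis .
  next
    case False
    then have "1 / t \<le> p" using t p by (simp add: field_simps)
    then have "(1 / t) ^ (N - 1) \<le> p ^ (N - 1)" using t by (intro power_mono) auto
    then have "W t \<le> ennreal (p ^ (N - 1)) * ennreal K"
      unfolding W_eq[of t] K(1)[symmetric] using Z_mono_r[OF t(2), of W]
      by (intro mult_mono ennreal_leI) (auto simp: power_one_over)
    also have "\<dots> = ennreal (p ^ (N - 1) * K)" using p by (subst ennreal_mult'[symmetric]) auto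
    also have "\<dots> \<le> ennreal (max 1 (p ^ (N - 1) * K))" by (rule ennreal_leI) simp
    finally show ?thesis .
  qed
  then show ?thesis using that[of "max 1 (p ^ (N - 1) * K)"] by auto
qed

text \<open>A continuation principle. Bounded up to \<open>R\<close>, the solution is finite at
  \<open>R\<close> with value \<open>M\<close>; prolonged by the constant \<open>M + 1\<close> over
  a length \<open>1 / c\<close>, and by infinity afterwards, it is a supersolution, because over
  that length the integral adds at most \<open>c * (r - R)\<close>, hence at most 1. Minimality of
  \<open>W\<close> does the rest.\<close>

lemma W_extends:
  assumes R: "0 < R" and b: "\<And>t. 0 < t \<Longrightarrow> t < R \<Longrightarrow> W t \<le> ennreal M0"
  obtains s where "R < s" "W s < top"
proof -
  have "W t \<le> ennreal (max 0 M0)" if "0 < t" "t < R" for t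
    using b[OF that] by (rule order_trans) (simp add: ennreal_leI)
  then have "W R \<le> ennreal ((1 + (p - 1) * max 0 M0 powr (p / (p - 1))) * R)"
    using S_bound[OF R, of W "max 0 M0"] unfolding S_def W_eq[symmetric] by simp
  then have "W R < top" by (meson ennreal_less_top le_less_trans)
  then obtain M where M: "W R = ennreal M" "0 \<le> M" by (cases "W R") auto
  define c where "c = 1 + (p - 1) * (M + 1) powr (p / (p - 1))"
  have c: "1 \<le> c" using p by (simp add: c_def)
  define u where "u t = (if t < R then W t else if t < R + 1 / c then ennreal (M + 1) else top)" for t
  have [measurable]: "u \<in> borel_measurable borel" unfolding u_def by measurable
  have "S u r \<le> u r" for r
  proof -
    consider "r < R" | "R \<le> r" "r < R + 1 / c" | "R + 1 / c \<le> r" by linarith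
    then show ?thesis
    proof cases
      case 1
      then have "Z u r = Z W r" unfolding Z_def by (intro nn_integral_cong) (auto simp: indicator_def u_def)
      then have "S u r = W r" unfolding S_def using W_eq[of r] by simp
      then show ?thesis using 1 by (simp add: u_def)
    next
      case 2
      then have r0: "0 < r" using R by simp
      have "Z u r \<le> (\<integral>\<^sup>+t. ennreal (t ^ (N - 1)) * \<Phi> (W t) * indicator {0<..<R} t
          + ennreal (r ^ (N - 1) * c) * indicator {R..<r} t \<partial>lborel)"
        unfolding Z_def
      proof (rule nn_integral_mono)
        fix t
        show "ennreal (t ^ (N - 1)) * \<Phi> (u t) * indicator {0<..<r} t
          \<le> ennreal (t ^ (N - 1)) * \<Phi> (W t) * indicator {0<..<R} t + ennreal (r ^ (N - 1) * c) * indicator {R..<r} t"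
        proof (cases "R \<le> t \<and> t < r")
          case True
          then have "u t = ennreal (M + 1)" using 2 by (simp add: u_def)
          then have "\<Phi> (u t) = ennreal c" using \<Phi>_ennreal[of "M + 1"] M by (simp only: c_def)
          moreover have "ennreal (t ^ (N - 1)) * ennreal c \<le> ennreal (r ^ (N - 1) * c)"
            using True R c by (subst ennreal_mult'[symmetric]) (auto intro!: ennreal_leI mult_right_mono power_mono)
          ultimately show ?thesis using True R by simp
        next
          case False
          then show ?thesis using 2 by (auto simp: indicator_def u_def)
        qed
      qed
      also have "\<dots> = Z W R + ennreal (r ^ (N - 1) * c) * ennreal (r - R)"
        using 2 by (subst nn_integral_add) (auto simp: Z_def nn_integral_cmult)
      also have "\<dots> = ennreal (R ^ (N - 1)) * ennreal M + ennreal (r ^ (N - 1) * c) * ennreal (r - R)"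
        using Z_W[OF R] M by simp
      also have "\<dots> = ennreal (R ^ (N - 1) * M + r ^ (N - 1) * c * (r - R))"
        using R M 2 c r0 by (simp add: ennreal_mult[symmetric] ennreal_plus[symmetric] del: ennreal_plus)
      also have "\<dots> \<le> ennreal (r ^ (N - 1) * (M + 1))"
      proof (rule ennreal_leI)
        have "R ^ (N - 1) * M \<le> r ^ (N - 1) * M" using R 2 M by (intro mult_right_mono power_mono) auto
        moreover have "r ^ (N - 1) * (c * (r - R)) \<le> r ^ (N - 1) * 1"
          using 2 c r0 by (intro mult_left_mono) (auto simp: field_simps)
        ultimately show "R ^ (N - 1) * M + r ^ (N - 1) * c * (r - R) \<le> r ^ (N - 1) * (M + 1)" by (simp add: algebra_simps)
      qed
      finally have "S u r \<le> ennreal (1 / r ^ (N - 1)) * ennreal (r ^ (N - 1) * (M + 1))"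
        unfolding S_def by (intro mult_left_mono) auto
      also have "\<dots> = ennreal (M + 1)" using r0 by (subst ennreal_mult'[symmetric]) auto
      finally show ?thesis using 2 by (simp add: u_def)
    next
      case 3
      have "0 < 1 / c" using c by simp
      then have "\<not> r < R" "\<not> r < R + 1 / c" using 3 by linarith+
      then show ?thesis by (simp add: u_def)
    qed
  qed
  from W_least[OF this, of "R + 1 / (2 * c)"] have "W (R + 1 / (2 * c)) \<le> u (R + 1 / (2 * c))" .
  also have "\<dots> = ennreal (M + 1)" using c by (simp add: u_def field_simps)
  finally have "W (R + 1 / (2 * c)) < top" using ennreal_less_top le_less_trans by blast
  moreover have "R < R + 1 / (2 * c)" using c by simp
  ultimately show ?thesis using that by blast
qed

definition w :: "real \<Rightarrow> real" where "w r = enn2real (W r)"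

definition k :: "real \<Rightarrow> real" where "k t = t ^ (N - 1) * (1 + (p - 1) * w t powr (p / (p - 1)))"

lemma w_measurable [measurable]: "w \<in> borel_measurable borel"
  unfolding w_def by measurable

lemma k_measurable [measurable]: "k \<in> borel_measurable borel"
  unfolding k_def by measurable

text \<open>Where \<open>W\<close> is finite, \<open>r ^ (N - 1) * w r\<close> is an integral of the
  locally bounded function \<open>k\<close>, hence locally Lipschitz. So \<open>w\<close> and
  \<open>k\<close> are continuous, and the fundamental theorem of calculus upgrades the integral
  equation to the differential one.\<close>

lemma riccati_w:
  assumes fin: "\<And>r. 0 < r \<Longrightarrow> r < R \<Longrightarrow> W r < top"
  shows "riccati p N 1 R w"
proof -
  have W_w: "W r = ennreal (w r)" if "0 < r" "r < R" for r using fin[OF that] by (simp add: w_def)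
  have w0: "0 \<le> w r" for r by (simp add: w_def)
  have k0: "0 \<le> k r" if "0 < r" for r using that p by (simp add: k_def)
  have bound: "\<exists>M\<ge>0. \<forall>t. 0 < t \<and> t \<le> r \<longrightarrow> w t \<le> M" if r: "0 < r" "r < R" for r
  proof -
    obtain M where M: "0 \<le> M" "\<And>t. 0 < t \<Longrightarrow> t \<le> r \<Longrightarrow> W t \<le> ennreal M"
      using W_bounded_below[OF fin[OF r] r(1)] by blast
    have "w t \<le> M" if t: "0 < t" "t \<le> r" for t
    proof -
      have "ennreal (w t) \<le> ennreal M" using M(2)[OF t] W_w[of t] t r by simp
      then show ?thesis using M(1) by (simp add: ennreal_le_iff)
    qed
    then show ?thesis using M(1) by blast
  qed
  have kb: "\<exists>C\<ge>0. \<forall>t. 0 < t \<and> t \<le> r \<longrightarrow> k t \<le> C" if r: "0 < r" "r < R" for r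
  proof -
    obtain M where M: "0 \<le> M" "\<And>t. 0 < t \<Longrightarrow> t \<le> r \<Longrightarrow> w t \<le> M" using bound[OF r] by blast
    have "k t \<le> r ^ (N - 1) * (1 + (p - 1) * M powr (p / (p - 1)))" if t: "0 < t" "t \<le> r" for t
      unfolding k_def using t M p w0 by (intro mult_mono power_mono add_left_mono mult_left_mono powr_mono2) auto
    then show ?thesis using r p M(1) by (intro exI[of _ "r ^ (N - 1) * (1 + (p - 1) * M powr (p / (p - 1)))"]) auto
  qed
  have ki: "set_integrable lborel {a..<b} k" if ab: "0 < a" "a \<le> b" "b < R" for a b
  proof -
    obtain C where C: "0 \<le> C" "\<And>t. 0 < t \<Longrightarrow> t \<le> b \<Longrightarrow> k t \<le> C" using kb[of b] ab by fastforce
    show ?thesis unfolding set_integrable_def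
    proof (rule Bochner_Integration.integrable_bound)
      show "integrable lborel (\<lambda>t. C * indicator {a..<b} t)" using ab by simp
      show "AE t in lborel. norm (indicat_real {a..<b} t *\<^sub>R k t) \<le> norm (C * indicat_real {a..<b} t)"
        using C ab k0 by (intro AE_I2) (auto simp: indicator_def)
    qed measurable
  qed
  have zdiff: "b ^ (N - 1) * w b = a ^ (N - 1) * w a + (LINT t:{a..<b}|lborel. k t)" if ab: "0 < a" "a \<le> b" "b < R" for a b
  proof -
    have [simp]: "0 < b" "a < R" using ab by auto
    have "Z W b = (\<integral>\<^sup>+t. ennreal (t ^ (N - 1)) * \<Phi> (W t) * indicator {0<..<a} t + ennreal (indicator {a..<b} t *\<^sub>R k t) \<partial>lborel)"
      unfolding Z_def
    proof (rule nn_integral_cong)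
      fix t
      show "ennreal (t ^ (N - 1)) * \<Phi> (W t) * indicator {0<..<b} t
        = ennreal (t ^ (N - 1)) * \<Phi> (W t) * indicator {0<..<a} t + ennreal (indicator {a..<b} t *\<^sub>R k t)"
      proof (cases "a \<le> t \<and> t < b")
        case True
        then show ?thesis using ab W_w[of t] \<Phi>_ennreal[OF w0, of t] p by (simp add: k_def ennreal_mult'')
      next
        case False
        then show ?thesis using ab by (auto simp: indicator_def)
      qed
    qed
    also have "\<dots> = Z W a + (\<integral>\<^sup>+t. ennreal (indicator {a..<b} t *\<^sub>R k t) \<partial>lborel)"
      by (subst nn_integral_add) (auto simp: Z_def)
    also have "(\<integral>\<^sup>+t. ennreal (indicator {a..<b} t *\<^sub>R k t) \<partial>lborel) = ennreal (LINT t:{a..<b}|lborel. k t)"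
      unfolding set_lebesgue_integral_def
      using ki[OF ab, unfolded set_integrable_def] k0 ab by (intro nn_integral_eq_integral) (auto simp: indicator_def)
    also have "Z W a = ennreal (a ^ (N - 1) * w a)" using ab by (simp add: Z_W W_w ennreal_mult'' w0)
    also have "Z W b = ennreal (b ^ (N - 1) * w b)" using ab by (simp add: Z_W W_w ennreal_mult'' w0)
    finally have "ennreal (b ^ (N - 1) * w b) = ennreal (a ^ (N - 1) * w a) + ennreal (LINT t:{a..<b}|lborel. k t)" .
    moreover have i0: "0 \<le> (LINT t:{a..<b}|lborel. k t)"
      unfolding set_lebesgue_integral_def using k0 ab by (intro integral_nonneg_AE AE_I2) (auto simp: indicator_def)
    ultimately have "ennreal (b ^ (N - 1) * w b) = ennreal (a ^ (N - 1) * w a + (LINT t:{a..<b}|lborel. k t))"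
      using ab w0 by (subst ennreal_plus) auto
    then show ?thesis using ab w0 i0 by (subst (asm) ennreal_inj) (auto intro!: add_nonneg_nonneg)
  qed
  have zcont: "continuous_on {a..b} (\<lambda>r. r ^ (N - 1) * w r)" if ab: "0 < a" "a \<le> b" "b < R" for a b
  proof -
    obtain C where C: "0 \<le> C" "\<And>t. 0 < t \<Longrightarrow> t \<le> b \<Longrightarrow> k t \<le> C" using kb[of b] ab by fastforce
    have lip: "\<bar>y ^ (N - 1) * w y - x ^ (N - 1) * w x\<bar> \<le> C * (y - x)" if "a \<le> x" "x \<le> y" "y \<le> b" for x y
    proof -
      have "y ^ (N - 1) * w y - x ^ (N - 1) * w x = (LINT t:{x..<y}|lborel. k t)"
        using zdiff[of x y] ab that by simp
      moreover have "0 \<le> (LINT t:{x..<y}|lborel. k t)"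
        unfolding set_lebesgue_integral_def using k0 ab that by (intro integral_nonneg_AE AE_I2) (auto simp: indicator_def)
      moreover have "(LINT t:{x..<y}|lborel. k t) \<le> (LINT t:{x..<y}|lborel. C)"
      proof (rule set_integral_mono)
        show "set_integrable lborel {x..<y} k" using ki[of x y] ab that by simp
        show "set_integrable lborel {x..<y} (\<lambda>_. C)" using that by (simp add: set_integrable_def)
        show "\<And>t. t \<in> {x..<y} \<Longrightarrow> k t \<le> C" using C ab that by auto
      qed
      moreover have "(LINT t:{x..<y}|lborel. C) = C * (y - x)" using that by (simp add: set_lebesgue_integral_def)
      ultimately show ?thesis by simp
    qed
    have "C-lipschitz_on {a..b} (\<lambda>r. r ^ (N - 1) * w r)"
    proof (rule lipschitz_onI[OF _ C(1)])
      fix x y assume "x \<in> {a..b}" "y \<in> {a..b}"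
      then show "dist (x ^ (N - 1) * w x) (y ^ (N - 1) * w y) \<le> C * dist x y"
        using lip[of x y] lip[of y x] by (cases "x \<le> y") (auto simp: dist_real_def abs_minus_commute)
    qed
    then show ?thesis by (rule lipschitz_on_continuous_on)
  qed
  have wcont: "continuous_on {a..b} w" if ab: "0 < a" "a \<le> b" "b < R" for a b
  proof -
    have "continuous_on {a..b} (\<lambda>r. (r ^ (N - 1) * w r) / r ^ (N - 1))"
      using ab by (intro continuous_intros zcont) auto
    then show ?thesis by (rule continuous_on_eq) (use ab in auto)
  qed
  have kcont: "continuous_on {a..b} k" if ab: "0 < a" "a \<le> b" "b < R" for a b
    unfolding k_def using w0 p by (intro continuous_intros wcont[OF ab] continuous_on_powr') (auto simp: less_imp_le)
  have zder: "((\<lambda>r. r ^ (N - 1) * w r) has_real_derivative k r) (at r)" if r: "0 < r" "r < R" for r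
  proof -
    define a where "a = r / 2"
    define b where "b = (r + R) / 2"
    have ab: "0 < a" "a < r" "r < b" "b < R" using r by (auto simp: a_def b_def)
    have "((\<lambda>x. integral {a..x} k) has_real_derivative k r) (at r within {a..b})"
      using ab by (intro integral_has_real_derivative kcont) auto
    then have "((\<lambda>x. a ^ (N - 1) * w a + integral {a..x} k) has_real_derivative k r) (at r within {a..b})"
      by (auto intro!: derivative_eq_intros)
    moreover have "a ^ (N - 1) * w a + integral {a..x} k = x ^ (N - 1) * w x" if x: "x \<in> {a..b}" for x
    proof -
      have "set_integrable lborel {a..x} k"
        unfolding set_integrable_def using x ab by (intro borel_integrable_compact kcont) auto
      then have "integral {a..x} k = (LINT t:{a..x}|lborel. k t)" by (rule set_borel_integral_eq_integral(2)[symmetric])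
      also have "\<dots> = (LINT t:{a..<x}|lborel. k t)"
        unfolding set_lebesgue_integral_def using AE_lborel_singleton[of x]
        by (intro integral_cong_AE) (auto simp: indicator_def elim: eventually_mono)
      finally show ?thesis using zdiff[of a x] x ab by simp
    qed
    ultimately have "((\<lambda>r. r ^ (N - 1) * w r) has_real_derivative k r) (at r within {a..b})"
      using ab by (elim has_field_derivative_transform_within[where d = 1]) auto
    then show ?thesis using ab at_within_Icc_at[of a r b] by simp
  qed
  have wder: "(w has_real_derivative 1 + (p - 1) * w r powr (p / (p - 1)) - (real N - 1) * w r / r) (at r)"
    if r: "0 < r" "r < R" for r
  proof -
    have "((\<lambda>r. (r ^ (N - 1) * w r) / r ^ (N - 1)) has_real_derivative
        (k r * r ^ (N - 1) - (r ^ (N - 1) * w r) * (real (N - 1) * r ^ (N - 1 - 1))) / (r ^ (N - 1) * r ^ (N - 1))) (at r)"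
      using DERIV_divide[OF zder[OF r] DERIV_pow[of "N - 1" r]] r by simp
    also have "(k r * r ^ (N - 1) - (r ^ (N - 1) * w r) * (real (N - 1) * r ^ (N - 1 - 1))) / (r ^ (N - 1) * r ^ (N - 1))
        = k r / r ^ (N - 1) - real (N - 1) * w r * (r ^ (N - 1 - 1) / r ^ (N - 1))"
      using r by (simp add: field_simps)
    also have "k r / r ^ (N - 1) = 1 + (p - 1) * w r powr (p / (p - 1))" using r by (simp add: k_def)
    also have "real (N - 1) * w r * (r ^ (N - 1 - 1) / r ^ (N - 1)) = (real N - 1) * w r / r"
    proof (cases "N = 1")
      case False
      then have "N - 1 = Suc (N - 1 - 1)" using N by simp
      then have "r ^ (N - 1) = r * r ^ (N - 1 - 1)" by (metis power_Suc)
      then show ?thesis using r N by (simp add: of_nat_diff)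
    qed simp
    finally have "((\<lambda>r. (r ^ (N - 1) * w r) / r ^ (N - 1)) has_real_derivative
       1 + (p - 1) * w r powr (p / (p - 1)) - (real N - 1) * w r / r) (at r)" .
    then show ?thesis
      by (rule has_field_derivative_transform_within_open[where S = "{0<..}"]) (use r in auto)
  qed
  \<comment> \<open>This bound plays the part of an initial condition at the singular point 0. It is
    \<open>S_bound\<close> applied to the fixed point itself.\<close>
  have lin: "\<exists>C\<ge>0. \<forall>r. 0 < r \<and> r \<le> \<rho> \<longrightarrow> w r \<le> C * r" if \<rho>: "\<rho> < R" for \<rho>
  proof (cases "0 < \<rho>")
    case True
    obtain M where M: "0 \<le> M" "\<And>t. 0 < t \<Longrightarrow> t \<le> \<rho> \<Longrightarrow> w t \<le> M" using bound[OF True \<rho>] by blast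
    define C where "C = 1 + (p - 1) * M powr (p / (p - 1))"
    have C0: "0 \<le> C" using p by (simp add: C_def)
    have "w r \<le> C * r" if r: "0 < r" "r \<le> \<rho>" for r
    proof -
      have "W t \<le> ennreal M" if "0 < t" "t < r" for t using M(2)[of t] W_w[of t] r \<rho> that by (simp add: ennreal_leI)
      then have "S W r \<le> ennreal (C * r)" unfolding C_def by (intro S_bound r M)
      moreover have "S W r = ennreal (w r)" unfolding S_def using W_eq[of r] W_w[of r] r \<rho> by simp
      ultimately have "ennreal (w r) \<le> ennreal (C * r)" by simp
      then show ?thesis using C0 r by (subst (asm) ennreal_le_iff) auto
    qed
    then show ?thesis using C0 by blast
  qed (auto intro!: exI[of _ 0])
  show ?thesis unfolding riccati_def using w0 wder lin w_measurable by blast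
qed

text \<open>If \<open>W\<close> becomes infinite, the supremum of its finiteness interval is a
  blow-up radius: a bound below it would let \<open>W_extends\<close> go further.\<close>

lemma riccati_maximal:
  "(\<forall>R>0. riccati p N 1 R w) \<or> (\<exists>R>0. riccati p N 1 R w \<and> \<not> (\<exists>M. \<forall>r. 0 < r \<and> r < R \<longrightarrow> w r \<le> M))"
proof (cases "\<forall>r>0. W r < top")
  case True
  then show ?thesis by (intro disjI1 allI impI riccati_w) auto
next
  case False
  then obtain b where b: "0 < b" "W b = top" using top.not_eq_extremum by blast
  define F where "F = {r. 0 < r \<and> W r < top}"
  have Fb: "r < b" if "r \<in> F" for r
    using that W_finite_below[of r b] b by (force simp: F_def not_less[symmetric])
  have "W (1 / (2 * p)) \<le> 1" using p by (intro W_le_1) (simp add: field_simps)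
  then have in_F: "1 / (2 * p) \<in> F" using p by (auto simp: F_def intro: le_less_trans)
  define R where "R = Sup F"
  have bdd: "bdd_above F" using Fb by (intro bdd_aboveI[of _ b]) (auto intro: less_imp_le)
  have "1 / (2 * p) \<le> R" unfolding R_def by (rule cSup_upper[OF in_F bdd])
  moreover have "0 < 1 / (2 * p)" using p by simp
  ultimately have R: "0 < R" by linarith
  have fin: "W r < top" if r: "0 < r" "r < R" for r
  proof -
    obtain s where "s \<in> F" "r < s" using less_cSupE[of r F] r in_F unfolding R_def by blast
    then show ?thesis using W_finite_below[of s r] r by (auto simp: F_def)
  qed
  have "riccati p N 1 R w" by (rule riccati_w[OF fin])
  moreover have "\<not> (\<exists>M. \<forall>r. 0 < r \<and> r < R \<longrightarrow> w r \<le> M)"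
  proof
    assume "\<exists>M. \<forall>r. 0 < r \<and> r < R \<longrightarrow> w r \<le> M"
    then obtain M where M: "\<And>r. 0 < r \<Longrightarrow> r < R \<Longrightarrow> w r \<le> M" by blast
    have "W t \<le> ennreal M" if "0 < t" "t < R" for t
      using M[OF that] fin[OF that] unfolding w_def by (metis ennreal_enn2real ennreal_leI)
    then obtain s where s: "R < s" "W s < top" using W_extends[OF R] by blast
    then have "s \<in> F" using R by (simp add: F_def)
    then have "s \<le> R" unfolding R_def by (rule cSup_upper[OF _ bdd])
    then show False using s by simp
  qed
  ultimately show ?thesis using R by blast
qed

end

lemma riccatiD:
  assumes "riccati p N l R w"
  shows "w \<in> borel_measurable borel" "0 < r \<Longrightarrow> r < R \<Longrightarrow> 0 \<le> w r"
    "0 < r \<Longrightarrow> r < R \<Longrightarrow>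
       (w has_real_derivative l + (p - 1) * w r powr (p / (p - 1)) - (real N - 1) * w r / r) (at r)"
    "\<rho> < R \<Longrightarrow> \<exists>C\<ge>0. \<forall>r. 0 < r \<and> r \<le> \<rho> \<longrightarrow> w r \<le> C * r"
  using assms by (simp_all add: riccati_def)

section \<open>Radial fields on star-shaped sets and cones\<close>

text \<open>\<open>k' x 1\<close> is the divergence of the field \<open>\<psi>(x) x\<close>.  Differentiating the integral of \<open>\<psi>\<close> over \<open>s S\<close> at \<open>s = 1\<close>
  replaces the divergence theorem, so that no regularity of the boundary is needed.\<close>

lemma star_divergence:
  fixes S :: "'a::euclidean_space set" and \<psi> :: "'a \<Rightarrow> real" and k' :: "'a \<Rightarrow> real \<Rightarrow> real"
  assumes S: "S \<in> sets borel" and B: "\<And>x. x \<in> S \<Longrightarrow> norm x \<le> B"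
    and star: "\<And>x s. x \<in> S \<Longrightarrow> 0 < s \<Longrightarrow> s \<le> 1 \<Longrightarrow> s *\<^sub>R x \<in> S"
    and \<psi>: "\<psi> \<in> borel_measurable borel" and sm: "1 < sm"
    and K: "\<And>x s. x \<in> S \<Longrightarrow> 1 \<le> s \<Longrightarrow> s \<le> sm \<Longrightarrow> \<bar>\<psi> (s *\<^sub>R x)\<bar> \<le> K"
    and nonneg: "\<And>x s. x \<in> S \<Longrightarrow> 1 \<le> s \<Longrightarrow> s \<le> sm \<Longrightarrow> 0 \<le> \<psi> (s *\<^sub>R x)"
    and der: "\<And>x s. x \<in> S \<Longrightarrow> x \<noteq> 0 \<Longrightarrow> 1 \<le> s \<Longrightarrow> s \<le> sm \<Longrightarrow>
        ((\<lambda>s. s ^ DIM('a) * \<psi> (s *\<^sub>R x)) has_real_derivative k' x s) (at s)"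
    and C: "\<And>x s. x \<in> S \<Longrightarrow> x \<noteq> 0 \<Longrightarrow> 1 \<le> s \<Longrightarrow> s \<le> sm \<Longrightarrow> \<bar>k' x s\<bar> \<le> C"
    and k'm: "(\<lambda>x. k' x 1) \<in> borel_measurable borel"
  shows "0 \<le> (LINT x|lborel. indicator S x * k' x 1)"
    and "(\<And>x s. x \<in> S \<Longrightarrow> 1 \<le> s \<Longrightarrow> s \<le> sm \<Longrightarrow> s *\<^sub>R x \<notin> S \<Longrightarrow> \<psi> (s *\<^sub>R x) = 0)
      \<Longrightarrow> (LINT x|lborel. indicator S x * k' x 1) = 0"
proof -
  note [measurable] = S \<psi> k'm
  define N where "N = DIM('a)"
  define s where "s n = 1 + (sm - 1) / real (n + 2)" for n
  have s1: "1 < s n" "s n \<le> sm" for n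
  proof -
    have "(sm - 1) / real (n + 2) \<le> (sm - 1) / 1" using sm by (intro divide_left_mono) auto
    then show "1 < s n" "s n \<le> sm" using sm by (auto simp: s_def)
  qed
  have sl: "s \<longlonglongrightarrow> 1"
  proof -
    have "(\<lambda>n. 1 / real (n + 2)) \<longlonglongrightarrow> 0" by (rule LIMSEQ_ignore_initial_segment[OF lim_1_over_n])
    then have "(\<lambda>n. 1 + (sm - 1) * (1 / real (n + 2))) \<longlonglongrightarrow> 1 + (sm - 1) * 0" by (intro tendsto_intros)
    then show ?thesis by (simp add: s_def[abs_def])
  qed
  have iS: "integrable lborel (\<lambda>x. c * indicator S x :: real)" for c
  proof (rule integrable_bounded_support[where B = B and C = "\<bar>c\<bar>"])
    fix x :: 'a
    show "norm (c * indicator S x) \<le> \<bar>c\<bar>" by (simp add: indicator_def)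
    show "c * indicator S x = 0" if "B < norm x" using B[of x] that by (cases "x \<in> S") auto
  qed measurable
  have i\<psi>: "integrable lborel (\<lambda>x. indicator S x * \<psi> (t *\<^sub>R x))" if t: "1 \<le> t" "t \<le> sm" for t
  proof (rule Bochner_Integration.integrable_bound[OF iS[of K]])
    show "AE x in lborel. norm (indicator S x * \<psi> (t *\<^sub>R x)) \<le> norm (K * indicator S x)"
    proof (rule AE_I2)
      fix x
      show "norm (indicator S x * \<psi> (t *\<^sub>R x)) \<le> norm (K * indicator S x)"
        using K[OF _ t, of x] by (cases "x \<in> S") auto
    qed
  qed measurable
  \<comment> \<open>By substitution, \<open>a t\<close> is the integral of \<open>\<psi>\<close>
    over the dilate of \<open>S\<close> by \<open>t\<close>. Its derivative at 1 is computed once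
    under the integral, giving \<open>k' x 1\<close>, and once geometrically.\<close>
  define a where "a t = (LINT x|lborel. indicator S x * (t ^ N * \<psi> (t *\<^sub>R x)))" for t
  have a_eq: "a t = (LINT y|lborel. indicator S ((1 / t) *\<^sub>R y) * \<psi> y)"
    and a_int: "integrable lborel (\<lambda>y. indicator S ((1 / t) *\<^sub>R y) * \<psi> y)" if t: "1 \<le> t" "t \<le> sm" for t
  proof -
    let ?f = "\<lambda>y. indicator S ((1 / t) *\<^sub>R y) * \<psi> y"
    have f: "?f (0 + t *\<^sub>R x) = indicator S x * \<psi> (t *\<^sub>R x)" for x using t by simp
    have "(LINT x|lborel. ?f (0 + t *\<^sub>R x)) = (1 / \<bar>t\<bar> ^ DIM('a)) *\<^sub>R (LINT y|lborel. ?f y)"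
      using t by (intro integral_lborel_affine) auto
    then have "(LINT x|lborel. indicator S x * \<psi> (t *\<^sub>R x)) = (1 / t ^ N) * (LINT y|lborel. ?f y)"
      unfolding f using t by (simp add: N_def)
    moreover have "a t = t ^ N * (LINT x|lborel. indicator S x * \<psi> (t *\<^sub>R x))"
      unfolding a_def by (simp flip: integral_mult_right_zero add: mult_ac)
    ultimately show "a t = (LINT y|lborel. ?f y)" using t by simp
    have "integrable lborel (\<lambda>x. ?f (0 + t *\<^sub>R x))" unfolding f by (rule i\<psi>[OF t])
    then show "integrable lborel ?f" using t by (subst (asm) integrable_lborel_affine) auto
  qed
  have lim: "(\<lambda>n. LINT x|lborel. indicator S x * ((s n ^ N * \<psi> (s n *\<^sub>R x) - \<psi> x) / (s n - 1)))
      \<longlonglongrightarrow> (LINT x|lborel. indicator S x * k' x 1)"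
  proof (rule integral_dominated_convergence[OF _ _ iS[of C]])
    have "AE x in lborel. x \<noteq> (0::'a)" by (rule AE_lborel_singleton)
    then show "AE x in lborel. (\<lambda>n. indicator S x * ((s n ^ N * \<psi> (s n *\<^sub>R x) - \<psi> x) / (s n - 1)))
        \<longlonglongrightarrow> indicator S x * k' x 1"
    proof eventually_elim
      case (elim x)
      show ?case
      proof (cases "x \<in> S")
        case True
        have "((\<lambda>s. s ^ N * \<psi> (s *\<^sub>R x)) has_real_derivative k' x 1) (at 1)"
          using der[OF True elim, of 1] sm by (simp add: N_def)
        then have "((\<lambda>t. (t ^ N * \<psi> (t *\<^sub>R x) - 1 ^ N * \<psi> (1 *\<^sub>R x)) / (t - 1)) \<longlongrightarrow> k' x 1) (at 1)"
          by (simp only: has_field_derivative_iff)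
        moreover have "filterlim s (at 1) sequentially"
          using sl s1(1) by (simp add: filterlim_at less_imp_neq[THEN not_sym])
        ultimately have "(\<lambda>n. (s n ^ N * \<psi> (s n *\<^sub>R x) - 1 ^ N * \<psi> (1 *\<^sub>R x)) / (s n - 1)) \<longlonglongrightarrow> k' x 1"
          by (rule filterlim_compose)
        then show ?thesis using True by simp
      qed simp
    qed
    fix n
    have "AE x in lborel. x \<noteq> (0::'a)" by (rule AE_lborel_singleton)
    then show "AE x in lborel. norm (indicator S x * ((s n ^ N * \<psi> (s n *\<^sub>R x) - \<psi> x) / (s n - 1))) \<le> C * indicator S x"
    proof eventually_elim
      case (elim x)
      show ?case
      proof (cases "x \<in> S")
        case True
        have "\<exists>z>1. z < s n \<and> s n ^ N * \<psi> (s n *\<^sub>R x) - 1 ^ N * \<psi> (1 *\<^sub>R x) = (s n - 1) * k' x z"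
        proof (rule MVT2[OF s1(1)])
          fix z assume "1 \<le> z" "z \<le> s n"
          then show "((\<lambda>s. s ^ N * \<psi> (s *\<^sub>R x)) has_real_derivative k' x z) (at z)"
            using der[OF True elim, of z] s1(2)[of n] unfolding N_def by linarith
        qed
        then obtain z where z: "1 < z" "z < s n" "s n ^ N * \<psi> (s n *\<^sub>R x) - \<psi> x = (s n - 1) * k' x z" by auto
        have "\<bar>k' x z\<bar> \<le> C" using z s1(2)[of n] by (intro C True elim) auto
        then show ?thesis using True z(3) s1(1)[of n] by simp
      qed simp
    qed
  qed measurable
  have q: "(LINT x|lborel. indicator S x * ((s n ^ N * \<psi> (s n *\<^sub>R x) - \<psi> x) / (s n - 1)))
      = (LINT y|lborel. (indicator S ((1 / s n) *\<^sub>R y) - indicator S y) * \<psi> y) / (s n - 1)" for n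
  proof -
    have s': "1 \<le> s n" "s n \<le> sm" using s1[of n] by auto
    have i1: "integrable lborel (\<lambda>x. indicator S x * (s n ^ N * \<psi> (s n *\<^sub>R x)))"
      using integrable_mult_right[OF i\<psi>[OF s'], of "s n ^ N"] by (simp add: mult_ac)
    have i2: "integrable lborel (\<lambda>x. indicator S x * \<psi> x)" using i\<psi>[of 1] sm by simp
    have "(LINT x|lborel. indicator S x * ((s n ^ N * \<psi> (s n *\<^sub>R x) - \<psi> x) / (s n - 1)))
      = (LINT x|lborel. (indicator S x * (s n ^ N * \<psi> (s n *\<^sub>R x)) - indicator S x * \<psi> x) / (s n - 1))"
      by (simp add: right_diff_distrib)
    also have "\<dots> = (a (s n) - (LINT x|lborel. indicator S x * \<psi> x)) / (s n - 1)"
      using i1 i2 by (simp add: a_def)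
    also have "a (s n) - (LINT x|lborel. indicator S x * \<psi> x) = (LINT y|lborel. (indicator S ((1 / s n) *\<^sub>R y) - indicator S y) * \<psi> y)"
      unfolding a_eq[OF s'] left_diff_distrib using a_int[OF s'] i2 by simp
    finally show ?thesis .
  qed
  \<comment> \<open>Star-shapedness puts \<open>S\<close> inside its dilate, so the difference of
    the indicators lives on the dilate minus \<open>S\<close>; the sign of \<open>\<psi>\<close>
    there is the sign of the boundary flux.\<close>
  have pt: "(indicator S ((1 / s n) *\<^sub>R y) - indicator S y) * \<psi> y
      = (if (1 / s n) *\<^sub>R y \<in> S \<and> y \<notin> S then \<psi> y else 0)" for n y
    using star[of y "1 / s n"] s1(1)[of n] by (auto simp: indicator_def)
  have bk: "y = s n *\<^sub>R ((1 / s n) *\<^sub>R y)" for n and y :: 'a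
  proof -
    have "s n * (1 / s n) = 1" using s1(1)[of n] by simp
    then show ?thesis unfolding scaleR_scaleR by simp
  qed
  show "0 \<le> (LINT x|lborel. indicator S x * k' x 1)"
  proof (rule LIMSEQ_le_const[OF lim], intro exI allI impI)
    fix n
    have "0 \<le> (indicator S ((1 / s n) *\<^sub>R y) - indicator S y) * \<psi> y" for y
      unfolding pt using nonneg[of "(1 / s n) *\<^sub>R y" "s n"] bk[of y n] s1[of n] by auto
    then show "0 \<le> (LINT x|lborel. indicator S x * ((s n ^ N * \<psi> (s n *\<^sub>R x) - \<psi> x) / (s n - 1)))"
      unfolding q using s1(1)[of n] by (intro divide_nonneg_pos integral_nonneg_AE AE_I2) auto
  qed
  assume z: "\<And>x s. x \<in> S \<Longrightarrow> 1 \<le> s \<Longrightarrow> s \<le> sm \<Longrightarrow> s *\<^sub>R x \<notin> S \<Longrightarrow> \<psi> (s *\<^sub>R x) = 0"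
  have z0: "(indicator S ((1 / s n) *\<^sub>R y) - indicator S y) * \<psi> y = 0" for n y
    unfolding pt using z[of "(1 / s n) *\<^sub>R y" "s n"] bk[of y n] s1[of n] by auto
  have "(\<lambda>n. 0) \<longlonglongrightarrow> (LINT x|lborel. indicator S x * k' x 1)"
    using lim unfolding q z0 by (simp only: Bochner_Integration.integral_zero div_0)
  then show "(LINT x|lborel. indicator S x * k' x 1) = 0" by (simp add: LIMSEQ_const_iff)
qed

text \<open>The field \<open>\<zeta> |v|^p w(|x|) x / |x|\<close> has total divergence 0 over the
  truncated cone, being tangent to the sides and zero beyond radius \<open>\<rho>\<close>. By
  Young's inequality its divergence is at least \<open>\<zeta> (l |v|^p - |gv|^p)\<close> minus the
  price \<open>|v|^p w |g\<zeta>|\<close> of the cut-off. No boundary condition for \<open>v\<close>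
  on the sides is involved, which is why it serves the Neumann problem.\<close>

lemma picone_cone:
  fixes v \<zeta> :: "'a::euclidean_space \<Rightarrow> real"
  assumes p: "1 < p" and ric: "riccati p DIM('a) l R w" and l: "0 \<le> l"
    and K: "K \<in> sets borel" and cone: "\<And>x s. x \<in> K \<Longrightarrow> 0 < s \<Longrightarrow> s *\<^sub>R x \<in> K"
    and v: "has_gradient v gv" "continuous_on UNIV gv" and \<zeta>: "has_gradient \<zeta> g\<zeta>" "continuous_on UNIV g\<zeta>"
    and \<zeta>0: "\<And>x. 0 \<le> \<zeta> x" and \<rho>: "0 < \<rho>" "\<rho> < R"
    and van: "\<And>x. x \<in> K \<Longrightarrow> \<rho> \<le> norm x \<Longrightarrow> \<zeta> x = 0 \<or> v x = 0"
  shows "(LINT x|lborel. indicator (K \<inter> ball 0 \<rho>) x * (\<zeta> x * (l * \<bar>v x\<bar> powr p - norm (gv x) powr p)))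
    \<le> (LINT x|lborel. indicator (K \<inter> ball 0 \<rho>) x * (\<bar>v x\<bar> powr p * w (norm x) * norm (g\<zeta> x)))"
proof -
  define q where "q = p / (p - 1)"
  define N where "N = DIM('a)"
  have N1: "1 \<le> N" unfolding N_def using DIM_positive[where 'a='a] by simp
  note [measurable] = K riccatiD(1)[OF ric]
  have vc: "continuous_on UNIV v" and \<zeta>c: "continuous_on UNIV \<zeta>" using has_gradient_continuous v \<zeta> by blast+
  note [measurable] = borel_measurable_continuous_onI[OF vc] borel_measurable_continuous_onI[OF \<zeta>c]
    borel_measurable_continuous_onI[OF v(2)] borel_measurable_continuous_onI[OF \<zeta>(2)]
  define S where "S = K \<inter> ball 0 \<rho>"
  have [measurable]: "S \<in> sets borel" by (simp add: S_def K)
  \<comment> \<open>Midway between 1 and \<open>R / \<rho>\<close>, so that dilates by factors up to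
    \<open>s0\<close> still avoid the blow-up radius of \<open>w\<close>.\<close>
  define s0 where "s0 = (1 + R / \<rho>) / 2"
  have s0: "1 < s0" using \<rho> by (simp add: s0_def field_simps)
  have s0\<rho>: "s0 * \<rho> < R" using \<rho> by (simp add: s0_def field_simps)
  define b where "b = s0 * \<rho>"
  have b0: "0 < b" "\<rho> \<le> b" "b < R" using \<rho> s0 s0\<rho> by (auto simp: b_def)
  have sb: "norm (s *\<^sub>R x) \<le> b" if "x \<in> S" "1 \<le> s" "s \<le> s0" for s x
  proof -
    have "s * norm x \<le> s0 * \<rho>" using that \<rho> s0 by (intro mult_mono) (auto simp: S_def)
    then show ?thesis using that by (simp add: b_def)
  qed
  obtain Cw where Cw: "0 \<le> Cw" "\<And>r. 0 < r \<Longrightarrow> r \<le> b \<Longrightarrow> w r \<le> Cw * r"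
    using riccatiD(4)[OF ric b0(3)] by blast
  have w0: "0 \<le> w r" if "0 < r" "r \<le> b" for r using riccatiD(2)[OF ric, of r] that b0 by simp
  define Wm where "Wm = Cw * b"
  have Wm0: "0 \<le> Wm" using Cw b0 by (simp add: Wm_def)
  have Wm: "w r \<le> Wm" if "0 < r" "r \<le> b" for r
    unfolding Wm_def using Cw(2)[OF that] mult_left_mono[OF that(2) Cw(1)] by linarith
  obtain X where X: "0 \<le> X" "\<And>x. norm x \<le> b \<Longrightarrow> norm (\<zeta> x) \<le> X" using bounded_on_cball[OF \<zeta>c] by blast
  obtain X' where X': "0 \<le> X'" "\<And>x. norm x \<le> b \<Longrightarrow> norm (g\<zeta> x) \<le> X'" using bounded_on_cball[OF \<zeta>(2)] by blast
  obtain V where V: "0 \<le> V" "\<And>x. norm x \<le> b \<Longrightarrow> norm (v x) \<le> V" using bounded_on_cball[OF vc] by blast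
  obtain V' where V': "0 \<le> V'" "\<And>x. norm x \<le> b \<Longrightarrow> norm (gv x) \<le> V'" using bounded_on_cball[OF v(2)] by blast
  have X2: "\<zeta> x \<le> X" if "norm x \<le> b" for x using X(2)[OF that] by simp
  have vp: "\<bar>v x\<bar> powr p \<le> V powr p" "\<bar>\<bar>v x\<bar> powr (p - 2) * v x\<bar> \<le> V powr (p - 1)" if "norm x \<le> b" for x
    unfolding abs_powr_mult_self(2) using V(2)[OF that] p by (auto intro!: powr_mono2)
  have wq: "w r powr q \<le> Wm powr q" if "0 < r" "r \<le> b" for r
    using Wm[OF that] w0[OF that] p by (intro powr_mono2) (auto simp: q_def)
  \<comment> \<open>The field is \<open>\<psi>(x) x\<close>; the linear bound on \<open>w\<close> at
    0 keeps the quotient \<open>w r / r\<close> bounded.\<close>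
  define \<psi> where "\<psi> x = \<zeta> x * \<bar>v x\<bar> powr p * (w (norm x) / norm x)" for x
  \<comment> \<open>The three parts of the divergence: the derivative falls on the cut-off, on
    \<open>|v|^p\<close>, or on \<open>w\<close> together with the volume factor. In the last one
    the Riccati equation cancels the singular term with \<open>w / r\<close>.\<close>
  define T1 where "T1 x y = (g\<zeta> y \<bullet> sgn x) * \<bar>v y\<bar> powr p * w (norm y)" for x y
  define T2 where "T2 x y = \<zeta> y * (p * (\<bar>v y\<bar> powr (p - 2) * v y) * (gv y \<bullet> sgn x) * w (norm y))" for x y
  define T3 where "T3 y = \<zeta> y * (\<bar>v y\<bar> powr p * (l + (p - 1) * w (norm y) powr q))" for y
  define k' where "k' x s = s ^ (N - 1) * (T1 x (s *\<^sub>R x) + T2 x (s *\<^sub>R x) + T3 (s *\<^sub>R x))" for x s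
  have Sball: "x \<in> S \<Longrightarrow> norm x \<le> \<rho>" for x by (simp add: S_def)
  have bT1: "\<bar>T1 x y\<bar> \<le> X' * V powr p * Wm" and bT2: "\<bar>T2 x y\<bar> \<le> X * (p * V powr (p - 1) * V' * Wm)"
    and bT3: "\<bar>T3 y\<bar> \<le> X * (V powr p * (l + (p - 1) * Wm powr q))" if y: "norm y \<le> b" "y \<noteq> 0" for x y
  proof -
    have ny: "0 < norm y" using y by simp
    have gx: "\<bar>g\<zeta> y \<bullet> sgn x\<bar> \<le> X'"
      using Cauchy_Schwarz_ineq2[of "g\<zeta> y" "sgn x"] X'(1) X'(2)[OF y(1)] mult_left_le[of "norm (sgn x)" "norm (g\<zeta> y)"]
      by (simp add: norm_sgn split: if_splits)
    have gvx: "\<bar>gv y \<bullet> sgn x\<bar> \<le> V'"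
      using Cauchy_Schwarz_ineq2[of "gv y" "sgn x"] V'(1) V'(2)[OF y(1)] mult_left_le[of "norm (sgn x)" "norm (gv y)"]
      by (simp add: norm_sgn split: if_splits)
    have wy: "\<bar>w (norm y)\<bar> \<le> Wm" using Wm[OF ny y(1)] w0[OF ny y(1)] by simp
    show "\<bar>T1 x y\<bar> \<le> X' * V powr p * Wm" unfolding T1_def abs_mult
      using gx wy vp(1)[OF y(1)] X' by (intro mult_mono) auto
    show "\<bar>T2 x y\<bar> \<le> X * (p * V powr (p - 1) * V' * Wm)" unfolding T2_def abs_mult[of "\<zeta> y"] abs_mult[of _ "w (norm y)"]
      abs_mult[of _ "gv y \<bullet> sgn x"] abs_mult[of p]
      using gvx wy vp(2)[OF y(1)] X2[OF y(1)] X V' p \<zeta>0[of y] by (intro mult_mono) auto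
    show "\<bar>T3 y\<bar> \<le> X * (V powr p * (l + (p - 1) * Wm powr q))" unfolding T3_def abs_mult
      using wq[OF ny y(1)] vp(1)[OF y(1)] X2[OF y(1)] X p l \<zeta>0[of y]
      by (intro mult_mono) (auto simp: abs_of_nonneg intro!: mult_left_mono)
  qed
  have i0: "(LINT x|lborel. indicator S x * k' x 1) = 0"
  proof (rule star_divergence(2)[where \<psi> = \<psi> and K = "X * V powr p * Cw" and sm = s0 and B = \<rho>
        and C = "s0 ^ (N - 1) * (X' * V powr p * Wm + X * (p * V powr (p - 1) * V' * Wm) + X * (V powr p * (l + (p - 1) * Wm powr q)))"])
    show "s *\<^sub>R x \<in> S" if "x \<in> S" "0 < s" "s \<le> 1" for x s
    proof -
      have "s * norm x \<le> 1 * norm x" using that by (intro mult_right_mono) auto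
      then show ?thesis using that cone by (auto simp: S_def)
    qed
    show "\<psi> \<in> borel_measurable borel" unfolding \<psi>_def by measurable
    show "(\<lambda>x. k' x 1) \<in> borel_measurable borel" unfolding k'_def T1_def T2_def T3_def by measurable
    fix x s assume x: "x \<in> S" and s: "1 \<le> s" "s \<le> s0"
    define y where "y = s *\<^sub>R x"
    have yb: "norm y \<le> b" unfolding y_def by (rule sb[OF x s])
    have quo: "0 \<le> w (norm y) / norm y" "w (norm y) / norm y \<le> Cw"
    proof -
      show "0 \<le> w (norm y) / norm y"
        using w0[of "norm y"] yb by (cases "y = 0") auto
      show "w (norm y) / norm y \<le> Cw"
        using Cw(1) Cw(2)[of "norm y"] yb by (cases "y = 0") (auto simp: pos_divide_le_eq)
    qed
    show "0 \<le> \<psi> (s *\<^sub>R x)" using quo(1) \<zeta>0 unfolding \<psi>_def y_def[symmetric] by (intro mult_nonneg_nonneg) auto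
    show "\<bar>\<psi> (s *\<^sub>R x)\<bar> \<le> X * V powr p * Cw"
    proof -
      have "\<zeta> y * \<bar>v y\<bar> powr p * (w (norm y) / norm y) \<le> X * V powr p * Cw"
        using quo \<zeta>0[of y] X X2[OF yb] vp(1)[OF yb] by (intro mult_mono) auto
      then show ?thesis using \<open>0 \<le> \<psi> (s *\<^sub>R x)\<close> unfolding \<psi>_def y_def[symmetric] by linarith
    qed
    show "\<psi> (s *\<^sub>R x) = 0" if "s *\<^sub>R x \<notin> S"
    proof -
      have "s *\<^sub>R x \<in> K" using x s cone by (auto simp: S_def)
      then show ?thesis using that van[of "s *\<^sub>R x"] p by (auto simp: S_def \<psi>_def)
    qed
    assume x0: "x \<noteq> 0"
    define r where "r = norm x"
    have r: "0 < r" "s * r \<le> b" "0 < s * r" "s * r < R" using x0 yb s b0 by (auto simp: r_def y_def)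
    have y0: "y \<noteq> 0" using x0 s by (simp add: y_def)
    have s0': "0 < s" using s by simp
    show "\<bar>k' x s\<bar> \<le> s0 ^ (N - 1) * (X' * V powr p * Wm + X * (p * V powr (p - 1) * V' * Wm) + X * (V powr p * (l + (p - 1) * Wm powr q)))"
      unfolding k'_def y_def[symmetric] abs_mult
    proof (rule mult_mono)
      show "\<bar>s ^ (N - 1)\<bar> \<le> s0 ^ (N - 1)" using s by (simp add: power_mono)
      show "\<bar>T1 x y + T2 x y + T3 y\<bar>
          \<le> X' * V powr p * Wm + X * (p * V powr (p - 1) * V' * Wm) + X * (V powr p * (l + (p - 1) * Wm powr q))"
        using bT1[OF yb y0, of x] bT2[OF yb y0, of x] bT3[OF yb y0] by linarith
    qed (use s0 in auto)
    define F where "F t = \<zeta> (0 + t *\<^sub>R x) * \<bar>v (0 + t *\<^sub>R x)\<bar> powr p * (t ^ (N - 1) * w (t * r) / r)" for t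
    have dv: "((\<lambda>t. \<bar>v (0 + t *\<^sub>R x)\<bar> powr p) has_real_derivative (p * (\<bar>v (0 + s *\<^sub>R x)\<bar> powr (p - 2) * v (0 + s *\<^sub>R x))) * (gv (0 + s *\<^sub>R x) \<bullet> x)) (at s)"
      by (rule DERIV_chain2[OF has_real_derivative_abs_powr[OF p] has_gradient_line[OF v(1)]])
    have dw: "((\<lambda>t. w (t * r)) has_real_derivative (l + (p - 1) * w (s * r) powr q - (real N - 1) * w (s * r) / (s * r)) * r) (at s)"
      unfolding q_def N_def by (rule DERIV_chain2[where g = "\<lambda>t. t * r" and x = s, OF riccatiD(3)[OF ric r(3,4)]])
        (auto intro!: derivative_eq_intros)
    have dn: "((\<lambda>t. t ^ (N - 1)) has_real_derivative real (N - 1) * s ^ (N - 1 - 1)) (at s)"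
      using DERIV_pow[of "N - 1" s] by simp
    have dF: "(F has_real_derivative k' x s) (at s)"
    proof -
      let ?y = "0 + s *\<^sub>R x"
      let ?w' = "l + (p - 1) * w (s * r) powr q - (real N - 1) * w (s * r) / (s * r)"
      have d: "(F has_real_derivative
         ((g\<zeta> ?y \<bullet> x) * \<bar>v ?y\<bar> powr p + ((p * (\<bar>v ?y\<bar> powr (p - 2) * v ?y)) * (gv ?y \<bullet> x)) * \<zeta> ?y) * (s ^ (N - 1) * w (s * r) / r)
         + ((real (N - 1) * s ^ (N - 1 - 1) * w (s * r) + ?w' * r * s ^ (N - 1)) / r) * (\<zeta> ?y * \<bar>v ?y\<bar> powr p)) (at s)"
        unfolding F_def by (intro DERIV_mult DERIV_cdivide dv dn dw has_gradient_line[OF \<zeta>(1)])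
      have e1: "(real (N - 1) * s ^ (N - 1 - 1) * w (s * r) + ?w' * r * s ^ (N - 1)) / r = s ^ (N - 1) * (l + (p - 1) * w (s * r) powr q)"
      proof (cases "N = 1")
        case True
        then show ?thesis using r by simp
      next
        case False
        then have "N - 1 = Suc (N - 1 - 1)" using N1 by simp
        then have pw: "s ^ (N - 1) = s * s ^ (N - 1 - 1)" by (metis power_Suc)
        have rN: "real (N - 1) = real N - 1" using N1 by (simp add: of_nat_diff)
        have alg: "(n * m * W + (L - n * W / (s * r)) * r * (s * m)) / r = (s * m) * L" for n m W L :: real
          using s0' r(1) by (simp add: field_simps)
        show ?thesis unfolding rN pw by (rule alg)
      qed
      have e2: "g\<zeta> ?y \<bullet> x = r * (g\<zeta> ?y \<bullet> sgn x)" "gv ?y \<bullet> x = r * (gv ?y \<bullet> sgn x)"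
        using r by (auto simp: sgn_div_norm r_def)
      have ny: "norm y = s * r" using s0' by (simp add: r_def y_def)

      have alg: "((r * g1) * a + ((p * b) * (r * g2)) * c) * (m * W / r) + (m * L) * (c * a)
          = m * (g1 * a * W + c * (p * b * g2 * W) + c * (a * L))" for g1 g2 a b c m W L
        using r(1) by (simp add: field_simps)
      show ?thesis
        using d unfolding e1 e2 alg unfolding k'_def T1_def T2_def T3_def y_def[symmetric] ny add_0 .
    qed
    have Feq: "s ^ DIM('a) * \<psi> (s *\<^sub>R x) = F s" if "s \<in> {0<..}" for s
    proof -
      have "s ^ DIM('a) = s * s ^ (N - 1)" using N1 unfolding N_def by (simp flip: power_Suc)
      moreover have "s * m * (c * a * (W / (s * r))) = c * a * (m * W / r)" for m c a W
        using that r(1) by simp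
      moreover have "norm (s *\<^sub>R x) = s * r" using that by (simp add: r_def)
      ultimately show ?thesis by (simp only: \<psi>_def F_def add_0)
    qed
    show "((\<lambda>s. s ^ DIM('a) * \<psi> (s *\<^sub>R x)) has_real_derivative k' x s) (at s)"
      by (rule has_field_derivative_transform_within_open[OF dF, of "{0<..}"]) (use Feq s0' in auto)
  qed (use s0 Sball in auto)
  have bdd: "integrable lborel (\<lambda>x. indicator S x * f x)" if "f \<in> borel_measurable borel" "\<And>x. norm x \<le> b \<Longrightarrow> x \<noteq> 0 \<Longrightarrow> \<bar>f x\<bar> \<le> C"
    for f :: "'a \<Rightarrow> real" and C
  proof -
    note [measurable] = that(1)
    show ?thesis
    proof (rule integrable_bounded_support[where B = \<rho> and C = "max \<bar>C\<bar> \<bar>f 0\<bar>"])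
      fix x
      show "norm (indicator S x * f x) \<le> max \<bar>C\<bar> \<bar>f 0\<bar>" if "norm x \<le> \<rho>"
        using that(1) that b0 \<open>\<And>x. norm x \<le> b \<Longrightarrow> x \<noteq> 0 \<Longrightarrow> \<bar>f x\<bar> \<le> C\<close>[of x]
        by (cases "x = 0") (auto simp: indicator_def)
      show "indicator S x * f x = 0" if "\<rho> < norm x" using that by (auto simp: S_def indicator_def)
    qed measurable
  qed
  have iL: "integrable lborel (\<lambda>x. indicator S x * (\<zeta> x * (l * \<bar>v x\<bar> powr p - norm (gv x) powr p)))"
  proof (rule bdd)
    fix x :: 'a assume x: "norm x \<le> b"
    have "\<bar>l * \<bar>v x\<bar> powr p - norm (gv x) powr p\<bar> \<le> l * V powr p + V' powr p"
    proof -
      have "0 \<le> l * \<bar>v x\<bar> powr p" "l * \<bar>v x\<bar> powr p \<le> l * V powr p" using l vp(1)[OF x] by (auto intro: mult_left_mono)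
      moreover have "0 \<le> norm (gv x) powr p" "norm (gv x) powr p \<le> V' powr p" using V'(2)[OF x] p by (auto intro: powr_mono2)
      ultimately show ?thesis by linarith
    qed
    then show "\<bar>\<zeta> x * (l * \<bar>v x\<bar> powr p - norm (gv x) powr p)\<bar> \<le> X * (l * V powr p + V' powr p)"
      unfolding abs_mult using X(2)[OF x] X(1) by (intro mult_mono) auto
  qed measurable
  have iR: "integrable lborel (\<lambda>x. indicator S x * (\<bar>v x\<bar> powr p * w (norm x) * norm (g\<zeta> x)))"
  proof (rule bdd)
    fix x :: 'a assume x: "norm x \<le> b" "x \<noteq> 0"
    have "\<bar>w (norm x)\<bar> \<le> Wm" using Wm[of "norm x"] w0[of "norm x"] x by simp
    then show "\<bar>\<bar>v x\<bar> powr p * w (norm x) * norm (g\<zeta> x)\<bar> \<le> V powr p * Wm * X'"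
      unfolding abs_mult using vp(1)[OF x(1)] X'(2)[OF x(1)] Wm0 by (intro mult_mono) auto
  qed measurable
  have iD: "integrable lborel (\<lambda>x. indicator S x * k' x 1)"
  proof (rule bdd)
    fix x :: 'a assume x: "norm x \<le> b" "x \<noteq> 0"
    show "\<bar>k' x 1\<bar> \<le> X' * V powr p * Wm + X * (p * V powr (p - 1) * V' * Wm) + X * (V powr p * (l + (p - 1) * Wm powr q))"
      using bT1[OF x, of x] bT2[OF x, of x] bT3[OF x] by (simp add: k'_def)
  next
    show "(\<lambda>x. k' x 1) \<in> borel_measurable borel" unfolding k'_def T1_def T2_def T3_def by measurable
  qed
  have "(LINT x|lborel. indicator S x * (\<zeta> x * (l * \<bar>v x\<bar> powr p - norm (gv x) powr p)))
      \<le> (LINT x|lborel. indicator S x * k' x 1 + indicator S x * (\<bar>v x\<bar> powr p * w (norm x) * norm (g\<zeta> x)))"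
  proof (rule integral_mono_AE)
    have "AE x in lborel. x \<noteq> (0::'a)" by (rule AE_lborel_singleton)
    then show "AE x in lborel. indicator S x * (\<zeta> x * (l * \<bar>v x\<bar> powr p - norm (gv x) powr p))
        \<le> indicator S x * k' x 1 + indicator S x * (\<bar>v x\<bar> powr p * w (norm x) * norm (g\<zeta> x))"
    proof eventually_elim
      case (elim x)
      show ?case
      proof (cases "x \<in> S")
        case True
        have nx: "0 < norm x" "norm x \<le> b" using elim True b0 by (auto simp: S_def)
        note w0x = w0[OF nx]
        let ?a = "\<bar>v x\<bar> powr p" and ?w = "w (norm x)"
        have t1: "- (?a * ?w * norm (g\<zeta> x)) \<le> T1 x x"
        proof -
          have "- norm (g\<zeta> x) \<le> g\<zeta> x \<bullet> sgn x"
            using Cauchy_Schwarz_ineq2[of "g\<zeta> x" "sgn x"] elim by (simp add: norm_sgn)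
          then have "(- norm (g\<zeta> x)) * (?a * ?w) \<le> (g\<zeta> x \<bullet> sgn x) * (?a * ?w)"
            using w0x by (intro mult_right_mono) auto
          then show ?thesis by (simp add: T1_def mult_ac)
        qed
        have t23: "\<zeta> x * (l * ?a - norm (gv x) powr p) \<le> T2 x x + T3 x"
        proof -
          \<comment> \<open>The slope that \<open>|v|\<close> would have if \<open>v\<close> were
            proportional to \<open>U\<close>, because \<open>- U' / U\<close> is this power of
            \<open>w\<close>. Taking Young's inequality at its equality case makes the estimate
            sharp.\<close>
          define m where "m = \<bar>v x\<bar> * ?w powr (1 / (p - 1))"
          have m0: "0 \<le> m" by (simp add: m_def)
          have mp: "m powr p = ?a * ?w powr q" by (simp add: m_def powr_mult powr_powr q_def)
          have mp1: "m powr (p - 1) = \<bar>v x\<bar> powr (p - 1) * ?w" using p w0x by (simp add: m_def powr_mult powr_powr)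
          have y: "p * norm (gv x) * (\<bar>v x\<bar> powr (p - 1) * ?w) \<le> norm (gv x) powr p + (p - 1) * (?a * ?w powr q)"
            using young_powr[OF p norm_ge_zero[of "gv x"] m0] unfolding mp mp1 .
          have "\<bar>(\<bar>v x\<bar> powr (p - 2) * v x) * (gv x \<bullet> sgn x)\<bar> \<le> \<bar>v x\<bar> powr (p - 1) * norm (gv x)"
            unfolding abs_mult[of _ "gv x \<bullet> sgn x"] abs_powr_mult_self(2)
            using Cauchy_Schwarz_ineq2[of "gv x" "sgn x"] elim by (intro mult_left_mono) (auto simp: norm_sgn)
          then have "- (\<bar>v x\<bar> powr (p - 1) * norm (gv x)) \<le> (\<bar>v x\<bar> powr (p - 2) * v x) * (gv x \<bullet> sgn x)" by linarith
          then have "(p * ?w) * - (\<bar>v x\<bar> powr (p - 1) * norm (gv x)) \<le> (p * ?w) * ((\<bar>v x\<bar> powr (p - 2) * v x) * (gv x \<bullet> sgn x))"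
            using p w0x by (intro mult_left_mono) auto
          with y have "l * ?a - norm (gv x) powr p \<le> p * (\<bar>v x\<bar> powr (p - 2) * v x) * (gv x \<bullet> sgn x) * ?w + ?a * (l + (p - 1) * ?w powr q)"
            by (simp add: algebra_simps)
          then have "\<zeta> x * (l * ?a - norm (gv x) powr p) \<le> \<zeta> x * (p * (\<bar>v x\<bar> powr (p - 2) * v x) * (gv x \<bullet> sgn x) * ?w + ?a * (l + (p - 1) * ?w powr q))"
            using \<zeta>0 by (rule mult_left_mono)
          then show ?thesis unfolding T2_def T3_def distrib_left[of "\<zeta> x"] .
        qed
        show ?thesis using True t1 t23 by (simp add: k'_def)
      qed simp
    qed
  qed (use iL iD iR in auto)
  also have "\<dots> = (LINT x|lborel. indicator S x * (\<bar>v x\<bar> powr p * w (norm x) * norm (g\<zeta> x)))"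
    using iD iR i0 by simp
  finally show ?thesis unfolding S_def .
qed

text \<open>Picone's inequality with the whole space as cone and the constant cut-off 1: the test
  function itself vanishes near the sphere, so some \<open>\<rho> < R\<close> contains its support
  and the blow-up of \<open>w\<close> at \<open>R\<close> is never met.\<close>

lemma dirichlet_ball_test:
  fixes \<phi> :: "'a::euclidean_space \<Rightarrow> real"
  assumes p: "1 < p" and ric: "riccati p DIM('a) l R w" and l: "0 \<le> l"
    and \<phi>: "\<phi> \<in> test_functions (ball c r)" and r: "r \<le> R"
  shows "l * (LINT x|lebesgue_on (ball c r). \<bar>\<phi> x\<bar> powr p) \<le> (LINT x|lebesgue_on (ball c r). norm (grad \<phi> x) powr p)"
proof (cases "0 < r")
  case r0: True
  note t = test_functionD[OF \<phi>]
  have \<phi>c: "continuous_on UNIV \<phi>" by (rule has_gradient_continuous[OF t(1)])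
  note [measurable] = borel_measurable_continuous_onI[OF \<phi>c] borel_measurable_continuous_onI[OF t(2)]
  have "\<exists>\<rho>. 0 < \<rho> \<and> \<rho> < R \<and> (\<forall>x. \<rho> \<le> dist c x \<longrightarrow> \<phi> x = 0)"
  proof (cases "{x. \<phi> x \<noteq> 0} = {}")
    case True
    then show ?thesis using r0 r by (intro exI[of _ "r / 2"]) auto
  next
    case False
    let ?K = "closure {x. \<phi> x \<noteq> 0}"
    have K: "compact ?K" "?K \<noteq> {}" "?K \<subseteq> ball c r" using \<phi> False unfolding test_functions_def by auto
    obtain y where y: "y \<in> ?K" "\<And>x. x \<in> ?K \<Longrightarrow> dist c x \<le> dist c y"
      using distance_attains_sup[OF K(1,2)] by blast
    have yr: "dist c y < r" using y(1) K(3) by auto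
    define \<rho> where "\<rho> = (dist c y + r) / 2"
    have "\<phi> x = 0" if "\<rho> \<le> dist c x" for x
    proof (rule ccontr)
      assume "\<phi> x \<noteq> 0"
      then have "x \<in> ?K" using closure_subset[of "{x. \<phi> x \<noteq> 0}"] by blast
      then show False using y(2)[of x] that yr by (simp add: \<rho>_def)
    qed
    moreover have "0 < \<rho>" "\<rho> < R" using yr r r0 by (auto simp: \<rho>_def intro: add_nonneg_pos)
    ultimately show ?thesis by blast
  qed
  then obtain \<rho> where \<rho>: "0 < \<rho>" "\<rho> < R" "\<And>x. \<rho> \<le> dist c x \<Longrightarrow> \<phi> x = 0" by blast
  define v where "v x = \<phi> (c + 1 *\<^sub>R x)" for x
  define gv where "gv x = 1 *\<^sub>R grad \<phi> (c + 1 *\<^sub>R x)" for x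
  have hv: "has_gradient v gv" unfolding v_def gv_def by (rule has_gradient_affine[OF t(1)])
  have gvc: "continuous_on UNIV gv" unfolding gv_def by (intro continuous_intros continuous_on_compose2[OF t(2)]) auto
  have v0: "v x = 0" if "\<rho> \<le> norm x" for x using \<rho>(3)[of "c + x"] that by (simp add: v_def dist_norm)
  have gv0: "gv x = 0" if "\<rho> < norm x" for x
    by (rule has_gradient_zero_outside[OF hv _ that]) (use v0 in auto)
  have one: "has_gradient (\<lambda>_. 1) (\<lambda>_::'a. 0)" by (simp add: has_gradient_def)
  have le: "(LINT x|lborel. indicator (UNIV \<inter> ball 0 \<rho>) x * (1 * (l * \<bar>v x\<bar> powr p - norm (gv x) powr p)))
    \<le> (LINT x|lborel. indicator (UNIV \<inter> ball 0 \<rho>) x * (\<bar>v x\<bar> powr p * w (norm x) * norm (0::'a)))"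
    by (rule picone_cone[OF p ric l _ _ hv gvc one _ _ \<rho>(1,2)]) (use v0 in auto)
  note [measurable] = borel_measurable_continuous_onI[OF has_gradient_continuous[OF hv]] borel_measurable_continuous_onI[OF gvc]
  obtain D where D: "0 \<le> D" "\<And>x. norm x \<le> \<rho> \<Longrightarrow> norm (v x) \<le> D" using bounded_on_cball[OF has_gradient_continuous[OF hv]] by blast
  obtain D' where D': "0 \<le> D'" "\<And>x. norm x \<le> \<rho> \<Longrightarrow> norm (gv x) \<le> D'" using bounded_on_cball[OF gvc] by blast
  have iv: "integrable lborel (\<lambda>x. \<bar>v x\<bar> powr p)"
    by (rule integrable_bounded_support[where B = \<rho> and C = "D powr p"]) (use D v0 p in \<open>auto intro: powr_mono2\<close>)
  have igv: "integrable lborel (\<lambda>x. norm (gv x) powr p)"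
    by (rule integrable_bounded_support[where B = \<rho> and C = "D' powr p"]) (use D' gv0 p in \<open>auto intro: powr_mono2\<close>)
  have [measurable]: "ball (0::'a) \<rho> \<in> sets borel" by simp
  have AE\<rho>: "AE x in lborel. norm (x::'a) \<noteq> \<rho>"
  proof -
    have "negligible (sphere (0::'a) \<rho>)" by (rule negligible_sphere)
    then have "AE x in lebesgue. x \<notin> sphere (0::'a) \<rho>" using negligible_iff_null_sets AE_not_in by blast
    then show ?thesis by (simp add: AE_completion_iff)
  qed
  have "(LINT x|lborel. l * \<bar>v x\<bar> powr p - norm (gv x) powr p)
      = (LINT x|lborel. indicator (UNIV \<inter> ball 0 \<rho>) x * (1 * (l * \<bar>v x\<bar> powr p - norm (gv x) powr p)))"
  proof (rule integral_cong_AE)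
    show "AE x in lborel. l * \<bar>v x\<bar> powr p - norm (gv x) powr p
        = indicator (UNIV \<inter> ball 0 \<rho>) x * (1 * (l * \<bar>v x\<bar> powr p - norm (gv x) powr p))"
      using AE\<rho>
    proof eventually_elim
      case (elim x)
      then show ?case using v0[of x] gv0[of x] p by (cases "norm x < \<rho>") auto
    qed
  qed measurable
  then have "l * (LINT x|lborel. \<bar>v x\<bar> powr p) - (LINT x|lborel. norm (gv x) powr p) \<le> 0"
    using le iv igv by simp
  moreover have "(LINT x|lborel. \<bar>v x\<bar> powr p) = (LINT x|lborel. \<bar>\<phi> x\<bar> powr p)"
    unfolding v_def by (subst integral_lborel_affine[of "\<lambda>x. \<bar>\<phi> x\<bar> powr p"]) auto
  moreover have "(LINT x|lborel. norm (gv x) powr p) = (LINT x|lborel. norm (grad \<phi> x) powr p)"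
    unfolding gv_def scaleR_one[of "grad _ _"] by (subst integral_lborel_affine[of "\<lambda>x. norm (grad \<phi> x) powr p"]) auto
  moreover have "(LINT x|lebesgue_on (ball c r). \<bar>\<phi> x\<bar> powr p) = (LINT x|lborel. \<bar>\<phi> x\<bar> powr p)"
  proof -
    have "(LINT x|lebesgue_on (ball c r). \<bar>\<phi> x\<bar> powr p) = (LINT x|lborel. indicator (ball c r) x *\<^sub>R (\<bar>\<phi> x\<bar> powr p))"
      by (rule integral_lebesgue_on_borel) auto
    also have "\<dots> = (LINT x|lborel. \<bar>\<phi> x\<bar> powr p)"
      using t(3) by (intro Bochner_Integration.integral_cong) (auto simp: indicator_def)
    finally show ?thesis .
  qed
  moreover have "(LINT x|lebesgue_on (ball c r). norm (grad \<phi> x) powr p) = (LINT x|lborel. norm (grad \<phi> x) powr p)"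
  proof -
    have "(LINT x|lebesgue_on (ball c r). norm (grad \<phi> x) powr p) = (LINT x|lborel. indicator (ball c r) x *\<^sub>R (norm (grad \<phi> x) powr p))"
      by (rule integral_lebesgue_on_borel) auto
    also have "\<dots> = (LINT x|lborel. norm (grad \<phi> x) powr p)"
      using t(4) by (intro Bochner_Integration.integral_cong) (auto simp: indicator_def)
    finally show ?thesis .
  qed
  ultimately show ?thesis by simp
next
  case False
  then have "ball c r = {}" by simp
  then show ?thesis by (simp only: integral_restrict_space sets.empty_sets Int_empty_left) simp
qed

section \<open>Radial profiles and the eigenvalue of a ball\<close>

text \<open>The eigenfunction \<open>U\<close> recovered from \<open>w\<close> and normalised by
  \<open>U 0 = 1\<close>. Three clauses serve later limits: the flux bound keeps \<open>U'\<close>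
  bounded where \<open>w\<close> blows up, the smallness clause stands for the decay of
  \<open>U\<close> at \<open>R\<close>, and the zero derivative at 0 makes \<open>U\<close> of a
  distance differentiable at its centre.\<close>

definition profile :: "real \<Rightarrow> real \<Rightarrow> real \<Rightarrow> (real \<Rightarrow> real) \<Rightarrow> (real \<Rightarrow> real) \<Rightarrow> bool" where
  "profile p l R w U \<longleftrightarrow> U \<in> borel_measurable borel \<and> U 0 = 1 \<and> (\<forall>r. 0 \<le> U r \<and> U r \<le> 1) \<and> (\<forall>r\<ge>R. U r = 0) \<and>
     (\<forall>r. 0 < r \<and> r < R \<longrightarrow> 0 < U r \<and> (U has_real_derivative - (w r powr (1 / (p - 1)) * U r)) (at r) \<and>
        w r * U r powr (p - 1) \<le> l * r) \<and>
     (\<forall>\<delta>>0. \<exists>r0. 0 < r0 \<and> r0 < R \<and> (\<forall>r\<ge>r0. U r < \<delta>)) \<and> (U has_real_derivative 0) (at 0)"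

lemma profileD:
  assumes "profile p l R w U"
  shows "U \<in> borel_measurable borel" "U 0 = 1" "0 \<le> U r" "U r \<le> 1" "R \<le> r \<Longrightarrow> U r = 0"
    "0 < r \<Longrightarrow> r < R \<Longrightarrow> 0 < U r" "0 < r \<Longrightarrow> r < R \<Longrightarrow> (U has_real_derivative - (w r powr (1 / (p - 1)) * U r)) (at r)"
    "0 < r \<Longrightarrow> r < R \<Longrightarrow> w r * U r powr (p - 1) \<le> l * r"
    "0 < \<delta> \<Longrightarrow> \<exists>r0. 0 < r0 \<and> r0 < R \<and> (\<forall>r\<ge>r0. U r < \<delta>)" "(U has_real_derivative 0) (at 0)"
  using assms unfolding profile_def by simp_all

lemma mult_powr_inverse_exponent:
  fixes x p :: real
  assumes "1 < p" "0 \<le> x"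
  shows "x * x powr (1 / (p - 1)) = x powr (p / (p - 1))"
proof (cases "x = 0")
  case False
  then have "x * x powr (1 / (p - 1)) = x powr 1 * x powr (1 / (p - 1))" using assms by simp
  also have "\<dots> = x powr (1 + 1 / (p - 1))" by (rule powr_add [symmetric])
  also have "1 + 1 / (p - 1) = p / (p - 1)" using assms by (simp add: field_simps)
  finally show ?thesis .
qed simp

text \<open>\<open>U\<close> is the exponential of minus the integral of
  \<open>w powr (1 / (p - 1))\<close>. That it tends to 0 at \<open>R\<close> is not visible from
  this formula; it is forced by the flux bound together with the unboundedness of
  \<open>w\<close>.\<close>

lemma profile_exists:
  assumes p: "1 < p" and N: "1 \<le> N" and ric: "riccati p N l R w" and R: "0 < R" and l: "0 < l"
    and unb: "\<not> (\<exists>M. \<forall>r. 0 < r \<and> r < R \<longrightarrow> w r \<le> M)"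
  shows "\<exists>U. profile p l R w U"
proof -
  define a where "a = 1 / (p - 1)"
  have a: "0 < a" using p by (simp add: a_def)
  define h where "h t = (if 0 < t then w t powr a else 0)" for t
  have wpos: "0 \<le> w r" if "0 < r" "r < R" for r by (rule riccatiD(2)[OF ric that])
  have h0: "0 \<le> h t" for t by (simp add: h_def)
  have hlin: "\<exists>C\<ge>0. \<forall>t. 0 \<le> t \<and> t \<le> \<rho> \<longrightarrow> h t \<le> (C * t) powr a" if \<rho>R: "\<rho> < R" for \<rho>
  proof -
    obtain C where C: "0 \<le> C" "\<And>r. 0 < r \<Longrightarrow> r \<le> \<rho> \<Longrightarrow> w r \<le> C * r" using riccatiD(4)[OF ric \<rho>R] by blast
    have "h t \<le> (C * t) powr a" if "0 \<le> t" "t \<le> \<rho>" for t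
      using C(2)[of t] wpos[of t] that \<open>\<rho> < R\<close> a by (auto simp: h_def intro!: powr_mono2)
    then show ?thesis using C(1) by blast
  qed
  have hc: "continuous_on {0..\<rho>} h" if \<rho>: "\<rho> < R" for \<rho>
    unfolding continuous_on_eq_continuous_within
  proof
    fix t assume t: "t \<in> {0..\<rho>}"
    show "continuous (at t within {0..\<rho>}) h"
    proof (cases "t = 0")
      case False
      then have t0: "0 < t" "t < R" using t \<rho> by auto
      have "isCont w t" using riccatiD(3)[OF ric t0] by (rule DERIV_isCont)
      moreover have ev: "\<forall>\<^sub>F s in nhds t. 0 \<le> w s"
        using eventually_nhds_in_open[of "{0<..<R}" t] t0 by (auto elim!: eventually_mono intro: wpos)
      ultimately have "isCont (\<lambda>s. w s powr a) t"
        using a unfolding isCont_def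
        by (intro tendsto_powr2) (auto simp: eventually_at_filter elim: eventually_mono)
      moreover have "\<forall>\<^sub>F s in nhds t. h s = w s powr a"
        using eventually_nhds_in_open[of "{0<..}" t] t0 by (auto elim!: eventually_mono simp: h_def)
      ultimately have "isCont h t" by (subst isCont_cong[of h "\<lambda>s. w s powr a"]) auto
      then show ?thesis by (rule continuous_at_imp_continuous_at_within)
    next
      case True
      obtain C where C: "0 \<le> C" "\<And>t. 0 \<le> t \<Longrightarrow> t \<le> \<rho> \<Longrightarrow> h t \<le> (C * t) powr a" using hlin[OF \<rho>] by blast
      have "((\<lambda>t. (C * t) powr a) \<longlongrightarrow> (C * 0) powr a) (at 0 within {0..\<rho>})"
        using a C(1) by (intro tendsto_powr2 tendsto_intros) (auto simp: eventually_at_filter)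
      then have "((\<lambda>t. (C * t) powr a) \<longlongrightarrow> 0) (at 0 within {0..\<rho>})" by simp
      then have "(h \<longlongrightarrow> 0) (at 0 within {0..\<rho>})"
      proof (rule Lim_null_comparison[rotated])
        show "\<forall>\<^sub>F t in at 0 within {0..\<rho>}. norm (h t) \<le> (C * t) powr a"
          using C(2) h0 by (auto simp: eventually_at_filter)
      qed
      moreover have "h 0 = 0" by (simp add: h_def)
      ultimately show ?thesis using True by (simp add: continuous_within)
    qed
  qed
  define I where "I r = integral {0..r} h" for r
  have Ider: "(I has_real_derivative h r) (at r)" if r: "0 < r" "r < R" for r
  proof -
    define b where "b = (r + R) / 2"
    have b: "r < b" "b < R" using r by (auto simp: b_def)
    have "(I has_real_derivative h r) (at r within {0..b})"
      unfolding I_def using r b by (intro integral_has_real_derivative hc) auto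
    then show ?thesis using r b at_within_Icc_at[of 0 r b] by simp
  qed
  have hi: "h integrable_on {0..r}" if "r < R" for r by (rule integrable_continuous_real[OF hc[OF that]])
  have I0: "0 \<le> I r" if "r < R" for r unfolding I_def using hi[OF that] h0 by (intro integral_nonneg) auto
  define U where "U r = (if r \<le> 0 then 1 else if r < R then exp (- I r) else 0)" for r
  have U01: "0 \<le> U r" "U r \<le> 1" for r using I0[of r] by (auto simp: U_def)
  have Upos: "0 < U r" if "0 < r" "r < R" for r using that by (simp add: U_def)
  have Uder: "(U has_real_derivative - (w r powr a * U r)) (at r)" if r: "0 < r" "r < R" for r
  proof -
    have "((\<lambda>r. exp (- I r)) has_real_derivative exp (- I r) * (- h r)) (at r)"
      by (rule DERIV_chain2[OF DERIV_exp DERIV_minus[OF Ider[OF r]]])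
    then have "(U has_real_derivative exp (- I r) * (- h r)) (at r)"
      by (rule has_field_derivative_transform_within_open[where S = "{0<..<R}"]) (use r in \<open>auto simp: U_def\<close>)
    then show ?thesis using r by (simp add: U_def h_def mult.commute)
  qed
  have Um: "U \<in> borel_measurable borel"
  proof -
    have "continuous_on {0<..<R} (\<lambda>r. exp (- I r))"
    proof (intro continuous_at_imp_continuous_on ballI)
      fix r assume "r \<in> {0<..<R}"
      then have "isCont I r" using Ider[of r] by (intro DERIV_isCont) auto
      then show "isCont (\<lambda>r. exp (- I r)) r" by (intro continuous_intros)
    qed
    then have "(\<lambda>r. indicator {0<..<R} r *\<^sub>R exp (- I r)) \<in> borel_measurable borel"
      by (intro borel_measurable_continuous_on_indicator) auto
    then have [measurable]: "(\<lambda>r. indicator {0<..<R} r * exp (- I r)) \<in> borel_measurable borel" by simp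
    have "U = (\<lambda>r. indicator {..0} r + indicator {0<..<R} r * exp (- I r))"
      by (auto simp: U_def indicator_def fun_eq_iff)
    also have "\<dots> \<in> borel_measurable borel" by measurable
    finally show ?thesis .
  qed
  \<comment> \<open>\<open>A\<close> is \<open>|U'| powr (p - 1)\<close>. In its derivative the
    superlinear terms cancel, leaving at most \<open>l\<close>; since \<open>A\<close> vanishes at 0
    by the linear bound on \<open>w\<close>, this gives \<open>A r \<le> l * r\<close>.\<close>
  define A where "A r = w r * U r powr (p - 1)" for r
  have Ader: "(A has_real_derivative U r powr (p - 1) * (l - (real N - 1) * w r / r)) (at r)" if r: "0 < r" "r < R" for r
  proof -
    have "((\<lambda>r. U r powr (p - 1)) has_real_derivative ((p - 1) * U r powr (p - 1 - 1)) * (- (w r powr a * U r))) (at r)"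
      by (rule DERIV_chain2[OF has_real_derivative_powr Uder[OF r]]) (rule Upos[OF r])
    moreover have "((p - 1) * U r powr (p - 1 - 1)) * (- (w r powr a * U r)) = - ((p - 1) * w r powr a * U r powr (p - 1))"
    proof -
      have pw: "U r powr (p - 1 - 1) * U r = U r powr (p - 1)"
        using Upos[OF r] powr_add[of "U r" "p - 1 - 1" 1] by simp
      show ?thesis unfolding pw[symmetric] by algebra
    qed
    ultimately have dU: "((\<lambda>r. U r powr (p - 1)) has_real_derivative - ((p - 1) * w r powr a * U r powr (p - 1))) (at r)"
      by (simp only:)
    have "(A has_real_derivative (l + (p - 1) * w r powr (p / (p - 1)) - (real N - 1) * w r / r) * U r powr (p - 1)
        + (- ((p - 1) * w r powr a * U r powr (p - 1))) * w r) (at r)"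
      unfolding A_def by (rule DERIV_mult[OF riccatiD(3)[OF ric r] dU])
    moreover have "w r powr (p / (p - 1)) = w r * w r powr a"
      using mult_powr_inverse_exponent[OF p wpos[OF r]] by (simp add: a_def)
    ultimately show ?thesis by (simp add: algebra_simps)
  qed
  have Abound: "A r \<le> l * r" if r: "0 < r" "r < R" for r
  proof -
    obtain C where C: "0 \<le> C" "\<And>t. 0 < t \<Longrightarrow> t \<le> r \<Longrightarrow> w t \<le> C * t" using riccatiD(4)[OF ric r(2)] by blast
    have key: "A r - l * r \<le> C * s" if s: "0 < s" "s < r" for s
    proof -
      have "(\<lambda>t. l * t - A t) s \<le> (\<lambda>t. l * t - A t) r"
      proof (rule DERIV_nonneg_imp_nondecreasing[OF less_imp_le[OF s(2)]])
        fix t assume t: "s \<le> t" "t \<le> r"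
        then have t': "0 < t" "t < R" using s r by auto
        have "U t powr (p - 1) * (l - (real N - 1) * w t / t) \<le> 1 * l"
        proof (rule order_trans[OF mult_left_mono])
          show "l - (real N - 1) * w t / t \<le> l" using N wpos[OF t'] t' by simp
          show "U t powr (p - 1) * l \<le> 1 * l"
            using U01[of t] p l powr_mono2[of "p - 1" "U t" 1] by (intro mult_right_mono) auto
        qed simp
        moreover have "((\<lambda>t. l * t - A t) has_real_derivative l - U t powr (p - 1) * (l - (real N - 1) * w t / t)) (at t)"
          by (auto intro!: derivative_eq_intros Ader[OF t'])
        ultimately show "\<exists>y. ((\<lambda>t. l * t - A t) has_real_derivative y) (at t) \<and> 0 \<le> y" by fastforce
      qed
      moreover have "A s \<le> C * s * 1"
        unfolding A_def using C(2)[of s] wpos[of s] s r U01[of s] p powr_mono2[of "p - 1" "U s" 1] C(1) by (intro mult_mono) auto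
      moreover have "0 \<le> l * s" using l s by simp
      ultimately show ?thesis by simp
    qed
    have "A r - l * r \<le> 0"
    proof (rule ccontr)
      assume "\<not> A r - l * r \<le> 0"
      then have d: "0 < A r - l * r" by simp
      define s where "s = min (r / 2) ((A r - l * r) / (2 * (C + 1)))"
      have s: "0 < s" "s < r" using d r C(1) by (auto simp: s_def)
      have "(C + 1) * s \<le> (C + 1) * ((A r - l * r) / (2 * (C + 1)))" using C(1) by (intro mult_left_mono) (auto simp: s_def)
      also have "\<dots> = (A r - l * r) / 2" using C(1) by (simp add: field_simps)
      finally have "C * s + s \<le> (A r - l * r) / 2" by (simp add: algebra_simps)
      then show False using key[OF s] d s by simp
    qed
    then show ?thesis by simp
  qed
  \<comment> \<open>If \<open>U\<close> stayed above \<open>\<delta>\<close>, the bound on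
    \<open>A\<close> would bound \<open>w\<close> by \<open>l * R / \<delta> powr (p - 1)\<close>,
    against the blow-up.\<close>
  have Uvan: "\<exists>r0. 0 < r0 \<and> r0 < R \<and> (\<forall>r\<ge>r0. U r < \<delta>)" if \<delta>: "0 < \<delta>" for \<delta>
  proof -
    have "\<exists>r0. 0 < r0 \<and> r0 < R \<and> U r0 < \<delta>"
    proof (rule ccontr)
      assume "\<not> ?thesis"
      then have ge: "\<delta> \<le> U r" if "0 < r" "r < R" for r using that by force
      have "w r \<le> l * R / \<delta> powr (p - 1)" if r: "0 < r" "r < R" for r
      proof -
        have "w r * \<delta> powr (p - 1) \<le> w r * U r powr (p - 1)"
          using ge[OF r] \<delta> p wpos[OF r] by (intro mult_left_mono powr_mono2) auto
        also have "\<dots> \<le> l * r" using Abound[OF r] by (simp add: A_def)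
        also have "\<dots> \<le> l * R" using l r by simp
        finally show ?thesis using \<delta> by (simp add: field_simps)
      qed
      then show False using unb by blast
    qed
    then obtain r0 where r0: "0 < r0" "r0 < R" "U r0 < \<delta>" by blast
    have "U r < \<delta>" if r: "r0 \<le> r" for r
    proof (cases "r < R")
      case True
      have "U r \<le> U r0"
      proof (rule DERIV_nonpos_imp_nonincreasing[OF r])
        fix t assume "r0 \<le> t" "t \<le> r"
        then have t: "0 < t" "t < R" using r0 True by auto
        show "\<exists>y. (U has_real_derivative y) (at t) \<and> y \<le> 0"
          using Uder[OF t] U01(1)[of t] by (intro exI[of _ "- (w t powr a * U t)"]) auto
      qed
      then show ?thesis using r0 by simp
    next
      case False
      then show ?thesis using r0 r \<delta> by (simp add: U_def)
    qed
    then show ?thesis using r0 by blast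
  qed
  have U00: "(U has_real_derivative 0) (at 0)"
  proof -
    have "((\<lambda>h. (U h - 1) / h) \<longlongrightarrow> 0) (at_left 0)"
      by (rule tendsto_eventually) (auto simp: U_def eventually_at_filter)
    moreover have "((\<lambda>h. (U h - 1) / h) \<longlongrightarrow> 0) (at_right 0)"
    proof -
      obtain C where C: "0 \<le> C" "\<And>t. 0 \<le> t \<Longrightarrow> t \<le> R / 2 \<Longrightarrow> h t \<le> (C * t) powr a" using hlin[of "R / 2"] R by auto
      have "((\<lambda>t. (C * t) powr a) \<longlongrightarrow> (C * 0) powr a) (at_right 0)"
        using a C(1) by (intro tendsto_powr2 tendsto_intros) (auto simp: eventually_at_filter)
      then have "((\<lambda>t. (C * t) powr a) \<longlongrightarrow> 0) (at_right 0)" by simp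
      then show ?thesis
      proof (rule Lim_null_comparison[rotated])
        have "norm ((U r - 1) / r) \<le> (C * r) powr a" if r: "0 < r" "r < R / 2" for r
        proof -
          have rR: "r < R" using r by simp
          have "I r \<le> integral {0..r} (\<lambda>_. (C * r) powr a)"
            unfolding I_def
          proof (rule integral_le[OF hi[OF rR] integrable_const_ivl])
            fix t assume t: "t \<in> {0..r}"
            then have "h t \<le> (C * t) powr a" using C(2)[of t] r by simp
            also have "\<dots> \<le> (C * r) powr a" using t C(1) a by (intro powr_mono2 mult_left_mono) auto
            finally show "h t \<le> (C * r) powr a" .
          qed
          then have "I r \<le> r * (C * r) powr a" using r by simp
          moreover have "1 - exp (- I r) \<le> I r" using exp_ge_add_one_self[of "- I r"] by simp
          moreover have "exp (- I r) \<le> 1" using I0[OF rR] by simp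
          ultimately have "\<bar>exp (- I r) - 1\<bar> \<le> r * (C * r) powr a" by linarith
          then show ?thesis using r by (simp add: U_def field_simps)
        qed
        then show "\<forall>\<^sub>F r in at_right 0. norm ((U r - 1) / r) \<le> (C * r) powr a"
          using R unfolding eventually_at_right_field by (intro exI[of _ "R / 2"]) auto
      qed
    qed
    ultimately have "((\<lambda>h. (U h - 1) / h) \<longlongrightarrow> 0) (at 0)" by (simp add: filterlim_split_at)
    moreover have "U 0 = 1" by (simp add: U_def)
    ultimately show ?thesis by (simp add: has_field_derivative_iff)
  qed
  have "profile p l R w U"
    unfolding profile_def a_def[symmetric]
  proof (intro conjI allI impI)
    show "U r = 0" if "R \<le> r" for r using that R by (simp add: U_def)
    show "w r * U r powr (p - 1) \<le> l * r" if "0 < r \<and> r < R" for r using Abound[of r] that by (simp add: A_def)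
  qed (use Um U01 Upos Uder Uvan U00 in \<open>auto simp: U_def[of 0]\<close>)
  then show ?thesis by blast
qed

text \<open>The left-hand sides are \<open>|U'|^p\<close> and \<open>|U'|\<close>; both are powers
  of \<open>w * U powr (p - 1)\<close>, which stays below \<open>l * R\<close> although
  \<open>w\<close> itself is unbounded.\<close>

lemma profile_flux_bound:
  assumes p: "1 < p" and ric: "riccati p N l R w" and pr: "profile p l R w U" and l: "0 \<le> l" and r: "0 < r" "r < R"
  shows "w r powr (p / (p - 1)) * U r powr p \<le> (l * R) powr (p / (p - 1))"
    and "w r powr (1 / (p - 1)) * U r \<le> (l * R) powr (1 / (p - 1))"
    and "w r powr (p / (p - 1)) * U r powr p = (w r powr (1 / (p - 1)) * U r) powr p"
proof -
  have w0: "0 \<le> w r" by (rule riccatiD(2)[OF ric r])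
  have A: "w r * U r powr (p - 1) \<le> l * R" using profileD(8)[OF pr r] mult_left_mono[OF less_imp_le[OF r(2)] l] by linarith
  have "w r powr (p / (p - 1)) * U r powr p = (w r * U r powr (p - 1)) powr (p / (p - 1))"
    using p w0 by (simp add: powr_mult powr_powr)
  also have "\<dots> \<le> (l * R) powr (p / (p - 1))" using A w0 p by (intro powr_mono2) auto
  finally show "w r powr (p / (p - 1)) * U r powr p \<le> (l * R) powr (p / (p - 1))" .
  have "w r powr (1 / (p - 1)) * U r = (w r * U r powr (p - 1)) powr (1 / (p - 1))"
    using p w0 profileD(6)[OF pr r] by (simp add: powr_mult powr_powr)
  also have "\<dots> \<le> (l * R) powr (1 / (p - 1))" using A w0 p by (intro powr_mono2) auto
  finally show "w r powr (1 / (p - 1)) * U r \<le> (l * R) powr (1 / (p - 1))" .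
  show "w r powr (p / (p - 1)) * U r powr p = (w r powr (1 / (p - 1)) * U r) powr p"
    using p w0 profileD(3)[OF pr] by (simp add: powr_mult powr_powr)
qed

text \<open>The field \<open>w(q) U(q)^p x / q\<close> has divergence \<open>l U^p - |U'|^p\<close>
  at \<open>q x\<close>, and it points outwards on a star-shaped set. Only the behaviour along rays
  matters, so any positive homogeneous \<open>q\<close> may replace the norm; this freedom is what
  the shrunken distance exploits.\<close>

lemma radial_star_truncated:
  fixes S :: "'a::euclidean_space set" and q :: "'a \<Rightarrow> real"
  assumes p: "1 < p" and ric: "riccati p DIM('a) l R w" and pr: "profile p l R w U" and l: "0 \<le> l"
    and S: "S \<in> sets borel" and B: "\<And>x. x \<in> S \<Longrightarrow> norm x \<le> B"
    and star: "\<And>x s. x \<in> S \<Longrightarrow> 0 < s \<Longrightarrow> s \<le> 1 \<Longrightarrow> s *\<^sub>R x \<in> S"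
    and q: "q \<in> borel_measurable borel" "\<And>s x. 0 < s \<Longrightarrow> q (s *\<^sub>R x) = s * q x" "\<And>x. x \<noteq> 0 \<Longrightarrow> 0 < q x" "q 0 = 0"
    and \<rho>: "0 < \<rho>" "\<rho> < R"
  shows "0 \<le> (LINT x|lborel. indicator (S \<inter> {x. q x < \<rho>}) x * (l * U (q x) powr p - w (q x) powr (p / (p - 1)) * U (q x) powr p))"
proof -
  define N where "N = DIM('a)"
  have N1: "1 \<le> N" unfolding N_def using DIM_positive[where 'a='a] by simp
  note [measurable] = S q(1) riccatiD(1)[OF ric] profileD(1)[OF pr]
  define s0 where "s0 = (1 + R / \<rho>) / 2"
  have s0: "1 < s0" using \<rho> by (simp add: s0_def field_simps)
  have s0\<rho>: "s0 * \<rho> < R" using \<rho> by (simp add: s0_def field_simps)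
  define S' where "S' = S \<inter> {x. q x < \<rho>}"
  have [measurable]: "S' \<in> sets borel" unfolding S'_def by measurable
  define c where "c r = l * U r powr p - w r powr (p / (p - 1)) * U r powr p" for r
  define k' where "k' x s = s ^ (N - 1) * c (s * q x)" for x s
  define \<psi> where "\<psi> x = w (q x) * U (q x) powr p / q x" for x
  obtain Cw where Cw: "0 \<le> Cw" "\<And>r. 0 < r \<Longrightarrow> r \<le> s0 * \<rho> \<Longrightarrow> w r \<le> Cw * r"
    using riccatiD(4)[OF ric s0\<rho>] by blast
  have Up: "0 \<le> U r powr p" "U r powr p \<le> 1" for r
    using profileD(3,4)[OF pr, of r] p powr_mono2[of p "U r" 1] by auto
  have sq: "0 < s * q x" "s * q x \<le> s0 * \<rho>" "s * q x < R" if "x \<in> S'" "x \<noteq> 0" "1 \<le> s" "s \<le> s0" for x s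
  proof -
    show "0 < s * q x" using q(3)[OF that(2)] that by simp
    show "s * q x \<le> s0 * \<rho>" using that q(3)[OF that(2)] s0 by (intro mult_mono) (auto simp: S'_def)
    then show "s * q x < R" using s0\<rho> by simp
  qed
  have "0 \<le> (LINT x|lborel. indicator S' x * k' x 1)"
  proof (rule star_divergence(1)[where \<psi> = \<psi> and K = Cw and sm = s0 and B = B and C = "s0 ^ (N - 1) * (l + (l * R) powr (p / (p - 1)))"])
    show "s *\<^sub>R x \<in> S'" if "x \<in> S'" "0 < s" "s \<le> 1" for x s
    proof (cases "x = 0")
      case False
      have "s * q x \<le> 1 * q x" using that q(3)[OF False] by (intro mult_right_mono) auto
      then show ?thesis using that star q(2) by (auto simp: S'_def)
    qed (use that in simp)
    show "\<psi> \<in> borel_measurable borel" unfolding \<psi>_def by measurable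
    show "(\<lambda>x. k' x 1) \<in> borel_measurable borel" unfolding k'_def c_def by measurable
    fix x s assume x: "x \<in> S'" and s: "1 \<le> s" "s \<le> s0"
    have bd: "0 \<le> \<psi> (s *\<^sub>R x) \<and> \<psi> (s *\<^sub>R x) \<le> Cw"
    proof (cases "x = 0")
      case True
      then show ?thesis using Cw(1) by (simp add: \<psi>_def q(4))
    next
      case False
      note r = sq[OF x False s]
      have w0: "0 \<le> w (s * q x)" by (rule riccatiD(2)[OF ric r(1,3)])
      have "w (s * q x) * U (s * q x) powr p \<le> (Cw * (s * q x)) * 1"
        using w0 Cw(1) Cw(2)[OF r(1,2)] Up r by (intro mult_mono) auto
      then show ?thesis using w0 Up r(1) s q(2)[of s x] by (simp add: \<psi>_def pos_divide_le_eq)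
    qed
    then show "\<bar>\<psi> (s *\<^sub>R x)\<bar> \<le> Cw" "0 \<le> \<psi> (s *\<^sub>R x)" by auto
    assume x0: "x \<noteq> 0"
    note r = sq[OF x x0 s]
    show "\<bar>k' x s\<bar> \<le> s0 ^ (N - 1) * (l + (l * R) powr (p / (p - 1)))"
      unfolding k'_def abs_mult
    proof (rule mult_mono)
      show "\<bar>s ^ (N - 1)\<bar> \<le> s0 ^ (N - 1)" using s by (simp add: power_mono)
      have "0 \<le> l * U (s * q x) powr p" using l by simp
      moreover have "l * U (s * q x) powr p \<le> l * 1" using l Up by (intro mult_left_mono)
      moreover have "0 \<le> w (s * q x) powr (p / (p - 1)) * U (s * q x) powr p" by simp
      moreover have "w (s * q x) powr (p / (p - 1)) * U (s * q x) powr p \<le> (l * R) powr (p / (p - 1))"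
        by (rule profile_flux_bound(1)[OF p ric pr l r(1,3)])
      ultimately show "\<bar>c (s * q x)\<bar> \<le> l + (l * R) powr (p / (p - 1))" unfolding c_def by linarith
    qed (use s0 in auto)
    have s0': "0 < s" using s by simp
    define Q where "Q = q x"
    have Q: "0 < Q" using q(3)[OF x0] by (simp add: Q_def)
    have rQ: "0 < s * Q" "s * Q < R" using r by (auto simp: Q_def)
    have w0: "0 \<le> w (s * Q)" by (rule riccatiD(2)[OF ric rQ])
    define F where "F t = (t ^ (N - 1) * w (t * Q)) * U (t * Q) powr p / Q" for t
    have dn: "((\<lambda>t. t ^ (N - 1)) has_real_derivative real (N - 1) * s ^ (N - 1 - 1)) (at s)"
      using DERIV_pow[of "N - 1" s] by simp
    have dm: "((\<lambda>t. t * Q) has_real_derivative Q) (at s)" by (auto intro!: derivative_eq_intros)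
    let ?w' = "l + (p - 1) * w (s * Q) powr (p / (p - 1)) - (real N - 1) * w (s * Q) / (s * Q)"
    have dw: "((\<lambda>t. w (t * Q)) has_real_derivative ?w' * Q) (at s)"
      unfolding N_def by (rule DERIV_chain2[where g = "\<lambda>t. t * Q" and x = s, OF riccatiD(3)[OF ric rQ] dm])
    have dU: "((\<lambda>t. U (t * Q)) has_real_derivative - (w (s * Q) powr (1 / (p - 1)) * U (s * Q)) * Q) (at s)"
      by (rule DERIV_chain2[where g = "\<lambda>t. t * Q" and x = s, OF profileD(7)[OF pr rQ] dm])
    have dUp: "((\<lambda>t. U (t * Q) powr p) has_real_derivative (p * U (s * Q) powr (p - 1)) * (- (w (s * Q) powr (1 / (p - 1)) * U (s * Q)) * Q)) (at s)"
      by (rule DERIV_chain2[where g = "\<lambda>t. U (t * Q)" and x = s, OF has_real_derivative_powr dU]) (rule profileD(6)[OF pr rQ])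
    have UU: "(p * U (s * Q) powr (p - 1)) * (- (w (s * Q) powr (1 / (p - 1)) * U (s * Q)) * Q)
        = - p * w (s * Q) powr (1 / (p - 1)) * U (s * Q) powr p * Q"
      using profileD(6)[OF pr rQ] powr_add[of "U (s * Q)" "p - 1" 1] by simp
    have dF: "(F has_real_derivative ((real (N - 1) * s ^ (N - 1 - 1) * w (s * Q) + ?w' * Q * s ^ (N - 1)) * U (s * Q) powr p
        + (- p * w (s * Q) powr (1 / (p - 1)) * U (s * Q) powr p * Q) * (s ^ (N - 1) * w (s * Q))) / Q) (at s)"
      unfolding F_def by (intro DERIV_cdivide DERIV_mult dn dw dUp[unfolded UU])
    have e1: "real (N - 1) * s ^ (N - 1 - 1) * w (s * Q) + ?w' * Q * s ^ (N - 1) = s ^ (N - 1) * (l + (p - 1) * w (s * Q) powr (p / (p - 1))) * Q"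
    proof (cases "N = 1")
      case True
      then show ?thesis using Q by simp
    next
      case False
      then have "N - 1 = Suc (N - 1 - 1)" using N1 by simp
      then have pw: "s ^ (N - 1) = s * s ^ (N - 1 - 1)" by (metis power_Suc)
      have rN: "real (N - 1) = real N - 1" using N1 by (simp add: of_nat_diff)
      have alg: "n * m * W + (L - n * W / (s * Q)) * Q * (s * m) = (s * m) * L * Q" for n m W L :: real
        using s0' Q by (simp add: field_simps)
      show ?thesis unfolding rN pw by (rule alg)
    qed
    have alg: "((m * L * Q) * u + (- p * b * u * Q) * (m * W)) / Q = m * (L * u - p * (W * b) * u)" for m L u b W
      using Q by (simp add: field_simps)
    have Wb: "w (s * Q) * w (s * Q) powr (1 / (p - 1)) = w (s * Q) powr (p / (p - 1))"
      by (rule mult_powr_inverse_exponent[OF p w0])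
    have "(F has_real_derivative k' x s) (at s)"
    proof -
      have "s ^ (N - 1) * ((l + (p - 1) * w (s * Q) powr (p / (p - 1))) * U (s * Q) powr p - p * w (s * Q) powr (p / (p - 1)) * U (s * Q) powr p) = k' x s"
        unfolding k'_def c_def Q_def by (simp add: algebra_simps)
      then show ?thesis using dF unfolding e1 alg Wb by simp
    qed
    moreover have "s ^ DIM('a) * \<psi> (s *\<^sub>R x) = F s" if "s \<in> {0<..}" for s
    proof -
      have "s ^ DIM('a) = s * s ^ (N - 1)" using N1 unfolding N_def by (simp flip: power_Suc)
      moreover have "s * m * (W * u / (s * Q)) = (m * W) * u / Q" for m W u using that Q by simp
      ultimately show ?thesis using that by (simp only: \<psi>_def F_def q(2) greaterThan_iff Q_def)
    qed
    ultimately show "((\<lambda>s. s ^ DIM('a) * \<psi> (s *\<^sub>R x)) has_real_derivative k' x s) (at s)"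
      by (elim has_field_derivative_transform_within_open[of _ _ _ "{0<..}"]) (use s0' in auto)
  qed (use s0 B in \<open>auto simp: S'_def\<close>)
  then show ?thesis by (simp add: k'_def c_def S'_def)
qed

text \<open>Truncation at \<open>\<rho>\<close> was needed because \<open>w\<close> is unbounded
  near \<open>R\<close>; the products with \<open>U^p\<close> are bounded, so dominated convergence
  removes it.\<close>

lemma radial_star:
  fixes S :: "'a::euclidean_space set" and q :: "'a \<Rightarrow> real"
  assumes p: "1 < p" and ric: "riccati p DIM('a) l R w" and pr: "profile p l R w U" and l: "0 \<le> l" and R: "0 < R"
    and S: "S \<in> sets borel" and B: "\<And>x. x \<in> S \<Longrightarrow> norm x \<le> B"
    and star: "\<And>x s. x \<in> S \<Longrightarrow> 0 < s \<Longrightarrow> s \<le> 1 \<Longrightarrow> s *\<^sub>R x \<in> S"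
    and q: "q \<in> borel_measurable borel" "\<And>s x. 0 < s \<Longrightarrow> q (s *\<^sub>R x) = s * q x" "\<And>x. x \<noteq> 0 \<Longrightarrow> 0 < q x" "q 0 = 0"
  shows "0 \<le> (LINT x|lborel. indicator (S \<inter> {x. q x < R}) x * (l * U (q x) powr p - w (q x) powr (p / (p - 1)) * U (q x) powr p))"
proof -
  note [measurable] = S q(1) riccatiD(1)[OF ric] profileD(1)[OF pr]
  define c where "c r = l * U r powr p - w r powr (p / (p - 1)) * U r powr p" for r
  have [measurable]: "c \<in> borel_measurable borel" unfolding c_def by measurable
  define \<rho> where "\<rho> n = R * (1 - 1 / real (n + 2))" for n
  have \<rho>: "0 < \<rho> n" "\<rho> n < R" for n
  proof -
    have "0 < 1 - 1 / real (n + 2)" "1 - 1 / real (n + 2) < 1" by (auto simp: field_simps)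
    then show "0 < \<rho> n" "\<rho> n < R" using R mult_strict_left_mono[of "1 - 1 / real (n + 2)" 1 R] by (auto simp: \<rho>_def)
  qed
  have "(\<lambda>n. 1 / real (n + 2)) \<longlonglongrightarrow> 0" by (rule LIMSEQ_ignore_initial_segment[OF lim_1_over_n])
  then have "(\<lambda>n. R * (1 - 1 / real (n + 2))) \<longlonglongrightarrow> R * (1 - 0)" by (intro tendsto_intros)
  then have \<rho>l: "\<rho> \<longlonglongrightarrow> R" by (simp add: \<rho>_def[abs_def])
  have cb: "\<bar>c r\<bar> \<le> l + (l * R) powr (p / (p - 1))" if r: "0 < r" "r < R" for r
  proof -
    have "U r powr p \<le> 1" using profileD(3,4)[OF pr, of r] p powr_mono2[of p "U r" 1] by auto
    then have "l * U r powr p \<le> l * 1" using l by (intro mult_left_mono)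
    moreover have "0 \<le> l * U r powr p" using l by simp
    moreover have "0 \<le> w r powr (p / (p - 1)) * U r powr p" by simp
    moreover have "w r powr (p / (p - 1)) * U r powr p \<le> (l * R) powr (p / (p - 1))"
      by (rule profile_flux_bound(1)[OF p ric pr l r])
    ultimately show ?thesis unfolding c_def by linarith
  qed
  have "(\<lambda>n. LINT x|lborel. indicator (S \<inter> {x. q x < \<rho> n}) x * c (q x)) \<longlonglongrightarrow> (LINT x|lborel. indicator (S \<inter> {x. q x < R}) x * c (q x))"
  proof (rule integral_dominated_convergence)
    show "integrable lborel (\<lambda>x. (l + (l * R) powr (p / (p - 1))) * indicator (cball (0::'a) B) x)"
      using emeasure_lborel_cball_finite[of "0::'a" B]
      by (intro integrable_mult_right integrable_real_indicator) (auto simp: less_top[symmetric])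
    show "AE x in lborel. (\<lambda>n. indicator (S \<inter> {x. q x < \<rho> n}) x * c (q x)) \<longlonglongrightarrow> indicator (S \<inter> {x. q x < R}) x * c (q x)"
    proof (rule AE_I2)
      fix x
      have "\<forall>\<^sub>F n in sequentially. indicator (S \<inter> {x. q x < \<rho> n}) x * c (q x) = indicator (S \<inter> {x. q x < R}) x * c (q x)"
      proof (cases "q x < R")
        case True
        then have "\<forall>\<^sub>F n in sequentially. q x < \<rho> n" by (rule order_tendstoD(1)[OF \<rho>l])
        then show ?thesis by eventually_elim (use True in \<open>simp add: indicator_def\<close>)
      next
        case False
        then have "\<not> q x < \<rho> n" for n using \<rho>(2)[of n] by simp
        then show ?thesis using False by (simp add: indicator_def)
      qed
      then show "(\<lambda>n. indicator (S \<inter> {x. q x < \<rho> n}) x * c (q x)) \<longlonglongrightarrow> indicator (S \<inter> {x. q x < R}) x * c (q x)"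
        by (rule tendsto_eventually)
    qed
    fix n
    have "AE x in lborel. x \<noteq> (0::'a)" by (rule AE_lborel_singleton)
    then show "AE x in lborel. norm (indicator (S \<inter> {x. q x < \<rho> n}) x * c (q x)) \<le> (l + (l * R) powr (p / (p - 1))) * indicator (cball 0 B) x"
    proof eventually_elim
      case (elim x)
      show ?case
      proof (cases "x \<in> S \<and> q x < \<rho> n")
        case True
        then show ?thesis using cb[of "q x"] q(3)[OF elim] \<rho>(2)[of n] B[of x] by simp
      next
        case False
        then show ?thesis using l by (auto simp: indicator_def)
      qed
    qed
  qed measurable
  then show ?thesis unfolding c_def
    by (rule LIMSEQ_le_const) (use radial_star_truncated[OF p ric pr l S B star q \<rho>] in blast)
qed

text \<open>Composition with \<open>soft \<delta>\<close> makes the profile continuously differentiable at the free boundary \<open>U = 0\<close> without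
  increasing its gradient.\<close>

definition soft :: "real \<Rightarrow> real \<Rightarrow> real" where
  "soft \<delta> u = (if u \<le> \<delta> then 0 else (u - \<delta>)\<^sup>2 / u)"

text \<open>For \<open>u > \<delta>\<close> the softened value equals
  \<open>u - 2 \<delta> + \<delta>^2 / u\<close>, which explains the formula and why the slope lies
  between 0 and 1.\<close>

definition soft' :: "real \<Rightarrow> real \<Rightarrow> real" where
  "soft' \<delta> u = (if u \<le> \<delta> then 0 else 1 - (\<delta> / u)\<^sup>2)"

lemma soft'_bounds: "0 < \<delta> \<Longrightarrow> 0 \<le> soft' \<delta> u \<and> soft' \<delta> u \<le> 1"
proof -
  assume \<delta>: "0 < \<delta>"
  have "(\<delta> / u)\<^sup>2 \<le> 1\<^sup>2" if "\<delta> < u" using \<delta> that by (intro power_mono) auto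
  then show ?thesis by (auto simp: soft'_def)
qed

lemma soft_bounds:
  assumes "0 < \<delta>"
  shows "0 \<le> soft \<delta> u" "0 \<le> u \<Longrightarrow> soft \<delta> u \<le> u" "0 \<le> u \<Longrightarrow> u - 2 * \<delta> \<le> soft \<delta> u"
proof -
  show "0 \<le> soft \<delta> u" using assms by (auto simp: soft_def)
  have eq: "(u - \<delta>)\<^sup>2 / u = u - 2 * \<delta> + \<delta>\<^sup>2 / u" if "\<delta> < u"
    using assms that by (simp add: field_simps power2_eq_square)
  have "\<delta> * \<delta> \<le> \<delta> * u" if "\<delta> < u" using assms that by (intro mult_left_mono) auto
  then have "\<delta>\<^sup>2 / u \<le> \<delta>" if "\<delta> < u" using assms that by (simp add: power2_eq_square pos_divide_le_eq)
  then show "soft \<delta> u \<le> u" if "0 \<le> u" using assms that eq by (fastforce simp: soft_def)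
  show "u - 2 * \<delta> \<le> soft \<delta> u" if "0 \<le> u" using assms that eq by (auto simp: soft_def)
qed

lemma soft_derivative:
  assumes \<delta>: "0 < \<delta>"
  shows "(soft \<delta> has_real_derivative soft' \<delta> u) (at u)"
proof -
  consider "u < \<delta>" | "\<delta> < u" | "u = \<delta>" by linarith
  then show ?thesis
  proof cases
    case 1
    have "((\<lambda>_. 0) has_real_derivative soft' \<delta> u) (at u)" using 1 by (simp add: soft'_def)
    then show ?thesis by (rule has_field_derivative_transform_within_open[of _ _ _ "{..<\<delta>}"]) (use 1 in \<open>auto simp: soft_def\<close>)
  next
    case 2
    have "((\<lambda>u. (u - \<delta>)\<^sup>2 / u) has_real_derivative (2 * (u - \<delta>) * u - (u - \<delta>)\<^sup>2) / (u * u)) (at u)"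
      using 2 \<delta> by (auto intro!: derivative_eq_intros)
    moreover have "(2 * (u - \<delta>) * u - (u - \<delta>)\<^sup>2) / (u * u) = soft' \<delta> u"
      using 2 \<delta> by (simp add: soft'_def power2_eq_square field_simps)
    ultimately have "((\<lambda>u. (u - \<delta>)\<^sup>2 / u) has_real_derivative soft' \<delta> u) (at u)" by simp
    then show ?thesis by (rule has_field_derivative_transform_within_open[of _ _ _ "{\<delta><..}"]) (use 2 in \<open>auto simp: soft_def\<close>)
  next
    case 3
    have "((\<lambda>y. soft \<delta> y / (y - \<delta>)) \<longlongrightarrow> 0) (at \<delta>)"
    proof (rule Lim_null_comparison)
      have "norm (soft \<delta> y / (y - \<delta>)) \<le> \<bar>y - \<delta>\<bar> / \<delta>" for y
      proof (cases "y \<le> \<delta>")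
        case True
        then show ?thesis using \<delta> by (simp add: soft_def)
      next
        case False
        then have "norm (soft \<delta> y / (y - \<delta>)) = (y - \<delta>) / y" using \<delta> by (simp add: soft_def power2_eq_square)
        also have "\<dots> \<le> (y - \<delta>) / \<delta>" using False \<delta> by (intro divide_left_mono) auto
        finally show ?thesis using False by simp
      qed
      then show "\<forall>\<^sub>F y in at \<delta>. norm (soft \<delta> y / (y - \<delta>)) \<le> \<bar>y - \<delta>\<bar> / \<delta>" by simp
      have "((\<lambda>y. \<bar>y - \<delta>\<bar> / \<delta>) \<longlongrightarrow> \<bar>\<delta> - \<delta>\<bar> / \<delta>) (at \<delta>)" using \<delta> by (intro tendsto_intros) auto
      then show "((\<lambda>y. \<bar>y - \<delta>\<bar> / \<delta>) \<longlongrightarrow> 0) (at \<delta>)" by simp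
    qed
    then show ?thesis using 3 by (simp add: has_field_derivative_iff soft_def soft'_def)
  qed
qed

section \<open>Trial functions built from a profile and an anisotropic distance\<close>

locale trial =
  fixes p l R :: real and w U :: "real \<Rightarrow> real" and e :: "'a::euclidean_space" and \<kappa> :: real
  assumes p: "1 < p" and l: "0 < l" and R: "0 < R" and ric: "riccati p DIM('a) l R w" and pr: "profile p l R w U"
    and e: "norm e = 1" and \<kappa>: "0 < \<kappa>" "\<kappa> \<le> 1"
begin

text \<open>The symmetric linear map that is the identity on the line of \<open>e\<close> and
  multiplication by \<open>\<kappa>\<close> on its orthogonal complement.\<close>

definition T :: "'a \<Rightarrow> 'a" where "T x = \<kappa> *\<^sub>R x + ((1 - \<kappa>) * (x \<bullet> e)) *\<^sub>R e"

definition q :: "'a \<Rightarrow> real" where "q x = norm (T x)"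

definition f :: "real \<Rightarrow> 'a \<Rightarrow> real" where "f \<delta> x = soft \<delta> (U (q x))"

text \<open>The chain rule for \<open>soft \<delta>\<close>, \<open>U\<close> and \<open>q\<close>,
  with \<open>T (sgn (T x))\<close> as gradient of \<open>q\<close>. The value 0 covers the origin,
  where \<open>q\<close> has a corner, and the region beyond the support.\<close>

definition gf :: "real \<Rightarrow> 'a \<Rightarrow> 'a" where
  "gf \<delta> x = (if x = 0 \<or> R \<le> q x then 0
     else (soft' \<delta> (U (q x)) * - (w (q x) powr (1 / (p - 1)) * U (q x))) *\<^sub>R T (sgn (T x)))"

text \<open>This is \<open>|U'|^p\<close> at \<open>q x\<close>: the energy density if
  \<open>q\<close> had unit slope.\<close>

definition Ed :: "'a \<Rightarrow> real" where "Ed x = w (q x) powr (p / (p - 1)) * U (q x) powr p"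

text \<open>The true energy density of \<open>U\<close> composed with \<open>q\<close>. It differs
  from \<open>Ed\<close> by the p-th power of the slope of \<open>q\<close>, which is at most
  1.\<close>

definition Es :: "'a \<Rightarrow> real" where
  "Es x = indicator {x. x \<noteq> 0 \<and> q x < R} x * (Ed x * norm (T (sgn (T x))) powr p)"

lemma ee: "e \<bullet> e = 1" using e by (simp add: norm_eq_1)

lemma T_scaleR: "T (s *\<^sub>R x) = s *\<^sub>R T x" by (simp add: T_def algebra_simps)

lemma T_has_derivative: "(T has_derivative T) (at x)"
  unfolding T_def by (auto intro!: derivative_eq_intros simp: algebra_simps)

lemma T_continuous: "continuous_on UNIV T"
  unfolding T_def by (intro continuous_intros)

lemma T_selfadjoint: "T x \<bullet> y = x \<bullet> T y"
  by (simp add: T_def inner_add_left inner_add_right inner_commute)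

lemma T_e: "T x \<bullet> e = x \<bullet> e"
  by (simp add: T_def inner_add_left ee algebra_simps)

lemma norm_T_le: "norm (T x) \<le> norm x"
proof -
  have "norm (T x) \<le> \<kappa> * norm x + (1 - \<kappa>) * \<bar>x \<bullet> e\<bar>"
    unfolding T_def using \<kappa> e by (intro order_trans[OF norm_triangle_ineq]) (simp add: abs_mult)
  also have "\<dots> \<le> \<kappa> * norm x + (1 - \<kappa>) * norm x"
    using \<kappa> Cauchy_Schwarz_ineq2[of x e] e by (intro add_left_mono mult_left_mono) auto
  finally show ?thesis by (simp add: algebra_simps)
qed

lemma T_eq_0: "T x = 0 \<longleftrightarrow> x = 0"
proof
  assume "T x = 0"
  then have "x \<bullet> e = 0" using T_e[of x] by simp
  then show "x = 0" using \<open>T x = 0\<close> \<kappa> by (simp add: T_def)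
qed (simp add: T_def)

text \<open>The source of strictness: off the axis the slope of the shrunken distance is below
  1.\<close>

lemma norm_T_less:
  assumes "\<kappa> < 1" "\<bar>y \<bullet> e\<bar> < norm y"
  shows "norm (T y) < norm y"
proof -
  have "norm (T y) \<le> \<kappa> * norm y + (1 - \<kappa>) * \<bar>y \<bullet> e\<bar>"
    unfolding T_def using \<kappa> e by (intro order_trans[OF norm_triangle_ineq]) (simp add: abs_mult)
  also have "\<dots> < \<kappa> * norm y + (1 - \<kappa>) * norm y"
    using assms by (intro add_strict_left_mono mult_strict_left_mono) auto
  finally show ?thesis by (simp add: algebra_simps)
qed

lemma q_measurable [measurable]: "q \<in> borel_measurable borel"
  unfolding q_def using T_continuous by (intro borel_measurable_continuous_onI continuous_intros)

lemma q_scaleR: "0 < s \<Longrightarrow> q (s *\<^sub>R x) = s * q x" by (simp add: q_def T_scaleR)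
lemma q_pos: "x \<noteq> 0 \<Longrightarrow> 0 < q x" by (simp add: q_def T_eq_0)
lemma q_0: "q 0 = 0" by (simp add: q_def T_def)
lemma q_nonneg: "0 \<le> q x" by (simp add: q_def)
text \<open>Shrinking leaves the axial coordinate alone, so the support \<open>q < R\<close> of a
  trial function stays in the slab \<open>|x . e| < R\<close>. This later separates the two
  halves.\<close>

lemma q_ge: "\<bar>x \<bullet> e\<bar> \<le> q x"
  unfolding q_def using Cauchy_Schwarz_ineq2[of "T x" e] T_e[of x] e by simp
lemma q_continuous: "continuous_on UNIV q"
  unfolding q_def using T_continuous by (intro continuous_intros)

lemma U_measurable [measurable]: "U \<in> borel_measurable borel" by (rule profileD(1)[OF pr])
lemma w_measurable [measurable]: "w \<in> borel_measurable borel" by (rule riccatiD(1)[OF ric])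

lemma T_measurable [measurable]: "T \<in> borel_measurable borel"
  using T_continuous by (rule borel_measurable_continuous_onI)

lemma Ed_measurable [measurable]: "Ed \<in> borel_measurable borel" unfolding Ed_def by measurable

lemma Es_measurable [measurable]: "Es \<in> borel_measurable borel"
  unfolding Es_def sgn_div_norm by measurable

lemma U_q: "0 \<le> U (q x)" "U (q x) \<le> 1" using profileD(3,4)[OF pr] by auto

text \<open>At the origin, where \<open>q\<close> is not differentiable, the vanishing derivative of
  \<open>U\<close> and \<open>q x \<le> |x|\<close> suffice. Near \<open>q x = R\<close> the profile
  is already below \<open>\<delta>\<close>, so the softened function is locally zero.\<close>

lemma f_has_gradient:
  assumes \<delta>: "0 < \<delta>"
  shows "has_gradient (f \<delta>) (gf \<delta>)"
  unfolding has_gradient_def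
proof
  fix x
  consider "x = 0" | "x \<noteq> 0" "q x < R" | "x \<noteq> 0" "R \<le> q x" by linarith
  then show "(f \<delta> has_derivative (\<lambda>h. gf \<delta> x \<bullet> h)) (at x)"
  proof cases
    case 1
    have "((\<lambda>r. soft \<delta> (U r)) has_real_derivative soft' \<delta> (U 0) * 0) (at 0)"
      by (rule DERIV_chain2[OF soft_derivative[OF \<delta>] profileD(10)[OF pr]])
    then have B: "((\<lambda>r. soft \<delta> (U r)) has_derivative (\<lambda>h. 0)) (at 0)"
      unfolding has_field_derivative_def by (rule has_derivative_eq_rhs) auto
    have "(f \<delta> has_derivative (\<lambda>h. 0)) (at 0)"
      unfolding has_derivative_at_alt
    proof (intro conjI allI impI)
      fix \<epsilon> :: real assume "0 < \<epsilon>"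
      then obtain d where d: "0 < d" "\<And>y. norm (y - 0) < d \<Longrightarrow> norm (soft \<delta> (U y) - soft \<delta> (U 0) - 0) \<le> \<epsilon> * norm (y - 0)"
        using B unfolding has_derivative_at_alt by blast
      show "\<exists>d>0. \<forall>y. norm (y - 0) < d \<longrightarrow> norm (f \<delta> y - f \<delta> 0 - 0) \<le> \<epsilon> * norm (y - 0)"
      proof (intro exI[of _ d] conjI allI impI d(1))
        fix y :: 'a assume y: "norm (y - 0) < d"
        then have "norm (q y - 0) < d" using norm_T_le[of y] by (simp add: q_def)
        from d(2)[OF this] have "norm (f \<delta> y - f \<delta> 0 - 0) \<le> \<epsilon> * q y" by (simp add: f_def q_0 q_nonneg)
        also have "\<dots> \<le> \<epsilon> * norm (y - 0)" using \<open>0 < \<epsilon>\<close> norm_T_le[of y] by (simp add: q_def)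
        finally show "norm (f \<delta> y - f \<delta> 0 - 0) \<le> \<epsilon> * norm (y - 0)" .
      qed
    qed simp
    then show ?thesis using 1 by (simp add: gf_def)
  next
    case 2
    have Tx: "T x \<noteq> 0" using 2 by (simp add: T_eq_0)
    have qd: "(q has_derivative (\<lambda>h. sgn (T x) \<bullet> T h)) (at x)"
      unfolding q_def using has_derivative_compose[OF T_has_derivative has_derivative_norm[OF Tx]]
      by (simp add: inner_commute)
    have "((\<lambda>r. soft \<delta> (U r)) has_real_derivative soft' \<delta> (U (q x)) * - (w (q x) powr (1 / (p - 1)) * U (q x))) (at (q x))"
      by (rule DERIV_chain2[OF soft_derivative[OF \<delta>] profileD(7)[OF pr q_pos[OF 2(1)] 2(2)]])
    from has_derivative_compose[OF qd this[unfolded has_field_derivative_def]]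
    have "(f \<delta> has_derivative (\<lambda>h. (soft' \<delta> (U (q x)) * - (w (q x) powr (1 / (p - 1)) * U (q x))) * (sgn (T x) \<bullet> T h))) (at x)"
      unfolding f_def .
    moreover have "(soft' \<delta> (U (q x)) * - (w (q x) powr (1 / (p - 1)) * U (q x))) * (sgn (T x) \<bullet> T h) = gf \<delta> x \<bullet> h" for h
      using 2 by (simp add: gf_def T_selfadjoint)
    ultimately show ?thesis by simp
  next
    case 3
    obtain r0 where r0: "0 < r0" "r0 < R" "\<And>r. r0 \<le> r \<Longrightarrow> U r < \<delta>" using profileD(9)[OF pr \<delta>] by blast
    have "((\<lambda>_. 0) has_derivative (\<lambda>h. gf \<delta> x \<bullet> h)) (at x)" using 3 by (simp add: gf_def)
    then show ?thesis
    proof (rule has_derivative_transform_within_open)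
      show "open {x. r0 < q x}" using q_continuous by (intro open_Collect_less continuous_intros)
      show "x \<in> {x. r0 < q x}" using 3 r0 by simp
      show "0 = f \<delta> y" if "y \<in> {x. r0 < q x}" for y using r0(3)[of "q y"] that by (simp add: f_def soft_def)
    qed
  qed
qed

lemma flux_bound: "x \<noteq> 0 \<Longrightarrow> q x < R \<Longrightarrow> w (q x) powr (1 / (p - 1)) * U (q x) \<le> (l * R) powr (1 / (p - 1))"
  using profile_flux_bound(2)[OF p ric pr _ q_pos] l by auto

lemma norm_T_sgn: "norm (T (sgn (T x))) \<le> 1"
  using norm_T_le[of "sgn (T x)"] by (simp add: norm_sgn split: if_splits)

lemma gf_le:
  assumes "0 < \<delta>" "x \<noteq> 0" "q x < R"
  shows "norm (gf \<delta> x) \<le> (w (q x) powr (1 / (p - 1)) * U (q x)) * norm (T (sgn (T x)))"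
proof -
  have "norm (gf \<delta> x) = soft' \<delta> (U (q x)) * ((w (q x) powr (1 / (p - 1)) * U (q x)) * norm (T (sgn (T x))))"
    using assms soft'_bounds[OF assms(1), of "U (q x)"] U_q[of x] by (simp add: gf_def abs_mult)
  also have "\<dots> \<le> 1 * ((w (q x) powr (1 / (p - 1)) * U (q x)) * norm (T (sgn (T x))))"
    using soft'_bounds[OF assms(1)] U_q[of x] by (intro mult_right_mono) auto
  finally show ?thesis by simp
qed

lemma gf_bounded: "0 < \<delta> \<Longrightarrow> norm (gf \<delta> x) \<le> (l * R) powr (1 / (p - 1))"
proof (cases "x \<noteq> 0 \<and> q x < R")
  case True
  assume "0 < \<delta>"
  then have "norm (gf \<delta> x) \<le> (w (q x) powr (1 / (p - 1)) * U (q x)) * norm (T (sgn (T x)))" using True by (intro gf_le) auto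
  also have "\<dots> \<le> (w (q x) powr (1 / (p - 1)) * U (q x)) * 1"
    using norm_T_sgn U_q[of x] by (intro mult_left_mono) auto
  also have "\<dots> \<le> (l * R) powr (1 / (p - 1))" using flux_bound True by simp
  finally show ?thesis .
qed (auto simp: gf_def)

lemma gf_powr_le: "0 < \<delta> \<Longrightarrow> norm (gf \<delta> x) powr p \<le> Es x"
proof (cases "x \<noteq> 0 \<and> q x < R")
  case True
  assume "0 < \<delta>"
  then have "norm (gf \<delta> x) powr p \<le> ((w (q x) powr (1 / (p - 1)) * U (q x)) * norm (T (sgn (T x)))) powr p"
    using True p by (intro powr_mono2 gf_le) auto
  also have "\<dots> = (w (q x) powr (1 / (p - 1)) * U (q x)) powr p * norm (T (sgn (T x))) powr p"
    using U_q by (simp add: powr_mult)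
  also have "(w (q x) powr (1 / (p - 1)) * U (q x)) powr p = Ed x"
    unfolding Ed_def using profile_flux_bound(3)[OF p ric pr _ q_pos] True l by simp
  finally show ?thesis using True by (simp add: Es_def)
qed (auto simp: gf_def Es_def Ed_def)

lemma f_bounds: "0 < \<delta> \<Longrightarrow> 0 \<le> f \<delta> x \<and> f \<delta> x \<le> U (q x) \<and> U (q x) - 2 * \<delta> \<le> f \<delta> x"
  using soft_bounds[of \<delta> "U (q x)"] U_q by (auto simp: f_def)

lemma f_zero: "0 < \<delta> \<Longrightarrow> R \<le> q x \<Longrightarrow> f \<delta> x = 0"
  using profileD(5)[OF pr] by (simp add: f_def soft_def)

lemma Ed_bound: "x \<noteq> 0 \<Longrightarrow> q x < R \<Longrightarrow> Ed x \<le> (l * R) powr (p / (p - 1))"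
  unfolding Ed_def using profile_flux_bound(1)[OF p ric pr _ q_pos] l by auto

lemma Ed_nonneg: "0 \<le> Ed x" by (simp add: Ed_def)

lemma Es_le: "Es x \<le> indicator {x. x \<noteq> 0 \<and> q x < R} x * Ed x"
proof -
  have "norm (T (sgn (T x))) powr p \<le> 1"
    using norm_T_sgn[of x] p powr_mono2[of p "norm (T (sgn (T x)))" 1] by auto
  then have "Ed x * norm (T (sgn (T x))) powr p \<le> Ed x * 1" by (intro mult_left_mono) (auto simp: Ed_nonneg)
  then show ?thesis by (auto simp: Es_def indicator_def)
qed

lemma Es_nonneg: "0 \<le> Es x" by (simp add: Es_def Ed_nonneg)

lemma Es_bound: "Es x \<le> (l * R) powr (p / (p - 1))"
  using Es_le[of x] Ed_bound[of x] by (cases "x \<noteq> 0 \<and> q x < R") (auto simp: Es_def)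

end

locale trial_domain = trial p l R w U e \<kappa>
  for p l R :: real and w U :: "real \<Rightarrow> real" and e :: "'a::euclidean_space" and \<kappa> :: real +
  fixes S :: "'a set" and B :: real
  assumes S: "S \<in> sets borel" and SB: "\<And>x. x \<in> S \<Longrightarrow> norm x \<le> B"
    and star: "\<And>x s. x \<in> S \<Longrightarrow> 0 < s \<Longrightarrow> s \<le> 1 \<Longrightarrow> s *\<^sub>R x \<in> S"
begin

lemma S_measurable [measurable]: "S \<in> sets borel" by (rule S)

lemma integrable_S:
  fixes h :: "'a \<Rightarrow> real"
  assumes [measurable]: "h \<in> borel_measurable borel" and "\<And>x. \<bar>h x\<bar> \<le> C"
  shows "integrable lborel (\<lambda>x. indicator S x * h x)"
proof (rule integrable_bounded_support[where B = B and C = "\<bar>C\<bar>"])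
  fix x
  show "norm (indicator S x * h x) \<le> \<bar>C\<bar>" using assms(2)[of x] by (auto simp: indicator_def)
  show "indicator S x * h x = 0" if "B < norm x" using SB[of x] that by (cases "x \<in> S") auto
qed measurable

lemma energy_le:
  "(LINT x|lborel. indicator S x * (indicator {x. x \<noteq> 0 \<and> q x < R} x * Ed x)) \<le> l * (LINT x|lborel. indicator S x * U (q x) powr p)"
proof -
  have Up: "\<bar>U (q x) powr p\<bar> \<le> 1" for x using U_q[of x] p powr_mono2[of p "U (q x)" 1] by auto
  have i1: "integrable lborel (\<lambda>x. indicator S x * U (q x) powr p)" by (rule integrable_S[OF _ Up]) measurable
  have i2: "integrable lborel (\<lambda>x. indicator S x * (indicator {x. x \<noteq> 0 \<and> q x < R} x * Ed x))"
    by (rule integrable_S[where C = "(l * R) powr (p / (p - 1))"]) (auto simp: indicator_def Ed_nonneg Ed_bound)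
  have "0 \<le> (LINT x|lborel. indicator (S \<inter> {x. q x < R}) x * (l * U (q x) powr p - w (q x) powr (p / (p - 1)) * U (q x) powr p))"
    by (rule radial_star[OF p ric pr less_imp_le[OF l] R S SB star q_measurable q_scaleR q_pos q_0])
  also have "\<dots> = (LINT x|lborel. l * (indicator S x * U (q x) powr p) - indicator S x * (indicator {x. x \<noteq> 0 \<and> q x < R} x * Ed x))"
  proof (rule integral_cong_AE)
    have "AE x in lborel. x \<noteq> (0::'a)" by (rule AE_lborel_singleton)
    then show "AE x in lborel. indicator (S \<inter> {x. q x < R}) x * (l * U (q x) powr p - w (q x) powr (p / (p - 1)) * U (q x) powr p)
       = l * (indicator S x * U (q x) powr p) - indicator S x * (indicator {x. x \<noteq> 0 \<and> q x < R} x * Ed x)"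
    proof eventually_elim
      case (elim x)
      then show ?case using profileD(5)[OF pr, of "q x"] p by (cases "q x < R") (auto simp: indicator_def Ed_def)
    qed
  qed measurable
  also have "\<dots> = l * (LINT x|lborel. indicator S x * U (q x) powr p) - (LINT x|lborel. indicator S x * (indicator {x. x \<noteq> 0 \<and> q x < R} x * Ed x))"
    using i1 i2 by simp
  finally show ?thesis by simp
qed

text \<open>The strict inequality leaves room for the softening: the masses converge as
  \<open>\<delta>\<close> tends to 0, while every softened gradient is dominated by
  \<open>Es\<close>, so no convergence of gradients is required.\<close>

lemma trial_quotient:
  assumes pos: "0 < (LINT x|lborel. indicator S x * U (q x) powr p)"
    and m: "(LINT x|lborel. indicator S x * Es x) < m * (LINT x|lborel. indicator S x * U (q x) powr p)"
  shows "\<exists>\<delta>>0. 0 < (LINT x|lborel. indicator S x * f \<delta> x powr p) \<and>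
     (LINT x|lborel. indicator S x * norm (gf \<delta> x) powr p) \<le> m * (LINT x|lborel. indicator S x * f \<delta> x powr p)"
proof -
  define \<delta> where "\<delta> n = 1 / real (n + 2)" for n
  have \<delta>: "0 < \<delta> n" for n by (simp add: \<delta>_def)
  have \<delta>l: "\<delta> \<longlonglongrightarrow> 0" unfolding \<delta>_def by (rule LIMSEQ_ignore_initial_segment[OF lim_1_over_n])
  define L where "L = (LINT x|lborel. indicator S x * U (q x) powr p)"
  have [measurable]: "f (\<delta> n) \<in> borel_measurable borel" for n
    using has_gradient_continuous[OF f_has_gradient[OF \<delta>]] by (rule borel_measurable_continuous_onI)
  have [measurable]: "gf (\<delta> n) \<in> borel_measurable borel" for n by (rule has_gradient_measurable[OF f_has_gradient[OF \<delta>]])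
  have lim: "(\<lambda>n. LINT x|lborel. indicator S x * f (\<delta> n) x powr p) \<longlonglongrightarrow> L"
    unfolding L_def
  proof (rule integral_dominated_convergence)
    have "integrable lborel (\<lambda>x. indicator S x * (1::real))" by (rule integrable_S[where C = 1]) auto
    then show "integrable lborel (\<lambda>x. indicator S x :: real)" by simp
    show "AE x in lborel. (\<lambda>n. indicator S x * f (\<delta> n) x powr p) \<longlonglongrightarrow> indicator S x * U (q x) powr p"
    proof (rule AE_I2)
      fix x
      have "(\<lambda>n. f (\<delta> n) x) \<longlonglongrightarrow> U (q x)"
      proof (rule tendsto_sandwich)
        show "\<forall>\<^sub>F n in sequentially. U (q x) - 2 * \<delta> n \<le> f (\<delta> n) x" using f_bounds[OF \<delta>] by simp
        show "\<forall>\<^sub>F n in sequentially. f (\<delta> n) x \<le> U (q x)" using f_bounds[OF \<delta>] by simp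
        have "(\<lambda>n. U (q x) - 2 * \<delta> n) \<longlonglongrightarrow> U (q x) - 2 * 0" by (intro tendsto_intros \<delta>l)
        then show "(\<lambda>n. U (q x) - 2 * \<delta> n) \<longlonglongrightarrow> U (q x)" by simp
      qed simp
      then have "(\<lambda>n. f (\<delta> n) x powr p) \<longlonglongrightarrow> U (q x) powr p"
        using p f_bounds[OF \<delta>] by (intro tendsto_powr') auto
      then show "(\<lambda>n. indicator S x * f (\<delta> n) x powr p) \<longlonglongrightarrow> indicator S x * U (q x) powr p"
        by (rule tendsto_mult_left)
    qed
    fix n
    show "AE x in lborel. norm (indicator S x * f (\<delta> n) x powr p) \<le> indicator S x"
    proof (rule AE_I2)
      fix x
      have "0 \<le> f (\<delta> n) x" "f (\<delta> n) x \<le> 1" using f_bounds[OF \<delta>, of n x] U_q[of x] by auto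
      then have "f (\<delta> n) x powr p \<le> 1" using p powr_mono2[of p "f (\<delta> n) x" 1] by auto
      then show "norm (indicator S x * f (\<delta> n) x powr p) \<le> indicator S x" by (auto simp: indicator_def)
    qed
  qed measurable
  have "(\<lambda>n. m * (LINT x|lborel. indicator S x * f (\<delta> n) x powr p)) \<longlonglongrightarrow> m * L" by (intro tendsto_intros lim)
  then have "\<forall>\<^sub>F n in sequentially. (LINT x|lborel. indicator S x * Es x) < m * (LINT x|lborel. indicator S x * f (\<delta> n) x powr p)"
    by (rule order_tendstoD(1)) (use m in \<open>simp add: L_def\<close>)
  moreover have "\<forall>\<^sub>F n in sequentially. 0 < (LINT x|lborel. indicator S x * f (\<delta> n) x powr p)"
    by (rule order_tendstoD(1)[OF lim]) (use pos in \<open>simp add: L_def\<close>)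
  ultimately have "\<forall>\<^sub>F n in sequentially. (LINT x|lborel. indicator S x * Es x) < m * (LINT x|lborel. indicator S x * f (\<delta> n) x powr p)
      \<and> 0 < (LINT x|lborel. indicator S x * f (\<delta> n) x powr p)" by (rule eventually_conj)
  then obtain n where n: "(LINT x|lborel. indicator S x * Es x) < m * (LINT x|lborel. indicator S x * f (\<delta> n) x powr p)"
      "0 < (LINT x|lborel. indicator S x * f (\<delta> n) x powr p)"
    unfolding eventually_sequentially by blast
  have "(LINT x|lborel. indicator S x * norm (gf (\<delta> n) x) powr p) \<le> (LINT x|lborel. indicator S x * Es x)"
  proof (rule integral_mono_AE')
    show "integrable lborel (\<lambda>x. indicator S x * Es x)"
      by (rule integrable_S[where C = "(l * R) powr (p / (p - 1))"]) (auto simp: Es_nonneg Es_bound)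
    show "AE x in lborel. indicator S x * norm (gf (\<delta> n) x) powr p \<le> indicator S x * Es x"
      by (intro AE_I2 mult_left_mono gf_powr_le \<delta>) auto
  qed (simp add: Es_nonneg)
  then show ?thesis using n \<delta>[of n] by (intro exI[of _ "\<delta> n"]) auto
qed

lemma mass_pos:
  assumes V: "open V" "V \<noteq> {}" "V \<subseteq> S" "\<And>x. x \<in> V \<Longrightarrow> q x < R"
  shows "0 < (LINT x|lborel. indicator S x * U (q x) powr p)"
proof -
  have Up: "\<bar>U (q x) powr p\<bar> \<le> 1" for x using U_q[of x] p powr_mono2[of p "U (q x)" 1] by auto
  have i: "integrable lborel (\<lambda>x. indicator S x * U (q x) powr p)" by (rule integrable_S[OF _ Up]) measurable
  have nn: "0 \<le> (LINT x|lborel. indicator S x * U (q x) powr p)" by (intro integral_nonneg_AE AE_I2) auto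
  have "(LINT x|lborel. indicator S x * U (q x) powr p) \<noteq> 0"
  proof
    assume "(LINT x|lborel. indicator S x * U (q x) powr p) = 0"
    then have "AE x in lborel. indicator S x * U (q x) powr p = 0"
      using integral_nonneg_eq_0_iff_AE[OF i] by simp
    moreover have "AE x in lborel. x \<noteq> (0::'a)" by (rule AE_lborel_singleton)
    ultimately have "AE x in lborel. x \<notin> V"
    proof eventually_elim
      case (elim x)
      show ?case
      proof
        assume "x \<in> V"
        then have "0 < U (q x)" using profileD(6)[OF pr q_pos[OF elim(2)]] V(4) by blast
        then show False using elim(1) V(3) \<open>x \<in> V\<close> by auto
      qed
    qed
    then show False using AE_notin_open[OF V(1)] V(2) by blast
  qed
  then show ?thesis using nn by linarith
qed

end

text \<open>The radial profile is the trial function for the upper bound, with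
  \<open>\<kappa> = 1\<close> so that \<open>q\<close> is the norm; Picone's inequality for test
  functions gives the lower bound with the same constant.\<close>

lemma lambda_ball:
  fixes c :: "'a::euclidean_space"
  assumes p: "1 < p" and l: "0 < l" and R: "0 < R" and ric: "riccati p DIM('a) l R w" and pr: "profile p l R w U"
  shows "lambda p (ball c R) = l"
proof -
  obtain e :: 'a where e: "norm e = 1" using vector_choose_size[of 1] by auto
  interpret trial_domain p l R w U e 1 "ball 0 R" R
    using assms e by unfold_locales (auto intro: order_trans[OF mult_left_le_one_le] le_less_trans[OF mult_left_le_one_le])
  have qn: "q x = norm x" for x by (simp add: q_def T_def)
  define L where "L = (LINT x|lborel. indicator (ball 0 R) x * U (q x) powr p)"
  have pos: "0 < L" unfolding L_def by (rule mass_pos[of "ball 0 R"]) (use R qn in auto)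
  have EL: "(LINT x|lborel. indicator (ball 0 R) x * Es x) \<le> l * L"
  proof -
    have "(LINT x|lborel. indicator (ball 0 R) x * Es x) \<le> (LINT x|lborel. indicator (ball 0 R) x * (indicator {x. x \<noteq> 0 \<and> q x < R} x * Ed x))"
    proof (rule integral_mono_AE')
      show "integrable lborel (\<lambda>x. indicator (ball 0 R) x * (indicator {x. x \<noteq> 0 \<and> q x < R} x * Ed x))"
        by (rule integrable_S[where C = "(l * R) powr (p / (p - 1))"]) (auto simp: indicator_def Ed_nonneg Ed_bound)
      show "AE x in lborel. indicator (ball 0 R) x * Es x \<le> indicator (ball 0 R) x * (indicator {x. x \<noteq> 0 \<and> q x < R} x * Ed x)"
        by (intro AE_I2 mult_left_mono Es_le) auto
    qed (simp add: Ed_nonneg)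
    then show ?thesis using energy_le unfolding L_def by linarith
  qed
  \<comment> \<open>The nonzero test function is carried along because the lower bound on the
    infimum requires a nonempty set.\<close>
  have up: "(\<exists>\<phi>\<in>test_functions (ball c R). \<not> (AE x in lebesgue_on (ball c R). \<phi> x = 0)) \<and> lambda p (ball c R) \<le> m" if m: "l < m" for m
  proof -
    have "l * L < m * L" using m pos by (intro mult_strict_right_mono) auto
    then have "(LINT x|lborel. indicator (ball 0 R) x * Es x) < m * L" using EL by linarith
    from trial_quotient[OF pos[unfolded L_def] this[unfolded L_def]]
    obtain \<delta> where \<delta>: "0 < \<delta>" "0 < (LINT x|lborel. indicator (ball 0 R) x * f \<delta> x powr p)"
      "(LINT x|lborel. indicator (ball 0 R) x * norm (gf \<delta> x) powr p) \<le> m * (LINT x|lborel. indicator (ball 0 R) x * f \<delta> x powr p)"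
      by blast
    have [measurable]: "f \<delta> \<in> borel_measurable borel" "gf \<delta> \<in> borel_measurable borel"
      using has_gradient_continuous[OF f_has_gradient[OF \<delta>(1)]] has_gradient_measurable[OF f_has_gradient[OF \<delta>(1)]]
      by (auto intro: borel_measurable_continuous_onI)
    obtain r0 where r0: "0 < r0" "r0 < R" "\<And>r. r0 \<le> r \<Longrightarrow> U r < \<delta>" using profileD(9)[OF pr \<delta>(1)] by blast
    define u where "u x = f \<delta> (- c + 1 *\<^sub>R x)" for x
    define gu where "gu x = 1 *\<^sub>R gf \<delta> (- c + 1 *\<^sub>R x)" for x
    have hu: "has_gradient u gu" unfolding u_def gu_def by (rule has_gradient_affine[OF f_has_gradient[OF \<delta>(1)]])
    have gub: "norm (gu x) \<le> (l * R) powr (1 / (p - 1))" for x unfolding gu_def using gf_bounded[OF \<delta>(1)] by simp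
    have u0: "u x = 0" if "x \<notin> cball c r0" for x
      using r0(3)[of "norm (- c + 1 *\<^sub>R x)"] that by (simp add: u_def f_def soft_def qn dist_norm norm_minus_commute)
    have sub: "cball c r0 \<subseteq> ball c R" using r0 by auto
    have f_out: "f \<delta> x = 0" "gf \<delta> x = 0" if "x \<notin> ball 0 R" for x
      using that f_zero[OF \<delta>(1), of x] by (auto simp: qn gf_def)
    have iu: "(LINT x|lborel. \<bar>u x\<bar> powr p) = (LINT x|lborel. indicator (ball 0 R) x * f \<delta> x powr p)"
    proof -
      have "(LINT x|lborel. \<bar>u x\<bar> powr p) = (LINT x|lborel. \<bar>f \<delta> x\<bar> powr p)"
        unfolding u_def by (subst integral_lborel_affine[of "\<lambda>x. \<bar>f \<delta> x\<bar> powr p"]) auto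
      also have "\<dots> = (LINT x|lborel. indicator (ball 0 R) x * f \<delta> x powr p)"
        using f_out f_bounds[OF \<delta>(1)] p by (intro Bochner_Integration.integral_cong) (auto simp: indicator_def)
      finally show ?thesis .
    qed
    have ig: "(LINT x|lborel. norm (gu x) powr p) = (LINT x|lborel. indicator (ball 0 R) x * norm (gf \<delta> x) powr p)"
    proof -
      have "(LINT x|lborel. norm (gu x) powr p) = (LINT x|lborel. norm (gf \<delta> x) powr p)"
        unfolding gu_def scaleR_one[of "gf _ _"] by (subst integral_lborel_affine[of "\<lambda>x. norm (gf \<delta> x) powr p"]) auto
      also have "\<dots> = (LINT x|lborel. indicator (ball 0 R) x * norm (gf \<delta> x) powr p)"
        using f_out p by (intro Bochner_Integration.integral_cong) (auto simp: indicator_def)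
      finally show ?thesis .
    qed
    have posu: "0 < (LINT x|lborel. \<bar>u x\<bar> powr p)" unfolding iu by (rule \<delta>(2))
    note ls = lambda_le_smooth[OF open_ball bounded_ball p hu gub compact_cball sub u0 posu]
    have "lambda p (ball c R) \<le> (LINT x|lborel. norm (gu x) powr p) / (LINT x|lborel. \<bar>u x\<bar> powr p)" by (rule ls(2))
    also have "\<dots> \<le> m" unfolding iu ig using \<delta>(2,3) by (simp add: pos_divide_le_eq)
    finally show ?thesis using ls(1) by blast
  qed
  have "lambda p (ball c R) \<le> l" by (rule dense_ge) (use up in blast)
  moreover have "l \<le> lambda p (ball c R)"
    unfolding lambda_def
  proof (rule cInf_greatest)
    obtain \<phi> where \<phi>: "\<phi> \<in> test_functions (ball c R)" "\<not> (AE x in lebesgue_on (ball c R). \<phi> x = 0)"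
      using up[of "l + 1"] by auto
    show "{(LINT x|lebesgue_on (ball c R). norm (g x) powr p) / (LINT x|lebesgue_on (ball c R). \<bar>v x\<bar> powr p) | v g.
        W1p_0 p (ball c R) v g \<and> \<not> (AE x in lebesgue_on (ball c R). v x = 0)} \<noteq> {}"
      using test_function_W1p_0[OF open_ball bounded_ball p \<phi>(1)] \<phi>(2) by blast
    fix t assume "t \<in> {(LINT x|lebesgue_on (ball c R). norm (g x) powr p) / (LINT x|lebesgue_on (ball c R). \<bar>v x\<bar> powr p) | v g.
        W1p_0 p (ball c R) v g \<and> \<not> (AE x in lebesgue_on (ball c R). v x = 0)}"
    then obtain v g where t: "t = (LINT x|lebesgue_on (ball c R). norm (g x) powr p) / (LINT x|lebesgue_on (ball c R). \<bar>v x\<bar> powr p)"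
      and vg: "W1p_0 p (ball c R) v g" "\<not> (AE x in lebesgue_on (ball c R). v x = 0)" by blast
    have le: "l * (LINT x|lebesgue_on (ball c R). \<bar>v x\<bar> powr p) \<le> (LINT x|lebesgue_on (ball c R). norm (g x) powr p)"
      by (rule dirichlet_lower_bound[OF open_ball bounded_ball p _ vg(1)])
        (rule dirichlet_ball_test[OF p ric less_imp_le[OF l] _ order_refl])
    have "v \<in> Lp p (ball c R)" using vg(1) by (simp add: W1p_0_def W1p_def)
    then have iv: "integrable (lebesgue_on (ball c R)) (\<lambda>x. \<bar>v x\<bar> powr p)" by (simp add: Lp_def)
    have "(LINT x|lebesgue_on (ball c R). \<bar>v x\<bar> powr p) \<noteq> 0"
    proof
      assume "(LINT x|lebesgue_on (ball c R). \<bar>v x\<bar> powr p) = 0"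
      then have "AE x in lebesgue_on (ball c R). \<bar>v x\<bar> powr p = 0" using integral_nonneg_eq_0_iff_AE[OF iv] by simp
      then show False using vg(2) by simp
    qed
    moreover have "0 \<le> (LINT x|lebesgue_on (ball c R). \<bar>v x\<bar> powr p)" by simp
    ultimately have "0 < (LINT x|lebesgue_on (ball c R). \<bar>v x\<bar> powr p)" by linarith
    then show "l \<le> t" unfolding t using le by (simp add: pos_le_divide_eq)
  qed
  ultimately show ?thesis by simp
qed

text \<open>Replacing \<open>U r\<close> by \<open>U (a r)\<close> multiplies the eigenvalue by
  \<open>a powr p\<close> and \<open>- U' / U\<close> by \<open>a\<close>, hence \<open>w\<close> by
  \<open>a powr (p - 1)\<close>.\<close>

lemma riccati_scale:
  assumes p: "1 < p" and ric: "riccati p N 1 R w" and a: "0 < a"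
  shows "riccati p N (a powr p) (R / a) (\<lambda>r. a powr (p - 1) * w (a * r))"
  unfolding riccati_def
proof (intro conjI allI impI)
  have [measurable]: "w \<in> borel_measurable borel" by (rule riccatiD(1)[OF ric])
  show "(\<lambda>r. a powr (p - 1) * w (a * r)) \<in> borel_measurable borel" by measurable
  fix r assume "0 < r \<and> r < R / a"
  then have r: "0 < r" "0 < a * r" "a * r < R" using a by (auto simp: field_simps)
  have w0: "0 \<le> w (a * r)" by (rule riccatiD(2)[OF ric r(2,3)])
  show "0 \<le> a powr (p - 1) * w (a * r)" using w0 by simp
  have ap: "a powr p = a powr (p - 1) * a" using a powr_add[of a "p - 1" 1] by simp
  have "((\<lambda>r. a * r) has_real_derivative a) (at r)" by (auto intro!: derivative_eq_intros)
  from DERIV_cmult[OF DERIV_chain2[where g = "\<lambda>r. a * r" and x = r, OF riccatiD(3)[OF ric r(2,3)] this], of "a powr (p - 1)"]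
  have "((\<lambda>r. a powr (p - 1) * w (a * r)) has_real_derivative
      a powr (p - 1) * ((1 + (p - 1) * w (a * r) powr (p / (p - 1)) - (real N - 1) * w (a * r) / (a * r)) * a)) (at r)" .
  moreover have "a powr (p - 1) * ((1 + (p - 1) * w (a * r) powr (p / (p - 1)) - (real N - 1) * w (a * r) / (a * r)) * a)
      = a powr p + (p - 1) * (a powr (p - 1) * w (a * r)) powr (p / (p - 1)) - (real N - 1) * (a powr (p - 1) * w (a * r)) / r"
  proof -
    have "(a powr (p - 1) * w (a * r)) powr (p / (p - 1)) = (a powr (p - 1) * a) * w (a * r) powr (p / (p - 1))"
      using p w0 a by (simp add: powr_mult powr_powr ap[symmetric])
    moreover have "A * ((1 + (p - 1) * Q - n * W / (a * r)) * a) = A * a + (p - 1) * ((A * a) * Q) - n * (A * W) / r" for A Q n W :: real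
      using a r(1) by (simp add: field_simps)
    ultimately show ?thesis unfolding ap by (simp only:)
  qed
  ultimately show "((\<lambda>r. a powr (p - 1) * w (a * r)) has_real_derivative
      a powr p + (p - 1) * (a powr (p - 1) * w (a * r)) powr (p / (p - 1)) - (real N - 1) * (a powr (p - 1) * w (a * r)) / r) (at r)" by simp
next
  fix \<rho> assume "\<rho> < R / a"
  then have "a * \<rho> < R" using a by (simp add: field_simps)
  then obtain C where C: "0 \<le> C" "\<And>r. 0 < r \<Longrightarrow> r \<le> a * \<rho> \<Longrightarrow> w r \<le> C * r" using riccatiD(4)[OF ric] by blast
  have "a powr (p - 1) * w (a * r) \<le> (a powr (p - 1) * C * a) * r" if "0 < r \<and> r \<le> \<rho>" for r
    using C(2)[of "a * r"] a that mult_left_mono[of "w (a * r)" "C * (a * r)" "a powr (p - 1)"] by (simp add: mult_ac)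
  then show "\<exists>C\<ge>0. \<forall>r. 0 < r \<and> r \<le> \<rho> \<longrightarrow> a powr (p - 1) * w (a * r) \<le> C * r"
    using C(1) a by (intro exI[of _ "a powr (p - 1) * C * a"]) auto
qed

text \<open>If a solution existed for all radii, rescaling it would bound \<open>\<Lambda>\<close> times the \<open>L\<^sup>p\<close> norm of a fixed
  test function by its energy for every \<open>\<Lambda>\<close>.\<close>

lemma riccati_blow_up:
  assumes p: "1 < p" and ric: "\<And>R. 0 < R \<Longrightarrow> riccati p DIM('a::euclidean_space) 1 R w"
  shows False
proof -
  obtain \<eta> :: "'a \<Rightarrow> real" where "mollifier \<eta>" by (rule mollifier_obtain)
  then interpret mollifier \<eta> .
  have t: "\<eta> \<in> test_functions (ball 0 2)"
    by (rule test_functionI[OF Ck_eta compact_cball[of 0 1]]) (auto simp: eta_support)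
  have [measurable]: "\<eta> \<in> borel_measurable borel" by measurable
  define I where "I = (LINT x|lebesgue_on (ball 0 2). \<bar>\<eta> x\<bar> powr p)"
  define G where "G = (LINT x|lebesgue_on (ball 0 2). norm (grad \<eta> x) powr p)"
  have key: "\<Lambda> * I \<le> G" if \<Lambda>: "0 < \<Lambda>" for \<Lambda>
  proof -
    define a where "a = \<Lambda> powr (1 / p)"
    have a: "0 < a" "a powr p = \<Lambda>" using \<Lambda> p by (auto simp: a_def powr_powr)
    \<comment> \<open>Rescaling divides the radius by \<open>a\<close>; starting from radius
      \<open>2 * a\<close> always leaves the ball of radius 2 that carries the fixed test
      function.\<close>
    have "riccati p DIM('a) (a powr p) ((2 * a) / a) (\<lambda>r. a powr (p - 1) * w (a * r))"
      using a by (intro riccati_scale[OF p ric]) auto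
    from dirichlet_ball_test[OF p this _ t] show ?thesis unfolding I_def G_def using a \<Lambda> by simp
  qed
  have I0: "0 \<le> I" by (simp add: I_def)
  have "I = 0"
  proof (rule ccontr)
    assume "I \<noteq> 0"
    then have "0 < I" using I0 by simp
    moreover have "0 \<le> G" by (simp add: G_def)
    ultimately have "((G + 1) / I) * I \<le> G" by (intro key divide_pos_pos) auto
    then show False using \<open>0 < I\<close> by simp
  qed
  have "I = (LINT x|lborel. indicator (ball 0 2) x *\<^sub>R (\<bar>\<eta> x\<bar> powr p))"
    unfolding I_def by (rule integral_lebesgue_on_borel) auto
  also have "\<dots> = (LINT x|lborel. \<bar>\<eta> x\<bar> powr p)"
    using eta_support p by (intro Bochner_Integration.integral_cong) (auto simp: indicator_def)
  finally have "(LINT x|lborel. \<bar>\<eta> x\<bar> powr p) = 0" using \<open>I = 0\<close> by simp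
  have "integrable lborel (\<lambda>x. \<bar>\<eta> x\<bar> powr p)"
  proof -
    obtain C where C: "0 \<le> C" "\<And>z. \<eta> z \<le> C" using eta_bounded by blast
    show ?thesis
      by (rule integrable_bounded_support[where B = 1 and C = "C powr p"]) (use C eta_support eta_nonneg p in \<open>auto intro!: powr_mono2\<close>)
  qed
  from integral_nonneg_eq_0_iff_AE[OF this] \<open>(LINT x|lborel. \<bar>\<eta> x\<bar> powr p) = 0\<close>
  have "AE x in lborel. \<bar>\<eta> x\<bar> powr p = 0" by simp
  then have "AE x in lborel. \<eta> x = 0" by simp
  then have "(LINT x|lborel. \<eta> x) = 0" by (rule integral_eq_zero_AE)
  then show False using eta_integral by simp
qed

text \<open>A solution for all radii is excluded by \<open>riccati_blow_up\<close>, so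
  \<open>riccati_maximal\<close> leaves one that is unbounded at a finite radius, which is what
  \<open>profile_exists\<close> asks for.\<close>

lemma eigenprofile_exists:
  assumes p: "1 < p"
  obtains R w U where "0 < R" "riccati p DIM('a::euclidean_space) 1 R w" "profile p 1 R w U"
proof -
  have N: "1 \<le> DIM('a)" using DIM_positive[where 'a='a] by simp
  interpret riccati_construction p "DIM('a)" using p N by unfold_locales
  have "\<not> (\<forall>R>0. riccati p DIM('a) 1 R local.w)" using riccati_blow_up[where 'a='a, OF p] by blast
  then obtain R where R: "0 < R" "riccati p DIM('a) 1 R local.w" "\<not> (\<exists>M. \<forall>r. 0 < r \<and> r < R \<longrightarrow> local.w r \<le> M)"
    using riccati_maximal by blast
  then obtain U where "profile p 1 R local.w U" using profile_exists[OF p N R(2,1) _ R(3)] by auto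
  then show ?thesis using that R by blast
qed

lemma profile_scale:
  assumes p: "1 < p" and pr: "profile p 1 R w U" and a: "0 < a"
  shows "profile p (a powr p) (R / a) (\<lambda>r. a powr (p - 1) * w (a * r)) (\<lambda>r. U (a * r))"
  unfolding profile_def
proof (intro conjI allI impI)
  have [measurable]: "U \<in> borel_measurable borel" by (rule profileD(1)[OF pr])
  show "(\<lambda>r. U (a * r)) \<in> borel_measurable borel" by measurable
  show "U (a * 0) = 1" using profileD(2)[OF pr] by simp
  show "0 \<le> U (a * r)" "U (a * r) \<le> 1" for r using profileD(3,4)[OF pr] by auto
  show "U (a * r) = 0" if "R / a \<le> r" for r using profileD(5)[OF pr] that a by (simp add: field_simps)
  have d: "((\<lambda>r. a * r) has_real_derivative a) (at r)" for r by (auto intro!: derivative_eq_intros)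
  {
    fix r assume "0 < r \<and> r < R / a"
    then have r: "0 < r" "0 < a * r" "a * r < R" using a by (auto simp: field_simps)
    show "0 < U (a * r)" by (rule profileD(6)[OF pr r(2,3)])
    have "((\<lambda>r. U (a * r)) has_real_derivative - (w (a * r) powr (1 / (p - 1)) * U (a * r)) * a) (at r)"
      by (rule DERIV_chain2[where g = "\<lambda>r. a * r" and x = r, OF profileD(7)[OF pr r(2,3)] d])
    moreover have "(a powr (p - 1) * w (a * r)) powr (1 / (p - 1)) = a * w (a * r) powr (1 / (p - 1))"
    proof (cases "0 \<le> w (a * r)")
      case True
      then show ?thesis using p a by (simp add: powr_mult powr_powr)
    next
      case False
      then show ?thesis using p a by (simp add: powr_mult powr_powr)
    qed
    ultimately show "((\<lambda>r. U (a * r)) has_real_derivative - ((a powr (p - 1) * w (a * r)) powr (1 / (p - 1)) * U (a * r))) (at r)"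
      by (simp add: mult_ac)
    have "a powr p = a powr (p - 1) * a" using a powr_add[of a "p - 1" 1] by simp
    then show "a powr (p - 1) * w (a * r) * U (a * r) powr (p - 1) \<le> a powr p * r"
      using mult_left_mono[OF profileD(8)[OF pr r(2,3)], of "a powr (p - 1)"] by (simp add: mult_ac)
  }
  fix \<delta> :: real assume "0 < \<delta>"
  then obtain r0 where r0: "0 < r0" "r0 < R" "\<And>r. r0 \<le> r \<Longrightarrow> U r < \<delta>" using profileD(9)[OF pr] by blast
  then show "\<exists>r0. 0 < r0 \<and> r0 < R / a \<and> (\<forall>r\<ge>r0. U (a * r) < \<delta>)"
    using a by (intro exI[of _ "r0 / a"]) (auto simp: field_simps)
next
  have d: "((\<lambda>r. a * r) has_real_derivative a) (at 0)" by (auto intro!: derivative_eq_intros)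
  have "(U has_real_derivative 0) (at (a * 0))" using profileD(10)[OF pr] by simp
  from DERIV_chain2[where g = "\<lambda>r. a * r" and x = 0, OF this d]
  show "((\<lambda>r. U (a * r)) has_real_derivative 0) (at 0)" by simp
qed

section \<open>The upper bound for the Neumann eigenvalue\<close>

text \<open>A name for the set in \<open>mu\<close>, so that its nonemptiness can be stated: lower
  bounds on the infimum depend on it.\<close>

definition neumann_quotients :: "real \<Rightarrow> 'a::euclidean_space set \<Rightarrow> real set" where
  "neumann_quotients p \<Omega> = {(LINT x|lebesgue_on \<Omega>. norm (g x) powr p) / (LINT x|lebesgue_on \<Omega>. \<bar>v x\<bar> powr p) | v g.
     W1p p \<Omega> v g \<and> \<not> (AE x in lebesgue_on \<Omega>. v x = 0) \<and>
     (LINT x|lebesgue_on \<Omega>. \<bar>v x\<bar> powr (p - 2) * v x) = 0}"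

lemma mu_le: "t \<in> neumann_quotients p \<Omega> \<Longrightarrow> mu p \<Omega> \<le> t"
  unfolding mu_def neumann_quotients_def[symmetric]
proof (erule cInf_lower)
  show "bdd_below (neumann_quotients p \<Omega>)"
    by (rule bdd_belowI[of _ 0]) (auto simp: neumann_quotients_def)
qed

text \<open>For disjoint supports, p-th powers of a combination are additive in mass and in energy,
  so a bound \<open>m\<close> on both quotients passes to every combination. This leaves both
  coefficients free for the constraint.\<close>

lemma neumann_quotient_disjoint:
  fixes u1 u2 :: "'a::euclidean_space \<Rightarrow> real"
  assumes \<Omega>: "open \<Omega>" "bounded \<Omega>" and p: "1 < p"
    and u1: "has_gradient u1 g1" "\<And>x. norm (g1 x) \<le> C1" "\<And>x. 0 \<le> u1 x"
    and u2: "has_gradient u2 g2" "\<And>x. norm (g2 x) \<le> C2" "\<And>x. 0 \<le> u2 x"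
    and dis: "\<And>x. u1 x = 0 \<or> u2 x = 0" "\<And>x. g1 x = 0 \<or> g2 x = 0"
    and pos1: "0 < (LINT x|lebesgue_on \<Omega>. u1 x powr p)" and pos2: "0 < (LINT x|lebesgue_on \<Omega>. u2 x powr p)"
    and m1: "(LINT x|lebesgue_on \<Omega>. norm (g1 x) powr p) \<le> m * (LINT x|lebesgue_on \<Omega>. u1 x powr p)"
    and m2: "(LINT x|lebesgue_on \<Omega>. norm (g2 x) powr p) \<le> m * (LINT x|lebesgue_on \<Omega>. u2 x powr p)"
  shows "\<exists>t\<in>neumann_quotients p \<Omega>. t \<le> m"
proof -
  have mc: "f \<in> borel_measurable (lebesgue_on \<Omega>)" and ib: "integrable (lebesgue_on \<Omega>) (\<lambda>x. \<bar>f x\<bar> powr r)"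
    if "has_gradient f g" "0 < r" for f g and r :: real
  proof -
    have c: "continuous_on UNIV f" by (rule has_gradient_continuous[OF that(1)])
    then have m: "f \<in> borel_measurable borel" by (rule borel_measurable_continuous_onI)
    show "f \<in> borel_measurable (lebesgue_on \<Omega>)" by (rule measurable_lebesgue_on[OF m])
    obtain B where B: "\<And>x. x \<in> \<Omega> \<Longrightarrow> norm x \<le> B" using \<Omega>(2) unfolding bounded_iff by blast
    obtain D where D: "\<And>x. norm x \<le> B \<Longrightarrow> norm (f x) \<le> D" using bounded_on_cball[OF c] by blast
    have "f \<in> Lp r \<Omega>" using B D by (intro Lp_bounded[OF \<Omega> m _ that(2)]) blast
    then show "integrable (lebesgue_on \<Omega>) (\<lambda>x. \<bar>f x\<bar> powr r)" by (simp add: Lp_def)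
  qed
  have ig: "integrable (lebesgue_on \<Omega>) (\<lambda>x. norm (g x) powr p)" if "has_gradient f g" "\<And>x. norm (g x) \<le> C" for f g C
    using W1pI[OF \<Omega> that, of p] p by (simp add: W1p_def Lp_def)
  have p1: "0 < p - 1" "0 < p" using p by auto
  have i1: "integrable (lebesgue_on \<Omega>) (\<lambda>x. u1 x powr p)" "integrable (lebesgue_on \<Omega>) (\<lambda>x. u1 x powr (p - 1))"
    using ib[OF u1(1) p1(2)] ib[OF u1(1) p1(1)] u1(3) by auto
  have i2: "integrable (lebesgue_on \<Omega>) (\<lambda>x. u2 x powr p)" "integrable (lebesgue_on \<Omega>) (\<lambda>x. u2 x powr (p - 1))"
    using ib[OF u2(1) p1(2)] ib[OF u2(1) p1(1)] u2(3) by auto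
  note ig1 = ig[OF u1(1,2)] and ig2 = ig[OF u2(1,2)]
  have posm: "0 < (LINT x|lebesgue_on \<Omega>. u x powr (p - 1))"
    if "integrable (lebesgue_on \<Omega>) (\<lambda>x. u x powr (p - 1))" "0 < (LINT x|lebesgue_on \<Omega>. u x powr p)" for u :: "'a \<Rightarrow> real"
  proof -
    have "(LINT x|lebesgue_on \<Omega>. u x powr (p - 1)) \<noteq> 0"
    proof
      assume "(LINT x|lebesgue_on \<Omega>. u x powr (p - 1)) = 0"
      then have "AE x in lebesgue_on \<Omega>. u x powr (p - 1) = 0" using integral_nonneg_eq_0_iff_AE[OF that(1)] by simp
      then have "AE x in lebesgue_on \<Omega>. u x powr p = 0" by eventually_elim simp
      then have "(LINT x|lebesgue_on \<Omega>. u x powr p) = 0" by (rule integral_eq_zero_AE)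
      then show False using that(2) by simp
    qed
    moreover have "0 \<le> (LINT x|lebesgue_on \<Omega>. u x powr (p - 1))" by simp
    ultimately show ?thesis by linarith
  qed
  define I1 where "I1 = (LINT x|lebesgue_on \<Omega>. u1 x powr (p - 1))"
  define I2 where "I2 = (LINT x|lebesgue_on \<Omega>. u2 x powr (p - 1))"
  have I: "0 < I1" "0 < I2" unfolding I1_def I2_def using posm i1 i2 pos1 pos2 by auto
  \<comment> \<open>The constraint reads \<open>a powr (p - 1) * I1 = b powr (p - 1) * I2\<close>,
    solved by swapping the two integrals.\<close>
  define a where "a = I2 powr (1 / (p - 1))"
  define b where "b = I1 powr (1 / (p - 1))"
  have ab: "0 < a" "0 < b" "a powr (p - 1) = I2" "b powr (p - 1) = I1" using I p1 by (auto simp: a_def b_def powr_powr)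
  define v where "v x = a * u1 x - b * u2 x" for x
  define gv where "gv x = a *\<^sub>R g1 x - b *\<^sub>R g2 x" for x
  have hv: "has_gradient v gv" unfolding v_def gv_def by (intro has_gradient_diff has_gradient_cmult u1 u2)
  have gvb: "norm (gv x) \<le> a * C1 + b * C2" for x
  proof -
    have "norm (gv x) \<le> norm (a *\<^sub>R g1 x) + norm (b *\<^sub>R g2 x)" unfolding gv_def by (rule norm_triangle_ineq4)
    also have "\<dots> \<le> a * C1 + b * C2" using ab u1(2) u2(2) by (intro add_mono) (auto intro: mult_left_mono)
    finally show ?thesis .
  qed
  have W: "W1p p \<Omega> v gv" by (rule W1pI[OF \<Omega> hv gvb p1(2)])
  have vp: "\<bar>v x\<bar> powr p = a powr p * u1 x powr p + b powr p * u2 x powr p" for x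
    using dis(1)[of x] ab u1(3)[of x] u2(3)[of x] by (auto simp: v_def abs_mult powr_mult)
  have gp: "norm (gv x) powr p = a powr p * norm (g1 x) powr p + b powr p * norm (g2 x) powr p" for x
    using dis(2)[of x] ab by (auto simp: gv_def powr_mult)
  have vm: "\<bar>v x\<bar> powr (p - 2) * v x = I2 * u1 x powr (p - 1) - I1 * u2 x powr (p - 1)" for x
  proof -
    have sg: "\<bar>t\<bar> powr (p - 2) * t = t powr (p - 1)" if "0 \<le> t" for t
      using abs_powr_mult_self(2)[of t p] that by (simp add: abs_mult)
    show ?thesis
    proof (cases "u2 x = 0")
      case True
      have "\<bar>v x\<bar> powr (p - 2) * v x = (a * u1 x) powr (p - 1)" using sg[of "a * u1 x"] True ab u1(3)[of x] by (simp add: v_def)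
      then show ?thesis using True ab u1(3)[of x] by (simp add: powr_mult)
    next
      case False
      then have u10: "u1 x = 0" using dis(1)[of x] by simp
      have "\<bar>v x\<bar> powr (p - 2) * v x = - (\<bar>b * u2 x\<bar> powr (p - 2) * (b * u2 x))" by (simp add: v_def u10)
      also have "\<dots> = - ((b * u2 x) powr (p - 1))" using sg[of "b * u2 x"] ab u2(3)[of x] by simp
      finally show ?thesis using u10 ab u2(3)[of x] by (simp add: powr_mult)
    qed
  qed
  have c0: "(LINT x|lebesgue_on \<Omega>. \<bar>v x\<bar> powr (p - 2) * v x) = 0"
    unfolding vm using i1 i2 by (simp add: I1_def I2_def)
  have Lv: "(LINT x|lebesgue_on \<Omega>. \<bar>v x\<bar> powr p) = a powr p * (LINT x|lebesgue_on \<Omega>. u1 x powr p) + b powr p * (LINT x|lebesgue_on \<Omega>. u2 x powr p)"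
    unfolding vp using i1 i2 by simp
  have Lg: "(LINT x|lebesgue_on \<Omega>. norm (gv x) powr p) = a powr p * (LINT x|lebesgue_on \<Omega>. norm (g1 x) powr p) + b powr p * (LINT x|lebesgue_on \<Omega>. norm (g2 x) powr p)"
    unfolding gp using ig1 ig2 by simp
  have Lpos: "0 < (LINT x|lebesgue_on \<Omega>. \<bar>v x\<bar> powr p)" unfolding Lv using ab pos1 pos2 by (intro add_pos_pos mult_pos_pos) auto
  have nz: "\<not> (AE x in lebesgue_on \<Omega>. v x = 0)"
  proof
    assume "AE x in lebesgue_on \<Omega>. v x = 0"
    then have "AE x in lebesgue_on \<Omega>. \<bar>v x\<bar> powr p = 0" by eventually_elim simp
    then have "(LINT x|lebesgue_on \<Omega>. \<bar>v x\<bar> powr p) = 0" by (rule integral_eq_zero_AE)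
    then show False using Lpos by simp
  qed
  have "(LINT x|lebesgue_on \<Omega>. norm (gv x) powr p) \<le> m * (LINT x|lebesgue_on \<Omega>. \<bar>v x\<bar> powr p)"
    unfolding Lv Lg using mult_left_mono[OF m1, of "a powr p"] mult_left_mono[OF m2, of "b powr p"]
    by (simp add: algebra_simps)
  then have "(LINT x|lebesgue_on \<Omega>. norm (gv x) powr p) / (LINT x|lebesgue_on \<Omega>. \<bar>v x\<bar> powr p) \<le> m"
    using Lpos by (simp add: pos_divide_le_eq)
  moreover have "(LINT x|lebesgue_on \<Omega>. norm (gv x) powr p) / (LINT x|lebesgue_on \<Omega>. \<bar>v x\<bar> powr p) \<in> neumann_quotients p \<Omega>"
    unfolding neumann_quotients_def using W nz c0 by blast
  ultimately show ?thesis by blast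
qed

text \<open>At a zero of \<open>w\<close> the equation gives the derivative \<open>l > 0\<close>, so
  \<open>w\<close> would be negative just to the left.\<close>

lemma riccati_pos:
  assumes ric: "riccati p N l R w" and p: "1 < p" and l: "0 < l" and r: "0 < r" "r < R"
  shows "0 < w r"
proof (rule ccontr)
  assume "\<not> 0 < w r"
  then have w0: "w r = 0" using riccatiD(2)[OF ric r] by simp
  have "(w has_real_derivative l) (at r)" using riccatiD(3)[OF ric r] w0 p by simp
  then obtain d where d: "0 < d" "\<And>h. 0 < h \<Longrightarrow> h < d \<Longrightarrow> w (r - h) < w r" using DERIV_pos_inc_left[OF _ l] by blast
  define h where "h = min (d / 2) (r / 2)"
  have h: "0 < h" "h < d" "0 < r - h" "r - h < R" using d r by (auto simp: h_def)
  then show False using d(2)[OF h(1,2)] riccatiD(2)[OF ric h(3,4)] w0 by simp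
qed

context trial_domain
begin

lemma Es_integral_le:
  "(LINT x|lborel. indicator S x * Es x) \<le> l * (LINT x|lborel. indicator S x * U (q x) powr p)"
proof -
  have "(LINT x|lborel. indicator S x * Es x) \<le> (LINT x|lborel. indicator S x * (indicator {x. x \<noteq> 0 \<and> q x < R} x * Ed x))"
  proof (rule integral_mono_AE')
    show "integrable lborel (\<lambda>x. indicator S x * (indicator {x. x \<noteq> 0 \<and> q x < R} x * Ed x))"
      by (rule integrable_S[where C = "(l * R) powr (p / (p - 1))"]) (auto simp: indicator_def Ed_nonneg Ed_bound)
    show "AE x in lborel. indicator S x * Es x \<le> indicator S x * (indicator {x. x \<noteq> 0 \<and> q x < R} x * Ed x)"
      by (intro AE_I2 mult_left_mono Es_le) auto
  qed (simp add: Ed_nonneg)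
  then show ?thesis using energy_le by linarith
qed

text \<open>On an open set away from the axis the slope of \<open>q\<close> is strictly below 1
  while \<open>U'\<close> is nonzero, so energy is lost on a set of positive measure.\<close>

lemma Es_integral_less:
  assumes V: "open V" "V \<noteq> {}" "V \<subseteq> S" "\<And>x. x \<in> V \<Longrightarrow> q x < R" "\<And>x. x \<in> V \<Longrightarrow> \<bar>x \<bullet> e\<bar> < q x" and \<kappa>1: "\<kappa> < 1"
  shows "(LINT x|lborel. indicator S x * Es x) < l * (LINT x|lborel. indicator S x * U (q x) powr p)"
proof -
  let ?E = "\<lambda>x. indicator S x * (indicator {x. x \<noteq> 0 \<and> q x < R} x * Ed x)"
  have iE: "integrable lborel ?E"
    by (rule integrable_S[where C = "(l * R) powr (p / (p - 1))"]) (auto simp: indicator_def Ed_nonneg Ed_bound)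
  have iEs: "integrable lborel (\<lambda>x. indicator S x * Es x)"
    by (rule integrable_S[where C = "(l * R) powr (p / (p - 1))"]) (auto simp: Es_nonneg Es_bound)
  have nn: "0 \<le> ?E x - indicator S x * Es x" for x
    using mult_left_mono[OF Es_le[of x], of "indicator S x"] by simp
  have i: "integrable lborel (\<lambda>x. ?E x - indicator S x * Es x)" using iE iEs by simp
  have "(LINT x|lborel. ?E x - indicator S x * Es x) \<noteq> 0"
  proof
    assume "(LINT x|lborel. ?E x - indicator S x * Es x) = 0"
    then have "AE x in lborel. ?E x - indicator S x * Es x = 0"
      using integral_nonneg_eq_0_iff_AE[OF i] nn by simp
    then have "AE x in lborel. x \<notin> V"
    proof eventually_elim
      case (elim x)
      show ?case
      proof
        assume x: "x \<in> V"
        have xS: "x \<in> S" and qR: "q x < R" and xe: "\<bar>x \<bullet> e\<bar> < q x" using V x by auto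
        have x0: "x \<noteq> 0" using xe by (auto simp: q_0)
        have Tx: "T x \<noteq> 0" using x0 by (simp add: T_eq_0)
        have "\<bar>sgn (T x) \<bullet> e\<bar> < norm (sgn (T x))"
          using xe Tx T_e[of x] by (simp add: sgn_div_norm q_def abs_mult field_simps)
        then have "norm (T (sgn (T x))) < norm (sgn (T x))" by (rule norm_T_less[OF \<kappa>1])
        then have "norm (T (sgn (T x))) < 1" using Tx by (simp add: norm_sgn)
        then have lt: "norm (T (sgn (T x))) powr p < 1" using p powr_less_mono2[of p "norm (T (sgn (T x)))" 1] by simp
        have "0 < w (q x)" "0 < U (q x)"
          using riccati_pos[OF ric p l q_pos[OF x0] qR] profileD(6)[OF pr q_pos[OF x0] qR] by auto
        then have "0 < Ed x" by (simp add: Ed_def)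
        then have "Ed x * norm (T (sgn (T x))) powr p < Ed x * 1" using lt by (intro mult_strict_left_mono)
        then show False using elim xS x0 qR lt \<open>0 < Ed x\<close> by (auto simp: Es_def)
      qed
    qed
    then show False using AE_notin_open[OF V(1)] V(2) by blast
  qed
  moreover have "0 \<le> (LINT x|lborel. ?E x - indicator S x * Es x)" using nn by (intro integral_nonneg_AE AE_I2) auto
  moreover have "(LINT x|lborel. ?E x - indicator S x * Es x) = (LINT x|lborel. ?E x) - (LINT x|lborel. indicator S x * Es x)"
    using iE iEs by simp
  ultimately show ?thesis using energy_le by linarith
qed

end

text \<open>One half of the trial function: the radial profile centred at an end point \<open>a\<close> of a diameter, with the
  distance to \<open>a\<close> shrunk orthogonally to the diameter.  The shrinking makes the comparison with the ball strict
  and keeps the support on one side of the midpoint.\<close>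

lemma half_trial:
  fixes \<Omega> :: "'a::euclidean_space set" and a e :: 'a
  assumes \<Omega>: "open \<Omega>" "bounded \<Omega>" "convex \<Omega>" and a: "a \<in> closure \<Omega>" and e: "norm e = 1"
    and p: "1 < p" and l: "0 < l" and R: "0 < R" and ric: "riccati p DIM('a) l R w" and pr: "profile p l R w U"
  shows "\<exists>m. m \<le> l \<and> (2 \<le> DIM('a) \<longrightarrow> m < l) \<and> (\<forall>m'>m. \<exists>u g C. has_gradient u g \<and> (\<forall>x. norm (g x) \<le> C) \<and> (\<forall>x. 0 \<le> u x) \<and>
     (\<forall>x. R \<le> (x - a) \<bullet> e \<longrightarrow> u x = 0 \<and> g x = 0) \<and>
     0 < (LINT x|lebesgue_on \<Omega>. u x powr p) \<and>
     (LINT x|lebesgue_on \<Omega>. norm (g x) powr p) \<le> m' * (LINT x|lebesgue_on \<Omega>. u x powr p))"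
proof -
  have [measurable]: "\<Omega> \<in> sets borel" using \<Omega> by simp
  define S where "S = {x. a + x \<in> \<Omega>}"
  obtain B where B: "\<And>x. x \<in> \<Omega> \<Longrightarrow> norm x \<le> B" using \<Omega>(2) unfolding bounded_iff by blast
  have oS: "open S"
  proof -
    have "S = (\<lambda>x. a + x) -` \<Omega>" by (auto simp: S_def)
    then show ?thesis using open_vimage[OF \<Omega>(1), of "\<lambda>x. a + x"] by (simp add: continuous_intros)
  qed
  \<comment> \<open>The factor 1/2 stands for any fixed contraction strictly between 0 and
    1.\<close>
  interpret trial_domain p l R w U e "1 / 2" S "B + norm a"
  proof unfold_locales
    show "S \<in> sets borel" using oS by simp
    show "norm x \<le> B + norm a" if "x \<in> S" for x
      using B[of "a + x"] that norm_triangle_ineq4[of "a + x" a] by (simp add: S_def)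
    show "s *\<^sub>R x \<in> S" if x: "x \<in> S" and s: "0 < s" "s \<le> 1" for x s
    proof (cases "s = 1 \<or> x = 0")
      case False
      \<comment> \<open>The centre lies only in the closure, but the open segment from an interior
        point to a closure point of a convex set stays in the interior.\<close>
      have "a + s *\<^sub>R x \<in> open_segment (a + x) a"
        unfolding in_segment using False s by (intro conjI exI[of _ "1 - s"]) (auto simp: algebra_simps)
      moreover have "open_segment (a + x) a \<subseteq> interior \<Omega>"
        using x \<Omega> by (intro in_interior_closure_convex_segment[OF \<Omega>(3) _ a]) (simp add: S_def interior_open)
      ultimately show ?thesis using interior_subset by (auto simp: S_def)
    qed (use x in auto)
  qed (use p l R ric pr e in auto)
  define L where "L = (LINT x|lborel. indicator S x * U (q x) powr p)"
  define V where "V = S \<inter> {x. q x < R}"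
  have oV: "open V" unfolding V_def using oS q_continuous by (intro open_Int open_Collect_less continuous_intros)
  have V0: "V \<noteq> {}"
  proof -
    obtain y where y: "y \<in> \<Omega>" "dist y a < R" using a R unfolding closure_approachable by blast
    have "q (y - a) \<le> norm (y - a)" unfolding q_def by (rule norm_T_le)
    then have "y - a \<in> V" using y by (simp add: V_def S_def dist_norm)
    then show ?thesis by blast
  qed
  have Lpos: "0 < L" unfolding L_def by (rule mass_pos[OF oV V0]) (auto simp: V_def)
  define m where "m = (LINT x|lborel. indicator S x * Es x) / L"
  have ml: "m \<le> l" unfolding m_def using Es_integral_le Lpos by (simp add: pos_divide_le_eq L_def)
  have mls: "m < l" if dim: "2 \<le> DIM('a)"
  proof -
    define V' where "V' = V \<inter> {x. \<bar>x \<bullet> e\<bar> < q x}"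
    have oV': "open V'" unfolding V'_def using oV q_continuous by (intro open_Int open_Collect_less continuous_intros)
    have "V' \<noteq> {}"
    proof -
      obtain y where y: "y \<in> V" using V0 by blast
      show ?thesis
      proof (cases "\<bar>y \<bullet> e\<bar> < q y")
        case True
        then show ?thesis using y by (auto simp: V'_def)
      next
        case False
        then have qe: "q y = \<bar>y \<bullet> e\<bar>" using q_ge[of y] by simp
        \<comment> \<open>If the shrunken distance equals the axial coordinate, \<open>T y\<close>
          is parallel to \<open>e\<close>. A small move orthogonal to \<open>e\<close> keeps the
          axial coordinate and increases \<open>q\<close>; this is where dimension at least 2
          enters.\<close>
        have "(norm (T y - (y \<bullet> e) *\<^sub>R e))\<^sup>2 = (norm (T y))\<^sup>2 - (y \<bullet> e)\<^sup>2"
          unfolding power2_norm_eq_inner using T_e[of y] ee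
          by (simp add: inner_diff_left inner_diff_right inner_commute power2_eq_square)
        also have "\<dots> = 0" using qe by (simp add: q_def)
        finally have Ty: "T y = (y \<bullet> e) *\<^sub>R e" by simp
        obtain b where b: "b \<noteq> 0" "orthogonal e b" using orthogonal_to_vector_exists[OF dim, of e] by blast
        have be: "b \<bullet> e = 0" using b(2) by (simp add: orthogonal_def inner_commute)
        obtain d where d: "0 < d" "ball y d \<subseteq> V" using oV y open_contains_ball by blast
        define t where "t = d / (2 * norm b)"
        have t: "0 < t" "t * norm b < d" using d b by (auto simp: t_def)
        define z where "z = y + t *\<^sub>R b"
        have zV: "z \<in> V" using d t by (auto simp: z_def dist_norm)
        have ze: "z \<bullet> e = y \<bullet> e" by (simp add: z_def inner_add_left be)
        have "T z = (y \<bullet> e) *\<^sub>R e + (t / 2) *\<^sub>R b"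
        proof -
          have "T z = T y + (t / 2) *\<^sub>R b" by (simp add: T_def z_def inner_add_left be algebra_simps)
          then show ?thesis using Ty by simp
        qed
        then have "(q z)\<^sup>2 = (y \<bullet> e)\<^sup>2 + (t / 2)\<^sup>2 * (b \<bullet> b)"
          unfolding q_def power2_norm_eq_inner using be ee
          by (simp add: inner_add_left inner_add_right inner_commute[of e b] power2_eq_square)
        moreover have "0 < (t / 2)\<^sup>2 * (b \<bullet> b)" using t b by (intro mult_pos_pos) auto
        ultimately have "\<bar>z \<bullet> e\<bar>\<^sup>2 < (q z)\<^sup>2" using ze by simp
        then have "\<bar>z \<bullet> e\<bar> < q z" using q_nonneg by (rule power2_less_imp_less)
        then show ?thesis using zV by (auto simp: V'_def)
      qed
    qed
    then have "(LINT x|lborel. indicator S x * Es x) < l * L" unfolding L_def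
      by (intro Es_integral_less[OF oV']) (auto simp: V'_def V_def)
    then show ?thesis unfolding m_def using Lpos by (simp add: pos_divide_less_eq)
  qed
  have "\<exists>u g C. has_gradient u g \<and> (\<forall>x. norm (g x) \<le> C) \<and> (\<forall>x. 0 \<le> u x) \<and>
     (\<forall>x. R \<le> (x - a) \<bullet> e \<longrightarrow> u x = 0 \<and> g x = 0) \<and>
     0 < (LINT x|lebesgue_on \<Omega>. u x powr p) \<and>
     (LINT x|lebesgue_on \<Omega>. norm (g x) powr p) \<le> m' * (LINT x|lebesgue_on \<Omega>. u x powr p)" if m': "m < m'" for m'
  proof -
    have "(LINT x|lborel. indicator S x * Es x) < m' * L" using m' Lpos by (simp add: m_def pos_divide_less_eq)
    then obtain \<delta> where \<delta>: "0 < \<delta>" "0 < (LINT x|lborel. indicator S x * f \<delta> x powr p)"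
      "(LINT x|lborel. indicator S x * norm (gf \<delta> x) powr p) \<le> m' * (LINT x|lborel. indicator S x * f \<delta> x powr p)"
      using trial_quotient[OF Lpos[unfolded L_def], of m'] unfolding L_def by blast
    have fg: "has_gradient (f \<delta>) (gf \<delta>)" by (rule f_has_gradient[OF \<delta>(1)])
    have [measurable]: "f \<delta> \<in> borel_measurable borel" "gf \<delta> \<in> borel_measurable borel"
      using has_gradient_continuous[OF fg] has_gradient_measurable[OF fg]
      by (auto intro: borel_measurable_continuous_onI)
    define u where "u x = f \<delta> (- a + 1 *\<^sub>R x)" for x
    define g where "g x = 1 *\<^sub>R gf \<delta> (- a + 1 *\<^sub>R x)" for x
    have ug: "has_gradient u g" unfolding u_def g_def by (rule has_gradient_affine[OF fg])
    have [measurable]: "u \<in> borel_measurable borel" "g \<in> borel_measurable borel"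
      unfolding u_def g_def by measurable
    have ind: "indicator S (- a + 1 *\<^sub>R x) = (indicator \<Omega> x :: real)" for x by (simp add: S_def indicator_def)
    have iu: "(LINT x|lebesgue_on \<Omega>. u x powr p) = (LINT x|lborel. indicator S x * f \<delta> x powr p)"
    proof -
      have "(LINT x|lebesgue_on \<Omega>. u x powr p) = (LINT x|lborel. indicator \<Omega> x *\<^sub>R (u x powr p))"
        by (rule integral_lebesgue_on_borel) auto
      also have "\<dots> = (LINT x|lborel. indicator S (- a + 1 *\<^sub>R x) * f \<delta> (- a + 1 *\<^sub>R x) powr p)"
        unfolding ind u_def by simp
      also have "\<dots> = (LINT x|lborel. indicator S x * f \<delta> x powr p)"
        by (subst integral_lborel_affine[of "\<lambda>x. indicator S x * f \<delta> x powr p"]) auto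
      finally show ?thesis .
    qed
    have ig: "(LINT x|lebesgue_on \<Omega>. norm (g x) powr p) = (LINT x|lborel. indicator S x * norm (gf \<delta> x) powr p)"
    proof -
      have "(LINT x|lebesgue_on \<Omega>. norm (g x) powr p) = (LINT x|lborel. indicator \<Omega> x *\<^sub>R (norm (g x) powr p))"
        by (rule integral_lebesgue_on_borel) auto
      also have "\<dots> = (LINT x|lborel. indicator S (- a + 1 *\<^sub>R x) * norm (gf \<delta> (- a + 1 *\<^sub>R x)) powr p)"
        unfolding ind g_def by simp
      also have "\<dots> = (LINT x|lborel. indicator S x * norm (gf \<delta> x) powr p)"
        by (subst integral_lborel_affine[of "\<lambda>x. indicator S x * norm (gf \<delta> x) powr p"]) auto
      finally show ?thesis .
    qed
    have z: "u x = 0 \<and> g x = 0" if "R \<le> (x - a) \<bullet> e" for x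
    proof -
      have "R \<le> q (- a + 1 *\<^sub>R x)" using q_ge[of "- a + 1 *\<^sub>R x"] that by simp
      then show ?thesis using f_zero[OF \<delta>(1)] by (simp add: u_def g_def gf_def)
    qed
    have gb: "norm (g x) \<le> (l * R) powr (1 / (p - 1))" for x using gf_bounded[OF \<delta>(1)] by (simp add: g_def)
    have u0: "0 \<le> u x" for x using f_bounds[OF \<delta>(1)] by (simp add: u_def)
    show ?thesis using ug gb u0 z \<delta>(2,3) unfolding iu[symmetric] ig[symmetric] by blast
  qed
  then show ?thesis using ml mls by blast
qed

text \<open>A diameter is attained on the closure, and each of its end points carries a half trial
  function of radius half the diameter. In dimension one only the weak inequality results, which
  still serves the sharpness statement.\<close>

lemma neumann_upper:
  fixes \<Omega> :: "'a::euclidean_space set"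
  assumes \<Omega>: "open \<Omega>" "bounded \<Omega>" "convex \<Omega>" "\<Omega> \<noteq> {}" and p: "1 < p" and l: "0 < l"
    and ric: "riccati p DIM('a) l (diameter \<Omega> / 2) w" and pr: "profile p l (diameter \<Omega> / 2) w U"
  shows "neumann_quotients p \<Omega> \<noteq> {}" "mu p \<Omega> \<le> l" "2 \<le> DIM('a) \<Longrightarrow> mu p \<Omega> < l"
proof -
  define d where "d = diameter \<Omega>"
  obtain y r where yr: "0 < r" "ball y r \<subseteq> \<Omega>" using \<Omega>(1,4) open_contains_ball by blast
  have "diameter (ball y r) \<le> diameter \<Omega>" by (rule diameter_subset[OF yr(2) \<Omega>(2)])
  then have d0: "0 < d" using yr(1) by (simp add: d_def)
  have "compact (closure \<Omega>)" "closure \<Omega> \<noteq> {}" using \<Omega> by auto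
  then obtain a b where ab: "a \<in> closure \<Omega>" "b \<in> closure \<Omega>" "dist a b = d"
    using diameter_compact_attained[of "closure \<Omega>"] diameter_closure[OF \<Omega>(2)] unfolding d_def by auto
  define e where "e = (1 / d) *\<^sub>R (b - a)"
  have e: "norm e = 1" using ab(3) d0 by (simp add: e_def dist_norm norm_minus_commute)
  have e': "norm (- e) = 1" using e by simp
  have bae: "(b - a) \<bullet> e = d"
    using ab(3) d0 by (simp add: e_def dist_norm norm_minus_commute dot_square_norm power2_eq_square)
  have R: "0 < d / 2" using d0 by simp
  note ric' = ric[folded d_def] and pr' = pr[folded d_def]
  obtain m1 where m1: "m1 \<le> l" "2 \<le> DIM('a) \<Longrightarrow> m1 < l" "\<And>m'. m1 < m' \<Longrightarrow> \<exists>u g C. has_gradient u g \<and> (\<forall>x. norm (g x) \<le> C) \<and> (\<forall>x. 0 \<le> u x) \<and>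
     (\<forall>x. d / 2 \<le> (x - a) \<bullet> e \<longrightarrow> u x = 0 \<and> g x = 0) \<and> 0 < (LINT x|lebesgue_on \<Omega>. u x powr p) \<and>
     (LINT x|lebesgue_on \<Omega>. norm (g x) powr p) \<le> m' * (LINT x|lebesgue_on \<Omega>. u x powr p)"
    using half_trial[OF \<Omega>(1-3) ab(1) e p l R ric' pr'] by blast
  obtain m2 where m2: "m2 \<le> l" "2 \<le> DIM('a) \<Longrightarrow> m2 < l" "\<And>m'. m2 < m' \<Longrightarrow> \<exists>u g C. has_gradient u g \<and> (\<forall>x. norm (g x) \<le> C) \<and> (\<forall>x. 0 \<le> u x) \<and>
     (\<forall>x. d / 2 \<le> (x - b) \<bullet> (- e) \<longrightarrow> u x = 0 \<and> g x = 0) \<and> 0 < (LINT x|lebesgue_on \<Omega>. u x powr p) \<and>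
     (LINT x|lebesgue_on \<Omega>. norm (g x) powr p) \<le> m' * (LINT x|lebesgue_on \<Omega>. u x powr p)"
    using half_trial[OF \<Omega>(1-3) ab(2) e' p l R ric' pr'] by blast
  have main: "\<exists>t\<in>neumann_quotients p \<Omega>. t \<le> m'" if m': "m1 < m'" "m2 < m'" for m'
  proof -
    obtain u1 g1 C1 where u1: "has_gradient u1 g1" "\<And>x. norm (g1 x) \<le> C1" "\<And>x. 0 \<le> u1 x"
      and s1: "\<And>x. d / 2 \<le> (x - a) \<bullet> e \<Longrightarrow> u1 x = 0 \<and> g1 x = 0" and p1: "0 < (LINT x|lebesgue_on \<Omega>. u1 x powr p)"
      and e1: "(LINT x|lebesgue_on \<Omega>. norm (g1 x) powr p) \<le> m' * (LINT x|lebesgue_on \<Omega>. u1 x powr p)"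
      using m1(3)[OF m'(1)] by blast
    obtain u2 g2 C2 where u2: "has_gradient u2 g2" "\<And>x. norm (g2 x) \<le> C2" "\<And>x. 0 \<le> u2 x"
      and s2: "\<And>x. d / 2 \<le> (x - b) \<bullet> (- e) \<Longrightarrow> u2 x = 0 \<and> g2 x = 0" and p2: "0 < (LINT x|lebesgue_on \<Omega>. u2 x powr p)"
      and e2: "(LINT x|lebesgue_on \<Omega>. norm (g2 x) powr p) \<le> m' * (LINT x|lebesgue_on \<Omega>. u2 x powr p)"
      using m2(3)[OF m'(2)] by blast
    \<comment> \<open>The two axial coordinates add up to \<open>d\<close>, so at every point one of
      them is at least \<open>d / 2\<close> and the function belonging to it vanishes together with
      its gradient.\<close>
    have alt: "d / 2 \<le> (x - a) \<bullet> e \<or> d / 2 \<le> (x - b) \<bullet> (- e)" for x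
      using bae by (auto simp: inner_diff_left)
    show ?thesis
      by (rule neumann_quotient_disjoint[OF \<Omega>(1,2) p u1 u2 _ _ p1 p2 e1 e2]) (use alt s1 s2 in blast)+
  qed
  show "neumann_quotients p \<Omega> \<noteq> {}" using main[of "l + 1"] m1(1) m2(1) by auto
  show "mu p \<Omega> \<le> l"
  proof (rule dense_ge)
    fix m' assume "l < m'"
    then obtain t where "t \<in> neumann_quotients p \<Omega>" "t \<le> m'" using main[of m'] m1(1) m2(1) by auto
    then show "mu p \<Omega> \<le> m'" using mu_le by (meson order_trans)
  qed
  assume dim: "2 \<le> DIM('a)"
  define m' where "m' = (max m1 m2 + l) / 2"
  have "m1 < m'" "m2 < m'" "m' < l" using m1(2)[OF dim] m2(2)[OF dim] by (auto simp: m'_def max_def)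
  then obtain t where "t \<in> neumann_quotients p \<Omega>" "t \<le> m'" using main[of m'] by auto
  then show "mu p \<Omega> < l" using mu_le[of t p \<Omega>] \<open>m' < l\<close> by linarith
qed

section \<open>Thin double cones\<close>

lemma powr_difference_le_segment:
  fixes v :: "'a::euclidean_space \<Rightarrow> real"
  assumes p: "1 < p" and v: "has_gradient v g" "continuous_on UNIV g" and D: "norm (y - x) \<le> D"
  shows "\<bar>v y - v x\<bar> powr p \<le> D powr p * (LINT t|lborel. indicator {0..1} t * norm (g ((1 - t) *\<^sub>R x + t *\<^sub>R y)) powr p)"
proof -
  have D0: "0 \<le> D" using D norm_ge_zero order_trans by blast
  have eq: "(1 - t) *\<^sub>R x + t *\<^sub>R y = x + t *\<^sub>R (y - x)" for t by (simp add: algebra_simps)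
  define F where "F t = g (x + t *\<^sub>R (y - x)) \<bullet> (y - x)" for t
  have gc: "continuous_on UNIV (\<lambda>t. g (x + t *\<^sub>R (y - x)))"
    by (intro continuous_on_compose2[OF v(2)] continuous_intros) auto
  have Fc: "continuous_on UNIV F" unfolding F_def by (intro continuous_intros gc)
  have 1: "(LINT t|lborel. F t * indicator {0..1} t) = v (x + 1 *\<^sub>R (y - x)) - v (x + 0 *\<^sub>R (y - x))"
    by (rule integral_FTC_Icc_real) (use has_gradient_line[OF v(1)] Fc in \<open>auto simp: F_def continuous_on_eq_continuous_at\<close>)
  have int: "integrable lborel (\<lambda>t. indicator {0..1} t * h t)" if "continuous_on UNIV h" for h :: "real \<Rightarrow> real"
    using borel_integrable_compact[of "{0..1::real}" h] continuous_on_subset[OF that] by simp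
  have "\<bar>v y - v x\<bar> powr p = norm (LINT t|lborel. indicator {0..1} t *\<^sub>R F t) powr p"
    using 1 by (simp add: mult.commute)
  also have "\<dots> \<le> (LINT t|lborel. indicator {0..1} t * norm (F t) powr p)"
  proof (rule powr_norm_integral_le[OF p])
    show "integrable lborel (\<lambda>t. indicator {0..1} t * norm (F t))" by (intro int continuous_intros Fc)
    show "integrable lborel (\<lambda>t. indicator {0..1} t * norm (F t) powr p)"
      using p by (intro int continuous_on_powr' continuous_intros Fc) auto
  qed auto
  also have "\<dots> \<le> (LINT t|lborel. indicator {0..1} t * (D powr p * norm (g (x + t *\<^sub>R (y - x))) powr p))"
  proof (rule integral_mono)
    show "integrable lborel (\<lambda>t. indicator {0..1} t * norm (F t) powr p)"
      using p by (intro int continuous_on_powr' continuous_intros Fc) auto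
    show "integrable lborel (\<lambda>t. indicator {0..1} t * (D powr p * norm (g (x + t *\<^sub>R (y - x))) powr p))"
      using p by (intro int continuous_on_powr' continuous_intros gc) auto
    fix t
    have "norm (F t) \<le> norm (g (x + t *\<^sub>R (y - x))) * D"
      unfolding F_def using Cauchy_Schwarz_ineq2 D by (intro order_trans[OF Cauchy_Schwarz_ineq2[unfolded real_norm_def[symmetric]]] mult_left_mono) auto
    then have "norm (F t) powr p \<le> (D * norm (g (x + t *\<^sub>R (y - x)))) powr p"
      using p by (intro powr_mono2) (auto simp: mult.commute)
    also have "\<dots> = D powr p * norm (g (x + t *\<^sub>R (y - x))) powr p" using D0 by (simp add: powr_mult)
    finally show "indicator {0..1} t * norm (F t) powr p \<le> indicator {0..1} t * (D powr p * norm (g (x + t *\<^sub>R (y - x))) powr p)"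
      by (intro mult_left_mono) auto
  qed
  also have "\<dots> = D powr p * (LINT t|lborel. indicator {0..1} t * norm (g (x + t *\<^sub>R (y - x))) powr p)"
    by (simp flip: integral_mult_right_zero add: mult_ac)
  finally show ?thesis unfolding eq .
qed

text \<open>After Fubini, for \<open>t \<le> 1/2\<close> one substitutes in \<open>x\<close> and for \<open>t \<ge> 1/2\<close> in \<open>y\<close>, so that the Jacobian is at
  most \<open>2 ^ DIM\<close>.\<close>

lemma segment_average_le:
  fixes h :: "'a::euclidean_space \<Rightarrow> ennreal"
  assumes [measurable]: "h \<in> borel_measurable borel" "L \<in> sets borel" and t: "0 \<le> t" "t \<le> 1"
  shows "(\<integral>\<^sup>+x. (\<integral>\<^sup>+y. indicator L x * indicator L y * h ((1 - t) *\<^sub>R x + t *\<^sub>R y) \<partial>lborel) \<partial>lborel)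
    \<le> ennreal (2 ^ DIM('a)) * emeasure lborel L * (\<integral>\<^sup>+z. h z \<partial>lborel)"
proof -
  let ?J = "\<integral>\<^sup>+z. h z \<partial>lborel" and ?N = "DIM('a)"
  have sub: "(\<integral>\<^sup>+x. h (a + s *\<^sub>R x) \<partial>lborel) \<le> ennreal (2 ^ ?N) * ?J" if s: "1 / 2 \<le> s" for a :: 'a and s
  proof -
    have "(\<integral>\<^sup>+x. h (a + s *\<^sub>R x) \<partial>lborel) = ennreal (1 / \<bar>s\<bar> ^ ?N) * ?J"
      using s by (intro nn_integral_lborel_affine) auto
    also have "\<dots> \<le> ennreal (2 ^ ?N) * ?J"
    proof (rule mult_right_mono[OF ennreal_leI])
      have "(1 / s) ^ ?N \<le> 2 ^ ?N" using s by (intro power_mono) (auto simp: field_simps)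
      then show "1 / \<bar>s\<bar> ^ ?N \<le> 2 ^ ?N" using s by (simp add: power_one_over)
    qed simp
    finally show ?thesis .
  qed
  show ?thesis
  proof (cases "t \<le> 1 / 2")
    case True
    have "(\<integral>\<^sup>+x. (\<integral>\<^sup>+y. indicator L x * indicator L y * h ((1 - t) *\<^sub>R x + t *\<^sub>R y) \<partial>lborel) \<partial>lborel)
        = (\<integral>\<^sup>+y. (\<integral>\<^sup>+x. indicator L x * indicator L y * h ((1 - t) *\<^sub>R x + t *\<^sub>R y) \<partial>lborel) \<partial>lborel)"
      by (rule lborel_pair.Fubini') measurable
    also have "\<dots> \<le> (\<integral>\<^sup>+y. indicator L y * (ennreal (2 ^ ?N) * ?J) \<partial>lborel)"
    proof (rule nn_integral_mono)
      fix y
      have "(\<integral>\<^sup>+x. indicator L x * indicator L y * h ((1 - t) *\<^sub>R x + t *\<^sub>R y) \<partial>lborel)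
          \<le> (\<integral>\<^sup>+x. indicator L y * h (t *\<^sub>R y + (1 - t) *\<^sub>R x) \<partial>lborel)"
        by (intro nn_integral_mono) (auto simp: indicator_def add.commute)
      also have "\<dots> = indicator L y * (\<integral>\<^sup>+x. h (t *\<^sub>R y + (1 - t) *\<^sub>R x) \<partial>lborel)"
        by (rule nn_integral_cmult) measurable
      also have "\<dots> \<le> indicator L y * (ennreal (2 ^ ?N) * ?J)"
        using True by (intro mult_left_mono sub) auto
      finally show "(\<integral>\<^sup>+x. indicator L x * indicator L y * h ((1 - t) *\<^sub>R x + t *\<^sub>R y) \<partial>lborel)
          \<le> indicator L y * (ennreal (2 ^ ?N) * ?J)" .
    qed
    also have "\<dots> = emeasure lborel L * (ennreal (2 ^ ?N) * ?J)" by (simp add: nn_integral_multc)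
    finally show ?thesis by (simp add: mult_ac)
  next
    case False
    have "(\<integral>\<^sup>+x. (\<integral>\<^sup>+y. indicator L x * indicator L y * h ((1 - t) *\<^sub>R x + t *\<^sub>R y) \<partial>lborel) \<partial>lborel)
        \<le> (\<integral>\<^sup>+x. indicator L x * (ennreal (2 ^ ?N) * ?J) \<partial>lborel)"
    proof (rule nn_integral_mono)
      fix x
      have "(\<integral>\<^sup>+y. indicator L x * indicator L y * h ((1 - t) *\<^sub>R x + t *\<^sub>R y) \<partial>lborel)
          \<le> (\<integral>\<^sup>+y. indicator L x * h ((1 - t) *\<^sub>R x + t *\<^sub>R y) \<partial>lborel)"
        by (intro nn_integral_mono) (auto simp: indicator_def)
      also have "\<dots> = indicator L x * (\<integral>\<^sup>+y. h ((1 - t) *\<^sub>R x + t *\<^sub>R y) \<partial>lborel)"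
        by (rule nn_integral_cmult) measurable
      also have "\<dots> \<le> indicator L x * (ennreal (2 ^ ?N) * ?J)"
        using False by (intro mult_left_mono sub) auto
      finally show "(\<integral>\<^sup>+y. indicator L x * indicator L y * h ((1 - t) *\<^sub>R x + t *\<^sub>R y) \<partial>lborel)
          \<le> indicator L x * (ennreal (2 ^ ?N) * ?J)" .
    qed
    also have "\<dots> = emeasure lborel L * (ennreal (2 ^ ?N) * ?J)" by (simp add: nn_integral_multc)
    finally show ?thesis by (simp add: mult_ac)
  qed
qed

text \<open>The constant \<open>c\<close> is the mean of \<open>v\<close>. Jensen's inequality
  reduces to differences \<open>v x - v y\<close>, which are integrals of the gradient along
  segments inside the convex set, and averaging over all segments costs \<open>2 ^ DIM('a)\<close>.
  What matters later is the scaling with \<open>D powr p\<close>, not the sharpness of the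
  constant.\<close>

lemma poincare_convex:
  fixes v :: "'a::euclidean_space \<Rightarrow> real"
  assumes p: "1 < p" and v: "has_gradient v g" "continuous_on UNIV g"
    and L: "open L" "convex L" "bounded L" "L \<noteq> {}" and D: "\<And>x y. x \<in> L \<Longrightarrow> y \<in> L \<Longrightarrow> norm (y - x) \<le> D"
  shows "\<exists>c. (LINT x|lborel. indicator L x * \<bar>v x - c\<bar> powr p)
    \<le> 2 ^ DIM('a) * D powr p * (LINT x|lborel. indicator L x * norm (g x) powr p)"
proof -
  have [measurable]: "L \<in> sets borel" using L by simp
  have vc: "continuous_on UNIV v" by (rule has_gradient_continuous[OF v(1)])
  note [measurable] = borel_measurable_continuous_onI[OF vc] borel_measurable_continuous_onI[OF v(2)]
  obtain B where B: "\<And>x. x \<in> L \<Longrightarrow> norm x \<le> B" using L(3) unfolding bounded_iff by blast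
  have int: "integrable lborel (\<lambda>x. indicator L x * h x)" if hc: "continuous_on UNIV h" for h :: "'a \<Rightarrow> real"
  proof -
    obtain C where C: "0 \<le> C" "\<And>x. norm x \<le> B \<Longrightarrow> norm (h x) \<le> C" using bounded_on_cball[OF hc] by blast
    note [measurable] = borel_measurable_continuous_onI[OF hc]
    show ?thesis
    proof (rule integrable_bounded_support[where B = B and C = C])
      fix x
      show "norm (indicator L x * h x) \<le> C" if "norm x \<le> B" using C that by (simp add: indicator_def)
      show "indicator L x * h x = 0" if "B < norm x" using B[of x] that by (cases "x \<in> L") auto
    qed measurable
  qed
  define m where "m = measure lborel L"
  have fin: "emeasure lborel L \<noteq> \<infinity>"
  proof -
    have "emeasure lborel L \<le> emeasure lborel (cball (0::'a) B)" using B by (intro emeasure_mono) auto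
    then show ?thesis using emeasure_lborel_cball_finite[of "0::'a" B] by (auto simp: top_unique)
  qed
  have em: "emeasure lborel L = ennreal m" unfolding m_def using fin by (simp add: emeasure_eq_ennreal_measure)
  have m0: "0 < m"
  proof -
    have "m \<noteq> 0"
    proof
      assume "m = 0"
      then have "emeasure lborel L = 0" using em by simp
      then have "AE x in lborel. x \<notin> L" by (intro AE_not_in) (auto simp: null_sets_def)
      then show False using AE_notin_open[OF L(1)] L(4) by blast
    qed
    then show ?thesis by (simp add: m_def order_less_le)
  qed
  have i1: "integrable lborel (indicator L :: 'a \<Rightarrow> real)" using fin by (intro integrable_real_indicator) (auto simp: less_top)
  define \<eta> where "\<eta> y = indicator L y / m" for y
  have \<eta>: "\<And>y. 0 \<le> \<eta> y" "integrable lborel \<eta>" "(LINT y|lborel. \<eta> y) = 1"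
  proof -
    show "0 \<le> \<eta> y" for y using m0 by (simp add: \<eta>_def)
    have e: "\<eta> = (\<lambda>y. indicator L y / m)" by (auto simp: \<eta>_def)
    show "integrable lborel \<eta>" unfolding e using i1 by (rule integrable_divide)
    have "(LINT y|lborel. \<eta> y) = (LINT y|lborel. indicator L y :: real) / m" unfolding e by simp
    also have "(LINT y|lborel. indicator L y :: real) = m" by (simp add: m_def)
    finally show "(LINT y|lborel. \<eta> y) = 1" using m0 by simp
  qed
  define c where "c = (LINT y|lborel. \<eta> y * v y)"
  define J where "J = (LINT x|lborel. indicator L x * norm (g x) powr p)"
  have J0: "0 \<le> J" unfolding J_def by (intro integral_nonneg_AE AE_I2) auto
  define h where "h z = indicator L z * norm (g z) powr p" for z
  have [measurable]: "h \<in> borel_measurable borel" unfolding h_def by measurable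
  have iJ: "integrable lborel h" unfolding h_def using p by (intro int continuous_on_powr' continuous_intros v(2)) auto
  have nJ: "(\<integral>\<^sup>+z. ennreal (h z) \<partial>lborel) = ennreal J"
    unfolding J_def h_def[symmetric] by (rule nn_integral_eq_integral[OF iJ]) (auto simp: h_def)
  have cdiff: "v x - c = (LINT y|lborel. \<eta> y *\<^sub>R (v x - v y))" for x
  proof -
    have "integrable lborel (\<lambda>y. \<eta> y * v y)" using int[OF vc] by (simp add: \<eta>_def)
    then show ?thesis using \<eta> by (simp add: c_def right_diff_distrib)
  qed
  have D0: "0 \<le> D"
  proof -
    obtain x where "x \<in> L" using L by blast
    then show ?thesis using D[of x x] by simp
  qed
  have st1: "ennreal (indicator L x * \<bar>v x - c\<bar> powr p)
      \<le> ennreal (D powr p / m) * (\<integral>\<^sup>+y. (\<integral>\<^sup>+t. indicator {0..1} t * (indicator L x * indicator L y * ennreal (h ((1 - t) *\<^sub>R x + t *\<^sub>R y))) \<partial>lborel) \<partial>lborel)" for x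
  proof (cases "x \<in> L")
    case True
    have ii: "integrable lborel (\<lambda>y. \<eta> y * norm (v x - v y))" "integrable lborel (\<lambda>y. \<eta> y * norm (v x - v y) powr p)"
    proof -
      have "continuous_on UNIV (\<lambda>y. norm (v x - v y) / m)" "continuous_on UNIV (\<lambda>y. norm (v x - v y) powr p / m)"
        using p m0 by (intro continuous_intros continuous_on_powr' vc; auto)+
      from int[OF this(1)] int[OF this(2)]
      show "integrable lborel (\<lambda>y. \<eta> y * norm (v x - v y))" "integrable lborel (\<lambda>y. \<eta> y * norm (v x - v y) powr p)"
        by (simp_all add: \<eta>_def)
    qed
    have "\<bar>v x - c\<bar> powr p \<le> (LINT y|lborel. \<eta> y * norm (v x - v y) powr p)"
      unfolding cdiff using powr_norm_integral_le[OF p \<eta> ii] by simp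
    then have "ennreal (indicator L x * \<bar>v x - c\<bar> powr p) \<le> ennreal (LINT y|lborel. \<eta> y * norm (v x - v y) powr p)"
      using True by (simp add: ennreal_leI)
    also have "\<dots> = (\<integral>\<^sup>+y. ennreal (\<eta> y * norm (v x - v y) powr p) \<partial>lborel)"
      by (rule nn_integral_eq_integral[OF ii(2), symmetric]) (auto simp: \<eta>)
    also have "\<dots> \<le> (\<integral>\<^sup>+y. ennreal (D powr p / m) * (\<integral>\<^sup>+t. indicator {0..1} t * (indicator L x * indicator L y * ennreal (h ((1 - t) *\<^sub>R x + t *\<^sub>R y))) \<partial>lborel) \<partial>lborel)"
    proof (rule nn_integral_mono)
      fix y
      show "ennreal (\<eta> y * norm (v x - v y) powr p)
        \<le> ennreal (D powr p / m) * (\<integral>\<^sup>+t. indicator {0..1} t * (indicator L x * indicator L y * ennreal (h ((1 - t) *\<^sub>R x + t *\<^sub>R y))) \<partial>lborel)"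
      proof (cases "y \<in> L")
        case y: True
        let ?G = "\<lambda>t. indicator {0..1} t * norm (g ((1 - t) *\<^sub>R x + t *\<^sub>R y)) powr p"
        have Gc: "continuous_on UNIV (\<lambda>t. norm (g ((1 - t) *\<^sub>R x + t *\<^sub>R y)) powr p)"
          using p by (intro continuous_on_powr' continuous_intros continuous_on_compose2[OF v(2)]) auto
        have Gi: "integrable lborel ?G"
          using borel_integrable_compact[of "{0..1::real}" "\<lambda>t. norm (g ((1 - t) *\<^sub>R x + t *\<^sub>R y)) powr p"] continuous_on_subset[OF Gc] by simp
        have "norm (v x - v y) powr p \<le> D powr p * (LINT t|lborel. ?G t)"
          using powr_difference_le_segment[OF p v D[OF True y]] by (simp add: abs_minus_commute)
        then have "\<eta> y * norm (v x - v y) powr p \<le> D powr p / m * (LINT t|lborel. ?G t)"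
          using y m0 by (simp add: \<eta>_def divide_right_mono)
        then have "ennreal (\<eta> y * norm (v x - v y) powr p) \<le> ennreal (D powr p / m * (LINT t|lborel. ?G t))" by (rule ennreal_leI)
        also have "\<dots> = ennreal (D powr p / m) * ennreal (LINT t|lborel. ?G t)" using m0 by (intro ennreal_mult') auto
        also have "ennreal (LINT t|lborel. ?G t) = (\<integral>\<^sup>+t. ennreal (?G t) \<partial>lborel)"
          by (rule nn_integral_eq_integral[OF Gi, symmetric]) auto
        also have "\<dots> = (\<integral>\<^sup>+t. indicator {0..1} t * (indicator L x * indicator L y * ennreal (h ((1 - t) *\<^sub>R x + t *\<^sub>R y))) \<partial>lborel)"
        proof (rule nn_integral_cong)
          fix t :: real
          show "ennreal (?G t) = indicator {0..1} t * (indicator L x * indicator L y * ennreal (h ((1 - t) *\<^sub>R x + t *\<^sub>R y)))"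
          proof (cases "t \<in> {0..1}")
            case t: True
            then have "(1 - t) *\<^sub>R x + t *\<^sub>R y \<in> L" using True y by (intro convexD[OF L(2)]) auto
            then show ?thesis using t True y by (simp add: h_def)
          qed simp
        qed
        finally show ?thesis .
      qed (simp add: \<eta>_def)
    qed
    also have "\<dots> = ennreal (D powr p / m) * (\<integral>\<^sup>+y. (\<integral>\<^sup>+t. indicator {0..1} t * (indicator L x * indicator L y * ennreal (h ((1 - t) *\<^sub>R x + t *\<^sub>R y))) \<partial>lborel) \<partial>lborel)"
      by (rule nn_integral_cmult) measurable
    finally show ?thesis .
  qed simp
  \<comment> \<open>Fubini brings the segment parameter \<open>t\<close> outermost, so that
    \<open>segment_average_le\<close> applies for each fixed \<open>t\<close>; the indicator of the
    unit interval then integrates to 1.\<close>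
  let ?k = "\<lambda>t x y. indicator L x * indicator L y * ennreal (h ((1 - t) *\<^sub>R x + t *\<^sub>R y))"
  have "(\<integral>\<^sup>+x. (\<integral>\<^sup>+y. (\<integral>\<^sup>+t. indicator {0..1} t * ?k t x y \<partial>lborel) \<partial>lborel) \<partial>lborel)
      = (\<integral>\<^sup>+x. (\<integral>\<^sup>+t. (\<integral>\<^sup>+y. indicator {0..1} t * ?k t x y \<partial>lborel) \<partial>lborel) \<partial>lborel)"
    by (intro nn_integral_cong lborel_pair.Fubini') measurable
  also have "\<dots> = (\<integral>\<^sup>+t. (\<integral>\<^sup>+x. (\<integral>\<^sup>+y. indicator {0..1} t * ?k t x y \<partial>lborel) \<partial>lborel) \<partial>lborel)"
    by (rule lborel_pair.Fubini') measurable
  also have "\<dots> = (\<integral>\<^sup>+t. indicator {0..1} t * (\<integral>\<^sup>+x. (\<integral>\<^sup>+y. ?k t x y \<partial>lborel) \<partial>lborel) \<partial>lborel)"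
    by (subst nn_integral_cmult, measurable, subst nn_integral_cmult, measurable)
  also have "\<dots> \<le> (\<integral>\<^sup>+t. indicator {0..1::real} t * (ennreal (2 ^ DIM('a)) * ennreal m * ennreal J) \<partial>lborel)"
  proof (rule nn_integral_mono)
    fix t :: real
    show "indicator {0..1} t * (\<integral>\<^sup>+x. (\<integral>\<^sup>+y. ?k t x y \<partial>lborel) \<partial>lborel) \<le> indicator {0..1} t * (ennreal (2 ^ DIM('a)) * ennreal m * ennreal J)"
    proof (cases "t \<in> {0..1}")
      case True
      have "(\<integral>\<^sup>+x. (\<integral>\<^sup>+y. ?k t x y \<partial>lborel) \<partial>lborel) \<le> ennreal (2 ^ DIM('a)) * emeasure lborel L * (\<integral>\<^sup>+z. ennreal (h z) \<partial>lborel)"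
        using True by (intro segment_average_le) auto
      then show ?thesis unfolding em nJ by (rule mult_left_mono) simp
    qed simp
  qed
  also have "\<dots> = ennreal (2 ^ DIM('a)) * ennreal m * ennreal J" by (simp add: nn_integral_multc)
  finally have triple: "(\<integral>\<^sup>+x. (\<integral>\<^sup>+y. (\<integral>\<^sup>+t. indicator {0..1} t * ?k t x y \<partial>lborel) \<partial>lborel) \<partial>lborel)
      \<le> ennreal (2 ^ DIM('a)) * ennreal m * ennreal J" .
  have "(\<integral>\<^sup>+x. ennreal (indicator L x * \<bar>v x - c\<bar> powr p) \<partial>lborel)
      \<le> (\<integral>\<^sup>+x. ennreal (D powr p / m) * (\<integral>\<^sup>+y. (\<integral>\<^sup>+t. indicator {0..1} t * ?k t x y \<partial>lborel) \<partial>lborel) \<partial>lborel)"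
    by (rule nn_integral_mono) (rule st1)
  also have "\<dots> = ennreal (D powr p / m) * (\<integral>\<^sup>+x. (\<integral>\<^sup>+y. (\<integral>\<^sup>+t. indicator {0..1} t * ?k t x y \<partial>lborel) \<partial>lborel) \<partial>lborel)"
    by (rule nn_integral_cmult) measurable
  also have "\<dots> \<le> ennreal (D powr p / m) * (ennreal (2 ^ DIM('a)) * ennreal m * ennreal J)"
    by (rule mult_left_mono[OF triple]) simp
  also have "\<dots> = ennreal (D powr p / m * (2 ^ DIM('a) * m * J))"
    using m0 J0 by (simp only: ennreal_mult mult_nonneg_nonneg divide_nonneg_pos powr_ge_zero less_imp_le zero_le_power zero_le_numeral)
  also have "D powr p / m * (2 ^ DIM('a) * m * J) = 2 ^ DIM('a) * D powr p * J" using m0 by simp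
  finally have le: "(\<integral>\<^sup>+x. ennreal (indicator L x * \<bar>v x - c\<bar> powr p) \<partial>lborel) \<le> ennreal (2 ^ DIM('a) * D powr p * J)" .
  have iv: "integrable lborel (\<lambda>x. indicator L x * \<bar>v x - c\<bar> powr p)"
    using p by (intro int continuous_on_powr' continuous_intros vc) auto
  have "(\<integral>\<^sup>+x. ennreal (indicator L x * \<bar>v x - c\<bar> powr p) \<partial>lborel) = ennreal (LINT x|lborel. indicator L x * \<bar>v x - c\<bar> powr p)"
    by (rule nn_integral_eq_integral[OF iv]) auto
  then have "(LINT x|lborel. indicator L x * \<bar>v x - c\<bar> powr p) \<le> 2 ^ DIM('a) * D powr p * J"
    using le J0 by (simp add: ennreal_le_iff)
  then show ?thesis unfolding J_def by blast
qed

section \<open>The cut-off function, the geometry of double cones and their eigenvalues\<close>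

definition step :: "real \<Rightarrow> real" where
  "step t = 2 * (max 0 t)\<^sup>2 - 4 * (max 0 (t - 1 / 2))\<^sup>2 + 2 * (max 0 (t - 1))\<^sup>2"

text \<open>A tent of height 2 over the unit interval. Its primitive is \<open>2 t^2\<close> up to
  1/2 and \<open>1 - 2 (1 - t)^2\<close> up to 1: a continuously differentiable transition from 0 to
  1 with slope at most 2.\<close>

definition step' :: "real \<Rightarrow> real" where
  "step' t = 4 * max 0 t - 8 * max 0 (t - 1 / 2) + 4 * max 0 (t - 1)"

lemma max_power2_derivative: "((\<lambda>t. (max 0 t)\<^sup>2) has_real_derivative 2 * max 0 t) (at (t::real))"
proof -
  consider "t < 0" | "0 < t" | "t = 0" by linarith
  then show ?thesis
  proof cases
    case 1
    have "((\<lambda>_. 0) has_real_derivative 2 * max 0 t) (at t)" using 1 by simp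
    then show ?thesis by (rule has_field_derivative_transform_within_open[of _ _ _ "{..<0}"]) (use 1 in auto)
  next
    case 2
    have "((\<lambda>t. t\<^sup>2) has_real_derivative 2 * max 0 t) (at t)" using 2 by (auto intro!: derivative_eq_intros)
    then show ?thesis by (rule has_field_derivative_transform_within_open[of _ _ _ "{0<..}"]) (use 2 in auto)
  next
    case 3
    have "((\<lambda>h::real. (max 0 h)\<^sup>2 / h) \<longlongrightarrow> 0) (at 0)"
    proof (rule Lim_null_comparison)
      have "norm ((max 0 h)\<^sup>2 / h) \<le> \<bar>h\<bar>" for h :: real
        by (cases "h \<le> 0") (auto simp: power2_eq_square)
      then show "\<forall>\<^sub>F h::real in at 0. norm ((max 0 h)\<^sup>2 / h) \<le> \<bar>h\<bar>" by simp
      show "((\<lambda>h::real. \<bar>h\<bar>) \<longlongrightarrow> 0) (at 0)" using tendsto_rabs[OF tendsto_ident_at[of "0::real" UNIV]] by simp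
    qed
    then show ?thesis using 3 by (simp add: has_field_derivative_iff)
  qed
qed

lemma step_derivative: "(step has_real_derivative step' t) (at t)"
proof -
  have s: "((\<lambda>t. (max 0 (t - a))\<^sup>2) has_real_derivative 2 * max 0 (t - a)) (at t)" for a :: real
    using DERIV_chain2[OF max_power2_derivative DERIV_diff[OF DERIV_ident DERIV_const], of a t UNIV] by simp
  show ?thesis unfolding step_def step'_def
    by (rule DERIV_cong[OF DERIV_add[OF DERIV_diff[OF DERIV_cmult[OF max_power2_derivative] DERIV_cmult[OF s]] DERIV_cmult[OF s]]]) simp
qed

lemma step_values: "t \<le> 0 \<Longrightarrow> step t = 0" "1 \<le> t \<Longrightarrow> step t = 1" "t \<le> 0 \<or> 1 \<le> t \<Longrightarrow> step' t = 0"
  "0 \<le> step' t" "step' t \<le> 2"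
  by (auto simp: step_def step'_def max_def power2_eq_square algebra_simps)

lemma step_nonneg: "0 \<le> step t" and step_le_1: "step t \<le> 1"
proof -
  have mono: "step s \<le> step t" if "s \<le> t" for s t
    by (rule DERIV_nonneg_imp_nondecreasing[OF that]) (use step_derivative step_values(4) in blast)
  show "0 \<le> step t" using mono[of "min t 0" t] step_values(1)[of "min t 0"] by simp
  show "step t \<le> 1" using mono[of t "max t 1"] step_values(2)[of "max t 1"] by simp
qed

text \<open>Two solid cones glued along a common base: axis \<open>e\<close>, tips
  \<open>L e\<close> and \<open>- L e\<close>, and radius \<open>\<epsilon> * L\<close> at the waist
  orthogonal to \<open>e\<close> through 0.\<close>

definition dcone :: "'a::euclidean_space \<Rightarrow> real \<Rightarrow> real \<Rightarrow> 'a set" where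
  "dcone e \<epsilon> L = {x. norm (x - (x \<bullet> e) *\<^sub>R e) < \<epsilon> * (L - \<bar>x \<bullet> e\<bar>)}"

lemma dcone_uminus: "dcone (- e) \<epsilon> L = dcone e \<epsilon> L"
  by (simp add: dcone_def)

lemma dcone_open: "open (dcone e \<epsilon> L)"
  unfolding dcone_def by (intro open_Collect_less continuous_intros)

lemma norm_decompose: "norm e = 1 \<Longrightarrow> norm x \<le> norm (x - (x \<bullet> e) *\<^sub>R e) + \<bar>x \<bullet> e\<bar>"
  using norm_triangle_ineq[of "x - (x \<bullet> e) *\<^sub>R e" "(x \<bullet> e) *\<^sub>R e"] by simp

text \<open>With the tip moved to the origin, the half is a cone cut by a hyperplane, on which
  Picone's inequality requires a cut-off. Letting it drop from 1 to 0 in a slab of width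
  \<open>\<delta>\<close> at the waist costs the mass there: \<open>l\<close> for the part cut away
  and \<open>2 * M / \<delta>\<close> for the gradient of the cut-off.\<close>

lemma half_dcone:
  fixes v :: "'a::euclidean_space \<Rightarrow> real"
  assumes p: "1 < p" and ric: "riccati p DIM('a) l R w" and l: "0 \<le> l" and e: "norm e = 1" and \<epsilon>: "0 < \<epsilon>" and L: "0 < L"
    and LR: "L * (1 + \<epsilon>) < R" and M: "\<And>r. 0 < r \<Longrightarrow> r \<le> L * (1 + \<epsilon>) \<Longrightarrow> w r \<le> M" "0 \<le> M"
    and v: "has_gradient v g" "continuous_on UNIV g" and \<delta>: "0 < \<delta>"
  shows "l * (LINT x|lborel. indicator (dcone e \<epsilon> L \<inter> {x. x \<bullet> e < 0}) x * \<bar>v x\<bar> powr p)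
    \<le> (LINT x|lborel. indicator (dcone e \<epsilon> L \<inter> {x. x \<bullet> e < 0}) x * norm (g x) powr p)
      + (l + 2 * M / \<delta>) * (LINT x|lborel. indicator (dcone e \<epsilon> L \<inter> {x. - \<delta> < x \<bullet> e \<and> x \<bullet> e < 0}) x * \<bar>v x\<bar> powr p)"
proof -
  have ee: "e \<bullet> e = 1" using e by (simp add: norm_eq_1)
  define K where "K = {y::'a. norm (y - (y \<bullet> e) *\<^sub>R e) < \<epsilon> * (y \<bullet> e)}"
  have Ko: "open K" unfolding K_def by (intro open_Collect_less continuous_intros)
  have [measurable]: "K \<in> sets borel" using Ko by simp
  have Kpos: "0 < y \<bullet> e" if "y \<in> K" for y
  proof -
    have "norm (y - (y \<bullet> e) *\<^sub>R e) < \<epsilon> * (y \<bullet> e)" using that by (simp add: K_def)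
    then have "0 < \<epsilon> * (y \<bullet> e)" by (rule le_less_trans[OF norm_ge_zero])
    then show ?thesis using \<epsilon> by (simp add: zero_less_mult_iff)
  qed
  have Knorm: "norm y < (1 + \<epsilon>) * (y \<bullet> e)" if "y \<in> K" for y
    using norm_decompose[OF e, of y] Kpos[OF that] that by (simp add: K_def algebra_simps)
  have cone: "s *\<^sub>R y \<in> K" if "y \<in> K" "0 < s" for y s
  proof -
    have "s *\<^sub>R y - ((s *\<^sub>R y) \<bullet> e) *\<^sub>R e = s *\<^sub>R (y - (y \<bullet> e) *\<^sub>R e)" by (simp add: algebra_simps)
    then have "norm (s *\<^sub>R y - ((s *\<^sub>R y) \<bullet> e) *\<^sub>R e) = s * norm (y - (y \<bullet> e) *\<^sub>R e)" using that by simp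
    also have "\<dots> < s * (\<epsilon> * (y \<bullet> e))" using that by (intro mult_strict_left_mono) (auto simp: K_def)
    finally show ?thesis by (simp add: K_def mult_ac)
  qed
  \<comment> \<open>Points of the cone \<open>K\<close> with axial coordinate below \<open>L\<close>
    have norm below this radius, which stays under the blow-up radius \<open>R\<close>.\<close>
  define \<rho> where "\<rho> = L * (1 + \<epsilon>)"
  have \<rho>: "0 < \<rho>" "\<rho> < R" using L \<epsilon> LR by (auto simp: \<rho>_def)
  define V where "V y = v (- (L *\<^sub>R e) + 1 *\<^sub>R y)" for y
  define gV where "gV y = 1 *\<^sub>R g (- (L *\<^sub>R e) + 1 *\<^sub>R y)" for y
  have hV: "has_gradient V gV" unfolding V_def gV_def by (rule has_gradient_affine[OF v(1)])
  have gVc: "continuous_on UNIV gV" unfolding gV_def by (intro continuous_intros continuous_on_compose2[OF v(2)]) auto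
  have Vc: "continuous_on UNIV V" by (rule has_gradient_continuous[OF hV])
  \<comment> \<open>In shifted coordinates the waist is at axial coordinate \<open>L\<close>;
    \<open>z\<close> is 1 up to \<open>L - \<delta>\<close> and 0 from \<open>L\<close>
    onwards.\<close>
  define z where "z y = step ((L - y \<bullet> e) / \<delta>)" for y
  define gz where "gz y = (- step' ((L - y \<bullet> e) / \<delta>) / \<delta>) *\<^sub>R e" for y
  have hz: "has_gradient z gz"
    unfolding has_gradient_def
  proof
    fix y
    have "((\<lambda>y. (L - y \<bullet> e) / \<delta>) has_derivative (\<lambda>h. - (h \<bullet> e) / \<delta>)) (at y)"
      using \<delta> by (auto intro!: derivative_eq_intros)
    from has_derivative_compose[OF this step_derivative[unfolded has_field_derivative_def]]
    show "(z has_derivative (\<lambda>h. gz y \<bullet> h)) (at y)"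
      unfolding z_def gz_def by (rule has_derivative_eq_rhs) (auto simp: inner_commute)
  qed
  have gzc: "continuous_on UNIV gz" unfolding gz_def step'_def by (intro continuous_intros) (use \<delta> in auto)
  have zc: "continuous_on UNIV z" by (rule has_gradient_continuous[OF hz])
  note [measurable] = borel_measurable_continuous_onI[OF Vc] borel_measurable_continuous_onI[OF gVc]
    borel_measurable_continuous_onI[OF zc] borel_measurable_continuous_onI[OF gzc] riccatiD(1)[OF ric]
  have pic: "(LINT y|lborel. indicator (K \<inter> ball 0 \<rho>) y * (z y * (l * \<bar>V y\<bar> powr p - norm (gV y) powr p)))
    \<le> (LINT y|lborel. indicator (K \<inter> ball 0 \<rho>) y * (\<bar>V y\<bar> powr p * w (norm y) * norm (gz y)))"
  proof (rule picone_cone[OF p ric l _ cone hV gVc hz gzc _ \<rho>])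
    show "0 \<le> z y" for y unfolding z_def by (rule step_nonneg)
    fix y assume y: "y \<in> K" "\<rho> \<le> norm y"
    then have "L * (1 + \<epsilon>) < (1 + \<epsilon>) * (y \<bullet> e)" using Knorm[of y] by (simp add: \<rho>_def)
    then have "L < y \<bullet> e" using \<epsilon> by (simp add: mult.commute)
    then show "z y = 0 \<or> V y = 0" using \<delta> by (simp add: z_def step_values(1) divide_le_0_iff)
  qed auto
  define H where "H = K \<inter> {y. y \<bullet> e < L}"
  define H' where "H' = K \<inter> {y. L - \<delta> < y \<bullet> e \<and> y \<bullet> e < L}"
  have [measurable]: "H \<in> sets borel" "H' \<in> sets borel" unfolding H_def H'_def by measurable
  have HB: "norm y < \<rho>" if "y \<in> H" for y
  proof -
    have "(1 + \<epsilon>) * (y \<bullet> e) < (1 + \<epsilon>) * L" using that \<epsilon> by (simp add: H_def)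
    then show ?thesis using Knorm[of y] that by (simp add: H_def \<rho>_def mult.commute)
  qed
  have HH': "H' \<subseteq> H" by (auto simp: H_def H'_def)
  have int: "integrable lborel (\<lambda>y. indicator A y * f y)" if A: "A \<in> sets borel" "A \<subseteq> ball 0 \<rho>" "continuous_on UNIV f" for A and f :: "'a \<Rightarrow> real"
  proof -
    obtain C where C: "0 \<le> C" "\<And>x. norm x \<le> \<rho> \<Longrightarrow> norm (f x) \<le> C" using bounded_on_cball[OF A(3)] by blast
    note [measurable] = borel_measurable_continuous_onI[OF A(3)] A(1)
    show ?thesis
    proof (rule integrable_bounded_support[where B = \<rho> and C = C])
      fix x
      show "norm (indicator A x * f x) \<le> C" if "norm x \<le> \<rho>" using C that by (simp add: indicator_def)
      show "indicator A x * f x = 0" if "\<rho> < norm x" using \<open>A \<subseteq> ball 0 \<rho>\<close> that by (auto simp: indicator_def)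
    qed measurable
  qed
  have Hb: "H \<subseteq> ball 0 \<rho>" "H' \<subseteq> ball 0 \<rho>" using HB HH' by auto
  have cVp: "continuous_on UNIV (\<lambda>y. \<bar>V y\<bar> powr p)" and cgp: "continuous_on UNIV (\<lambda>y. norm (gV y) powr p)"
    using p by (intro continuous_on_powr' continuous_intros Vc gVc; auto)+
  have iH: "integrable lborel (\<lambda>y. indicator H y * \<bar>V y\<bar> powr p)" by (intro int Hb cVp) auto
  have iH': "integrable lborel (\<lambda>y. indicator H' y * \<bar>V y\<bar> powr p)" by (intro int Hb cVp) auto
  have iG: "integrable lborel (\<lambda>y. indicator H y * norm (gV y) powr p)" by (intro int Hb cgp) auto
  have iP: "integrable lborel (\<lambda>y. indicator (K \<inter> ball 0 \<rho>) y * (z y * (l * \<bar>V y\<bar> powr p - norm (gV y) powr p)))"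
    by (intro int continuous_intros zc cVp cgp) auto
  have zH: "z y = 0" if "L \<le> y \<bullet> e" for y using that \<delta> by (simp add: z_def step_values(1) divide_le_0_iff)
  have z1: "z y = 1" if "y \<bullet> e \<le> L - \<delta>" for y using that \<delta> by (simp add: z_def step_values(2) pos_le_divide_eq)
  have z01: "0 \<le> z y" "z y \<le> 1" for y unfolding z_def by (rule step_nonneg, rule step_le_1)
  \<comment> \<open>Off the slab \<open>z\<close> is 1 and both sides agree. Inside it,
    \<open>z \<le> 1\<close> only lowers the energy subtracted, and the last summand supplies all of
    the mass on the left.\<close>
  have p1: "l * (indicator H y * \<bar>V y\<bar> powr p) \<le> indicator (K \<inter> ball 0 \<rho>) y * (z y * (l * \<bar>V y\<bar> powr p - norm (gV y) powr p))
      + indicator H y * norm (gV y) powr p + l * (indicator H' y * \<bar>V y\<bar> powr p)" for y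
  proof (cases "y \<in> K \<and> norm y < \<rho>")
    case True
    show ?thesis
    proof (cases "y \<bullet> e < L")
      case yL: True
      then have yH: "y \<in> H" using True by (simp add: H_def)
      have a: "z y * norm (gV y) powr p \<le> 1 * norm (gV y) powr p" using z01[of y] by (intro mult_right_mono) auto
      show ?thesis
      proof (cases "L - \<delta> < y \<bullet> e")
        case True
        then have "y \<in> H'" using yH yL by (simp add: H_def H'_def)
        moreover have "0 \<le> z y * (l * \<bar>V y\<bar> powr p)" using z01[of y] l by simp
        ultimately show ?thesis using yH a \<open>y \<in> K \<and> norm y < \<rho>\<close> by (simp add: right_diff_distrib)
      next
        case False
        then have "y \<notin> H'" "z y = 1" using z1[of y] by (auto simp: H'_def)
        then show ?thesis using yH \<open>y \<in> K \<and> norm y < \<rho>\<close> by simp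
      qed
    next
      case False
      then show ?thesis using zH[of y] by (auto simp: H_def H'_def indicator_def)
    qed
  next
    case False
    then have "y \<notin> H" "y \<notin> H'" using HB[of y] HH' by (auto simp: H_def)
    then show ?thesis using False by (auto simp: indicator_def)
  qed
  have p2: "indicator (K \<inter> ball 0 \<rho>) y * (\<bar>V y\<bar> powr p * w (norm y) * norm (gz y)) \<le> (2 * M / \<delta>) * (indicator H' y * \<bar>V y\<bar> powr p)" for y
  proof (cases "y \<in> K \<and> norm y < \<rho>")
    case True
    show ?thesis
    proof (cases "y \<in> H'")
      case yH': True
      have y0: "0 < norm y" using True Kpos[of y] by auto
      have "w (norm y) \<le> M" using M(1)[OF y0] True by (simp add: \<rho>_def)
      moreover have "norm (gz y) \<le> 2 / \<delta>"
        using \<delta> e step_values(4,5)[of "(L - y \<bullet> e) / \<delta>"] by (simp add: gz_def divide_right_mono)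
      moreover have "0 \<le> w (norm y)" using riccatiD(2)[OF ric y0] True \<rho> by simp
      ultimately have "w (norm y) * norm (gz y) \<le> M * (2 / \<delta>)" using M(2) by (intro mult_mono) auto
      then have "\<bar>V y\<bar> powr p * (w (norm y) * norm (gz y)) \<le> \<bar>V y\<bar> powr p * (M * (2 / \<delta>))" by (intro mult_left_mono) auto
      then show ?thesis using True yH' by (simp add: mult_ac)
    next
      case False
      then have "(L - y \<bullet> e) / \<delta> \<le> 0 \<or> 1 \<le> (L - y \<bullet> e) / \<delta>"
        using True \<delta> by (auto simp: H'_def divide_le_0_iff pos_le_divide_eq)
      then have "gz y = 0" by (simp add: gz_def step_values(3))
      then show ?thesis using M(2) \<delta> by simp
    qed
  next
    case False
    then show ?thesis using M(2) \<delta> by (auto simp: indicator_def)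
  qed
  have "l * (LINT y|lborel. indicator H y * \<bar>V y\<bar> powr p) = (LINT y|lborel. l * (indicator H y * \<bar>V y\<bar> powr p))" by simp
  also have "\<dots> \<le> (LINT y|lborel. indicator (K \<inter> ball 0 \<rho>) y * (z y * (l * \<bar>V y\<bar> powr p - norm (gV y) powr p))
      + indicator H y * norm (gV y) powr p + l * (indicator H' y * \<bar>V y\<bar> powr p))"
    by (rule integral_mono) (use iH iP iG iH' p1 in auto)
  also have "\<dots> = (LINT y|lborel. indicator (K \<inter> ball 0 \<rho>) y * (z y * (l * \<bar>V y\<bar> powr p - norm (gV y) powr p)))
      + (LINT y|lborel. indicator H y * norm (gV y) powr p) + l * (LINT y|lborel. indicator H' y * \<bar>V y\<bar> powr p)"
    using iP iG iH' by simp
  also have "(LINT y|lborel. indicator (K \<inter> ball 0 \<rho>) y * (z y * (l * \<bar>V y\<bar> powr p - norm (gV y) powr p)))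
      \<le> (2 * M / \<delta>) * (LINT y|lborel. indicator H' y * \<bar>V y\<bar> powr p)"
  proof -
    have nnw: "0 \<le> indicator (K \<inter> ball 0 \<rho>) y * (\<bar>V y\<bar> powr p * w (norm y) * norm (gz y))" for y
    proof (cases "y \<in> K \<and> norm y < \<rho>")
      case True
      then have "0 < norm y" using Kpos[of y] by auto
      then have "0 \<le> w (norm y)" using riccatiD(2)[OF ric] True \<rho> by simp
      then show ?thesis by simp
    next
      case False
      then show ?thesis by (auto simp: indicator_def)
    qed
    have "(LINT y|lborel. indicator (K \<inter> ball 0 \<rho>) y * (\<bar>V y\<bar> powr p * w (norm y) * norm (gz y)))
        \<le> (LINT y|lborel. (2 * M / \<delta>) * (indicator H' y * \<bar>V y\<bar> powr p))"
      by (rule integral_mono_AE') (use iH' p2 M \<delta> in auto)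
    then show ?thesis using pic by simp
  qed
  finally have main: "l * (LINT y|lborel. indicator H y * \<bar>V y\<bar> powr p)
      \<le> (LINT y|lborel. indicator H y * norm (gV y) powr p) + (l + 2 * M / \<delta>) * (LINT y|lborel. indicator H' y * \<bar>V y\<bar> powr p)"
    by (simp add: algebra_simps)
  have iH: "indicator H y = (indicator (dcone e \<epsilon> L \<inter> {x. x \<bullet> e < 0}) (- (L *\<^sub>R e) + 1 *\<^sub>R y) :: real)" for y
  proof -
    define x where "x = - (L *\<^sub>R e) + 1 *\<^sub>R y"
    have xe: "x \<bullet> e = y \<bullet> e - L" by (simp add: x_def inner_add_left inner_diff_left ee)
    have xx: "x - (x \<bullet> e) *\<^sub>R e = y - (y \<bullet> e) *\<^sub>R e" unfolding xe by (simp add: x_def algebra_simps)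
    have "x \<in> dcone e \<epsilon> L \<inter> {x. x \<bullet> e < 0} \<longleftrightarrow> y \<in> H"
      unfolding dcone_def H_def K_def using xx xe by auto
    then show ?thesis unfolding x_def[symmetric] by (simp add: indicator_def)
  qed
  have iH': "indicator H' y = (indicator (dcone e \<epsilon> L \<inter> {x. - \<delta> < x \<bullet> e \<and> x \<bullet> e < 0}) (- (L *\<^sub>R e) + 1 *\<^sub>R y) :: real)" for y
  proof -
    define x where "x = - (L *\<^sub>R e) + 1 *\<^sub>R y"
    have xe: "x \<bullet> e = y \<bullet> e - L" by (simp add: x_def inner_add_left inner_diff_left ee)
    have xx: "x - (x \<bullet> e) *\<^sub>R e = y - (y \<bullet> e) *\<^sub>R e" unfolding xe by (simp add: x_def algebra_simps)
    have "x \<in> dcone e \<epsilon> L \<inter> {x. - \<delta> < x \<bullet> e \<and> x \<bullet> e < 0} \<longleftrightarrow> y \<in> H'"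
      unfolding dcone_def H'_def K_def using xx xe by auto
    then show ?thesis unfolding x_def[symmetric] by (simp add: indicator_def)
  qed
  have [measurable]: "dcone e \<epsilon> L \<in> sets borel" using dcone_open[of e \<epsilon> L] by simp
  note [measurable] = borel_measurable_continuous_onI[OF has_gradient_continuous[OF v(1)]] borel_measurable_continuous_onI[OF v(2)]
  have tr: "(LINT y|lborel. f (- (L *\<^sub>R e) + 1 *\<^sub>R y)) = (LINT x|lborel. f x)" if "f \<in> borel_measurable borel" for f :: "'a \<Rightarrow> real"
    using integral_lborel_affine[OF that, of 1 "- (L *\<^sub>R e)"] by simp
  have t1: "(LINT y|lborel. indicator H y * \<bar>V y\<bar> powr p) = (LINT x|lborel. indicator (dcone e \<epsilon> L \<inter> {x. x \<bullet> e < 0}) x * \<bar>v x\<bar> powr p)"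
    unfolding iH V_def by (rule tr) measurable
  have t2: "(LINT y|lborel. indicator H y * norm (gV y) powr p) = (LINT x|lborel. indicator (dcone e \<epsilon> L \<inter> {x. x \<bullet> e < 0}) x * norm (g x) powr p)"
    unfolding iH gV_def scaleR_one[of "g _"] by (rule tr) measurable
  have t3: "(LINT y|lborel. indicator H' y * \<bar>V y\<bar> powr p)
      = (LINT x|lborel. indicator (dcone e \<epsilon> L \<inter> {x. - \<delta> < x \<bullet> e \<and> x \<bullet> e < 0}) x * \<bar>v x\<bar> powr p)"
    unfolding iH' V_def by (rule tr) measurable
  show ?thesis using main unfolding t1 t2 t3 .
qed

lemma dcone_iff: "x \<in> dcone e \<epsilon> L \<longleftrightarrow> norm (x - (x \<bullet> e) *\<^sub>R e) + \<epsilon> * \<bar>x \<bullet> e\<bar> < \<epsilon> * L"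
  by (simp add: dcone_def right_diff_distrib less_diff_eq)

lemma zero_in_dcone: "0 < \<epsilon> \<Longrightarrow> 0 < L \<Longrightarrow> 0 \<in> dcone e \<epsilon> L"
  by (simp add: dcone_def)

lemma dcone_convex:
  assumes "0 < \<epsilon>"
  shows "convex (dcone e \<epsilon> L)"
proof (rule convexI)
  fix x y :: 'a and s t :: real
  assume xy: "x \<in> dcone e \<epsilon> L" "y \<in> dcone e \<epsilon> L" and st: "0 \<le> s" "0 \<le> t" "s + t = 1"
  let ?q = "\<lambda>x::'a. x - (x \<bullet> e) *\<^sub>R e"
  let ?z = "s *\<^sub>R x + t *\<^sub>R y"
  have "?q ?z = s *\<^sub>R ?q x + t *\<^sub>R ?q y" by (simp add: algebra_simps inner_add_left)
  then have "norm (?q ?z) \<le> s * norm (?q x) + t * norm (?q y)"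
    using norm_triangle_ineq[of "s *\<^sub>R ?q x" "t *\<^sub>R ?q y"] st by simp
  moreover have "\<bar>?z \<bullet> e\<bar> \<le> s * \<bar>x \<bullet> e\<bar> + t * \<bar>y \<bullet> e\<bar>"
    using abs_triangle_ineq[of "s * (x \<bullet> e)" "t * (y \<bullet> e)"] st by (simp add: inner_add_left abs_mult)
  then have "\<epsilon> * \<bar>?z \<bullet> e\<bar> \<le> \<epsilon> * (s * \<bar>x \<bullet> e\<bar> + t * \<bar>y \<bullet> e\<bar>)" using assms by (intro mult_left_mono) auto
  ultimately have "norm (?q ?z) + \<epsilon> * \<bar>?z \<bullet> e\<bar>
      \<le> s * (norm (?q x) + \<epsilon> * \<bar>x \<bullet> e\<bar>) + t * (norm (?q y) + \<epsilon> * \<bar>y \<bullet> e\<bar>)"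
    by (simp add: algebra_simps)
  also have "\<dots> < \<epsilon> * L" using xy st by (intro convex_bound_lt) (auto simp: dcone_iff)
  finally show "?z \<in> dcone e \<epsilon> L" by (simp add: dcone_iff)
qed

text \<open>At height \<open>t = |x . e|\<close> the norm is at most
  \<open>\<epsilon> (L - t) + t\<close>, which \<open>\<epsilon> \<le> 1\<close> turns into
  \<open>L\<close>. Hence the diameter is exactly the distance between the tips.\<close>

lemma dcone_subset_cball:
  assumes e: "norm e = 1" and \<epsilon>: "0 < \<epsilon>" "\<epsilon> \<le> 1"
  shows "dcone e \<epsilon> L \<subseteq> cball 0 L"
proof
  fix x assume x: "x \<in> dcone e \<epsilon> L"
  have "0 < \<epsilon> * (L - \<bar>x \<bullet> e\<bar>)" using x by (auto simp: dcone_def intro: le_less_trans[OF norm_ge_zero])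
  then have "0 < L - \<bar>x \<bullet> e\<bar>" using \<epsilon> by (simp add: zero_less_mult_iff)
  then have "\<epsilon> * (L - \<bar>x \<bullet> e\<bar>) \<le> 1 * (L - \<bar>x \<bullet> e\<bar>)" using \<epsilon> by (intro mult_right_mono) auto
  then show "x \<in> cball 0 L" using norm_decompose[OF e, of x] x by (simp add: dcone_def)
qed

lemma dcone_tip:
  assumes e: "norm e = 1" and \<epsilon>: "0 < \<epsilon>" and L: "0 < L"
  shows "L *\<^sub>R e \<in> closure (dcone e \<epsilon> L)"
  unfolding closure_approachable
proof (intro allI impI)
  fix h :: real assume h: "0 < h"
  define t where "t = max 0 (L - h / 2)"
  have t: "0 \<le> t" "t < L" "L - t < h" using h L by (auto simp: t_def)
  have ee: "e \<bullet> e = 1" using e by (simp add: norm_eq_1)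
  have "t *\<^sub>R e \<in> dcone e \<epsilon> L" using t \<epsilon> by (simp add: dcone_def ee)
  moreover have "dist (t *\<^sub>R e) (L *\<^sub>R e) < h"
    using t e by (simp add: dist_norm scaleR_left_diff_distrib[symmetric])
  ultimately show "\<exists>y\<in>dcone e \<epsilon> L. dist y (L *\<^sub>R e) < h" by blast
qed

lemma dcone_tip': "norm e = 1 \<Longrightarrow> 0 < \<epsilon> \<Longrightarrow> 0 < L \<Longrightarrow> - (L *\<^sub>R e) \<in> closure (dcone e \<epsilon> L)"
  using dcone_tip[of "- e" \<epsilon> L] by (simp add: dcone_uminus)

lemma diameter_dcone:
  assumes e: "norm e = 1" and \<epsilon>: "0 < \<epsilon>" "\<epsilon> \<le> 1" and L: "0 < L"
  shows "diameter (dcone e \<epsilon> L) = 2 * L"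
proof (rule antisym)
  have "diameter (dcone e \<epsilon> L) \<le> diameter (cball (0::'a) L)"
    by (rule diameter_subset[OF dcone_subset_cball[OF e \<epsilon>]]) simp
  then show "diameter (dcone e \<epsilon> L) \<le> 2 * L" using L by simp
  have bd: "bounded (dcone e \<epsilon> L)" using dcone_subset_cball[OF e \<epsilon>] bounded_cball bounded_subset by blast
  have "dist (L *\<^sub>R e) (- (L *\<^sub>R e)) \<le> diameter (closure (dcone e \<epsilon> L))"
    by (rule diameter_bounded_bound) (use bd dcone_tip[OF e \<epsilon>(1) L] dcone_tip'[OF e \<epsilon>(1) L] in auto)
  moreover have "dist (L *\<^sub>R e) (- (L *\<^sub>R e)) = 2 * L"
  proof -
    have "L *\<^sub>R e - - (L *\<^sub>R e) = (2 * L) *\<^sub>R e" by (simp add: scaleR_2[symmetric])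
    then show ?thesis using e L by (simp add: dist_norm)
  qed
  ultimately show "2 * L \<le> diameter (dcone e \<epsilon> L)" by (simp add: diameter_closure[OF bd])
qed

lemma hausdorff_dcone:
  assumes e: "norm e = 1" and \<epsilon>: "0 < \<epsilon>" and L: "0 < L"
  shows "0 \<le> hausdorff_dist (dcone e \<epsilon> L) (closed_segment (- (L *\<^sub>R e)) (L *\<^sub>R e))"
    "hausdorff_dist (dcone e \<epsilon> L) (closed_segment (- (L *\<^sub>R e)) (L *\<^sub>R e)) \<le> \<epsilon> * L"
proof -
  let ?S = "dcone e \<epsilon> L" and ?T = "closed_segment (- (L *\<^sub>R e)) (L *\<^sub>R e)"
  have ne: "?S \<noteq> {}" using zero_in_dcone[OF \<epsilon> L] by blast
  have "?T \<subseteq> closure ?S"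
    by (rule closed_segment_subset[OF dcone_tip'[OF e \<epsilon> L] dcone_tip[OF e \<epsilon> L] convex_closure[OF dcone_convex[OF \<epsilon>]]])
  then have "infdist y ?S = 0" if "y \<in> ?T" for y using that in_closure_iff_infdist_zero[OF ne] by blast
  then have 2: "(SUP y\<in>?T. infdist y ?S) = 0" by (simp cong: SUP_cong_simp)
  have 1: "(SUP x\<in>?S. infdist x ?T) \<le> \<epsilon> * L"
  proof (rule cSUP_least[OF ne])
    fix x assume x: "x \<in> ?S"
    have "0 < \<epsilon> * (L - \<bar>x \<bullet> e\<bar>)" using x by (auto simp: dcone_def intro: le_less_trans[OF norm_ge_zero])
    then have xL: "\<bar>x \<bullet> e\<bar> < L" using \<epsilon> by (simp add: zero_less_mult_iff)
    have seg: "(x \<bullet> e) *\<^sub>R e \<in> ?T"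
      unfolding in_segment
    proof (intro exI conjI)
      let ?u = "(x \<bullet> e / L + 1) / 2"
      show "0 \<le> ?u" "?u \<le> 1" using xL L by (auto simp: field_simps abs_less_iff)
      have "(1 - ?u) *\<^sub>R - (L *\<^sub>R e) + ?u *\<^sub>R (L *\<^sub>R e) = (?u * L - (1 - ?u) * L) *\<^sub>R e"
        by (simp only: scaleR_left_diff_distrib scaleR_scaleR scaleR_minus_right) simp
      also have "?u * L - (1 - ?u) * L = (2 * ?u - 1) * L" by (simp only: left_diff_distrib) simp
      also have "(2 * ?u - 1) * L = x \<bullet> e" using L by (simp add: field_simps)
      finally show "(x \<bullet> e) *\<^sub>R e = (1 - ?u) *\<^sub>R - (L *\<^sub>R e) + ?u *\<^sub>R (L *\<^sub>R e)" by simp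
    qed
    have "infdist x ?T \<le> dist x ((x \<bullet> e) *\<^sub>R e)" by (rule infdist_le[OF seg])
    also have "\<dots> \<le> \<epsilon> * (L - \<bar>x \<bullet> e\<bar>)" using x by (simp add: dcone_def dist_norm)
    also have "\<dots> \<le> \<epsilon> * L" using \<epsilon> by (intro mult_left_mono) auto
    finally show "infdist x ?T \<le> \<epsilon> * L" .
  qed
  show "0 \<le> hausdorff_dist ?S ?T" "hausdorff_dist ?S ?T \<le> \<epsilon> * L"
    unfolding hausdorff_dist_def 2 using 1 \<epsilon> L by auto
qed

text \<open>On the thin waist \<open>\<bar>x \<bullet> e\<bar> < \<epsilon>\<close> the crude Poincare inequality costs \<open>\<epsilon> powr p\<close>, which beats the factor
  \<open>1 / \<epsilon>\<close> coming from the cut-off function.\<close>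

lemma dcone_poincare:
  fixes v :: "'a::euclidean_space \<Rightarrow> real"
  assumes p: "1 < p" and ric: "riccati p DIM('a) l R w" and l: "0 \<le> l" and e: "norm e = 1" and \<epsilon>: "0 < \<epsilon>" "\<epsilon> \<le> 1"
    and L: "0 < L" and LR: "L * (1 + \<epsilon>) < R" and M: "\<And>r. 0 < r \<Longrightarrow> r \<le> L * (1 + \<epsilon>) \<Longrightarrow> w r \<le> M" "0 \<le> M"
    and v: "has_gradient v g" "continuous_on UNIV g"
  shows "\<exists>c. l * (LINT x|lborel. indicator (dcone e \<epsilon> L) x * \<bar>v x - c\<bar> powr p)
    \<le> (1 + (l + 2 * M / \<epsilon>) * (2 ^ DIM('a) * (2 * \<epsilon> * (1 + L)) powr p)) * (LINT x|lborel. indicator (dcone e \<epsilon> L) x * norm (g x) powr p)"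
proof -
  define Q where "Q = dcone e \<epsilon> L"
  \<comment> \<open>The slab has the same width \<open>\<epsilon>\<close> as the cross-section up to
    constants, so its diameter is at most \<open>2 * \<epsilon> * (1 + L)\<close> and the Poincare
    constant is of order \<open>\<epsilon> powr p\<close>.\<close>
  define W where "W = Q \<inter> {x. \<bar>x \<bullet> e\<bar> < \<epsilon>}"
  have Qo: "open Q" unfolding Q_def by (rule dcone_open)
  have QB: "Q \<subseteq> cball 0 L" unfolding Q_def by (rule dcone_subset_cball[OF e \<epsilon>])
  have Wo: "open W" unfolding W_def by (intro open_Int Qo open_Collect_less continuous_intros)
  have Wslab: "{x. \<bar>x \<bullet> e\<bar> < \<epsilon>} = {x. e \<bullet> x < \<epsilon>} \<inter> {x. e \<bullet> x > - \<epsilon>}" by (auto simp: inner_commute abs_less_iff)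
  have Wc: "convex W" unfolding W_def Wslab Q_def
    by (intro convex_Int dcone_convex \<epsilon> convex_halfspace_lt convex_halfspace_gt)
  have Wb: "bounded W" using QB bounded_cball bounded_subset unfolding W_def by (metis le_infI1)
  have "0 \<in> W" using \<epsilon> by (simp add: W_def Q_def zero_in_dcone[OF \<epsilon>(1) L])
  then have W0: "W \<noteq> {}" by blast
  have WD: "norm (y - x) \<le> 2 * \<epsilon> * (1 + L)" if "x \<in> W" "y \<in> W" for x y
  proof -
    have q: "norm (z - (z \<bullet> e) *\<^sub>R e) \<le> \<epsilon> * L" if "z \<in> W" for z
    proof -
      have "norm (z - (z \<bullet> e) *\<^sub>R e) \<le> \<epsilon> * (L - \<bar>z \<bullet> e\<bar>)" using that by (auto simp: W_def Q_def dcone_def)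
      also have "\<dots> \<le> \<epsilon> * L" using \<epsilon> by (intro mult_left_mono) auto
      finally show ?thesis .
    qed
    have n: "norm z \<le> \<epsilon> * (1 + L)" if "z \<in> W" for z
      using norm_decompose[OF e, of z] q[OF that] that by (simp add: W_def algebra_simps)
    show ?thesis using norm_triangle_ineq4[of y x] n[OF that(1)] n[OF that(2)] by simp
  qed
  obtain c where c: "(LINT x|lborel. indicator W x * \<bar>v x - c\<bar> powr p)
      \<le> 2 ^ DIM('a) * (2 * \<epsilon> * (1 + L)) powr p * (LINT x|lborel. indicator W x * norm (g x) powr p)"
    using poincare_convex[OF p v Wo Wc Wb W0 WD] by blast
  define u where "u x = v x + - c" for x
  have u: "has_gradient u g" unfolding u_def by (rule has_gradient_add_const[OF v(1)])
  have uc: "continuous_on UNIV u" by (rule has_gradient_continuous[OF u])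
  let ?A = "\<lambda>f::'a. Q \<inter> {x. x \<bullet> f < 0}" and ?W = "\<lambda>f::'a. Q \<inter> {x. - \<epsilon> < x \<bullet> f \<and> x \<bullet> f < 0}"
  have [measurable]: "Q \<in> sets borel" "W \<in> sets borel" using Qo Wo by auto
  have int: "integrable lborel (\<lambda>y. indicator A y * f y)" if A: "A \<in> sets borel" "A \<subseteq> Q" "continuous_on UNIV f" for A and f :: "'a \<Rightarrow> real"
  proof -
    obtain C where C: "0 \<le> C" "\<And>x. norm x \<le> L \<Longrightarrow> norm (f x) \<le> C" using bounded_on_cball[OF A(3)] by blast
    note [measurable] = borel_measurable_continuous_onI[OF A(3)] A(1)
    show ?thesis
    proof (rule integrable_bounded_support[where B = L and C = C])
      fix x
      show "norm (indicator A x * f x) \<le> C" if "norm x \<le> L" using C that by (simp add: indicator_def)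
      show "indicator A x * f x = 0" if "L < norm x" using \<open>A \<subseteq> Q\<close> QB that by (auto simp: indicator_def)
    qed measurable
  qed
  have cu: "continuous_on UNIV (\<lambda>x. \<bar>u x\<bar> powr p)" and cg: "continuous_on UNIV (\<lambda>x. norm (g x) powr p)"
    using p by (intro continuous_on_powr' continuous_intros uc v(2); auto)+
  have [measurable]: "?A f \<in> sets borel" "?W f \<in> sets borel" for f by measurable
  have iQ: "integrable lborel (\<lambda>x. indicator Q x * \<bar>u x\<bar> powr p)"
    and iA: "integrable lborel (\<lambda>x. indicator (?A f) x * \<bar>u x\<bar> powr p)"
    and iW: "integrable lborel (\<lambda>x. indicator W x * \<bar>u x\<bar> powr p)"
    and iWf: "integrable lborel (\<lambda>x. indicator (?W f) x * \<bar>u x\<bar> powr p)"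
    and gQ: "integrable lborel (\<lambda>x. indicator Q x * norm (g x) powr p)"
    and gA: "integrable lborel (\<lambda>x. indicator (?A f) x * norm (g x) powr p)"
    and gW: "integrable lborel (\<lambda>x. indicator W x * norm (g x) powr p)" for f
    by (intro int cu cg; auto simp: W_def)+
  \<comment> \<open>Reversing \<open>e\<close> maps the double cone to itself and exchanges its
    halves, so one estimate serves both.\<close>
  have half: "l * (LINT x|lborel. indicator (?A f) x * \<bar>u x\<bar> powr p)
      \<le> (LINT x|lborel. indicator (?A f) x * norm (g x) powr p)
        + (l + 2 * M / \<epsilon>) * (LINT x|lborel. indicator (?W f) x * \<bar>u x\<bar> powr p)" if "f = e \<or> f = - e" for f
    using half_dcone[OF p ric l _ \<epsilon>(1) L LR M u v(2) \<epsilon>(1), of f] that e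
    unfolding Q_def by (auto simp only: dcone_uminus norm_minus_cancel)
  have "AE x in lebesgue. x \<bullet> e \<noteq> 0"
  proof -
    have "e \<noteq> 0" using e by auto
    then have "negligible {x. e \<bullet> x = 0}" by (intro negligible_hyperplane) auto
    then have "{x. e \<bullet> x = 0} \<in> null_sets lebesgue" by (simp add: negligible_iff_null_sets)
    from AE_not_in[OF this] show ?thesis by (simp add: inner_commute)
  qed
  then have ae: "AE x in lborel. x \<bullet> e \<noteq> 0" by (simp add: AE_completion_iff)
  have "(LINT x|lborel. indicator Q x * \<bar>u x\<bar> powr p)
      = (LINT x|lborel. indicator (?A e) x * \<bar>u x\<bar> powr p + indicator (?A (- e)) x * \<bar>u x\<bar> powr p)"
  proof (rule integral_cong_AE)
    show "(\<lambda>x. indicator Q x * \<bar>u x\<bar> powr p) \<in> borel_measurable lborel"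
      "(\<lambda>x. indicator (?A e) x * \<bar>u x\<bar> powr p + indicator (?A (- e)) x * \<bar>u x\<bar> powr p) \<in> borel_measurable lborel"
      by (intro borel_measurable_add borel_measurable_integrable iQ iA)+
    show "AE x in lborel. indicator Q x * \<bar>u x\<bar> powr p = indicator (?A e) x * \<bar>u x\<bar> powr p + indicator (?A (- e)) x * \<bar>u x\<bar> powr p"
      using ae by eventually_elim (auto simp: indicator_def)
  qed
  also have "\<dots> = (LINT x|lborel. indicator (?A e) x * \<bar>u x\<bar> powr p) + (LINT x|lborel. indicator (?A (- e)) x * \<bar>u x\<bar> powr p)"
    by (rule Bochner_Integration.integral_add[OF iA iA])
  finally have 1: "(LINT x|lborel. indicator Q x * \<bar>u x\<bar> powr p)
      = (LINT x|lborel. indicator (?A e) x * \<bar>u x\<bar> powr p) + (LINT x|lborel. indicator (?A (- e)) x * \<bar>u x\<bar> powr p)" .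
  have "(LINT x|lborel. indicator (?A e) x * norm (g x) powr p) + (LINT x|lborel. indicator (?A (- e)) x * norm (g x) powr p)
      = (LINT x|lborel. indicator (?A e) x * norm (g x) powr p + indicator (?A (- e)) x * norm (g x) powr p)"
    by (rule Bochner_Integration.integral_add[OF gA gA, symmetric])
  also have "\<dots> \<le> (LINT x|lborel. indicator Q x * norm (g x) powr p)"
    by (rule integral_mono[OF Bochner_Integration.integrable_add[OF gA gA] gQ]) (auto simp: indicator_def)
  finally have 2: "(LINT x|lborel. indicator (?A e) x * norm (g x) powr p) + (LINT x|lborel. indicator (?A (- e)) x * norm (g x) powr p)
      \<le> (LINT x|lborel. indicator Q x * norm (g x) powr p)" .
  have "(LINT x|lborel. indicator (?W e) x * \<bar>u x\<bar> powr p) + (LINT x|lborel. indicator (?W (- e)) x * \<bar>u x\<bar> powr p)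
      = (LINT x|lborel. indicator (?W e) x * \<bar>u x\<bar> powr p + indicator (?W (- e)) x * \<bar>u x\<bar> powr p)"
    by (rule Bochner_Integration.integral_add[OF iWf iWf, symmetric])
  also have "\<dots> \<le> (LINT x|lborel. indicator W x * \<bar>u x\<bar> powr p)"
    by (rule integral_mono[OF Bochner_Integration.integrable_add[OF iWf iWf] iW]) (auto simp: indicator_def W_def)
  also have "\<dots> \<le> 2 ^ DIM('a) * (2 * \<epsilon> * (1 + L)) powr p * (LINT x|lborel. indicator W x * norm (g x) powr p)"
    using c by (simp add: u_def)
  also have "\<dots> \<le> 2 ^ DIM('a) * (2 * \<epsilon> * (1 + L)) powr p * (LINT x|lborel. indicator Q x * norm (g x) powr p)"
    by (intro mult_left_mono integral_mono[OF gW gQ]) (auto simp: indicator_def W_def)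
  finally have 3: "(LINT x|lborel. indicator (?W e) x * \<bar>u x\<bar> powr p) + (LINT x|lborel. indicator (?W (- e)) x * \<bar>u x\<bar> powr p)
      \<le> 2 ^ DIM('a) * (2 * \<epsilon> * (1 + L)) powr p * (LINT x|lborel. indicator Q x * norm (g x) powr p)" .
  have alg: "l * q \<le> (1 + k * d) * G"
    if "q = a + a'" "l * a \<le> b + k * s" "l * a' \<le> b' + k * s'" "b + b' \<le> G" "s + s' \<le> d * G" "0 \<le> k" for q a a' b b' k s s' d G :: real
  proof -
    have "l * q \<le> (b + b') + k * (s + s')" using that by (simp add: algebra_simps)
    also have "\<dots> \<le> G + k * (d * G)" using that by (intro add_mono mult_left_mono)
    finally show ?thesis by (simp add: algebra_simps)
  qed
  have "l * (LINT x|lborel. indicator Q x * \<bar>u x\<bar> powr p)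
    \<le> (1 + (l + 2 * M / \<epsilon>) * (2 ^ DIM('a) * (2 * \<epsilon> * (1 + L)) powr p)) * (LINT x|lborel. indicator Q x * norm (g x) powr p)"
    by (rule alg[OF 1 half half 2 3]) (use l M \<epsilon> in auto)
  then show ?thesis unfolding Q_def u_def by auto
qed

text \<open>The denominator is 1 plus the loss at the waist. The smooth inequality up to a constant
  becomes a bound on all admissible quotients through \<open>neumann_lower_bound\<close>.\<close>

lemma mu_dcone_ge:
  fixes e :: "'a::euclidean_space"
  assumes p: "1 < p" and ric: "riccati p DIM('a) l R w" and l: "0 < l" and e: "norm e = 1" and \<epsilon>: "0 < \<epsilon>" "\<epsilon> \<le> 1"
    and L: "0 < L" and LR: "L * (1 + \<epsilon>) < R" and M: "\<And>r. 0 < r \<Longrightarrow> r \<le> L * (1 + \<epsilon>) \<Longrightarrow> w r \<le> M" "0 \<le> M"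
    and ne: "neumann_quotients p (dcone e \<epsilon> L) \<noteq> {}"
  shows "l / (1 + (l + 2 * M / \<epsilon>) * (2 ^ DIM('a) * (2 * \<epsilon> * (1 + L)) powr p)) \<le> mu p (dcone e \<epsilon> L)"
proof -
  define Q where "Q = dcone e \<epsilon> L"
  define k where "k = 1 + (l + 2 * M / \<epsilon>) * (2 ^ DIM('a) * (2 * \<epsilon> * (1 + L)) powr p)"
  have "1 + 0 \<le> k" unfolding k_def using l M \<epsilon> by (intro add_left_mono mult_nonneg_nonneg add_nonneg_nonneg) auto
  then have k: "0 < k" by simp
  have Q: "open Q" "bounded Q" "convex Q" "0 \<in> Q"
    unfolding Q_def using dcone_open dcone_convex[OF \<epsilon>(1)] zero_in_dcone[OF \<epsilon>(1) L]
      bounded_subset[OF bounded_cball dcone_subset_cball[OF e \<epsilon>]] by blast+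
  have [measurable]: "Q \<in> sets borel" using Q(1) by simp
  have P: "\<exists>c. l / k * (LINT x|lebesgue_on Q. \<bar>v x - c\<bar> powr p) \<le> (LINT x|lebesgue_on Q. norm (g x) powr p)"
    if v: "has_gradient v g" "continuous_on UNIV g" for v :: "'a \<Rightarrow> real" and g
  proof -
    have [measurable]: "v \<in> borel_measurable borel" "g \<in> borel_measurable borel"
      by (intro borel_measurable_continuous_onI has_gradient_continuous[OF v(1)] v(2))+
    obtain c where c: "l * (LINT x|lborel. indicator Q x * \<bar>v x - c\<bar> powr p) \<le> k * (LINT x|lborel. indicator Q x * norm (g x) powr p)"
      using dcone_poincare[OF p ric less_imp_le[OF l] e \<epsilon> L LR M v] unfolding Q_def k_def by blast
    have a: "(LINT x|lebesgue_on Q. f x) = (LINT x|lborel. indicator Q x * f x)" if "f \<in> borel_measurable borel" for f :: "'a \<Rightarrow> real"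
      using that by (subst integral_lebesgue_on_borel) auto
    have "l / k * (LINT x|lebesgue_on Q. \<bar>v x - c\<bar> powr p) \<le> (LINT x|lebesgue_on Q. norm (g x) powr p)"
      using c k by (subst (1 2) a) (auto simp: pos_divide_le_eq mult.commute)
    then show ?thesis ..
  qed
  have "l / k \<le> Inf (neumann_quotients p Q)"
  proof (rule cInf_greatest)
    show "neumann_quotients p Q \<noteq> {}" using ne by (simp add: Q_def)
    fix t assume "t \<in> neumann_quotients p Q"
    then obtain v g where t: "t = (LINT x|lebesgue_on Q. norm (g x) powr p) / (LINT x|lebesgue_on Q. \<bar>v x\<bar> powr p)"
      and W: "W1p p Q v g" and nz: "\<not> (AE x in lebesgue_on Q. v x = 0)"
      and z: "(LINT x|lebesgue_on Q. \<bar>v x\<bar> powr (p - 2) * v x) = 0"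
      unfolding neumann_quotients_def by blast
    have i: "integrable (lebesgue_on Q) (\<lambda>x. \<bar>v x\<bar> powr p)" using W by (auto simp: W1p_def Lp_def)
    have "(LINT x|lebesgue_on Q. \<bar>v x\<bar> powr p) \<noteq> 0"
      using nz integral_nonneg_eq_0_iff_AE[OF i] by auto
    moreover have "0 \<le> (LINT x|lebesgue_on Q. \<bar>v x\<bar> powr p)" by simp
    ultimately have "0 < (LINT x|lebesgue_on Q. \<bar>v x\<bar> powr p)" by linarith
    moreover have "l / k * (LINT x|lebesgue_on Q. \<bar>v x\<bar> powr p) \<le> (LINT x|lebesgue_on Q. norm (g x) powr p)"
      using k l by (intro neumann_lower_bound[OF Q p _ P W z]) auto
    ultimately show "l / k \<le> t" unfolding t by (simp add: pos_le_divide_eq)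
  qed
  then show ?thesis unfolding mu_def neumann_quotients_def[symmetric] Q_def k_def .
qed

text \<open>The term at risk is \<open>1 / \<epsilon>\<close> times
  \<open>\<epsilon> powr p\<close>, that is \<open>\<epsilon> powr (p - 1)\<close>, and it vanishes
  in the limit because \<open>p > 1\<close>.\<close>

lemma dcone_constant_tendsto:
  fixes \<epsilon> :: "nat \<Rightarrow> real"
  assumes p: "1 < p" and L: "0 < L" and e: "\<And>k. 0 < \<epsilon> k" "\<epsilon> \<longlonglongrightarrow> 0"
  shows "(\<lambda>k. l / (1 + (l + 2 * M / \<epsilon> k) * (a * (2 * \<epsilon> k * (1 + L)) powr p))) \<longlonglongrightarrow> l"
proof -
  have eq: "(l + 2 * M / \<epsilon> k) * (a * (2 * \<epsilon> k * (1 + L)) powr p)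
      = a * (2 * (1 + L)) powr p * (l * \<epsilon> k powr p + 2 * M * \<epsilon> k powr (p - 1))" for k
  proof -
    have "(2 * \<epsilon> k * (1 + L)) powr p = (2 * (1 + L)) powr p * \<epsilon> k powr p"
      using e(1)[of k] L powr_mult[of "2 * (1 + L)" "\<epsilon> k" p] by (simp add: mult_ac)
    moreover have "\<epsilon> k powr p = \<epsilon> k * \<epsilon> k powr (p - 1)" using e(1)[of k] by (simp add: powr_mult_base)
    ultimately show ?thesis using e(1)[of k] by (simp add: algebra_simps)
  qed
  have z: "(\<lambda>k. \<epsilon> k powr s) \<longlonglongrightarrow> 0" if "0 < s" for s
    using tendsto_zero_powrI[OF e(2) tendsto_const _ that] e(1) by (simp add: less_imp_le)
  have "(\<lambda>k. l / (1 + a * (2 * (1 + L)) powr p * (l * \<epsilon> k powr p + 2 * M * \<epsilon> k powr (p - 1))))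
      \<longlonglongrightarrow> l / (1 + a * (2 * (1 + L)) powr p * (l * 0 + 2 * M * 0))"
    using p by (intro tendsto_intros z) auto
  then show ?thesis unfolding eq by simp
qed

theorem theorem3p1:
  fixes p :: real
  assumes "1 < p"
  shows "(2 \<le> DIM('a::euclidean_space) \<longrightarrow>
            (\<forall>\<Omega> :: 'a set. open \<Omega> \<and> bounded \<Omega> \<and> convex \<Omega> \<and> \<Omega> \<noteq> {} \<longrightarrow>
              (\<forall>(c :: 'a) (r :: real). 0 < r \<longrightarrow>
                 mu p \<Omega> < lambda p (ball c r) * (diameter (ball c r) / diameter \<Omega>) powr p)))
       \<and> (\<forall>d > 0. \<exists>\<Omega> :: nat \<Rightarrow> 'a set.
            (\<forall>k. open (\<Omega> k) \<and> bounded (\<Omega> k) \<and> convex (\<Omega> k) \<and> \<Omega> k \<noteq> {}) \<and>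
            (\<forall>k. diameter (\<Omega> k) = d) \<and>
            (\<exists>a b. dist a b = d \<and>
               (\<lambda>k. hausdorff_dist (\<Omega> k) (closed_segment a b)) \<longlonglongrightarrow> 0) \<and>
            (\<forall>c :: 'a. (\<lambda>k. mu p (\<Omega> k)) \<longlonglongrightarrow> lambda p (ball c (d / 2))))"
proof -
  have p: "1 < p" by fact
  obtain R w U where R: "0 < R" and ric: "riccati p DIM('a) 1 R w" and pr: "profile p 1 R w U"
    by (rule eigenprofile_exists[where 'a='a, OF p])
  \<comment> \<open>The solution with eigenvalue 1 lives on radius \<open>R\<close>; scaling by
    \<open>R / r\<close> moves it to radius \<open>r\<close> and turns the eigenvalue into
    \<open>?l r\<close>.\<close>
  let ?l = "\<lambda>r. (R / r) powr p" and ?w = "\<lambda>r s. (R / r) powr (p - 1) * w (R / r * s)" and ?U = "\<lambda>r s. U (R / r * s)"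
  have l0: "0 < ?l r" if "0 < r" for r using that R by simp
  have rr: "R / (R / r) = r" for r using R by simp
  have ricr: "riccati p DIM('a) (?l r) r (?w r)" if "0 < r" for r
    using riccati_scale[OF p ric, of "R / r"] that R unfolding rr by simp
  have prr: "profile p (?l r) r (?w r) (?U r)" if "0 < r" for r
    using profile_scale[OF p pr, of "R / r"] that R unfolding rr by simp
  have lam: "lambda p (ball c r) = ?l r" if "0 < r" for c :: 'a and r
    by (rule lambda_ball[OF p l0[OF that] that ricr[OF that] prr[OF that]])
  show ?thesis
  proof (intro conjI impI allI)
    fix \<Omega> :: "'a set" and c :: 'a and r :: real
    assume N: "2 \<le> DIM('a)" and "open \<Omega> \<and> bounded \<Omega> \<and> convex \<Omega> \<and> \<Omega> \<noteq> {}" and r: "0 < r"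
    then have \<Omega>: "open \<Omega>" "bounded \<Omega>" "convex \<Omega>" "\<Omega> \<noteq> {}" by auto
    obtain y s where y: "0 < s" "ball y s \<subseteq> \<Omega>" using \<Omega>(1,4) open_contains_ball by blast
    have "diameter (ball y s) \<le> diameter \<Omega>" by (rule diameter_subset[OF y(2) \<Omega>(2)])
    then have d: "0 < diameter \<Omega> / 2" using y by simp
    have "mu p \<Omega> < ?l (diameter \<Omega> / 2)"
      by (rule neumann_upper(3)[OF \<Omega> p l0[OF d] ricr[OF d] prr[OF d] N])
    \<comment> \<open>All balls share the one pair \<open>R\<close>, \<open>w\<close>, so the radius
      of the comparison ball cancels against its diameter.\<close>
    also have "\<dots> = (R / r * (2 * r / diameter \<Omega>)) powr p" using r by (simp add: mult.commute)
    also have "\<dots> = lambda p (ball c r) * (diameter (ball c r) / diameter \<Omega>) powr p"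
      using r R d by (subst powr_mult) (auto simp: lam)
    finally show "mu p \<Omega> < lambda p (ball c r) * (diameter (ball c r) / diameter \<Omega>) powr p" .
  next
    fix d :: real assume d: "0 < d"
    define L where "L = d / 2"
    have L: "0 < L" using d by (simp add: L_def)
    obtain e :: 'a where e: "norm e = 1" using vector_choose_size[of 1] by auto
    define \<epsilon> where "\<epsilon> k = inverse (real (Suc k))" for k
    have \<epsilon>: "0 < \<epsilon> k" "\<epsilon> k \<le> 1" for k by (auto simp: \<epsilon>_def inverse_le_1_iff)
    have \<epsilon>0: "\<epsilon> \<longlonglongrightarrow> 0" unfolding \<epsilon>_def by (rule LIMSEQ_inverse_real_of_nat)
    define Q where "Q k = dcone e (\<epsilon> k) L" for k
    have Q: "open (Q k)" "bounded (Q k)" "convex (Q k)" "Q k \<noteq> {}" for k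
      unfolding Q_def using dcone_open dcone_convex[OF \<epsilon>(1)] zero_in_dcone[OF \<epsilon>(1) L]
        bounded_subset[OF bounded_cball dcone_subset_cball[OF e \<epsilon>]] by blast+
    have diam: "diameter (Q k) = 2 * L" for k unfolding Q_def by (rule diameter_dcone[OF e \<epsilon> L])
    then have dL: "diameter (Q k) / 2 = L" for k by simp
    have "(\<lambda>k. hausdorff_dist (Q k) (closed_segment (- (L *\<^sub>R e)) (L *\<^sub>R e))) \<longlonglongrightarrow> 0"
    proof (rule tendsto_sandwich[OF _ _ tendsto_const])
      show "(\<lambda>k. \<epsilon> k * L) \<longlonglongrightarrow> 0" by (rule tendsto_mult_left_zero[OF \<epsilon>0])
      show "\<forall>\<^sub>F k in sequentially. 0 \<le> hausdorff_dist (Q k) (closed_segment (- (L *\<^sub>R e)) (L *\<^sub>R e))"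
        "\<forall>\<^sub>F k in sequentially. hausdorff_dist (Q k) (closed_segment (- (L *\<^sub>R e)) (L *\<^sub>R e)) \<le> \<epsilon> k * L"
        unfolding Q_def using hausdorff_dcone[OF e \<epsilon>(1) L] by auto
    qed
    moreover have "dist (- (L *\<^sub>R e)) (L *\<^sub>R e) = d"
    proof -
      have "- (L *\<^sub>R e) - L *\<^sub>R e = (- L - L) *\<^sub>R e" by (simp only: scaleR_left_diff_distrib scaleR_minus_left)
      also have "- L - L = - d" by (simp add: L_def)
      finally show ?thesis using e d by (simp add: dist_norm)
    qed
    ultimately have haus: "\<exists>a b. dist a b = d \<and> (\<lambda>k. hausdorff_dist (Q k) (closed_segment a b)) \<longlonglongrightarrow> 0" by blast
    have up: "mu p (Q k) \<le> ?l L" and ne: "neumann_quotients p (Q k) \<noteq> {}" for k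
    proof -
      note a = neumann_upper[OF Q p l0[OF L], of k, unfolded dL, OF ricr[OF L] prr[OF L]]
      show "mu p (Q k) \<le> ?l L" "neumann_quotients p (Q k) \<noteq> {}" by (rule a)+
    qed
    have mu: "(\<lambda>k. mu p (Q k)) \<longlonglongrightarrow> ?l L"
    proof (rule order_tendstoI)
      fix t assume "?l L < t"
      then show "\<forall>\<^sub>F k in sequentially. mu p (Q k) < t" using up le_less_trans by (intro always_eventually allI) blast
    next
      fix t assume t: "t < ?l L"
      \<comment> \<open>The solution for radius \<open>L\<close> blows up exactly at the distance
        from tip to waist, where the cut-off needs a bound. A radius \<open>S\<close> slightly above
        \<open>L\<close> gives a solution bounded there, with an eigenvalue still above
        \<open>t\<close>.\<close>
      have "isCont ?l L" using L R by (intro continuous_intros) auto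
      then have "(?l \<longlongrightarrow> ?l L) (at_right L)" unfolding isCont_def by (rule filterlim_mono) (auto simp: at_le)
      then have "\<forall>\<^sub>F r in at_right L. t < ?l r" using t by (rule order_tendstoD)
      then obtain b where b: "L < b" "\<And>r. L < r \<Longrightarrow> r < b \<Longrightarrow> t < ?l r" unfolding eventually_at_right_field by blast
      define S where "S = (L + b) / 2"
      have S': "L < S" "S < b" using b(1) by (auto simp: S_def)
      have S: "L < S" "t < ?l S" by (rule S'(1), rule b(2)[OF S'])
      have S0: "0 < S" using S L by simp
      \<comment> \<open>Strictly between \<open>L\<close> and \<open>S\<close>: eventually the half
        cones, of size up to \<open>L * (1 + \<epsilon> k)\<close>, fit inside radius
        \<open>\<rho>\<close>, and one bound on \<open>w\<close> serves all of them.\<close>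
      define \<rho> where "\<rho> = (L + S) / 2"
      have \<rho>: "L < \<rho>" "\<rho> < S" using S by (auto simp: \<rho>_def)
      obtain C where C: "0 \<le> C" "\<And>r. 0 < r \<Longrightarrow> r \<le> \<rho> \<Longrightarrow> ?w S r \<le> C * r"
        using riccatiD(4)[OF ricr[OF S0] \<rho>(2)] by blast
      have wM: "?w S r \<le> C * \<rho>" if "0 < r" "r \<le> \<rho>" for r
        using C(2)[OF that] mult_left_mono[OF that(2) C(1)] by linarith
      have M0: "0 \<le> C * \<rho>" using C \<rho> L by simp
      have "(\<lambda>k. L * (1 + \<epsilon> k)) \<longlonglongrightarrow> L * (1 + 0)" by (intro tendsto_intros \<epsilon>0)
      then have ev: "\<forall>\<^sub>F k in sequentially. L * (1 + \<epsilon> k) < \<rho>" using \<rho>(1) by (intro order_tendstoD(2)) auto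
      define K where "K k = ?l S / (1 + (?l S + 2 * (C * \<rho>) / \<epsilon> k) * (2 ^ DIM('a) * (2 * \<epsilon> k * (1 + L)) powr p))" for k
      have "K \<longlonglongrightarrow> ?l S" unfolding K_def by (rule dcone_constant_tendsto[OF p L \<epsilon>(1) \<epsilon>0])
      then have "\<forall>\<^sub>F k in sequentially. t < K k" using S(2) by (rule order_tendstoD)
      with ev show "\<forall>\<^sub>F k in sequentially. t < mu p (Q k)"
      proof eventually_elim
        case (elim k)
        have "K k \<le> mu p (Q k)" unfolding K_def Q_def
        proof (rule mu_dcone_ge[OF p ricr[OF S0] l0[OF S0] e \<epsilon> L _ _ M0])
          show "L * (1 + \<epsilon> k) < S" using elim \<rho> by simp
          show "?w S r \<le> C * \<rho>" if "0 < r" "r \<le> L * (1 + \<epsilon> k)" for r using wM[of r] that elim by simp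
          show "neumann_quotients p (dcone e (\<epsilon> k) L) \<noteq> {}" using ne[of k] by (simp add: Q_def)
        qed
        then show ?case using elim by simp
      qed
    qed
    show "\<exists>\<Omega> :: nat \<Rightarrow> 'a set.
            (\<forall>k. open (\<Omega> k) \<and> bounded (\<Omega> k) \<and> convex (\<Omega> k) \<and> \<Omega> k \<noteq> {}) \<and>
            (\<forall>k. diameter (\<Omega> k) = d) \<and>
            (\<exists>a b. dist a b = d \<and>
               (\<lambda>k. hausdorff_dist (\<Omega> k) (closed_segment a b)) \<longlonglongrightarrow> 0) \<and>
            (\<forall>c :: 'a. (\<lambda>k. mu p (\<Omega> k)) \<longlonglongrightarrow> lambda p (ball c (d / 2)))"
    proof (intro exI[of _ Q] conjI allI)
      show "diameter (Q k) = d" for k using diam by (simp add: L_def)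
      show "(\<lambda>k. mu p (Q k)) \<longlonglongrightarrow> lambda p (ball c (d / 2))" for c :: 'a
        using mu lam[OF L, of c] by (simp add: L_def)
    qed (use Q haus in auto)
  qed
qed

end
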